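(* Let $l\geq 2$ be an integer and $\epsilon>0$. Define $c(l)=c(l,\epsilon)$ recursively by $c(2)=\log 2+\epsilon$, $c(3)=\tfrac{3}{2}\log 2+\epsilon$ and, for $l\geq 4$, $c(l)=\tfrac{l}{2}\log 2+c(\lfloor l/2\rfloor)+\epsilon$. Then for almost all $n\in S$ (i.e. for all $n$ in a subset of $S$ of relative density one in $S$) we have $$\mathcal{Q}\big(l,n,\, n^{1/2}/(\log n)^{c(l)}\big)=\emptyset .$$
   Context: $S=\{n=a^2+b^2:\ a,b\in\mathbb{Z}\}$ is the set of positive integers representable as a sum of two squares. For $n\in S$ the "lattice points" are the $\xi\in\mathbb{Z}^2$ with $|\xi|^2=n$. For a positive integer $l$, $n\in S$ and $K>0$, the set of spectral quasi-correlations is $$\mathcal{Q}(l,n,K)=\{(\xi_1,\dots,\xi_l)\in(\mathbb{Z}^2)^l:\ |\xi_i|^2=n \text{ for all } i,\ 0<|\xi_1+\dots+\xi_l|\leq K\}.$$ A subset $A\subseteq S$ has relative density one if $\#\{n\in A: n\le X\}/\#\{n\in S:n\le X\}\to 1$ as $X\to\infty$. $\lfloor x\rfloor$ is the integer part of $x$. *)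

theory Defs
  imports "HOL-Analysis.Analysis"
begin

definition two_squares :: "nat set" where
  "two_squares = {n. n > 0 \<and> (\<exists>a b :: int. int n = a\<^sup>2 + b\<^sup>2)}"

definition lnorm :: "int \<times> int \<Rightarrow> real" where
  "lnorm \<xi> = norm (real_of_int (fst \<xi>), real_of_int (snd \<xi>))"

(* An l-tuple of lattice points is a list of length l. *)
definition quasi_correlations :: "nat \<Rightarrow> nat \<Rightarrow> real \<Rightarrow> (int \<times> int) list set" where
  "quasi_correlations l n K =
     {\<xi>s. length \<xi>s = l \<and> (\<forall>\<xi>\<in>set \<xi>s. (lnorm \<xi>)\<^sup>2 = real n) \<and>
          0 < lnorm (sum_list \<xi>s) \<and> lnorm (sum_list \<xi>s) \<le> K}"

definition relative_density_one :: "nat set \<Rightarrow> bool" where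
  "relative_density_one A \<longleftrightarrow> A \<subseteq> two_squares \<and>
     ((\<lambda>X :: real. real (card {n \<in> A. real n \<le> X}) /
                   real (card {n \<in> two_squares. real n \<le> X})) \<longlongrightarrow> 1) at_top"

(* The value 0 for l < 2 is a dummy: l div 2 >= 2 whenever l >= 4. *)
fun corr_exponent :: "real \<Rightarrow> nat \<Rightarrow> real" where
  "corr_exponent \<epsilon> l =
     (if l < 2 then 0
      else if l = 2 then ln 2 + \<epsilon>
      else if l = 3 then 3 / 2 * ln 2 + \<epsilon>
      else real l / 2 * ln 2 + corr_exponent \<epsilon> (l div 2) + \<epsilon>)"

declare corr_exponent.simps [simp del]

end

theory Submission
  imports Defs "HOL-Number_Theory.Number_Theory" "HOL-Real_Asymp.Real_Asymp"
begin


text \<open>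
  Split a tuple of lattice points of norm n = p m at a prime p = \<pi> * cnj \<pi>: every point is \<pi> or cnj \<pi>
  times a point of norm m, so the sum is P = \<pi> A + cnj \<pi> B with A and B sums of points of norm m. If both are
  nonempty sums, then either the shorter one is itself zero or unusually small (so m is exceptional for a smaller l),
  or else the smallness of P confines the direction of \<pi> to an arc of width (log n)^{-(l/2) log 2 - \<epsilon>}. Almost
  every n has about (1/2) log log n prime factors congruent to 1 mod 4, hence at most (log n)^{(l/2) log 2 + o(1)}
  tuples, and the union bound over tuples wins by a power of the logarithm. Gaussian primes in an arc are counted
  with Brun's pure sieve. Natural density is reached by weighting n with log n = (sum of log p over p dividing n).

  If p does not separate the tuple, m is exceptional with the same l, so one needs the logarithmic sum of 1/m over
  exceptional m. There the common Gaussian factor of the tuple is removed first; every prime of the remaining norm m'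
  separates. A prime factor of m' above a power of log n is treated as before; if there is none, m' is smooth but
  exceeds a power of log n, which forces a separating prime p > exp(sqrt(log log n)), and the few tuples on the smooth
  part are beaten by the trivial saving p^{-1/2}.
\<close>

section \<open>Primes modulo 4\<close>

text \<open>The threshold is measured with L = log N for a fixed bound N, not with log n: a small
  sum then stays small after multiplication by a Gaussian integer, and passing from n to n/p does
  not change what exceptional means. With weight log p on the pairs (n, p), n = p m, the exceptional
  m contribute about N times their logarithmic sum. The total to beat is N sqrt(log N), because S
  has at least of order N / sqrt(log N) elements up to N; so the logarithmic sum has to be
  o(sqrt(log N)). Weighting by primes cannot prove this: an unseparated tuple sends the logarithmic
  sum for l back to itself, multiplied by the sum of 1/p, which is about log log N. In the primitive
  part l drops strictly unless an arc appears, and the factor log log N is paid for by proving a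
  saving of every power of log log N, by induction on l. Arcs win a power of log N, far more than
  all such losses; a smooth primitive part wins only the exponential of a root of log log N, which
  is still enough.\<close>

lemma sum_divisors_swap:
  fixes f :: "nat \<Rightarrow> nat \<Rightarrow> real"
  shows "(\<Sum>n\<in>{1..N}. \<Sum>d | d dvd n. f d (n div d)) = (\<Sum>d\<in>{1..N}. \<Sum>k\<in>{1..N div d}. f d k)"
proof -
  have "(\<Sum>n\<in>{1..N}. \<Sum>d | d dvd n. f d (n div d))
      = (\<Sum>(n,d)\<in>(SIGMA n:{1..N}. {d. d dvd n}). f d (n div d))"
    by (subst sum.Sigma) auto
  also have "\<dots> = (\<Sum>(d,k)\<in>(SIGMA d:{1..N}. {1..N div d}). f d k)"
  proof (rule sum.reindex_bij_witness[of _ "\<lambda>(d,k). (d * k, d)" "\<lambda>(n,d). (d, n div d)"], goal_cases)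
    case (2 a)
    then obtain n d where nd: "a = (n,d)" "1 \<le> n" "n \<le> N" "d dvd n" by auto
    then have "d > 0" "d \<le> n" by (auto intro: Nat.gr0I dvd_imp_le)
    with nd show ?case
      by (auto simp: div_le_mono Suc_le_eq div_greater_zero_iff)
  next
    case (4 b)
    then obtain d k where dk: "b = (d,k)" "1 \<le> d" "d \<le> N" "1 \<le> k" "k \<le> N div d" by auto
    then have "d * k \<le> N" by (metis div_times_less_eq_dividend le_trans mult.commute mult_le_mono1)
    with dk show ?case by auto
  qed auto
  also have "\<dots> = (\<Sum>d\<in>{1..N}. \<Sum>k\<in>{1..N div d}. f d k)"
    by (subst sum.Sigma) auto
  finally show ?thesis .
qed

section \<open>Chebyshev and Mertens estimates\<close>

definition chebyshev_psi :: "nat \<Rightarrow> real" where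
  "chebyshev_psi N = (\<Sum>d\<in>{1..N}. mangoldt d)"

lemma ln_fact_eq_sum_mangoldt:
  "ln (fact N :: real) = (\<Sum>d\<in>{1..N}. mangoldt d * real (N div d))"
proof -
  have "ln (fact N :: real) = (\<Sum>n\<in>{1..N}. ln (real n))"
    by (simp add: fact_prod ln_prod flip: One_nat_def) (subst ln_prod; simp)
  also have "\<dots> = (\<Sum>n\<in>{1..N}. \<Sum>d | d dvd n. mangoldt d)"
    by (intro sum.cong refl) (use mangoldt_sum[where ?'a = real] in auto)
  also have "\<dots> = (\<Sum>d\<in>{1..N}. \<Sum>k\<in>{1..N div d}. mangoldt d)"
    using sum_divisors_swap[of "\<lambda>d k. mangoldt d" N] by simp
  finally show ?thesis by (simp add: mult.commute)
qed

text \<open>The weight floor(2N/d) - 2 floor(N/d) is nonnegative for every d and equals 1 for N < d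
  <= 2N, so the difference is at most the logarithm of the central binomial coefficient.\<close>

lemma chebyshev_psi_double: "chebyshev_psi (2 * N) - chebyshev_psi N \<le> 2 * real N * ln 2"
proof -
  have "chebyshev_psi (2 * N) - chebyshev_psi N = (\<Sum>d\<in>{N+1..2*N}. mangoldt d)"
  proof -
    have "{1..2*N} = {1..N} \<union> {N+1..2*N}" by auto
    then show ?thesis unfolding chebyshev_psi_def by (simp add: sum.union_disjoint)
  qed
  also have "\<dots> = (\<Sum>d\<in>{N+1..2*N}. mangoldt d * (real (2*N div d) - 2 * real (N div d)))"
  proof (intro sum.cong refl)
    fix d assume d: "d \<in> {N+1..2*N}"
    then have "N div d = 0" "2 * N div d = 1" by (auto simp: div_nat_eqI)
    then show "mangoldt d = mangoldt d * (real (2*N div d) - 2 * real (N div d))" by simp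
  qed
  also have "\<dots> \<le> (\<Sum>d\<in>{1..2*N}. mangoldt d * (real (2*N div d) - 2 * real (N div d)))"
  proof (intro sum_mono2)
    fix d
    have "2 * (N div d) \<le> 2 * N div d"
      by (metis div_mult2_eq div_mult_mult1_if mult_2 nonzero_mult_div_cancel_left
          div_add1_eq le_add1 zero_neq_numeral)
    then have "2 * real (N div d) \<le> real (2 * N div d)" by linarith
    then show "0 \<le> mangoldt d * (real (2*N div d) - 2 * real (N div d))"
      by (intro mult_nonneg_nonneg mangoldt_nonneg) auto
  qed auto
  also have "\<dots> = (\<Sum>d\<in>{1..2*N}. mangoldt d * real (2*N div d))
        - 2 * (\<Sum>d\<in>{1..2*N}. mangoldt d * real (N div d))"
    by (simp add: sum_subtractf sum_distrib_left algebra_simps)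
  also have "(\<Sum>d\<in>{1..2*N}. mangoldt d * real (N div d)) = (\<Sum>d\<in>{1..N}. mangoldt d * real (N div d))"
    by (intro sum.mono_neutral_right) auto
  also have "(\<Sum>d\<in>{1..2*N}. mangoldt d * real (2*N div d)) - 2 * (\<Sum>d\<in>{1..N}. mangoldt d * real (N div d))
      = ln (fact (2*N)) - 2 * ln (fact N :: real)"
    by (simp add: ln_fact_eq_sum_mangoldt)
  also have "\<dots> = ln (real ((2*N) choose N))"
    by (simp add: binomial_fact ln_div ln_mult ln_realpow)
  also have "\<dots> \<le> ln (real (2 ^ (2*N)))"
  proof -
    have "(2*N) choose N \<le> 2 ^ (2*N)" by (rule binomial_le_pow2)
    moreover have "0 < (2*N) choose N" by simp
    ultimately show ?thesis by (subst ln_le_cancel_iff) (auto simp flip: of_nat_power)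
  qed
  also have "\<dots> = 2 * real N * ln 2" by (simp add: ln_realpow)
  finally show ?thesis .
qed

lemma chebyshev_psi_mono: "M \<le> N \<Longrightarrow> chebyshev_psi M \<le> chebyshev_psi N"
  unfolding chebyshev_psi_def by (intro sum_mono2) (auto simp: mangoldt_nonneg)

text \<open>Doubling bounds the function at powers of two. The least power of two above N is at most
  2N, which gives the constant 4 log 2 < 3.\<close>

lemma chebyshev_psi_le: "chebyshev_psi N \<le> 3 * real N"
proof (cases "N = 0")
  case True
  then show ?thesis by (simp add: chebyshev_psi_def)
next
  case False
  have pow: "chebyshev_psi (2 ^ k) \<le> 2 * 2 ^ k * ln 2" for k
  proof (induction k)
    case (Suc k)
    then show ?case using chebyshev_psi_double[of "2 ^ k"] by (simp add: algebra_simps)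
  qed (simp add: chebyshev_psi_def)
  define k where "k = (LEAST k. N \<le> 2 ^ k)"
  have ex: "N \<le> 2 ^ N" by (simp add: less_imp_le)
  have k: "N \<le> 2 ^ k" unfolding k_def by (rule LeastI, rule ex)
  have k2: "2 ^ k \<le> 2 * N"
  proof (cases k)
    case 0 then show ?thesis using False by simp
  next
    case (Suc j)
    then have "\<not> N \<le> 2 ^ j" unfolding k_def using not_less_Least by (metis lessI)
    then show ?thesis using Suc by simp
  qed
  have "chebyshev_psi N \<le> 2 * 2 ^ k * ln 2"
    using chebyshev_psi_mono[OF k] pow[of k] by linarith
  also have "\<dots> \<le> 2 * (2 * real N) * ln 2"
  proof -
    have "real (2 ^ k) \<le> real (2 * N)" using k2 by (simp only: of_nat_le_iff)
    then show ?thesis by (intro mult_right_mono mult_left_mono) auto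
  qed
  also have "\<dots> \<le> 3 * real N" using ln2_le_25_over_36 mult_left_mono[of "4 * ln 2" 3 "real N"] by (simp add: algebra_simps)
  finally show ?thesis .
qed


lemma ln_Suc_minus_ln_le:
  assumes "k \<ge> 1"
  shows "ln (real (Suc k)) - ln (real k) \<le> 1 / real k"
proof -
  have "ln (1 + 1 / real k) \<le> 1 / real k" by (rule ln_add_one_self_le_self) simp
  moreover have "1 + 1 / real k = real (Suc k) / real k" using assms by (simp add: field_simps)
  moreover have "ln (real (Suc k) / real k) = ln (real (Suc k)) - ln (real k)"
    using assms by (simp add: ln_div)
  ultimately show ?thesis by simp
qed

lemma ln_fact_bounds:
  assumes "N \<ge> 1"
  shows "real N * ln (real N) - real N \<le> ln (fact N)" "ln (fact N) \<le> real N * ln (real N)"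
proof -
  show "real N * ln (real N) - real N \<le> ln (fact N)"
    using assms
  proof (induction N rule: nat_induct_at_least)
    case base then show ?case by simp
  next
    case (Suc n)
    have "real n * (ln (real (Suc n)) - ln (real n)) \<le> 1"
      using Suc ln_Suc_minus_ln_le[of n] by (simp add: field_simps)
    moreover have "ln (fact (Suc n) :: real) = ln (real (Suc n)) + ln (fact n)"
      by (simp add: ln_mult del: of_nat_Suc)
    ultimately show ?case using Suc by (simp add: algebra_simps)
  qed
  have "(fact N :: real) \<le> real N ^ N"
    by (metis fact_le_power le_refl of_nat_fact of_nat_power of_nat_le_iff)
  then have "ln (fact N :: real) \<le> ln (real N ^ N)" by (subst ln_le_cancel_iff) (use assms in auto)
  then show "ln (fact N) \<le> real N * ln (real N)" using assms by (simp add: ln_realpow)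
qed

lemma real_div_ge: "d > 0 \<Longrightarrow> real N / real d \<le> real (N div d) + 1"
proof -
  assume d: "d > 0"
  have "real N = real d * real (N div d) + real (N mod d)"
    by (metis mult_div_mod_eq of_nat_add of_nat_mult)
  moreover have "real (N mod d) \<le> real d" using d by (simp add: less_imp_le)
  ultimately show ?thesis using d by (simp add: field_simps)
qed

lemma real_div_le: "real (N div d) \<le> real N / real d"
proof (cases "d = 0")
  case False
  have "real (N div d) * real d \<le> real N"
    by (metis div_times_less_eq_dividend of_nat_le_iff of_nat_mult)
  with False show ?thesis by (simp add: field_simps)
qed simp

text \<open>Dropping the floors in log N! = sum of Lambda(d) floor(N/d) costs at most psi(N), which
  is O(N). After division by N only a constant is lost against Stirling's log N + O(1).\<close>

lemma sum_mangoldt_over_n: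
  assumes "N \<ge> 1"
  shows "\<bar>(\<Sum>d\<in>{1..N}. mangoldt d / real d) - ln (real N)\<bar> \<le> 3"
proof -
  let ?M = "\<Sum>d\<in>{1..N}. mangoldt d / real d"
  have "real N * ?M = (\<Sum>d\<in>{1..N}. mangoldt d * (real N / real d))"
    by (simp add: sum_distrib_left mult_ac)
  also have "\<dots> \<le> (\<Sum>d\<in>{1..N}. mangoldt d * (real (N div d) + 1))"
    by (intro sum_mono mult_left_mono real_div_ge mangoldt_nonneg) auto
  also have "\<dots> = ln (fact N) + chebyshev_psi N"
    by (simp add: ln_fact_eq_sum_mangoldt chebyshev_psi_def algebra_simps sum.distrib)
  also have "\<dots> \<le> real N * ln (real N) + 3 * real N"
    using ln_fact_bounds[OF assms] chebyshev_psi_le[of N] by linarith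
  finally have up: "real N * ?M \<le> real N * (ln (real N) + 3)" by (simp add: algebra_simps)
  have "real N * (ln (real N) - 1) \<le> ln (fact N)"
    using ln_fact_bounds[OF assms] by (simp add: algebra_simps)
  also have "\<dots> \<le> (\<Sum>d\<in>{1..N}. mangoldt d * (real N / real d))"
    unfolding ln_fact_eq_sum_mangoldt
    by (intro sum_mono mult_left_mono mangoldt_nonneg) (auto simp: real_div_le)
  also have "\<dots> = real N * ?M" by (simp add: sum_distrib_left mult_ac)
  finally have lo: "real N * (ln (real N) - 1) \<le> real N * ?M" .
  from up lo have "?M \<le> ln (real N) + 3" "ln (real N) - 1 \<le> ?M"
    using assms by (simp_all add: mult_le_cancel_left)
  then show ?thesis by (simp add: abs_le_iff)
qed

text \<open>The nonprincipal character modulo 4; L(1, chi4) is at least 2/3 because the series alternates.\<close>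

definition chi4 :: "nat \<Rightarrow> real" where
  "chi4 n = (if n mod 4 = 1 then 1 else if n mod 4 = 3 then -1 else 0)"

lemma chi4_mult: "chi4 (a * b) = chi4 a * chi4 b"
proof -
  have *: "a * b mod 4 = ((a mod 4) * (b mod 4)) mod 4" by (simp add: mod_mult_eq)
  have "a mod 4 < 4" "b mod 4 < 4" by simp_all
  then have "a mod 4 \<in> {0,1,2,3}" "b mod 4 \<in> {0,1,2,3}" by auto
  then show ?thesis unfolding chi4_def * by auto
qed

lemma abs_chi4_le: "\<bar>chi4 n\<bar> \<le> 1" by (simp add: chi4_def)

lemma sum_chi4: "(\<Sum>k\<in>{1..n}. chi4 k) = (if n mod 4 \<in> {1,2} then 1 else 0)"
proof (induction n)
  case (Suc n)
  have "n mod 4 < 4" by simp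
  then have "n mod 4 \<in> {0,1,2,3}" by auto
  then show ?case using Suc by (auto simp: chi4_def mod_Suc)
qed simp

lemma alternating_chi4_bound:
  fixes f :: "nat \<Rightarrow> real"
  assumes dec: "\<And>k. k > M \<Longrightarrow> f (Suc k) \<le> f k" and pos: "\<And>k. f k \<ge> 0"
  shows "\<bar>\<Sum>k\<in>{M<..N}. chi4 k * f k\<bar> \<le> f (Suc M)"
proof (cases "N > M")
  case False then show ?thesis using pos by simp
next
  case True
  define S where "S n = (\<Sum>k\<in>{1..n}. chi4 k)" for n
  have S: "0 \<le> S n" "S n \<le> 1" for n unfolding S_def sum_chi4 by auto
  have S_Suc: "S (Suc n) = S n + chi4 (Suc n)" for n unfolding S_def by simp
  \<comment> \<open>Abel summation with its boundary terms. The inner sum of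
    \<open>S n * (f n - f (Suc n))\<close> is bounded below by 0 and above by the telescoping sum
    that arises from \<open>S n \<le> 1\<close>.\<close>
  have "- S M * f (Suc M) + S N * f N \<le> (\<Sum>k\<in>{M<..N}. chi4 k * f k) \<and>
    (\<Sum>k\<in>{M<..N}. chi4 k * f k) \<le> - S M * f (Suc M) + f (Suc M) - f N + S N * f N"
    using True[unfolded Suc_le_eq[symmetric]]
  proof (induction N rule: nat_induct_at_least)
    case base
    have "{M<..Suc M} = {Suc M}" by auto
    then show ?case by (simp add: S_Suc algebra_simps)
  next
    case (Suc n)
    have "{M<..Suc n} = insert (Suc n) {M<..n}" using Suc by auto
    then have eq: "(\<Sum>k\<in>{M<..Suc n}. chi4 k * f k) = (\<Sum>k\<in>{M<..n}. chi4 k * f k) + chi4 (Suc n) * f (Suc n)"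
      by simp
    have "0 \<le> S n * (f n - f (Suc n))" "S n * (f n - f (Suc n)) \<le> f n - f (Suc n)"
      using S[of n] dec[of n] Suc(1) by (auto intro!: mult_nonneg_nonneg mult_left_le_one_le)
    then show ?case using Suc.IH unfolding eq S_Suc by (simp add: algebra_simps)
  qed
  moreover have "0 \<le> S M * f (Suc M)" "S M * f (Suc M) \<le> f (Suc M)"
      "0 \<le> S N * f N" "S N * f N \<le> f N"
    using S pos by (auto intro!: mult_nonneg_nonneg mult_left_le_one_le)
  ultimately show ?thesis by linarith
qed

lemma sum_split_at:
  fixes f :: "nat \<Rightarrow> real"
  assumes "M \<le> N"
  shows "(\<Sum>k\<in>{1..N}. f k) = (\<Sum>k\<in>{1..M}. f k) + (\<Sum>k\<in>{M<..N}. f k)"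
proof -
  have "{1..N} = {1..M} \<union> {M<..N}" using assms by auto
  moreover have "{1..M} \<inter> {M<..N} = {}" by auto
  ultimately show ?thesis by (simp add: sum.union_disjoint)
qed

lemma chi4_recip_diff:
  assumes "M \<le> N"
  shows "\<bar>(\<Sum>k\<in>{1..M}. chi4 k / real k) - (\<Sum>k\<in>{1..N}. chi4 k / real k)\<bar> \<le> 1 / (real M + 1)"
proof -
  have "\<bar>\<Sum>k\<in>{M<..N}. chi4 k * (1 / real k)\<bar> \<le> 1 / real (Suc M)"
    by (rule alternating_chi4_bound) (auto simp: field_simps)
  then show ?thesis unfolding sum_split_at[OF assms, of "\<lambda>k. chi4 k / real k"] by (simp add: add.commute)
qed

lemma chi4_recip_ge: 
  assumes "N \<ge> 1"
  shows "(\<Sum>k\<in>{1..N}. chi4 k / real k) \<ge> 2 / 3"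
proof (cases "N = 1")
  case True then show ?thesis by (simp add: chi4_def)
next
  case False
  have "{1..2::nat} = {1,2}" by auto
  then have "(\<Sum>k\<in>{1..2}. chi4 k / real k) = 1" by (simp add: chi4_def)
  moreover have "\<bar>(\<Sum>k\<in>{1..2}. chi4 k / real k) - (\<Sum>k\<in>{1..N}. chi4 k / real k)\<bar> \<le> 1 / (real 2 + 1)"
    by (rule chi4_recip_diff) (use False assms in simp)
  ultimately show ?thesis by (simp only: abs_le_iff) simp
qed

lemma ln_over_decreasing:
  assumes "k \<ge> 3"
  shows "ln (real (Suc k)) / real (Suc k) \<le> ln (real k) / real k"
proof -
  have "exp 1 \<le> real k" using e_less_272 assms by linarith
  then have "1 \<le> ln (real k)" using assms by (subst ln_ge_iff) auto
  moreover have "real k * (ln (real (Suc k)) - ln (real k)) \<le> 1"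
    using assms ln_Suc_minus_ln_le[of k] by (simp add: field_simps)
  ultimately have "real k * (ln (real (Suc k)) - ln (real k)) \<le> ln (real k)" by linarith
  then show ?thesis using assms by (simp add: field_simps)
qed

text \<open>The quotient log k / k decreases only from k = 3 on, so the terms up to 3 are bounded by
  hand and the alternating estimate covers the rest.\<close>

lemma chi4_ln_sum_bound: "\<bar>\<Sum>k\<in>{1..N}. chi4 k * (ln (real k) / real k)\<bar> \<le> 2"
proof -
  have le1: "ln (real k) / real k \<le> 1" for k
    by (cases "k = 0") (auto simp: divide_le_eq ln_bound)
  have "\<bar>\<Sum>k\<in>{1..min N 3}. chi4 k * (ln (real k) / real k)\<bar> \<le> 1"
  proof -
    have "N = 0 \<or> N = 1 \<or> N = 2 \<or> N \<ge> 3" by auto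
    then have "min N 3 \<in> {0,1,2,3}" by auto
    moreover have "{1..2::nat} = {1,2}" "{1..3::nat} = {1,2,3}" by auto
    ultimately show ?thesis using le1[of 3] by (auto simp: chi4_def)
  qed
  moreover have "\<bar>\<Sum>k\<in>{min N 3<..N}. chi4 k * (ln (real k) / real k)\<bar> \<le> 1"
  proof (cases "N \<ge> 3")
    case True
    have "\<bar>\<Sum>k\<in>{3<..N}. chi4 k * (ln (real k) / real k)\<bar> \<le> ln (real (Suc 3)) / real (Suc 3)"
    proof (rule alternating_chi4_bound)
      show "0 \<le> ln (real k) / real k" for k by (cases "k = 0") auto
      show "ln (real (Suc k)) / real (Suc k) \<le> ln (real k) / real k" if "k > 3" for k
        using that by (intro ln_over_decreasing) simp
    qed
    then show ?thesis using le1[of "Suc 3"] True by (simp add: min_def)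
  qed simp
  ultimately show ?thesis
    unfolding sum_split_at[of "min N 3" N, OF min.cobounded1] by linarith
qed

text \<open>Expanding log k into Lambda(d) turns the bounded sum of chi(k) log k / k into the sum of
  chi(d) Lambda(d) / d times the partial sum \<open>P (N div d)\<close> of L(1, chi). Replacing this
  by \<open>P N\<close> costs d/N in each term, in total psi(N)/N <= 3. Then \<open>P N\<close>,
  being at least 2/3, is divided out, and 5 / (2/3) <= 8.\<close>

lemma sum_chi4_mangoldt_over_n:
  assumes "N \<ge> 1"
  shows "\<bar>\<Sum>d\<in>{1..N}. chi4 d * mangoldt d / real d\<bar> \<le> 8"
proof -
  define P where "P M = (\<Sum>k\<in>{1..M}. chi4 k / real k)" for M
  let ?A = "\<Sum>d\<in>{1..N}. chi4 d * mangoldt d / real d"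
  have "(\<Sum>k\<in>{1..N}. chi4 k * (ln (real k) / real k))
      = (\<Sum>n\<in>{1..N}. \<Sum>d | d dvd n. chi4 d * mangoldt d / real d * (chi4 (n div d) / real (n div d)))"
  proof (intro sum.cong refl)
    fix n assume n: "n \<in> {1..N}"
    have "chi4 n * (ln (real n) / real n) = (\<Sum>d | d dvd n. chi4 n / real n * mangoldt d)"
    proof -
      have "(\<Sum>d | d dvd n. mangoldt d :: real) = ln (real n)"
        using n mangoldt_sum[where ?'a = real, of n] by simp
      then have "chi4 n * (ln (real n) / real n) = chi4 n / real n * (\<Sum>d | d dvd n. mangoldt d)" by simp
      then show ?thesis by (simp only: sum_distrib_left)
    qed
    also have "\<dots> = (\<Sum>d | d dvd n. chi4 d * mangoldt d / real d * (chi4 (n div d) / real (n div d)))"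
    proof (intro sum.cong refl)
      fix d assume "d \<in> {d. d dvd n}"
      then obtain e where e: "n = d * e" by (auto elim: dvdE)
      then have "d > 0" "e > 0" using n by (auto intro: Nat.gr0I)
      then show "chi4 n / real n * mangoldt d = chi4 d * mangoldt d / real d * (chi4 (n div d) / real (n div d))"
        using e by (simp add: chi4_mult)
    qed
    finally show "chi4 n * (ln (real n) / real n) = \<dots>" .
  qed
  also have "\<dots> = (\<Sum>d\<in>{1..N}. \<Sum>k\<in>{1..N div d}. chi4 d * mangoldt d / real d * (chi4 k / real k))"
    by (rule sum_divisors_swap[of "\<lambda>d k. chi4 d * mangoldt d / real d * (chi4 k / real k)"])
  also have "\<dots> = (\<Sum>d\<in>{1..N}. chi4 d * mangoldt d / real d * P (N div d))"
    by (simp add: P_def sum_distrib_left)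
  finally have Q: "\<bar>\<Sum>d\<in>{1..N}. chi4 d * mangoldt d / real d * P (N div d)\<bar> \<le> 2"
    using chi4_ln_sum_bound[of N] by simp
  have PA: "P N * ?A = (\<Sum>d\<in>{1..N}. chi4 d * mangoldt d / real d * P N)"
    by (subst mult.commute) (rule sum_distrib_right)
  have "\<bar>P N * ?A - (\<Sum>d\<in>{1..N}. chi4 d * mangoldt d / real d * P (N div d))\<bar>
      = \<bar>\<Sum>d\<in>{1..N}. chi4 d * mangoldt d / real d * (P N - P (N div d))\<bar>"
    unfolding PA right_diff_distrib by (subst sum_subtractf) (rule refl)
  also have "\<dots> \<le> (\<Sum>d\<in>{1..N}. \<bar>chi4 d * mangoldt d / real d * (P N - P (N div d))\<bar>)"
    by (rule sum_abs)
  also have "\<dots> \<le> (\<Sum>d\<in>{1..N}. mangoldt d / real N)"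
  proof (intro sum_mono)
    fix d assume d: "d \<in> {1..N}"
    have "\<bar>P N - P (N div d)\<bar> \<le> 1 / (real (N div d) + 1)"
      using chi4_recip_diff[of "N div d" N] by (simp add: P_def abs_minus_commute)
    also have "\<dots> \<le> real d / real N"
      using real_div_ge[of d N] d by (simp add: field_simps)
    finally have 1: "\<bar>P N - P (N div d)\<bar> \<le> real d / real N" .
    have "\<bar>chi4 d * mangoldt d / real d * (P N - P (N div d))\<bar>
        = \<bar>chi4 d\<bar> * (mangoldt d / real d * \<bar>P N - P (N div d)\<bar>)"
      by (simp add: abs_mult)
    also have "\<dots> \<le> 1 * (mangoldt d / real d * (real d / real N))"
      by (intro mult_mono abs_chi4_le mult_left_mono 1) (auto simp: mangoldt_nonneg)
    also have "\<dots> = mangoldt d / real N" using d by simp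
    finally show "\<bar>chi4 d * mangoldt d / real d * (P N - P (N div d))\<bar> \<le> mangoldt d / real N" .
  qed
  also have "\<dots> = chebyshev_psi N / real N" by (simp add: chebyshev_psi_def sum_divide_distrib)
  also have "\<dots> \<le> 3" using chebyshev_psi_le[of N] assms by (simp add: divide_le_eq)
  finally have "\<bar>P N * ?A\<bar> \<le> 5" using Q by linarith
  moreover have "P N \<ge> 2 / 3" using chi4_recip_ge[OF assms] by (simp add: P_def)
  then have "2 / 3 * \<bar>?A\<bar> \<le> P N * \<bar>?A\<bar>" by (intro mult_right_mono) auto
  moreover have "P N * \<bar>?A\<bar> = \<bar>P N * ?A\<bar>" using \<open>P N \<ge> 2 / 3\<close> by (simp add: abs_mult)
  ultimately have "2 / 3 * \<bar>?A\<bar> \<le> 5" by linarith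
  then show ?thesis by simp
qed

text \<open>Only proper prime powers matter. For fixed p their terms sum to at most 2 log p / p^2,
  and log p <= 2 sqrt p makes this 4 p^(-3/2), a convergent series.\<close>

lemma sum_mangoldt_nonprime_bounded:
  obtains C where "\<And>N. (\<Sum>n | n \<in> {1..N} \<and> \<not> prime n. mangoldt n / real n) \<le> C"
proof -
  define g where "g n = 4 * (real n powr (-3/2))" for n
  have sm: "summable g" unfolding g_def by (intro summable_mult) (simp add: summable_real_powr_iff)
  have "(\<Sum>n | n \<in> {1..N} \<and> \<not> prime n. mangoldt n / real n) \<le> suminf g" for N
  proof -
    define A where "A = {n \<in> {1..N}. primepow n \<and> \<not> prime n}"
    define B where "B = (SIGMA p:{p. prime p \<and> p \<le> N}. {2..N})"
    have finB: "finite B" unfolding B_def by auto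
    have "(\<Sum>n | n \<in> {1..N} \<and> \<not> prime n. mangoldt n / real n) = (\<Sum>n\<in>A. mangoldt n / real n)"
      unfolding A_def by (rule sum.mono_neutral_right) (auto simp: mangoldt_def)
    also have "\<dots> \<le> (\<Sum>n\<in>(\<lambda>(p,k). p ^ k) ` B. mangoldt n / real n)"
    proof (intro sum_mono2)
      show "A \<subseteq> (\<lambda>(p,k). p ^ k) ` B"
      proof
        fix n assume n: "n \<in> A"
        then obtain p k where pk: "prime p" "k > 0" "n = p ^ k" by (auto simp: A_def primepow_def)
        have "k \<noteq> 1" using n pk by (auto simp: A_def)
        then have k2: "k \<ge> 2" using pk by simp
        have "k < 2 ^ k" by simp
        also have "(2::nat) ^ k \<le> p ^ k" using prime_ge_2_nat[OF pk(1)] by (rule power_mono) simp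
        finally have "k \<le> N" using n pk by (auto simp: A_def)
        moreover have "p \<le> p ^ k" using pk prime_gt_0_nat[of p] by (simp add: self_le_power)
        ultimately show "n \<in> (\<lambda>(p,k). p ^ k) ` B"
          using n pk k2 by (auto simp: A_def B_def intro!: image_eqI[of _ _ "(p,k)"])
      qed
    qed (use finB in \<open>auto simp: mangoldt_nonneg\<close>)
    also have "\<dots> \<le> (\<Sum>x\<in>B. mangoldt ((\<lambda>(p,k). p ^ k) x) / real ((\<lambda>(p,k). p ^ k) x))"
      by (rule order_trans[OF sum_image_le]) (auto simp: finB mangoldt_nonneg)
    also have "\<dots> = (\<Sum>p | prime p \<and> p \<le> N. \<Sum>k\<in>{2..N}. ln (real p) / real p ^ k)"
      unfolding B_def by (subst sum.Sigma) (auto intro!: sum.cong)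
    also have "\<dots> \<le> (\<Sum>p | prime p \<and> p \<le> N. g p)"
    proof (intro sum_mono)
      fix p assume "p \<in> {p. prime p \<and> p \<le> N}"
      then have p2: "p \<ge> 2" by (auto simp: prime_ge_2_nat)
      define r where "r = 1 / real p"
      have r: "0 < r" "r \<le> 1/2" using p2 by (auto simp: r_def field_simps)
      \<comment> \<open>The subtracted term is a strengthening that lets the induction on
        \<open>M\<close> close for every ratio up to 1/2.\<close>
      have geo: "(\<Sum>k\<in>{2..M}. r ^ k) \<le> 2 * r ^ 2 - 2 * r ^ Suc M" if "M \<ge> 1" for M
        using that
      proof (induction M rule: nat_induct_at_least)
        case base
        then show ?case by (simp add: power2_eq_square)
      next
        case (Suc m)
        have "2 * (r ^ Suc m * r) \<le> 2 * (r ^ Suc m * (1/2))"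
          by (intro mult_left_mono) (use r in auto)
        then have "2 * r ^ Suc (Suc m) \<le> r ^ Suc m" by (simp add: mult_ac)
        moreover have "(\<Sum>k\<in>{2..Suc m}. r ^ k) = (\<Sum>k\<in>{2..m}. r ^ k) + r ^ Suc m"
          using Suc(1) by simp
        ultimately show ?case using Suc.IH by linarith
      qed
      have geo': "(\<Sum>k\<in>{2..N}. r ^ k) \<le> 2 * r ^ 2"
      proof (cases "N \<ge> 1")
        case True
        then show ?thesis using geo[of N] r by (smt (verit) zero_le_power)
      qed (use r in simp)
      have "ln (sqrt (real p)) \<le> sqrt (real p)" using p2 by (intro ln_bound) simp
      then have lnp: "ln (real p) \<le> 2 * sqrt (real p)" using p2 by (simp add: ln_sqrt)
      have "(\<Sum>k\<in>{2..N}. ln (real p) / real p ^ k) = ln (real p) * (\<Sum>k\<in>{2..N}. r ^ k)"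
        by (simp add: sum_distrib_left r_def power_one_over)
      also have "\<dots> \<le> ln (real p) * (2 * r ^ 2)"
        by (intro mult_left_mono geo') (use p2 in auto)
      also have "\<dots> \<le> 2 * sqrt (real p) * (2 * r ^ 2)"
        by (intro mult_right_mono lnp) (use r in auto)
      also have "\<dots> = g p"
      proof -
        have "real p powr (-3/2) = real p powr (1/2 + (- 2))" by simp
        also have "\<dots> = real p powr (1/2) * real p powr (-2)" by (rule powr_add)
        also have "\<dots> = sqrt (real p) * r ^ 2"
          using p2 by (simp add: powr_half_sqrt powr_minus powr_numeral r_def field_simps)
        finally show ?thesis by (simp add: g_def)
      qed
      finally show "(\<Sum>k\<in>{2..N}. ln (real p) / real p ^ k) \<le> g p" .
    qed
    also have "\<dots> \<le> suminf g" by (rule sum_le_suminf[OF sm]) (auto simp: g_def)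
    finally show ?thesis .
  qed
  then show ?thesis using that by blast
qed


text \<open>At odd primes the indicator of the class a is (1 + s chi(p)) / 2 with s = 1 or -1. The
  principal part gives log N, the twisted part is bounded, and the prime 2 is corrected
  separately.\<close>

lemma mertens_first_mod4:
  assumes a: "a \<in> {1, 3}"
  obtains C where "C \<ge> 0" "\<And>N. N \<ge> 1 \<Longrightarrow>
    \<bar>(\<Sum>p | prime p \<and> p mod 4 = a \<and> p \<le> N. ln (real p) / real p) - ln (real N) / 2\<bar> \<le> C"
proof -
  obtain C0 where C0: "\<And>N. (\<Sum>n | n \<in> {1..N} \<and> \<not> prime n. mangoldt n / real n) \<le> C0"
    using sum_mangoldt_nonprime_bounded by blast
  define s :: real where "s = (if a = 1 then 1 else -1)"
  have s: "\<bar>s\<bar> = 1" by (simp add: s_def)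
  have "\<bar>(\<Sum>p | prime p \<and> p mod 4 = a \<and> p \<le> N. ln (real p) / real p) - ln (real N) / 2\<bar> \<le> (3 + 8 + 2 * C0 + 1) / 2"
    if N: "N \<ge> 1" for N
  proof -
    define P where "P = {p \<in> {1..N::nat}. prime p}"
    define Q where "Q = {p \<in> {1..N::nat}. \<not> prime p}"
    have un: "{1..N} = P \<union> Q" "P \<inter> Q = {}" "finite P" "finite Q" by (auto simp: P_def Q_def)
    have split: "(\<Sum>n\<in>{1..N}. f n) = (\<Sum>n\<in>P. f n) + (\<Sum>n\<in>Q. f n)" for f :: "nat \<Rightarrow> real"
      unfolding un(1) by (rule sum.union_disjoint) (use un in auto)
    have QC: "(\<Sum>n\<in>Q. mangoldt n / real n) \<le> C0" using C0[of N] by (simp add: Q_def)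
    have Q0: "0 \<le> (\<Sum>n\<in>Q. mangoldt n / real n)" by (intro sum_nonneg) (auto simp: mangoldt_nonneg)
    have "\<bar>\<Sum>n\<in>Q. chi4 n * mangoldt n / real n\<bar> \<le> (\<Sum>n\<in>Q. \<bar>chi4 n * mangoldt n / real n\<bar>)"
      by (rule sum_abs)
    also have "\<dots> \<le> (\<Sum>n\<in>Q. mangoldt n / real n)"
      by (intro sum_mono) (auto simp: abs_mult mangoldt_nonneg intro!: divide_right_mono mult_left_le_one_le abs_chi4_le)
    finally have Qchi: "\<bar>\<Sum>n\<in>Q. chi4 n * mangoldt n / real n\<bar> \<le> C0" using QC by linarith
    have A: "\<bar>(\<Sum>p\<in>P. ln (real p) / real p) - ln (real N)\<bar> \<le> 3 + C0"
    proof -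
      have "(\<Sum>n\<in>P. mangoldt n / real n) = (\<Sum>p\<in>P. ln (real p) / real p)"
        by (intro sum.cong) (auto simp: P_def)
      then show ?thesis using sum_mangoldt_over_n[OF N] split[of "\<lambda>n. mangoldt n / real n"] QC Q0 by linarith
    qed
    have B: "\<bar>\<Sum>p\<in>P. chi4 p * (ln (real p) / real p)\<bar> \<le> 8 + C0"
    proof -
      have "(\<Sum>n\<in>P. chi4 n * mangoldt n / real n) = (\<Sum>p\<in>P. chi4 p * (ln (real p) / real p))"
        by (intro sum.cong) (auto simp: P_def)
      then show ?thesis using sum_chi4_mangoldt_over_n[OF N] split[of "\<lambda>n. chi4 n * mangoldt n / real n"] Qchi by linarith
    qed
    have "(\<Sum>p | prime p \<and> p mod 4 = a \<and> p \<le> N. ln (real p) / real p)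
        = (\<Sum>p\<in>P. (if p mod 4 = a then ln (real p) / real p else 0))"
      unfolding P_def by (rule sum.mono_neutral_cong_left) (auto simp: Suc_le_eq prime_gt_0_nat)
    also have "\<dots> = (\<Sum>p\<in>P. (ln (real p) / real p + s * (chi4 p * (ln (real p) / real p))
        - (if p = 2 then ln 2 / 2 else 0)) / 2)"
    proof (intro sum.cong refl)
      fix p assume p: "p \<in> P"
      show "(if p mod 4 = a then ln (real p) / real p else 0) = (ln (real p) / real p + s * (chi4 p * (ln (real p) / real p))
        - (if p = 2 then ln 2 / 2 else 0)) / 2"
      proof (cases "p = 2")
        case True then show ?thesis using a by (auto simp: chi4_def)
      next
        case False
        then have "odd p" using p prime_odd_nat[of p] prime_ge_2_nat[of p] by (auto simp: P_def)
        then have "p mod 4 = 1 \<or> p mod 4 = 3" by presburger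
        then show ?thesis using a False by (auto simp: chi4_def s_def)
      qed
    qed
    also have "\<dots> = ((\<Sum>p\<in>P. ln (real p) / real p) + s * (\<Sum>p\<in>P. chi4 p * (ln (real p) / real p))
        - (\<Sum>p\<in>P. (if p = 2 then ln 2 / 2 else 0))) / 2"
      by (simp add: sum_subtractf sum.distrib sum_distrib_left flip: sum_divide_distrib)
    finally have eq: "(\<Sum>p | prime p \<and> p mod 4 = a \<and> p \<le> N. ln (real p) / real p) = \<dots>" .
    have "\<bar>s * (\<Sum>p\<in>P. chi4 p * (ln (real p) / real p))\<bar> \<le> 8 + C0"
      using B s by (simp add: abs_mult)
    moreover have "\<bar>\<Sum>p\<in>P. (if p = 2 then ln 2 / 2 else 0) :: real\<bar> \<le> 1"
      using un ln2_le_25_over_36 by (simp add: sum.delta)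
    moreover have "\<bar>(X + Y - Z) / 2 - W / 2\<bar> \<le> (3 + 8 + 2 * C0 + 1) / 2"
      if "\<bar>X - W\<bar> \<le> 3 + C0" "\<bar>Y\<bar> \<le> 8 + C0" "\<bar>Z\<bar> \<le> 1" for X Y Z W :: real
    proof -
      have "(X + Y - Z) / 2 - W / 2 = ((X - W) + Y - Z) / 2" by (simp add: field_simps)
      moreover have "\<bar>(X - W) + Y - Z\<bar> \<le> 3 + 8 + 2 * C0 + 1" using that by linarith
      then have "\<bar>((X - W) + Y - Z) / 2\<bar> \<le> (3 + 8 + 2 * C0 + 1) / 2" by (simp only: abs_divide) simp
      ultimately show ?thesis by (simp only:)
    qed
    ultimately show ?thesis using A unfolding eq by blast
  qed
  moreover have "C0 \<ge> 0" using C0[of 0] by simp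
  ultimately show ?thesis using that[of "(3 + 8 + 2 * C0 + 1) / 2"] by simp
qed

text \<open>Abel summation written as telescoping. \<open>D\<close> is the error with the boundary
  term \<open>r N / ln (real N)\<close> taken out; each increment of \<open>D\<close> is at most
  \<open>C + c\<close> times the decrease of 1 / log n, so \<open>D\<close> stays bounded.\<close>

lemma partial_summation_ln:
  fixes a :: "nat \<Rightarrow> real"
  assumes c: "c \<ge> 0" and R: "\<And>N. N \<ge> 1 \<Longrightarrow> \<bar>(\<Sum>n\<in>{2..N}. a n) - c * ln (real N)\<bar> \<le> C"
  obtains C' where "C' \<ge> 0" "\<And>N. N \<ge> 2 \<Longrightarrow> \<bar>(\<Sum>n\<in>{2..N}. a n / ln (real n)) - c * ln (ln (real N))\<bar> \<le> C'"
proof -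
  define r where "r N = (\<Sum>n\<in>{2..N}. a n) - c * ln (real N)" for N
  have r: "N \<ge> 1 \<Longrightarrow> \<bar>r N\<bar> \<le> C" for N using R by (simp add: r_def)
  have C: "C \<ge> 0" using r[of 1] by simp
  define D where "D N = (\<Sum>n\<in>{2..N}. a n / ln (real n)) - c * ln (ln (real N)) - r N / ln (real N)" for N
  have tele: "\<bar>D N - D 2\<bar> \<le> (C + c) * (1 / ln 2 - 1 / ln (real N))" if "N \<ge> 2" for N
    using that
  proof (induction N rule: nat_induct_at_least)
    case base then show ?case by simp
  next
    case (Suc n)
    define u v where "u = ln (real n)" and "v = ln (real (Suc n))"
    have u: "u > 0" "u < v" using Suc by (auto simp: u_def v_def)
    have vu: "v - u \<le> 1"
    proof -
      have "1 / real n \<le> 1" using Suc by simp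
      then show ?thesis using ln_Suc_minus_ln_le[of n] Suc unfolding u_def v_def by linarith
    qed
    have a: "a (Suc n) = r (Suc n) - r n + c * (v - u)"
      using Suc by (simp add: r_def u_def v_def algebra_simps)
    have "D (Suc n) - D n = a (Suc n) / v - c * (ln v - ln u) - r (Suc n) / v + r n / u"
      using Suc by (simp add: D_def u_def v_def algebra_simps)
    also have "\<dots> = r n * (1 / u - 1 / v) + c * ((v - u) / v - (ln v - ln u))"
      unfolding a using u by (simp add: field_simps)
    finally have eq: "D (Suc n) - D n = r n * (1 / u - 1 / v) + c * ((v - u) / v - (ln v - ln u))" .
    have lnvu: "ln v - ln u = ln (v / u)" "ln u - ln v = ln (u / v)" using u by (simp_all add: ln_div)
    have "ln (v / u) \<le> v / u - 1" using u by (intro ln_le_minus_one) simp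
    then have up: "ln v - ln u \<le> (v - u) / u" unfolding lnvu using u by (simp add: field_simps)
    have "ln (u / v) \<le> u / v - 1" using u by (intro ln_le_minus_one) simp
    then have lo: "(v - u) / v \<le> ln v - ln u" using lnvu(2) u by (simp add: field_simps)
    have pos: "1 / u - 1 / v \<ge> 0" using u by (simp add: field_simps)
    have "(v - u) / u - (v - u) / v = (v - u) * (1 / u - 1 / v)" by (simp add: algebra_simps)
    also have "\<dots> \<le> 1 * (1 / u - 1 / v)" by (intro mult_right_mono vu pos)
    finally have "(v - u) / u - (v - u) / v \<le> 1 / u - 1 / v" by simp
    then have "\<bar>(v - u) / v - (ln v - ln u)\<bar> \<le> 1 / u - 1 / v" using up lo unfolding abs_le_iff by linarith
    then have "\<bar>c * ((v - u) / v - (ln v - ln u))\<bar> \<le> c * (1 / u - 1 / v)"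
      using c by (simp add: abs_mult mult_left_mono)
    moreover have "\<bar>r n * (1 / u - 1 / v)\<bar> \<le> C * (1 / u - 1 / v)"
      using r[of n] Suc pos by (simp add: abs_mult mult_right_mono)
    ultimately have "\<bar>D (Suc n) - D n\<bar> \<le> (C + c) * (1 / u - 1 / v)"
      unfolding eq by (simp add: distrib_right)
    then show ?case using Suc.IH unfolding u_def v_def by (simp add: algebra_simps)
  qed
  have "\<bar>(\<Sum>n\<in>{2..N}. a n / ln (real n)) - c * ln (ln (real N))\<bar> \<le> \<bar>D 2\<bar> + (C + c) / ln 2 + C / ln 2"
    if N: "N \<ge> 2" for N
  proof -
    have l: "ln 2 \<le> ln (real N)" "0 < ln (2::real)" using N by auto
    have "\<bar>r N / ln (real N)\<bar> = \<bar>r N\<bar> / ln (real N)"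
    proof -
      have "ln (real N) > 0" using l by linarith
      then show ?thesis by simp
    qed
    also have "\<dots> \<le> C / ln 2" by (intro frac_le r) (use l N C in auto)
    finally have "\<bar>r N / ln (real N)\<bar> \<le> C / ln 2" .
    moreover have "\<bar>D N - D 2\<bar> \<le> (C + c) / ln 2"
    proof -
      have "(C + c) * (1 / ln 2 - 1 / ln (real N)) \<le> (C + c) * (1 / ln 2)"
        using l C c by (intro mult_left_mono) (auto intro: order_trans[of 0 "ln 2"])
      then show ?thesis using tele[OF N] by simp
    qed
    ultimately show ?thesis unfolding D_def by linarith
  qed
  moreover have "\<bar>D 2\<bar> + (C + c) / ln 2 + C / ln 2 \<ge> 0" using C c by simp
  ultimately show ?thesis using that by blast
qed

lemma mertens_second_mod4:
  assumes a: "a \<in> {1, 3}"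
  obtains C where "C \<ge> 0" "\<And>N. N \<ge> 2 \<Longrightarrow>
    \<bar>(\<Sum>p | prime p \<and> p mod 4 = a \<and> p \<le> N. 1 / real p) - ln (ln (real N)) / 2\<bar> \<le> C"
proof -
  obtain C where C: "C \<ge> 0" "\<And>N. N \<ge> 1 \<Longrightarrow>
    \<bar>(\<Sum>p | prime p \<and> p mod 4 = a \<and> p \<le> N. ln (real p) / real p) - ln (real N) / 2\<bar> \<le> C"
    using mertens_first_mod4[OF a] by blast
  define f where "f n = (if prime n \<and> n mod 4 = a then ln (real n) / real n else 0)" for n :: nat
  have conv: "(\<Sum>p | prime p \<and> p mod 4 = a \<and> p \<le> N. g p) = (\<Sum>n\<in>{2..N}. if prime n \<and> n mod 4 = a then g n else 0)"
    for g :: "nat \<Rightarrow> real" and N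
    by (rule sum.mono_neutral_cong_left) (auto simp: prime_ge_2_nat)
  have "\<bar>(\<Sum>n\<in>{2..N}. f n) - 1/2 * ln (real N)\<bar> \<le> C" if "N \<ge> 1" for N
    using C(2)[OF that] unfolding conv f_def by simp
  from partial_summation_ln[OF _ this] obtain C' where C': "C' \<ge> 0"
    "\<And>N. N \<ge> 2 \<Longrightarrow> \<bar>(\<Sum>n\<in>{2..N}. f n / ln (real n)) - 1/2 * ln (ln (real N))\<bar> \<le> C'" by auto
  have "(\<Sum>n\<in>{2..N}. f n / ln (real n)) = (\<Sum>n\<in>{2..N}. if prime n \<and> n mod 4 = a then 1 / real n else 0)" for N
    by (intro sum.cong refl) (auto simp: f_def)
  then show ?thesis using that[of C'] C' unfolding conv by simp
qed


section \<open>Gaussian integers\<close>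

text \<open>Gaussian integers live inside the complex numbers, so that absolute values, directions
  and arcs can be discussed without a coercion.\<close>

definition gint :: "complex set" where
  "gint = {z. Re z \<in> \<int> \<and> Im z \<in> \<int>}"

lemma gint_0 [simp]: "0 \<in> gint" and gint_1 [simp]: "1 \<in> gint" and gint_ii [simp]: "\<i> \<in> gint"
  by (auto simp: gint_def)

lemma gint_add [intro]: "a \<in> gint \<Longrightarrow> b \<in> gint \<Longrightarrow> a + b \<in> gint"
  and gint_minus [intro]: "a \<in> gint \<Longrightarrow> - a \<in> gint"
  and gint_mult [intro]: "a \<in> gint \<Longrightarrow> b \<in> gint \<Longrightarrow> a * b \<in> gint"
  and gint_cnj [intro]: "a \<in> gint \<Longrightarrow> cnj a \<in> gint"
  by (auto simp: gint_def)

lemma gint_of_nat [simp]: "of_nat n \<in> gint" by (auto simp: gint_def)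

lemma gint_sum_list: "set zs \<subseteq> gint \<Longrightarrow> sum_list zs \<in> gint"
  by (induction zs) auto

lemma gintE:
  assumes "z \<in> gint"
  obtains x y :: int where "z = Complex (of_int x) (of_int y)"
proof -
  obtain x y :: int where "Re z = of_int x" "Im z = of_int y"
    using assms by (auto simp: gint_def elim!: Ints_cases)
  then show ?thesis using that[of x y] by (simp add: complex_eq_iff)
qed

lemma gint_Complex [simp]: "Complex (of_int x) (of_int y) \<in> gint"
  by (simp add: gint_def)

section \<open>Gaussian integers of given norm\<close>

definition circ :: "nat \<Rightarrow> complex set" where
  "circ m = {z \<in> gint. (cmod z)\<^sup>2 = real m}"

lemma circ_gint: "z \<in> circ m \<Longrightarrow> z \<in> gint" by (simp add: circ_def)

lemma circ_cmod: "z \<in> circ m \<Longrightarrow> cmod z = sqrt (real m)"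
  by (metis (mono_tags, lifting) circ_def mem_Collect_eq norm_ge_zero real_sqrt_unique)

lemma circ_Complex_iff: "Complex (of_int x) (of_int y) \<in> circ m \<longleftrightarrow> x\<^sup>2 + y\<^sup>2 = int m"
proof -
  have "real_of_int (x\<^sup>2 + y\<^sup>2) = real m \<longleftrightarrow> x\<^sup>2 + y\<^sup>2 = int m"
    by (metis of_int_eq_iff of_int_of_nat_eq)
  then show ?thesis unfolding circ_def by (simp add: cmod_power2)
qed

lemma circE:
  assumes "z \<in> circ m"
  obtains x y :: int where "z = Complex (of_int x) (of_int y)" "x\<^sup>2 + y\<^sup>2 = int m"
  using assms circ_gint gintE circ_Complex_iff by metis

lemma gint_in_circ:
  assumes "z \<in> gint"
  obtains m where "z \<in> circ m"
proof -
  obtain x y :: int where z: "z = Complex (of_int x) (of_int y)" using gintE[OF assms] by blast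
  have "z \<in> circ (nat (x\<^sup>2 + y\<^sup>2))" unfolding z circ_Complex_iff by simp
  then show ?thesis using that by blast
qed

lemma circ_cnj: "z \<in> circ m \<Longrightarrow> cnj z \<in> circ m"
  by (auto simp: circ_def)

lemma circ_mult: "z \<in> circ a \<Longrightarrow> w \<in> circ b \<Longrightarrow> z * w \<in> circ (a * b)"
  by (auto simp: circ_def norm_mult power_mult_distrib)

lemma circ_nonzero: "z \<in> circ m \<Longrightarrow> m > 0 \<Longrightarrow> z \<noteq> 0"
  by (auto simp: circ_def)

lemma gint_cmod_ge_1:
  assumes "z \<in> gint" "z \<noteq> 0"
  shows "cmod z \<ge> 1"
proof -
  obtain m where m: "z \<in> circ m" using gint_in_circ assms(1) by blast
  then have "m \<noteq> 0" using assms(2) by (cases m) (auto simp: circ_def)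
  then show ?thesis using circ_cmod[OF m] by simp
qed

lemma circ_subset_image:
  "circ m \<subseteq> (\<lambda>(x,y). Complex (of_int x) (of_int y)) ` ({- int m..int m} \<times> {- int m..int m})"
proof
  fix z assume "z \<in> circ m"
  then obtain x y :: int where xy: "z = Complex (of_int x) (of_int y)" "x\<^sup>2 + y\<^sup>2 = int m"
    by (rule circE)
  have bd: "\<bar>a\<bar> \<le> a\<^sup>2" for a :: int
  proof (cases "a = 0")
    case False
    then have "\<bar>a\<bar> * 1 \<le> \<bar>a\<bar> * \<bar>a\<bar>" by (intro mult_left_mono) auto
    then show ?thesis by (simp add: power2_eq_square)
  qed simp
  have "\<bar>x\<bar> \<le> int m" "\<bar>y\<bar> \<le> int m"
    using bd[of x] bd[of y] xy(2) zero_le_power2[of x] zero_le_power2[of y] by linarith+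
  then show "z \<in> (\<lambda>(x,y). Complex (of_int x) (of_int y)) ` ({- int m..int m} \<times> {- int m..int m})"
    unfolding xy by (auto intro!: image_eqI[of _ _ "(x,y)"])
qed

lemma finite_circ [simp]: "finite (circ m)"
  by (rule finite_subset[OF circ_subset_image]) simp

lemma circ_1: "circ 1 \<subseteq> {1, -1, \<i>, -\<i>}"
proof
  fix z assume "z \<in> circ 1"
  then obtain x y :: int where xy: "z = Complex (of_int x) (of_int y)" "x\<^sup>2 + y\<^sup>2 = 1"
    by (rule circE) simp
  have "x\<^sup>2 \<le> 1" "y\<^sup>2 \<le> 1" using xy(2) zero_le_power2[of x] zero_le_power2[of y] by linarith+
  then have "\<bar>x\<bar> \<le> 1" "\<bar>y\<bar> \<le> 1" by (simp_all add: abs_square_le_1)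
  then have "x \<in> {-1,0,1}" "y \<in> {-1,0,1}" by auto
  then show "z \<in> {1, -1, \<i>, -\<i>}" using xy by (auto simp: complex_eq_iff)
qed

text \<open>The product of z with the conjugate of \<pi> = a + b i has real part a x + b y and
  imaginary part a y - b x. The squares of these add up to p^2 m, so p divides both as soon as it
  divides one, and the product is p w, that is, w times \<pi> times its conjugate.\<close>

lemma circ_dvd_aux:
  assumes p: "prime p" and \<pi>: "Complex (of_int a) (of_int b) \<in> circ p"
    and z: "Complex (of_int x) (of_int y) \<in> circ (p * m)" and d: "int p dvd a * x + b * y"
  obtains w where "w \<in> circ m" "Complex (of_int x) (of_int y) = Complex (of_int a) (of_int b) * w"
proof -
  let ?p = "Complex (of_int a) (of_int b)" and ?z = "Complex (of_int x) (of_int y)"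
  have ab: "a\<^sup>2 + b\<^sup>2 = int p" using \<pi> circ_Complex_iff by blast
  have xy: "x\<^sup>2 + y\<^sup>2 = int p * int m" using z circ_Complex_iff by simp
  have pp: "prime (int p)" using p by simp
  have "(a * y - b * x)\<^sup>2 = (a\<^sup>2 + b\<^sup>2) * (x\<^sup>2 + y\<^sup>2) - (a * x + b * y)\<^sup>2"
    by (simp add: power2_eq_square algebra_simps)
  then have "(a * y - b * x)\<^sup>2 = int p * (int p * int m) - (a * x + b * y)\<^sup>2" unfolding ab xy .
  moreover have "int p dvd \<dots>" using d by (simp add: power2_eq_square)
  ultimately have "int p dvd (a * y - b * x)\<^sup>2" by simp
  then have "int p dvd a * y - b * x" using pp prime_dvd_power by blast
  then obtain u v where uv: "a * x + b * y = int p * u" "a * y - b * x = int p * v"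
    using d by (auto elim!: dvdE)
  define w where "w = Complex (of_int u) (of_int v)"
  have p0: "real p \<noteq> 0" using p by auto
  have e1: "of_nat p * w = ?z * cnj ?p"
  proof -
    have "real_of_int (a * x + b * y) = real p * of_int u" "real_of_int (a * y - b * x) = real p * of_int v"
      using uv by simp_all
    then show ?thesis by (simp add: complex_eq_iff w_def algebra_simps)
  qed
  have e2: "?p * cnj ?p = of_nat p"
  proof -
    have "(of_int a)\<^sup>2 + (of_int b)\<^sup>2 = real p" using ab by (metis of_int_add of_int_of_nat_eq of_int_power)
    then show ?thesis by (simp add: complex_eq_iff power2_eq_square)
  qed
  have "of_nat p * ?z = ?z * (?p * cnj ?p)" unfolding e2 by simp
  also have "\<dots> = ?p * (of_nat p * w)" unfolding e1 by (simp add: mult_ac)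
  finally have "of_nat p * ?z = of_nat p * (?p * w)" by (simp add: mult_ac)
  then have eq: "?z = ?p * w" using p0 by (simp only: mult_cancel_left) auto
  have "(cmod ?z)\<^sup>2 = (cmod ?p)\<^sup>2 * (cmod w)\<^sup>2" by (subst eq) (simp add: norm_mult power_mult_distrib)
  then have "real p * (cmod w)\<^sup>2 = real p * real m" using z \<pi> by (simp add: circ_def)
  then have "(cmod w)\<^sup>2 = real m" using p0 by simp
  then have "w \<in> circ m" by (simp add: circ_def w_def)
  then show ?thesis using eq that by blast
qed

text \<open>The product (a x + b y)(a x - b y) equals a^2 (x^2 + y^2) - y^2 (a^2 + b^2), a multiple
  of p. Which factor p divides decides between \<pi> and its conjugate.\<close>

lemma circ_prime_dvd:
  assumes p: "prime p" and \<pi>: "\<pi> \<in> circ p" and z: "z \<in> circ (p * m)"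
  shows "\<exists>w\<in>circ m. z = \<pi> * w \<or> z = cnj \<pi> * w"
proof -
  obtain a b :: int where ab: "\<pi> = Complex (of_int a) (of_int b)" "a\<^sup>2 + b\<^sup>2 = int p"
    using \<pi> by (rule circE)
  obtain x y :: int where xy: "z = Complex (of_int x) (of_int y)" "x\<^sup>2 + y\<^sup>2 = int (p * m)"
    using z by (rule circE)
  have "(a * x + b * y) * (a * x - b * y) = a\<^sup>2 * (x\<^sup>2 + y\<^sup>2) - y\<^sup>2 * (a\<^sup>2 + b\<^sup>2)"
    by (simp add: power2_eq_square algebra_simps)
  also have "\<dots> = int p * (a\<^sup>2 * int m - y\<^sup>2)" unfolding ab xy by (simp add: algebra_simps)
  finally have "int p dvd (a * x + b * y) * (a * x - b * y)" by simp
  moreover have "prime (int p)" using p by simp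
  ultimately consider "int p dvd a * x + b * y" | "int p dvd a * x - b * y"
    using prime_dvd_multD by blast
  then show ?thesis
  proof cases
    case 1
    then show ?thesis using circ_dvd_aux[OF p, of a b x y m] \<pi> z ab xy by metis
  next
    case 2
    have "cnj \<pi> = Complex (of_int a) (of_int (- b))" using ab by (simp add: complex_eq_iff)
    moreover have "int p dvd a * x + (- b) * y" using 2 by simp
    ultimately show ?thesis using circ_dvd_aux[OF p, of a "- b" x y m] circ_cnj[OF \<pi>] z xy by metis
  qed
qed

text \<open>Thue's pigeonhole argument.\<close>

lemma prime_dvd_sq_plus_one_sum_squares:
  assumes p: "prime p" and s: "int p dvd s\<^sup>2 + 1"
  shows "circ p \<noteq> {}"
proof -
  define k where "k = nat \<lfloor>sqrt (real p)\<rfloor>"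
  have k1: "real k \<le> sqrt (real p)" and k2: "sqrt (real p) < real k + 1"
    unfolding k_def by (simp_all add: of_nat_nat)
  have "(real k)\<^sup>2 \<le> real p" using k1 by (metis of_nat_0_le_iff power_mono real_sqrt_pow2)
  then have kp: "k\<^sup>2 \<le> p" by (metis of_nat_le_iff of_nat_power)
  have "p < (real k + 1)\<^sup>2" using k2 by (metis of_nat_0_le_iff power_strict_mono real_sqrt_ge_0_iff real_sqrt_pow2 zero_less_numeral)
  then have "real p < real ((k + 1)\<^sup>2)" by (simp add: add.commute)
  then have pk: "p < (k + 1)\<^sup>2" by (simp only: of_nat_less_iff)
  \<comment> \<open>A prime is not a square. The strict inequality that follows from this excludes
    the value 2p for the sum of two squares found below.\<close>
  have kne: "k\<^sup>2 \<noteq> p" using p by (auto simp: prime_power_iff)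
  define f where "f = (\<lambda>(u,v). (int u - s * int v) mod int p)"
  have "card (f ` ({0..k} \<times> {0..k})) \<le> card {0..<int p}"
    using p by (intro card_mono) (auto simp: f_def prime_gt_0_nat)
  also have "\<dots> < card ({0..k} \<times> {0..k})" using pk by (simp add: power2_eq_square)
  finally have "\<not> inj_on f ({0..k} \<times> {0..k})" using card_image by fastforce
  then obtain u v u' v' where uv: "u \<le> k" "v \<le> k" "u' \<le> k" "v' \<le> k" "(u,v) \<noteq> (u',v')"
    "f (u,v) = f (u',v')" unfolding inj_on_def by auto
  define d e where "d = int u - int u'" and "e = int v - int v'"
  have "int p dvd (int u - s * int v) - (int u' - s * int v')"
    using uv(6) by (simp add: f_def mod_eq_dvd_iff)
  then have dv: "int p dvd d - s * e" by (simp add: d_def e_def algebra_simps)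
  have "d\<^sup>2 + e\<^sup>2 = (d - s * e) * (d + s * e) + e\<^sup>2 * (s\<^sup>2 + 1)"
    by (simp add: power2_eq_square algebra_simps)
  then have "int p dvd d\<^sup>2 + e\<^sup>2" using dv s by simp
  then obtain q where q: "d\<^sup>2 + e\<^sup>2 = int p * q" by (auto elim: dvdE)
  have "\<bar>d\<bar> \<le> int k" "\<bar>e\<bar> \<le> int k" using uv by (auto simp: d_def e_def)
  then have "d\<^sup>2 \<le> (int k)\<^sup>2" "e\<^sup>2 \<le> (int k)\<^sup>2" by (simp_all add: abs_le_square_iff[symmetric])
  moreover have "(int k)\<^sup>2 < int p" using kp kne by (metis le_neq_implies_less of_nat_less_iff of_nat_power)
  ultimately have "int p * q < int p * 2" using q by linarith
  then have "q < 2" using p by (simp add: prime_gt_0_nat)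
  moreover have "d \<noteq> 0 \<or> e \<noteq> 0" using uv(5) by (auto simp: d_def e_def)
  then have "d\<^sup>2 + e\<^sup>2 > 0" by (simp add: sum_power2_gt_zero_iff)
  then have "q > 0" using q p by (metis of_nat_0_less_iff prime_gt_0_nat zero_less_mult_pos)
  ultimately have "q = 1" by simp
  then have "Complex (of_int d) (of_int e) \<in> circ p" using q circ_Complex_iff by simp
  then show ?thesis by auto
qed

lemma QuadRes_minus_one_mod4:
  assumes p: "prime p" "p > 2"
  shows "QuadRes (int p) (-1) \<longleftrightarrow> p mod 4 = 1"
proof -
  have odd: "odd p" using p by (simp add: prime_odd_nat)
  have n0: "\<not> [-1 = 0] (mod int p)" using p by (auto simp: cong_0_iff)
  have n1: "\<not> [-1 = 1] (mod int p)" using p by (auto simp: cong_iff_dvd_diff dest: zdvd_imp_le)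
  have L: "[Legendre (-1) (int p) = (-1) ^ ((p - 1) div 2)] (mod int p)"
    using euler_criterion[of p "-1"] p by simp
  have par: "p mod 4 = 1 \<longleftrightarrow> even ((p - 1) div 2)" using odd by presburger
  show ?thesis
  proof
    assume "QuadRes (int p) (-1)"
    then have "[1 = (-1) ^ ((p - 1) div 2)] (mod int p)" using L n0 by (simp add: Legendre_def)
    then have "even ((p - 1) div 2)" using n1 by (cases "even ((p - 1) div 2)") (auto simp: cong_sym_eq)
    then show "p mod 4 = 1" using par by simp
  next
    assume "p mod 4 = 1"
    then have "[Legendre (-1) (int p) = 1] (mod int p)" using L par by simp
    then show "QuadRes (int p) (-1)" using n0 n1 by (auto simp: Legendre_def split: if_splits)
  qed
qed

lemma sqrt_minus_one_mod:
  assumes "prime p" "p mod 4 = 1"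
  obtains s :: int where "int p dvd s\<^sup>2 + 1"
proof -
  have "p > 2" using assms prime_ge_2_nat[of p] by (cases "p = 2") auto
  then have "QuadRes (int p) (-1)" using QuadRes_minus_one_mod4 assms by blast
  then show ?thesis using that by (auto simp: QuadRes_def cong_iff_dvd_diff)
qed

lemma circ_prime_mod4_1: "prime p \<Longrightarrow> p mod 4 = 1 \<Longrightarrow> circ p \<noteq> {}"
  using sqrt_minus_one_mod prime_dvd_sq_plus_one_sum_squares by metis

text \<open>If x were invertible modulo p, then y/x would be a square root of -1.\<close>

lemma prime_3_mod_4_dvd:
  fixes x y :: int
  assumes p: "prime p" "p mod 4 = 3" and d: "int p dvd x\<^sup>2 + y\<^sup>2"
  shows "int p dvd x"
proof (rule ccontr)
  assume nd: "\<not> int p dvd x"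
  have p2: "p > 2" using p prime_ge_2_nat[of p] by (cases "p = 2") auto
  have "coprime (int p) x" using nd p(1) prime_imp_coprime[of "int p" x] by simp
  then have "coprime x (int p)" by (simp add: coprime_commute)
  then obtain x' where x': "[x * x' = 1] (mod int p)" using cong_solve_coprime_int by blast
  have "(y * x')\<^sup>2 + 1 = x'\<^sup>2 * (x\<^sup>2 + y\<^sup>2) - (x * x' - 1) * (x * x' + 1)"
    by (simp add: power2_eq_square algebra_simps)
  moreover have "int p dvd x * x' - 1" using x' by (simp add: cong_iff_dvd_diff)
  ultimately have "int p dvd (y * x')\<^sup>2 + 1" using d by simp
  then have "QuadRes (int p) (-1)" unfolding QuadRes_def cong_iff_dvd_diff by (metis diff_minus_eq_add)
  then show False using QuadRes_minus_one_mod4[OF p(1) p2] p(2) by simp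
qed

lemma circ_prime_3_mod_4:
  assumes p: "prime p" "p mod 4 = 3" and z: "z \<in> circ m" and d: "p dvd m"
  shows "\<exists>w m'. m = p\<^sup>2 * m' \<and> w \<in> circ m' \<and> z = of_nat p * w"
proof -
  obtain x y :: int where xy: "z = Complex (of_int x) (of_int y)" "x\<^sup>2 + y\<^sup>2 = int m"
    using z by (rule circE)
  have "int p dvd x\<^sup>2 + y\<^sup>2" using d xy(2) by simp
  then have "int p dvd x" "int p dvd y"
    using prime_3_mod_4_dvd[OF p, of x y] prime_3_mod_4_dvd[OF p, of y x] by (simp_all add: add.commute)
  then obtain u v where uv: "x = int p * u" "y = int p * v" by (auto elim!: dvdE)
  define m' where "m' = nat (u\<^sup>2 + v\<^sup>2)"
  have "int m = int (p\<^sup>2 * m')"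
    unfolding m'_def using xy(2) uv by (simp add: power_mult_distrib algebra_simps)
  then have "m = p\<^sup>2 * m'" by (simp only: of_nat_eq_iff)
  moreover have "Complex (of_int u) (of_int v) \<in> circ m'" unfolding circ_Complex_iff m'_def by simp
  moreover have "z = of_nat p * Complex (of_int u) (of_int v)" unfolding xy uv by (simp add: complex_eq_iff)
  ultimately show ?thesis by blast
qed

lemma circ_2: "1 + \<i> \<in> circ 2" by (auto simp: circ_def cmod_def)

text \<open>Counting with multiplicity makes this additive on all products, coprime or not, and two
  to this power still bounds the number of points on a circle up to the four units.\<close>

definition om1 :: "nat \<Rightarrow> nat" where
  "om1 n = size (filter_mset (\<lambda>p. p mod 4 = 1) (prime_factorization n))"

lemma om1_mult: "a > 0 \<Longrightarrow> b > 0 \<Longrightarrow> om1 (a * b) = om1 a + om1 b"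
  by (simp add: om1_def prime_factorization_mult)

lemma om1_prime: "prime p \<Longrightarrow> om1 p = (if p mod 4 = 1 then 1 else 0)"
  by (simp add: om1_def prime_factorization_prime)

lemma om1_dvd_mono:
  assumes "a dvd b" "b > 0"
  shows "om1 a \<le> om1 b"
  using assms om1_mult[of a] by (auto elim!: dvdE)

text \<open>One prime is removed at a time. At 2 the factors 1 + i and 1 - i differ by a unit, so
  nothing grows. A prime congruent to 1 modulo 4 offers two factors and at most doubles the count. A
  prime congruent to 3 occurs squared and acts as a scalar. The units give the 4.\<close>

lemma card_circ_le:
  assumes "m > 0"
  shows "card (circ m) \<le> 4 * 2 ^ om1 m"
  using assms
proof (induction m rule: less_induct)
  case (less m)
  show ?case
  proof (cases "m = 1")
    case True
    have "card (circ 1) \<le> card {1, -1, \<i>, -\<i>}" by (intro card_mono circ_1) simp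
    also have "\<dots> \<le> 4" using card_length[of "[1, -1, \<i>, -\<i>]"] by simp
    also have "(4::nat) \<le> 4 * 2 ^ om1 m" by simp
    finally show ?thesis using True by simp
  next
    case False
    then obtain p where p: "prime p" "p dvd m" using prime_factor_nat by blast
    then obtain m' where m': "m = p * m'" by (auto elim: dvdE)
    have m'0: "m' > 0" "m' < m" using m' less.prems p(1) prime_ge_2_nat[of p] by auto
    have IH: "card (circ m') \<le> 4 * 2 ^ om1 m'" using less.IH m'0 by blast
    have om: "om1 m = om1 p + om1 m'" unfolding m' using p m'0 by (intro om1_mult) (auto simp: prime_gt_0_nat)
    consider "p = 2" | "p mod 4 = 1" | "p mod 4 = 3"
    proof -
      have "p = 2 \<or> odd p" using p(1) prime_odd_nat[of p] prime_ge_2_nat[of p] by (cases "p = 2") auto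
      moreover have "p mod 4 = 1 \<or> p mod 4 = 3" if "odd p" using that by presburger
      ultimately show ?thesis using that by blast
    qed
    then show ?thesis
    proof cases
      case 1
      have "circ m \<subseteq> (\<lambda>w. (1 + \<i>) * w) ` circ m'"
      proof
        fix z assume "z \<in> circ m"
        then have "z \<in> circ (2 * m')" using m' 1 by simp
        with circ_prime_dvd[of 2 "1 + \<i>" z m'] circ_2 obtain w where w: "w \<in> circ m'"
          "z = (1 + \<i>) * w \<or> z = cnj (1 + \<i>) * w" by auto
        have "cnj (1 + \<i>) * w = (1 + \<i>) * (- \<i> * w)" by (simp add: complex_eq_iff algebra_simps)
        moreover have "- \<i> * w \<in> gint" using circ_gint[OF w(1)] by (intro gint_mult gint_minus gint_ii)
        then have "- \<i> * w \<in> circ m'" using w(1) by (simp add: circ_def norm_mult)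
        ultimately show "z \<in> (\<lambda>w. (1 + \<i>) * w) ` circ m'" using w by blast
      qed
      then have "card (circ m) \<le> card ((\<lambda>w. (1 + \<i>) * w) ` circ m')" by (intro card_mono) auto
      also have "\<dots> \<le> card (circ m')" by (rule card_image_le) simp
      finally show ?thesis using IH om by (simp add: power_add le_trans)
    next
      case 2
      then obtain \<pi> where \<pi>: "\<pi> \<in> circ p" using circ_prime_mod4_1[OF p(1)] by auto
      have "circ m \<subseteq> (\<lambda>w. \<pi> * w) ` circ m' \<union> (\<lambda>w. cnj \<pi> * w) ` circ m'"
        using circ_prime_dvd[OF p(1) \<pi>, of _ m'] unfolding m' by blast
      then have "card (circ m) \<le> card ((\<lambda>w. \<pi> * w) ` circ m' \<union> (\<lambda>w. cnj \<pi> * w) ` circ m')"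
        by (intro card_mono) auto
      also have "\<dots> \<le> card ((\<lambda>w. \<pi> * w) ` circ m') + card ((\<lambda>w. cnj \<pi> * w) ` circ m')"
        by (rule card_Un_le)
      also have "\<dots> \<le> card (circ m') + card (circ m')" by (intro add_mono card_image_le) auto
      finally show ?thesis using IH om 2 p(1) by (simp add: om1_prime power_add)
    next
      case 3
      show ?thesis
      proof (cases "circ m = {}")
        case True then show ?thesis by simp
      next
        case False
        then obtain z0 where "z0 \<in> circ m" by auto
        with circ_prime_3_mod_4[OF p(1) 3] p(2) obtain m2 where m2: "m = p\<^sup>2 * m2" by blast
        then have m20: "m2 > 0" "m' = p * m2" using less.prems m' p(1) by (auto simp: power2_eq_square)
        then have "m2 < m" using m2 m'0 p(1) prime_ge_2_nat[of p] by auto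
        then have IH2: "card (circ m2) \<le> 4 * 2 ^ om1 m2" using less.IH m20 by blast
        have "circ m \<subseteq> (\<lambda>w. of_nat p * w) ` circ m2"
        proof
          fix z assume "z \<in> circ m"
          with circ_prime_3_mod_4[OF p(1) 3] p(2) obtain w m3 where
            w: "m = p\<^sup>2 * m3" "w \<in> circ m3" "z = of_nat p * w" by blast
          then have "m3 = m2" using m2 p(1) by simp
          then show "z \<in> (\<lambda>w. of_nat p * w) ` circ m2" using w by blast
        qed
        then have "card (circ m) \<le> card ((\<lambda>w. of_nat p * w :: complex) ` circ m2)" by (intro card_mono) auto
        also have "\<dots> \<le> card (circ m2)" by (rule card_image_le) simp
        also have "\<dots> \<le> 4 * 2 ^ om1 m2" by (rule IH2)
        also have "\<dots> \<le> 4 * 2 ^ om1 m"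
          using om1_dvd_mono[of m2 m] m2 less.prems by (intro mult_left_mono power_increasing) auto
        finally show ?thesis .
      qed
    qed
  qed
qed

section \<open>Primitive tuples and their splitting at a prime\<close>

definition primitive_list :: "complex list \<Rightarrow> bool" where
  "primitive_list zs \<longleftrightarrow> (\<forall>h\<in>gint. (\<forall>z\<in>set zs. \<exists>w\<in>gint. z = h * w) \<longrightarrow> cmod h \<le> 1)"

lemma sum_list_mult_const_left: "sum_list (map (\<lambda>z. g * z) zs) = g * sum_list (zs :: complex list)"
  by (induction zs) (auto simp: algebra_simps)

text \<open>Descent on the norm: a common divisor of modulus greater than 1 has norm at least 2, and
  dividing it out divides m by that norm. The divisors met on the way multiply up to
  \<open>g\<close>.\<close>

lemma primitive_reduction:
  assumes "zs \<noteq> []" "set zs \<subseteq> circ m" "m > 0"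
  shows "\<exists>g k m' zs'. g \<in> circ k \<and> m = k * m' \<and> zs = map (\<lambda>z. g * z) zs' \<and> set zs' \<subseteq> circ m' \<and> primitive_list zs'"
  using assms
proof (induction m arbitrary: zs rule: less_induct)
  case (less m)
  show ?case
  proof (cases "primitive_list zs")
    case True
    have "1 \<in> circ 1" by (simp add: circ_def)
    then show ?thesis using True less.prems
      by (intro exI[of _ 1] exI[of _ 1] exI[of _ m] exI[of _ zs]) auto
  next
    case False
    then obtain h where h: "h \<in> gint" "\<forall>z\<in>set zs. \<exists>w\<in>gint. z = h * w" "cmod h > 1"
      by (auto simp: primitive_list_def not_le)
    obtain k0 where k0: "h \<in> circ k0" using h(1) gint_in_circ by blast
    have "(cmod h)\<^sup>2 > 1" using h(3) by (simp add: power_gt1_lemma one_less_power)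
    then have k01: "k0 > 1" using k0 by (simp add: circ_def)
    define f where "f z = (SOME w. w \<in> gint \<and> z = h * w)" for z
    have f: "f z \<in> gint \<and> z = h * f z" if "z \<in> set zs" for z
      unfolding f_def by (rule someI_ex) (use h(2) that in auto)
    define ws where "ws = map f zs"
    have zs: "zs = map (\<lambda>z. h * z) ws"
      unfolding ws_def map_map o_def by (rule map_idI[symmetric]) (use f in auto)
    obtain m0 where m0: "f (hd zs) \<in> circ m0" using f[of "hd zs"] less.prems(1) gint_in_circ hd_in_set by metis
    have rel: "real m = real k0 * (cmod (f z))\<^sup>2" if "z \<in> set zs" for z
    proof -
      have "real m = (cmod z)\<^sup>2" using that less.prems(2) by (auto simp: circ_def)
      also have "\<dots> = (cmod (h * f z))\<^sup>2" using f[OF that] by metis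
      also have "\<dots> = real k0 * (cmod (f z))\<^sup>2" using k0 by (simp add: circ_def norm_mult power_mult_distrib)
      finally show ?thesis .
    qed
    have "real m = real (k0 * m0)" using rel[of "hd zs"] m0 less.prems(1) by (simp add: circ_def)
    then have m: "m = k0 * m0" by (simp only: of_nat_eq_iff)
    have "f z \<in> circ m0" if "z \<in> set zs" for z
      using rel[OF that] f[OF that] k01 m by (simp add: circ_def)
    then have sub: "set ws \<subseteq> circ m0" by (auto simp: ws_def)
    have "m0 > 0" "m0 < m" using m k01 less.prems(3) by auto
    moreover have "ws \<noteq> []" using less.prems(1) by (simp add: ws_def)
    ultimately obtain g k m' zs' where IH: "g \<in> circ k" "m0 = k * m'" "ws = map (\<lambda>z. g * z) zs'"
      "set zs' \<subseteq> circ m'" "primitive_list zs'" using less.IH[OF _ _ sub] by blast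
    have "h * g \<in> circ (k0 * k)" using k0 IH(1) by (rule circ_mult)
    moreover have "m = (k0 * k) * m'" using m IH(2) by simp
    moreover have "zs = map (\<lambda>z. (h * g) * z) zs'" unfolding zs IH(3) by (simp add: mult.assoc)
    ultimately show ?thesis using IH by blast
  qed
qed

text \<open>The last two clauses keep track of an empty side: in that case one Gaussian prime
  divides every entry, which is what a primitive list excludes.\<close>

lemma circ_list_split:
  assumes p: "prime p" and \<pi>: "\<pi> \<in> circ p" and zs: "set zs \<subseteq> circ (p * m)"
  shows "\<exists>us vs. set us \<subseteq> circ m \<and> set vs \<subseteq> circ m \<and> length us + length vs = length zs \<and>
     sum_list zs = \<pi> * sum_list us + cnj \<pi> * sum_list vs \<and>
     (vs = [] \<longrightarrow> (\<forall>z\<in>set zs. \<exists>w\<in>gint. z = \<pi> * w)) \<and>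
     (us = [] \<longrightarrow> (\<forall>z\<in>set zs. \<exists>w\<in>gint. z = cnj \<pi> * w))"
  using zs
proof (induction zs)
  case Nil
  show ?case by (intro exI[of _ "[]"]) auto
next
  case (Cons z zs)
  then obtain us vs where IH: "set us \<subseteq> circ m" "set vs \<subseteq> circ m" "length us + length vs = length zs"
     "sum_list zs = \<pi> * sum_list us + cnj \<pi> * sum_list vs"
     "vs = [] \<longrightarrow> (\<forall>z\<in>set zs. \<exists>w\<in>gint. z = \<pi> * w)"
     "us = [] \<longrightarrow> (\<forall>z\<in>set zs. \<exists>w\<in>gint. z = cnj \<pi> * w)" by auto
  from Cons.prems circ_prime_dvd[OF p \<pi>] obtain w where w: "w \<in> circ m" "z = \<pi> * w \<or> z = cnj \<pi> * w"
    by (meson list.set_intros(1) subsetD)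
  from w(2) show ?case
  proof
    assume "z = \<pi> * w"
    then show ?thesis using IH w(1) by (intro exI[of _ "w # us"] exI[of _ vs]) (auto simp: algebra_simps intro: circ_gint)
  next
    assume "z = cnj \<pi> * w"
    then show ?thesis using IH w(1) by (intro exI[of _ us] exI[of _ "w # vs"]) (auto simp: algebra_simps intro: circ_gint)
  qed
qed

text \<open>Above 2, and above a prime congruent to 3 modulo 4, there is only one Gaussian prime up
  to units. If p divides the norm, that prime divides every entry.\<close>

lemma primitive_prime_mod4:
  assumes prim: "primitive_list zs" and zs: "set zs \<subseteq> circ m" and p: "prime p" "p dvd m"
  shows "p mod 4 = 1"
proof -
  have p2: "p \<ge> 2" using p prime_ge_2_nat by blast
  have "p \<noteq> 2"
  proof
    assume "p = 2"
    then obtain m' where m': "m = 2 * m'" using p by (auto elim: dvdE)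
    have "\<exists>w\<in>gint. z = (1 + \<i>) * w" if "z \<in> set zs" for z
    proof -
      from circ_prime_dvd[of 2 "1 + \<i>" z m'] circ_2 zs that m' obtain w where w: "w \<in> circ m'"
        "z = (1 + \<i>) * w \<or> z = cnj (1 + \<i>) * w" by auto
      have "cnj (1 + \<i>) * w = (1 + \<i>) * (- \<i> * w)" by (simp add: complex_eq_iff algebra_simps)
      moreover have "- \<i> * w \<in> gint" using circ_gint[OF w(1)] by (intro gint_mult gint_minus gint_ii)
      ultimately show ?thesis using w circ_gint by metis
    qed
    moreover have "1 + \<i> \<in> gint" by (intro gint_add gint_1 gint_ii)
    ultimately have "cmod (1 + \<i>) \<le> 1" using prim unfolding primitive_list_def by blast
    then show False by (simp add: cmod_def)
  qed
  moreover have "p mod 4 \<noteq> 3"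
  proof
    assume 3: "p mod 4 = 3"
    have "\<exists>w\<in>gint. z = of_nat p * w" if "z \<in> set zs" for z
      using circ_prime_3_mod_4[OF p(1) 3 _ p(2)] zs that circ_gint by (metis subsetD)
    then have "cmod (of_nat p) \<le> 1" using prim gint_of_nat unfolding primitive_list_def by blast
    then show False using p2 by simp
  qed
  moreover have "odd p" using p(1) p2 \<open>p \<noteq> 2\<close> prime_odd_nat[of p] by auto
  ultimately show ?thesis by presburger
qed

lemma primitive_split:
  assumes prim: "primitive_list zs" and p: "prime p" and \<pi>: "\<pi> \<in> circ p" and zs: "set zs \<subseteq> circ (p * m)"
  obtains us vs where "set us \<subseteq> circ m" "set vs \<subseteq> circ m" "length us + length vs = length zs"
    "sum_list zs = \<pi> * sum_list us + cnj \<pi> * sum_list vs" "us \<noteq> []" "vs \<noteq> []"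
proof -
  obtain us vs where uv: "set us \<subseteq> circ m" "set vs \<subseteq> circ m" "length us + length vs = length zs"
     "sum_list zs = \<pi> * sum_list us + cnj \<pi> * sum_list vs"
     "vs = [] \<longrightarrow> (\<forall>z\<in>set zs. \<exists>w\<in>gint. z = \<pi> * w)"
     "us = [] \<longrightarrow> (\<forall>z\<in>set zs. \<exists>w\<in>gint. z = cnj \<pi> * w)"
    using circ_list_split[OF p \<pi> zs] by blast
  have big: "cmod \<pi> > 1" "cmod (cnj \<pi>) > 1" using circ_cmod[OF \<pi>] p by (auto simp: prime_gt_Suc_0_nat)
  have "vs \<noteq> []" using uv(5) prim big(1) circ_gint[OF \<pi>] unfolding primitive_list_def by (meson not_le)
  moreover have "us \<noteq> []" using uv(6) prim big(2) circ_gint[OF circ_cnj[OF \<pi>]] unfolding primitive_list_def by (meson not_le)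
  ultimately show ?thesis using that uv by blast
qed

text \<open>With C = A/B and t = |C|, choose \<beta> of modulus 1 with \<beta>^2 = - conj(C) / t.
  Multiplication by \<beta> turns z C + conj(z) into - t \<zeta> + conj(\<zeta>) for \<zeta> = z
  conj(\<beta>), whose imaginary part is -(1 + t) Im \<zeta>. Since 1 + t >= 1, the point z lies
  close to the line through \<beta>, uniformly in A and B, and this line depends on A and B only. If
  A = 0, then \<theta> < 1 leaves only z = 0.\<close>

lemma arc_in_strip:
  fixes A B :: complex
  assumes B: "B \<noteq> 0" and \<theta>: "\<theta> < 1"
  obtains c s :: real where "c\<^sup>2 + s\<^sup>2 = 1"
    "\<And>z. cmod (z * A + cnj z * B) \<le> \<theta> * cmod z * cmod B \<Longrightarrow> \<bar>s * Re z - c * Im z\<bar> \<le> \<theta> * cmod z"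
proof (cases "A = 0")
  case True
  show ?thesis
  proof (rule that[of 1 0])
    fix z assume "cmod (z * A + cnj z * B) \<le> \<theta> * cmod z * cmod B"
    then have "(1 - \<theta>) * (cmod z * cmod B) \<le> 0" using True by (simp add: norm_mult algebra_simps)
    then have "cmod z * cmod B \<le> 0" using \<theta> by (simp add: mult_le_0_iff)
    then have "z = 0" using B by (simp add: mult_le_0_iff)
    then show "\<bar>0 * Re z - 1 * Im z\<bar> \<le> \<theta> * cmod z" by simp
  qed simp
next
  case False
  define C where "C = A / B"
  define t where "t = cmod C"
  have t: "t > 0" using B False by (simp add: t_def C_def)
  define \<beta> where "\<beta> = csqrt (- cnj C / of_real t)"
  have \<beta>2: "\<beta>\<^sup>2 = - cnj C / of_real t" by (simp add: \<beta>_def)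
  have "(cmod \<beta>)\<^sup>2 = 1" using t by (simp flip: norm_power) (simp add: \<beta>2 norm_divide t_def)
  then have \<beta>1: "cmod \<beta> = 1" using power2_eq_1_iff[of "cmod \<beta>"] norm_ge_zero[of \<beta>] by linarith
  have bb: "\<beta> * cnj \<beta> = 1" using \<beta>1 by (simp add: complex_norm_square[symmetric])
  have C: "C * \<beta> = - of_real t * cnj \<beta>"
  proof -
    have "cnj (\<beta>\<^sup>2) = - C / of_real t" unfolding \<beta>2 by simp
    then have "C = - of_real t * (cnj \<beta>)\<^sup>2" using t by (simp add: field_simps)
    then have "C * \<beta> = - of_real t * cnj \<beta> * (\<beta> * cnj \<beta>)" by (simp add: power2_eq_square mult_ac)
    then show ?thesis unfolding bb by simp
  qed
  show ?thesis
  proof (rule that[of "Re \<beta>" "Im \<beta>"])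
    show "(Re \<beta>)\<^sup>2 + (Im \<beta>)\<^sup>2 = 1" using \<open>(cmod \<beta>)\<^sup>2 = 1\<close> by (simp add: cmod_power2)
    fix z assume le: "cmod (z * A + cnj z * B) \<le> \<theta> * cmod z * cmod B"
    have "z * A + cnj z * B = B * (z * C + cnj z)" using B by (simp add: C_def field_simps)
    then have "cmod B * cmod (z * C + cnj z) \<le> cmod B * (\<theta> * cmod z)" using le by (simp add: norm_mult mult_ac)
    then have "cmod (z * C + cnj z) \<le> \<theta> * cmod z" using B by (simp add: mult_le_cancel_left)
    then have le2: "cmod ((z * C + cnj z) * \<beta>) \<le> \<theta> * cmod z" using \<beta>1 by (simp add: norm_mult)
    define \<zeta> where "\<zeta> = z * cnj \<beta>"
    have "(z * C + cnj z) * \<beta> = z * (C * \<beta>) + cnj z * \<beta>" by (simp add: algebra_simps)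
    also have "\<dots> = - of_real t * \<zeta> + cnj \<zeta>" unfolding C by (simp add: \<zeta>_def mult_ac)
    finally have "cmod (- of_real t * \<zeta> + cnj \<zeta>) \<le> \<theta> * cmod z" using le2 by simp
    then have "\<bar>Im (- of_real t * \<zeta> + cnj \<zeta>)\<bar> \<le> \<theta> * cmod z" using abs_Im_le_cmod order_trans by blast
    moreover have "Im (- of_real t * \<zeta> + cnj \<zeta>) = - ((1 + t) * Im \<zeta>)" by (simp add: algebra_simps)
    then have "\<bar>Im (- of_real t * \<zeta> + cnj \<zeta>)\<bar> = (1 + t) * \<bar>Im \<zeta>\<bar>"
      using t by (simp only: abs_minus_cancel abs_mult)
    ultimately have "(1 + t) * \<bar>Im \<zeta>\<bar> \<le> \<theta> * cmod z" by simp
    moreover have "1 * \<bar>Im \<zeta>\<bar> \<le> (1 + t) * \<bar>Im \<zeta>\<bar>" using t by (intro mult_right_mono) auto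
    moreover have "\<bar>Im \<beta> * Re z - Re \<beta> * Im z\<bar> = \<bar>Im \<zeta>\<bar>" by (simp add: \<zeta>_def algebra_simps abs_minus_commute)
    ultimately show "\<bar>Im \<beta> * Re z - Re \<beta> * Im z\<bar> \<le> \<theta> * cmod z" by linarith
  qed
qed


section \<open>Sums over smooth numbers and over sums of two squares\<close>

definition big_omega :: "nat \<Rightarrow> nat" where
  "big_omega n = size (prime_factorization n)"

lemma big_omega_mult: "a > 0 \<Longrightarrow> b > 0 \<Longrightarrow> big_omega (a * b) = big_omega a + big_omega b"
  by (simp add: big_omega_def prime_factorization_mult)

lemma big_omega_prime_power: "prime p \<Longrightarrow> big_omega (p ^ k) = k"
  by (simp add: big_omega_def prime_factorization_prime_power)

lemma big_omega_1 [simp]: "big_omega 1 = 0" "big_omega (Suc 0) = 0"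
  by (simp_all add: big_omega_def)

lemma om1_le_big_omega: "om1 n \<le> big_omega n"
  unfolding om1_def big_omega_def by (rule size_filter_mset_lesseq)

lemma geometric_partial_le:
  fixes r :: real
  assumes "0 \<le> r" "r < 1"
  shows "(\<Sum>k\<in>{..K}. r ^ k) \<le> 1 / (1 - r)"
proof -
  have "(\<Sum>k\<in>{..K}. r ^ k) \<le> suminf (\<lambda>k. r ^ k)"
    by (rule sum_le_suminf) (use assms in \<open>auto intro: summable_geometric\<close>)
  also have "\<dots> = 1 / (1 - r)" by (rule suminf_geometric) (use assms in auto)
  finally show ?thesis .
qed

text \<open>The Euler product, built up one prime q at a time by writing d = q^k e. Arbitrary finite
  sets \<open>F\<close> avoid every question of convergence, and y < 2 <= q keeps each geometric
  ratio below 1.\<close>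

lemma euler_sum_le_prod:
  fixes y :: real
  assumes "finite P" "\<And>p. p \<in> P \<Longrightarrow> prime p" "0 \<le> y" "y < 2"
    and "finite F" "\<And>d. d \<in> F \<Longrightarrow> d > 0 \<and> prime_factors d \<subseteq> P"
  shows "(\<Sum>d\<in>F. y ^ big_omega d / real d) \<le> (\<Prod>p\<in>P. 1 / (1 - y / real p))"
  using assms(1,2,5,6)
proof (induction P arbitrary: F rule: finite_induct)
  case empty
  have "F \<subseteq> {1}"
  proof
    fix d assume "d \<in> F"
    then have "d > 0" "prime_factors d = {}" using empty by auto
    then show "d \<in> {1}" by (simp add: prime_factorization_empty_iff)
  qed
  then have "(\<Sum>d\<in>F. y ^ big_omega d / real d) \<le> (\<Sum>d\<in>{1}. y ^ big_omega d / real d)"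
    by (intro sum_mono2) (use assms in auto)
  then show ?case by simp
next
  case (insert q P)
  have q: "prime q" "q \<ge> 2" using insert.prems(1)[of q] prime_ge_2_nat by auto
  define r where "r = y / real q"
  have r: "0 \<le> r" "r < 1" using assms(3,4) q by (auto simp: r_def divide_less_eq)
  define k where "k d = multiplicity q d" for d
  define e where "e d = d div q ^ k d" for d
  have de: "d = q ^ k d * e d" for d
    unfolding k_def e_def using multiplicity_dvd[of q d] by simp
  have e_pos: "e d > 0" if "d \<in> F" for d
    using de[of d] insert.prems(3)[OF that] by (intro Nat.gr0I) auto
  have nq: "\<not> q dvd e d" if "d \<in> F" for d
    using insert.prems(3)[OF that] q(1) multiplicity_decompose[of d q] unfolding e_def k_def
    by (metis not_prime_unit less_numeral_extra(3))
  have e_fac: "prime_factors (e d) \<subseteq> P" if "d \<in> F" for d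
  proof
    fix p assume p: "p \<in> prime_factors (e d)"
    then have "p dvd e d" "prime p" by auto
    then have "p dvd d" using de[of d] by (metis dvd_mult)
    then have "p \<in> prime_factors d" using \<open>prime p\<close> insert.prems(3)[OF that] by (auto simp: prime_factors_dvd)
    then have "p \<in> insert q P" using insert.prems(3)[OF that] by blast
    moreover have "p \<noteq> q" using \<open>p dvd e d\<close> nq[OF that] by auto
    ultimately show "p \<in> P" by simp
  qed
  obtain K where K: "\<And>d. d \<in> F \<Longrightarrow> k d \<le> K"
    using finite_imageI[OF insert.prems(2), of k] by (metis Max_ge image_eqI)
  have summand: "y ^ big_omega d / real d = r ^ k d * (y ^ big_omega (e d) / real (e d))" if "d \<in> F" for d
  proof -
    have "big_omega d = k d + big_omega (e d)"
      using de[of d] e_pos[OF that] q big_omega_mult[of "q ^ k d" "e d"] by (simp add: big_omega_prime_power)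
    moreover have "real d = real q ^ k d * real (e d)" using de[of d] by (metis of_nat_mult of_nat_power)
    ultimately show ?thesis by (simp add: r_def power_add power_divide)
  qed
  have inj: "inj_on (\<lambda>d. (k d, e d)) F"
    by (rule inj_onI) (metis de prod.inject)
  have "(\<Sum>d\<in>F. y ^ big_omega d / real d) = (\<Sum>d\<in>F. r ^ k d * (y ^ big_omega (e d) / real (e d)))"
    by (intro sum.cong refl summand)
  also have "\<dots> = (\<Sum>(j,c)\<in>(\<lambda>d. (k d, e d)) ` F. r ^ j * (y ^ big_omega c / real c))"
    by (subst sum.reindex[OF inj]) simp
  also have "\<dots> \<le> (\<Sum>(j,c)\<in>{..K} \<times> e ` F. r ^ j * (y ^ big_omega c / real c))"
    by (intro sum_mono2) (use K insert.prems(2) r assms(3) in auto)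
  also have "\<dots> = (\<Sum>j\<in>{..K}. r ^ j) * (\<Sum>c\<in>e ` F. y ^ big_omega c / real c)"
    by (simp add: sum_product sum.cartesian_product)
  also have "\<dots> \<le> (1 / (1 - r)) * (\<Prod>p\<in>P. 1 / (1 - y / real p))"
  proof (intro mult_mono geometric_partial_le r)
    show "(\<Sum>c\<in>e ` F. y ^ big_omega c / real c) \<le> (\<Prod>p\<in>P. 1 / (1 - y / real p))"
    proof (rule insert.IH)
      fix c assume "c \<in> e ` F"
      then show "c > 0 \<and> prime_factors c \<subseteq> P" using e_pos e_fac by blast
    qed (use insert.prems in auto)
  qed (use r assms(3) in \<open>auto intro!: sum_nonneg\<close>)
  also have "\<dots> = (\<Prod>p\<in>insert q P. 1 / (1 - y / real p))" using insert by (simp add: r_def)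
  finally show ?case .
qed

text \<open>The range up to 3/4 is that of y/p for y <= 3/2 and p >= 2.\<close>

lemma one_over_one_minus_le_exp:
  fixes t :: real
  assumes "0 \<le> t" "t \<le> 3/4"
  shows "1 / (1 - t) \<le> exp (t + 2 * t\<^sup>2)"
proof -
  define x where "x = t + 2 * t\<^sup>2"
  have "x \<ge> 0" using assms by (simp add: x_def)
  then have "1 + x + x\<^sup>2 / 2 \<le> exp x" by (rule exp_lower_Taylor_quadratic)
  then have "(1 - t) * (1 + x + x\<^sup>2 / 2) \<le> (1 - t) * exp x" using assms by (intro mult_left_mono) auto
  moreover have "(1 - t) * (1 + x + x\<^sup>2 / 2) = 1 + t\<^sup>2 * (3/2 - t / 2 - 2 * t ^ 3)"
    by (simp add: x_def power2_eq_square power3_eq_cube field_simps)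
  moreover have "t ^ 3 \<le> (3/4) ^ 3" using assms by (intro power_mono) auto
  then have "3/2 - t / 2 - 2 * t ^ 3 \<ge> 0" using assms by (simp add: power3_eq_cube)
  then have "t\<^sup>2 * (3/2 - t / 2 - 2 * t ^ 3) \<ge> 0" by simp
  ultimately have "1 \<le> (1 - t) * exp x" by linarith
  then show ?thesis using assms by (simp add: x_def divide_le_eq mult.commute)
qed

text \<open>The quadratic terms of the exponents add up to at most 2 y^2 zeta(2) <= (9/2) zeta(2),
  hence a constant independent of y and of the set of primes.\<close>

lemma euler_sum_le_exp:
  obtains C where "C > 0" "\<And>P F (y::real). finite P \<Longrightarrow> (\<And>p. p \<in> P \<Longrightarrow> prime p) \<Longrightarrow> 0 \<le> y \<Longrightarrow> y \<le> 3/2 \<Longrightarrow>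
    finite F \<Longrightarrow> (\<And>d. d \<in> F \<Longrightarrow> d > 0 \<and> prime_factors d \<subseteq> P) \<Longrightarrow>
    (\<Sum>d\<in>F. y ^ big_omega d / real d) \<le> C * exp (y * (\<Sum>p\<in>P. 1 / real p))"
proof -
  have sm: "summable (\<lambda>n. 1 / real n ^ 2)"
    using inverse_power_summable[of 2, where ?'a = real] by (simp add: field_simps)
  define Z where "Z = suminf (\<lambda>n. 1 / real n ^ 2)"
  have "(\<Sum>d\<in>F. y ^ big_omega d / real d) \<le> exp (9/2 * Z) * exp (y * (\<Sum>p\<in>P. 1 / real p))"
    if P: "finite P" "\<And>p. p \<in> P \<Longrightarrow> prime p" and y: "0 \<le> y" "y \<le> 3/2"
    and F: "finite F" "\<And>d. d \<in> F \<Longrightarrow> d > 0 \<and> prime_factors d \<subseteq> P" for P F and y :: real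
  proof -
    have "(\<Sum>d\<in>F. y ^ big_omega d / real d) \<le> (\<Prod>p\<in>P. 1 / (1 - y / real p))"
      by (rule euler_sum_le_prod) (use P y F in auto)
    also have "\<dots> \<le> (\<Prod>p\<in>P. exp (y / real p + 2 * (y / real p)\<^sup>2))"
    proof (intro prod_mono conjI)
      fix p assume "p \<in> P"
      then have "p \<ge> 2" using P prime_ge_2_nat by blast
      then have t: "0 \<le> y / real p" "y / real p \<le> 3/4" using y by (auto simp: divide_le_eq)
      show "1 / (1 - y / real p) \<le> exp (y / real p + 2 * (y / real p)\<^sup>2)"
        by (rule one_over_one_minus_le_exp[OF t])
      show "0 \<le> 1 / (1 - y / real p)" using t by (intro divide_nonneg_nonneg) linarith+
    qed
    also have "\<dots> = exp (y * (\<Sum>p\<in>P. 1 / real p) + 2 * y\<^sup>2 * (\<Sum>p\<in>P. 1 / real p ^ 2))"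
      using P by (simp add: exp_sum[symmetric] sum.distrib sum_distrib_left power_divide)
    also have "\<dots> \<le> exp (y * (\<Sum>p\<in>P. 1 / real p) + 9/2 * Z)"
    proof -
      have "(\<Sum>p\<in>P. 1 / real p ^ 2) \<le> Z" unfolding Z_def
        by (rule sum_le_suminf[OF sm P(1)]) auto
      moreover have "y\<^sup>2 \<le> (3/2)\<^sup>2" using y by (intro power_mono) auto
      then have "2 * y\<^sup>2 \<le> 9/2" by (simp add: power2_eq_square)
      ultimately have "2 * y\<^sup>2 * (\<Sum>p\<in>P. 1 / real p ^ 2) \<le> 9/2 * Z"
        by (intro mult_mono) (auto intro: sum_nonneg)
      then show ?thesis by simp
    qed
    finally show ?thesis by (simp add: exp_add mult.commute)
  qed
  then show ?thesis using that[of "exp (9/2 * Z)"] by simp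
qed

lemma real_le_iff_le_nat_floor: "z \<ge> 0 \<Longrightarrow> real p \<le> z \<longleftrightarrow> p \<le> nat \<lfloor>z\<rfloor>"
  by (simp add: le_nat_iff le_floor_iff)

lemma ln_ln_floor_le: "z \<ge> 3 \<Longrightarrow> ln (ln (real (nat \<lfloor>z\<rfloor>))) \<le> ln (ln z)"
proof -
  assume z: "z \<ge> 3"
  then have 1: "3 \<le> nat \<lfloor>z\<rfloor>" by (simp add: le_nat_iff le_floor_iff)
  have "real (nat \<lfloor>z\<rfloor>) \<le> z" using z real_le_iff_le_nat_floor[of z "nat \<lfloor>z\<rfloor>"] by simp
  then have "ln (real (nat \<lfloor>z\<rfloor>)) \<le> ln z" using 1 by (subst ln_le_cancel_iff) auto
  moreover have "ln (real (nat \<lfloor>z\<rfloor>)) > 0" using 1 by (intro ln_gt_zero) linarith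
  ultimately show ?thesis by (subst ln_le_cancel_iff) auto
qed

lemma primes_mod4_recip_le:
  assumes a: "a \<in> {1, 3}"
  obtains C where "C \<ge> 0" "\<And>z. z \<ge> 3 \<Longrightarrow>
    (\<Sum>p | prime p \<and> p mod 4 = a \<and> real p \<le> z. 1 / real p) \<le> ln (ln z) / 2 + C"
proof -
  obtain C where C: "C \<ge> 0" "\<And>N. N \<ge> 2 \<Longrightarrow>
    \<bar>(\<Sum>p | prime p \<and> p mod 4 = a \<and> p \<le> N. 1 / real p) - ln (ln (real N)) / 2\<bar> \<le> C"
    using mertens_second_mod4[OF a] by blast
  show ?thesis
  proof (rule that[OF C(1)])
    fix z :: real assume z: "z \<ge> 3"
    then have 1: "3 \<le> nat \<lfloor>z\<rfloor>" by (simp add: le_nat_iff le_floor_iff)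
    have "{p. prime p \<and> p mod 4 = a \<and> real p \<le> z} = {p. prime p \<and> p mod 4 = a \<and> p \<le> nat \<lfloor>z\<rfloor>}"
      using z by (auto simp: real_le_iff_le_nat_floor)
    then show "(\<Sum>p | prime p \<and> p mod 4 = a \<and> real p \<le> z. 1 / real p) \<le> ln (ln z) / 2 + C"
      using C(2)[of "nat \<lfloor>z\<rfloor>"] 1 ln_ln_floor_le[OF z] by (simp add: abs_le_iff)
  qed
qed

lemma finite_real_le: "finite {p :: nat. P p \<and> real p \<le> z}"
proof (rule finite_subset)
  show "{p. P p \<and> real p \<le> z} \<subseteq> {..nat \<lfloor>z\<rfloor>}" by (auto simp: le_nat_iff le_floor_iff)
qed simp

lemma prime_mod4_cases:
  assumes "prime (p::nat)"
  obtains "p = 2" | "p mod 4 = 1" | "p mod 4 = 3"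
proof -
  have "p = 2 \<or> odd p" using assms prime_odd_nat[of p] prime_ge_2_nat[of p] by (cases "p = 2") auto
  moreover have "p mod 4 = 1 \<or> p mod 4 = 3" if "odd p" using that by presburger
  ultimately show ?thesis using that by blast
qed

lemma sum_Un_le_real:
  fixes f :: "'a \<Rightarrow> real"
  assumes "finite A" "finite B" "\<And>x. x \<in> A \<inter> B \<Longrightarrow> f x \<ge> 0"
  shows "sum f (A \<union> B) \<le> sum f A + sum f B"
  using sum.union_inter[OF assms(1,2), of f] sum_nonneg[of "A \<inter> B" f] assms(3) by fastforce

lemma primes_recip_le:
  obtains C where "C \<ge> 0" "\<And>z. z \<ge> 3 \<Longrightarrow> (\<Sum>p | prime p \<and> real p \<le> z. 1 / real p) \<le> ln (ln z) + C"
proof -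
  obtain C1 where C1: "C1 \<ge> 0" "\<And>z. z \<ge> 3 \<Longrightarrow>
    (\<Sum>p | prime p \<and> p mod 4 = 1 \<and> real p \<le> z. 1 / real p) \<le> ln (ln z) / 2 + C1"
    using primes_mod4_recip_le[of 1] by blast
  obtain C3 where C3: "C3 \<ge> 0" "\<And>z. z \<ge> 3 \<Longrightarrow>
    (\<Sum>p | prime p \<and> p mod 4 = 3 \<and> real p \<le> z. 1 / real p) \<le> ln (ln z) / 2 + C3"
    using primes_mod4_recip_le[of 3] by blast
  have "(\<Sum>p | prime p \<and> real p \<le> z. 1 / real p) \<le> ln (ln z) + (C1 + C3 + 1/2)" if z: "z \<ge> 3" for z
  proof -
    let ?A = "\<lambda>a. {p. prime p \<and> p mod 4 = a \<and> real p \<le> z}"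
    have fin: "finite (?A a)" for a
      using finite_real_le[of "\<lambda>p. prime p \<and> p mod 4 = a" z] by (simp add: conj_assoc)
    have "{p. prime p \<and> real p \<le> z} \<subseteq> {2} \<union> ?A 1 \<union> ?A 3"
    proof
      fix p assume "p \<in> {p. prime p \<and> real p \<le> z}"
      then have p: "prime p" "real p \<le> z" by auto
      from p(1) show "p \<in> {2} \<union> ?A 1 \<union> ?A 3" by (rule prime_mod4_cases) (use p in auto)
    qed
    then have "(\<Sum>p | prime p \<and> real p \<le> z. 1 / real p) \<le> (\<Sum>p\<in>{2} \<union> ?A 1 \<union> ?A 3. 1 / real p)"
      by (intro sum_mono2) (use fin in auto)
    also have "\<dots> \<le> (\<Sum>p\<in>{2} \<union> ?A 1. 1 / real p) + (\<Sum>p\<in>?A 3. 1 / real p)"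
      by (intro sum_Un_le_real) (use fin in auto)
    also have "(\<Sum>p\<in>{2} \<union> ?A 1. 1 / real p) \<le> (\<Sum>p\<in>{2}. 1 / real p) + (\<Sum>p\<in>?A 1. 1 / real p)"
      by (intro sum_Un_le_real) (use fin in auto)
    finally show ?thesis using C1(2)[OF z] C3(2)[OF z] by simp
  qed
  then show ?thesis using that[of "C1 + C3 + 1/2"] C1 C3 by simp
qed

definition smooth :: "real \<Rightarrow> nat \<Rightarrow> bool" where
  "smooth z d \<longleftrightarrow> (\<forall>p\<in>prime_factors d. real p \<le> z)"

text \<open>Mertens' estimate gives the power 3/2 of log z, which is rounded up to 2. The base has
  to stay below 2 because of the Euler factor at the prime 2.\<close>

lemma smooth_sum_big_omega:
  obtains C where "C > 0" "\<And>z F. z \<ge> 3 \<Longrightarrow> finite F \<Longrightarrow> (\<And>d. d \<in> F \<Longrightarrow> d > 0 \<and> smooth z d) \<Longrightarrow>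
    (\<Sum>d\<in>F. (3/2) ^ big_omega d / real d) \<le> C * (ln z)\<^sup>2"
proof -
  obtain C where C: "C > 0" "\<And>P F (y::real). finite P \<Longrightarrow> (\<And>p. p \<in> P \<Longrightarrow> prime p) \<Longrightarrow> 0 \<le> y \<Longrightarrow> y \<le> 3/2 \<Longrightarrow>
    finite F \<Longrightarrow> (\<And>d. d \<in> F \<Longrightarrow> d > 0 \<and> prime_factors d \<subseteq> P) \<Longrightarrow>
    (\<Sum>d\<in>F. y ^ big_omega d / real d) \<le> C * exp (y * (\<Sum>p\<in>P. 1 / real p))"
    using euler_sum_le_exp by blast
  obtain D where D: "D \<ge> 0" "\<And>z. z \<ge> 3 \<Longrightarrow> (\<Sum>p | prime p \<and> real p \<le> z. 1 / real p) \<le> ln (ln z) + D"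
    using primes_recip_le by blast
  have "(\<Sum>d\<in>F. (3/2) ^ big_omega d / real d) \<le> C * exp (2 * D) * (ln z)\<^sup>2"
    if z: "z \<ge> 3" and F: "finite F" "\<And>d. d \<in> F \<Longrightarrow> d > 0 \<and> smooth z d" for z F
  proof -
    have lz: "ln z \<ge> 1"
      using z e_less_272 by (subst ln_ge_iff) auto
    let ?P = "{p. prime p \<and> real p \<le> z}"
    have "(\<Sum>d\<in>F. (3/2) ^ big_omega d / real d) \<le> C * exp (3/2 * (\<Sum>p\<in>?P. 1 / real p))"
      by (rule C(2)) (use F in \<open>auto simp: smooth_def finite_real_le\<close>)
    also have "\<dots> \<le> C * exp (2 * (ln (ln z) + D))"
    proof -
      have "3/2 * (\<Sum>p\<in>?P. 1 / real p) \<le> 2 * (\<Sum>p\<in>?P. 1 / real p)"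
        by (intro mult_right_mono sum_nonneg) auto
      also have "\<dots> \<le> 2 * (ln (ln z) + D)" using D(2)[OF z] by simp
      finally show ?thesis using C(1) by simp
    qed
    also have "\<dots> = C * exp (2 * D) * (ln z)\<^sup>2"
      using lz by (simp add: exp_add distrib_left exp_double)
    finally show ?thesis .
  qed
  then show ?thesis using that[of "C * exp (2 * D)"] C by simp
qed

text \<open>Rankin's trick: each d with at least V prime factors satisfies 1 <= (2/3)^V
  (3/2)^Omega(d).\<close>

lemma smooth_tail_sum:
  obtains C where "C > 0" "\<And>z F V. z \<ge> 3 \<Longrightarrow> finite F \<Longrightarrow>
    (\<And>d. d \<in> F \<Longrightarrow> d > 0 \<and> smooth z d \<and> V \<le> real (big_omega d)) \<Longrightarrow>
    (\<Sum>d\<in>F. 1 / real d) \<le> C * (ln z)\<^sup>2 * (2/3) powr V"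
proof -
  obtain C where C: "C > 0" "\<And>z F. z \<ge> 3 \<Longrightarrow> finite F \<Longrightarrow> (\<And>d. d \<in> F \<Longrightarrow> d > 0 \<and> smooth z d) \<Longrightarrow>
    (\<Sum>d\<in>F. (3/2) ^ big_omega d / real d) \<le> C * (ln z)\<^sup>2"
    using smooth_sum_big_omega by blast
  have "(\<Sum>d\<in>F. 1 / real d) \<le> C * (ln z)\<^sup>2 * (2/3) powr V"
    if z: "z \<ge> 3" and F: "finite F" "\<And>d. d \<in> F \<Longrightarrow> d > 0 \<and> smooth z d \<and> V \<le> real (big_omega d)" for z F V
  proof -
    have "(\<Sum>d\<in>F. 1 / real d) \<le> (\<Sum>d\<in>F. (2/3) powr V * ((3/2) ^ big_omega d / real d))"
    proof (intro sum_mono)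
      fix d assume d: "d \<in> F"
      have "(1::real) = (2/3) powr real (big_omega d) * (3/2) ^ big_omega d"
        by (simp add: powr_realpow power_mult_distrib[symmetric])
      also have "\<dots> \<le> (2/3) powr V * (3/2) ^ big_omega d"
        using F(2)[OF d] by (intro mult_right_mono powr_mono') auto
      finally have "1 / real d \<le> (2/3) powr V * (3/2) ^ big_omega d / real d" by (intro divide_right_mono) auto
      then show "1 / real d \<le> (2/3) powr V * ((3/2) ^ big_omega d / real d)" by simp
    qed
    also have "\<dots> = (2/3) powr V * (\<Sum>d\<in>F. (3/2) ^ big_omega d / real d)" by (simp add: sum_distrib_left)
    also have "\<dots> \<le> (2/3) powr V * (C * (ln z)\<^sup>2)"
      by (intro mult_left_mono C(2)) (use z F in auto)
    finally show ?thesis by (simp add: mult_ac)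
  qed
  then show ?thesis using that C(1) by blast
qed

section \<open>Structure and frequency of sums of two squares\<close>

lemma two_squares_iff_circ: "n \<in> two_squares \<longleftrightarrow> n > 0 \<and> circ n \<noteq> {}"
proof -
  have "(\<exists>a b :: int. int n = a\<^sup>2 + b\<^sup>2) \<longleftrightarrow> circ n \<noteq> {}"
  proof
    assume "\<exists>a b :: int. int n = a\<^sup>2 + b\<^sup>2"
    then obtain a b :: int where "int n = a\<^sup>2 + b\<^sup>2" by auto
    then have "Complex (of_int a) (of_int b) \<in> circ n" by (simp add: circ_Complex_iff)
    then show "circ n \<noteq> {}" by auto
  next
    assume "circ n \<noteq> {}"
    then obtain z where "z \<in> circ n" by auto
    then show "\<exists>a b :: int. int n = a\<^sup>2 + b\<^sup>2" by (rule circE) metis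
  qed
  then show ?thesis by (simp add: two_squares_def)
qed

lemma two_squares_pos: "n \<in> two_squares \<Longrightarrow> n > 0" by (simp add: two_squares_def)

lemma two_squares_mult: "a \<in> two_squares \<Longrightarrow> b \<in> two_squares \<Longrightarrow> a * b \<in> two_squares"
  unfolding two_squares_iff_circ using circ_mult by fastforce

lemma two_squares_1: "1 \<in> two_squares"
proof -
  have "1 \<in> circ 1" by (simp add: circ_def)
  then show ?thesis by (auto simp: two_squares_iff_circ)
qed

lemma two_squares_prime: "prime p \<Longrightarrow> p = 2 \<or> p mod 4 = 1 \<Longrightarrow> p \<in> two_squares"
  using circ_2 circ_prime_mod4_1[of p] by (auto simp: two_squares_iff_circ prime_gt_0_nat)

lemma two_squares_cancel_prime:
  assumes "p * m \<in> two_squares" "prime p" "p = 2 \<or> p mod 4 = 1"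
  shows "m \<in> two_squares"
proof -
  obtain \<pi> where \<pi>: "\<pi> \<in> circ p" using two_squares_prime[OF assms(2,3)] by (auto simp: two_squares_iff_circ)
  obtain z where z: "z \<in> circ (p * m)" using assms(1) by (auto simp: two_squares_iff_circ)
  show ?thesis using circ_prime_dvd[OF assms(2) \<pi> z] assms(1) by (auto simp: two_squares_iff_circ)
qed

lemma two_squares_prime_3:
  assumes "m \<in> two_squares" "prime p" "p mod 4 = 3" "p dvd m"
  obtains m' where "m = p\<^sup>2 * m'" "m' \<in> two_squares"
proof -
  obtain z where z: "z \<in> circ m" using assms(1) by (auto simp: two_squares_iff_circ)
  obtain w m' where w: "m = p\<^sup>2 * m'" "w \<in> circ m'" using circ_prime_3_mod_4[OF assms(2,3) z assms(4)] by blast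
  moreover have "m' > 0" using w(1) two_squares_pos[OF assms(1)] by (auto intro: Nat.gr0I)
  ultimately show ?thesis using that[of m'] by (auto simp: two_squares_iff_circ)
qed

text \<open>Primes congruent to 3 modulo 4 occur squared and go into v; all others are collected in
  u. Sums over m are thus bounded by an Euler sum over u times a convergent sum of 1/v^2.\<close>

lemma two_squares_decompose:
  assumes "m \<in> two_squares"
  shows "\<exists>u v. m = u * v\<^sup>2 \<and> u > 0 \<and> v > 0 \<and> (\<forall>p\<in>prime_factors u. p = 2 \<or> p mod 4 = 1) \<and> om1 m \<le> big_omega u"
  using assms
proof (induction m rule: less_induct)
  case (less m)
  show ?case
  proof (cases "m = 1")
    case True
    then show ?thesis using om1_le_big_omega[of 1] by (intro exI[of _ 1]) auto
  next
    case False
    then obtain p where p: "prime p" "p dvd m" using prime_factor_nat by blast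
    have p2: "p \<ge> 2" using p prime_ge_2_nat by blast
    have main: ?thesis if p1: "p = 2 \<or> p mod 4 = 1"
    proof -
      obtain m' where m': "m = p * m'" using p(2) by (auto elim: dvdE)
      have S: "m' \<in> two_squares" using two_squares_cancel_prime less.prems m' p1 p(1) by blast
      then have "m' > 0" by (rule two_squares_pos)
      then have "m' < m" using m' p2 by simp
      then obtain u v where uv: "m' = u * v\<^sup>2" "u > 0" "v > 0" "\<forall>p\<in>prime_factors u. p = 2 \<or> p mod 4 = 1"
        "om1 m' \<le> big_omega u" using less.IH S by blast
      have "om1 m = om1 p + om1 m'" unfolding m' using p2 \<open>m' > 0\<close> by (intro om1_mult) auto
      also have "\<dots> \<le> big_omega p + big_omega u" using om1_le_big_omega[of p] uv by simp
      also have "\<dots> = big_omega (p * u)" using p2 uv by (intro big_omega_mult[symmetric]) auto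
      finally have "om1 m \<le> big_omega (p * u)" .
      moreover have "\<forall>q\<in>prime_factors (p * u). q = 2 \<or> q mod 4 = 1"
        using uv p p1 p2 by (auto simp: prime_factors_product prime_prime_factors)
      moreover have "m = (p * u) * v\<^sup>2" using m' uv by simp
      moreover have "p * u > 0" using p2 uv by simp
      ultimately show ?thesis using uv by blast
    qed
    from p(1) show ?thesis
    proof (rule prime_mod4_cases)
      assume 3: "p mod 4 = 3"
      obtain m' where m': "m = p\<^sup>2 * m'" "m' \<in> two_squares"
        using two_squares_prime_3[OF less.prems p(1) 3 p(2)] by blast
      then have "m' > 0" using two_squares_pos by blast
      moreover have "1 < p\<^sup>2" using power_mono[of 2 p 2] p2 by simp
      ultimately have "m' < m" using m' by simp
      then obtain u v where uv: "m' = u * v\<^sup>2" "u > 0" "v > 0" "\<forall>p\<in>prime_factors u. p = 2 \<or> p mod 4 = 1"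
        "om1 m' \<le> big_omega u" using less.IH m'(2) by blast
      have "om1 m = om1 (p * p) + om1 m'" unfolding m' power2_eq_square using p2 \<open>m' > 0\<close> by (intro om1_mult) auto
      also have "om1 (p * p) = 0" using p2 p(1) 3 by (simp add: om1_mult om1_prime)
      finally have "om1 m \<le> big_omega u" using uv by simp
      moreover have "m = u * (p * v)\<^sup>2" using m' uv by (simp add: power_mult_distrib)
      moreover have "p * v > 0" using p2 uv by simp
      ultimately show ?thesis using uv by blast
    qed (use main in auto)
  qed
qed

text \<open>Since m is recovered from (u, v), the sum is at most the product of the two sums. Only 2
  and the primes congruent to 1 modulo 4 enter the Euler sum, whence the exponent y/2. The case y =
  1 is the logarithmic size of S; larger y detects an excess of prime factors.\<close>

lemma two_squares_sum_om1:
  obtains C where "C > 0" "\<And>y N. 1 \<le> y \<Longrightarrow> y \<le> 3/2 \<Longrightarrow> N \<ge> 3 \<Longrightarrow>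
    (\<Sum>m | m \<in> two_squares \<and> m \<le> N. y ^ om1 m / real m) \<le> C * ln (real N) powr (y / 2)"
proof -
  obtain C where C: "C > 0" "\<And>P F (y::real). finite P \<Longrightarrow> (\<And>p. p \<in> P \<Longrightarrow> prime p) \<Longrightarrow> 0 \<le> y \<Longrightarrow> y \<le> 3/2 \<Longrightarrow>
    finite F \<Longrightarrow> (\<And>d. d \<in> F \<Longrightarrow> d > 0 \<and> prime_factors d \<subseteq> P) \<Longrightarrow>
    (\<Sum>d\<in>F. y ^ big_omega d / real d) \<le> C * exp (y * (\<Sum>p\<in>P. 1 / real p))"
    using euler_sum_le_exp by blast
  obtain D where D: "D \<ge> 0" "\<And>z. z \<ge> 3 \<Longrightarrow>
    (\<Sum>p | prime p \<and> p mod 4 = 1 \<and> real p \<le> z. 1 / real p) \<le> ln (ln z) / 2 + D"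
    using primes_mod4_recip_le[of 1] by blast
  have sm: "summable (\<lambda>n. 1 / real n ^ 2)"
    using inverse_power_summable[of 2, where ?'a = real] by (simp add: field_simps)
  define Z where "Z = suminf (\<lambda>n. 1 / real n ^ 2)"
  have Z: "Z > 0" unfolding Z_def by (rule suminf_pos2[OF sm, of 1]) auto
  have "(\<Sum>m | m \<in> two_squares \<and> m \<le> N. y ^ om1 m / real m) \<le> Z * C * exp (3/2 * (1/2 + D)) * ln (real N) powr (y / 2)"
    if y: "1 \<le> y" "y \<le> 3/2" and N: "N \<ge> 3" for y N
  proof -
    define M where "M = {m. m \<in> two_squares \<and> m \<le> N}"
    have finM: "finite M" unfolding M_def by simp
    have "\<forall>m. \<exists>uv. m \<in> M \<longrightarrow> m = fst uv * (snd uv)\<^sup>2 \<and> fst uv > 0 \<and> snd uv > 0 \<and>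
        (\<forall>p\<in>prime_factors (fst uv). p = 2 \<or> p mod 4 = 1) \<and> om1 m \<le> big_omega (fst uv)"
      using two_squares_decompose unfolding M_def by (metis (no_types, lifting) fst_conv snd_conv mem_Collect_eq)
    then obtain h where h: "\<And>m. m \<in> M \<Longrightarrow> m = fst (h m) * (snd (h m))\<^sup>2 \<and> fst (h m) > 0 \<and> snd (h m) > 0 \<and>
        (\<forall>p\<in>prime_factors (fst (h m)). p = 2 \<or> p mod 4 = 1) \<and> om1 m \<le> big_omega (fst (h m))"
      by metis
    define U where "U = (fst \<circ> h) ` M"
    define V where "V = (snd \<circ> h) ` M"
    have UV: "finite U" "finite V" unfolding U_def V_def using finM by auto
    have inj: "inj_on h M" by (rule inj_onI) (metis h)
    have "(\<Sum>m\<in>M. y ^ om1 m / real m) \<le> (\<Sum>m\<in>M. y ^ big_omega (fst (h m)) / real (fst (h m)) * (1 / real (snd (h m)) ^ 2))"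
    proof (intro sum_mono)
      fix m assume m: "m \<in> M"
      have "om1 m \<le> big_omega (fst (h m))" using h[OF m] by blast
      then have "y ^ om1 m / real m \<le> y ^ big_omega (fst (h m)) / real m"
        using y by (intro divide_right_mono power_increasing) auto
      moreover have eq: "real m = real (fst (h m)) * real (snd (h m)) ^ 2" using h[OF m] by (metis of_nat_mult of_nat_power)
      ultimately have "y ^ om1 m / real m \<le> y ^ big_omega (fst (h m)) / (real (fst (h m)) * real (snd (h m)) ^ 2)"
        by simp
      then show "y ^ om1 m / real m \<le> y ^ big_omega (fst (h m)) / real (fst (h m)) * (1 / real (snd (h m)) ^ 2)" by simp
    qed
    also have "\<dots> = (\<Sum>(u,v)\<in>h ` M. y ^ big_omega u / real u * (1 / real v ^ 2))"
      by (subst sum.reindex[OF inj]) (simp add: case_prod_unfold)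
    also have "\<dots> \<le> (\<Sum>(u,v)\<in>U \<times> V. y ^ big_omega u / real u * (1 / real v ^ 2))"
    proof (rule sum_mono2)
      show "h ` M \<subseteq> U \<times> V" 
      proof
        fix x assume "x \<in> h ` M"
        then obtain m where "m \<in> M" "x = h m" by blast
        then have "fst x \<in> U" "snd x \<in> V" by (simp_all add: U_def V_def)
        then show "x \<in> U \<times> V" by (simp only: mem_Times_iff)
      qed
    qed (use UV y in auto)
    also have "\<dots> = (\<Sum>u\<in>U. y ^ big_omega u / real u) * (\<Sum>v\<in>V. 1 / real v ^ 2)"
      by (simp add: sum_product sum.cartesian_product)
    also have "\<dots> \<le> (C * exp (y * (1/2 + (ln (ln (real N)) / 2 + D)))) * Z"
    proof (intro mult_mono)
      let ?P1 = "{p. prime p \<and> p mod 4 = 1 \<and> real p \<le> real N}"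
      let ?P = "{2} \<union> ?P1"
      have finP: "finite ?P1" by simp
      have "(\<Sum>u\<in>U. y ^ big_omega u / real u) \<le> C * exp (y * (\<Sum>p\<in>?P. 1 / real p))"
      proof (rule C(2))
        fix d assume "d \<in> U"
        then obtain m where m: "m \<in> M" "d = fst (h m)" by (auto simp: U_def)
        have "d > 0" using h m by blast
        moreover have "prime_factors d \<subseteq> ?P"
        proof
          fix p assume p: "p \<in> prime_factors d"
          then have "p \<le> d" using \<open>d > 0\<close> by (auto intro: dvd_imp_le)
          also have "d dvd m" using h[OF m(1)] m(2) by (metis dvd_triv_left)
          then have "d \<le> m" using m(1) by (auto simp: M_def two_squares_pos intro: dvd_imp_le)
          also have "m \<le> N" using m by (simp add: M_def)
          finally have "p \<le> N" .
          then show "p \<in> ?P" using p h[OF m(1)] m(2) by auto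
        qed
        ultimately show "d > 0 \<and> prime_factors d \<subseteq> ?P" by simp
      qed (use finP UV y in auto)
      also have "(\<Sum>p\<in>?P. 1 / real p) \<le> (\<Sum>p\<in>{2}. 1 / real p) + (\<Sum>p\<in>?P1. 1 / real p)"
        by (intro sum_Un_le_real) (use finP in auto)
      also have "\<dots> \<le> 1/2 + (ln (ln (real N)) / 2 + D)" using D(2)[of "real N"] N by simp
      finally show "(\<Sum>u\<in>U. y ^ big_omega u / real u) \<le> C * exp (y * (1/2 + (ln (ln (real N)) / 2 + D)))"
        using y C(1) by (simp add: mult_left_mono)
      show "(\<Sum>v\<in>V. 1 / real v ^ 2) \<le> Z" unfolding Z_def by (rule sum_le_suminf[OF sm UV(2)]) auto
    qed (use C in \<open>auto intro: sum_nonneg\<close>)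
    also have "\<dots> \<le> Z * C * exp (3/2 * (1/2 + D)) * ln (real N) powr (y / 2)"
    proof -
      have lN: "ln (real N) > 0" using N by simp
      have "exp (y * (1/2 + (ln (ln (real N)) / 2 + D))) = exp (y * (1/2 + D)) * ln (real N) powr (y / 2)"
        using lN by (simp add: powr_def algebra_simps flip: exp_add)
      also have "\<dots> \<le> exp (3/2 * (1/2 + D)) * ln (real N) powr (y / 2)"
        using y D(1) mult_right_mono[of y "3/2" "1/2 + D"] by (intro mult_right_mono) auto
      finally show ?thesis using C(1) Z by (simp add: mult_ac mult_left_mono)
    qed
    finally show ?thesis unfolding M_def .
  qed
  moreover have "Z * C * exp (3/2 * (1/2 + D)) > 0" using Z C by simp
  ultimately show ?thesis using that by blast
qed


lemma decompose_mod4: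
  assumes "n > 0"
  shows "\<exists>a b. n = a * b \<and> a \<in> two_squares \<and> b > 0 \<and> (\<forall>p\<in>prime_factors b. p mod 4 = 3)"
  using assms
proof (induction n rule: less_induct)
  case (less n)
  show ?case
  proof (cases "n = 1")
    case True
    then show ?thesis using two_squares_1 by (intro exI[of _ 1]) auto
  next
    case False
    then obtain p where p: "prime p" "p dvd n" using prime_factor_nat by blast
    then obtain m where m: "n = p * m" by (auto elim: dvdE)
    have "m > 0" "m < n" using m less.prems prime_ge_2_nat[OF p(1)] by auto
    then obtain a b where ab: "m = a * b" "a \<in> two_squares" "b > 0" "\<forall>p\<in>prime_factors b. p mod 4 = 3"
      using less.IH by blast
    have main: ?thesis if "p = 2 \<or> p mod 4 = 1"
    proof -
      have "p * a \<in> two_squares" using two_squares_mult two_squares_prime[OF p(1) that] ab by blast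
      then show ?thesis using ab m by (intro exI[of _ "p * a"] exI[of _ b]) auto
    qed
    from p(1) show ?thesis
    proof (rule prime_mod4_cases)
      assume 3: "p mod 4 = 3"
      have "\<forall>q\<in>prime_factors (p * b). q mod 4 = 3"
        using ab p 3 by (auto simp: prime_factors_product prime_prime_factors)
      moreover have "n = a * (p * b)" using m ab by simp
      moreover have "p * b > 0" using p(1) ab by (simp add: prime_gt_0_nat)
      ultimately show ?thesis using ab by blast
    qed (use main in auto)
  qed
qed

lemma ln_prime_nonneg: "prime p \<Longrightarrow> 0 \<le> ln (real p)"
  using prime_ge_1_nat[of p] by simp

lemma ln_le_harm: "ln (real N) \<le> 2 * (\<Sum>n\<in>{1..N}. 1 / real n)"
proof (induction N)
  case (Suc N)
  show ?case
  proof (cases "N = 0")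
    case False
    then have "1 / real N \<le> 2 * (1 / real (Suc N))" by (simp add: field_simps)
    moreover have "ln (real (Suc N)) - ln (real N) \<le> 1 / real N"
      using ln_Suc_minus_ln_le[of N] False by simp
    ultimately show ?thesis using Suc by (simp del: of_nat_Suc)
  qed simp
qed simp

text \<open>
  Each n is a sum of two squares times a number built from primes 3 mod 4, and the reciprocals of the latter sum to
  O(sqrt(log N)), while the harmonic sum is at least log N up to a constant.
\<close>

lemma two_squares_recip_sum_ge:
  obtains c where "c > 0" "\<And>N. N \<ge> 3 \<Longrightarrow> (\<Sum>m | m \<in> two_squares \<and> m \<le> N. 1 / real m) \<ge> c * sqrt (ln (real N))"
proof -
  obtain C where C: "C > 0" "\<And>P F (y::real). finite P \<Longrightarrow> (\<And>p. p \<in> P \<Longrightarrow> prime p) \<Longrightarrow> 0 \<le> y \<Longrightarrow> y \<le> 3/2 \<Longrightarrow>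
    finite F \<Longrightarrow> (\<And>d. d \<in> F \<Longrightarrow> d > 0 \<and> prime_factors d \<subseteq> P) \<Longrightarrow>
    (\<Sum>d\<in>F. y ^ big_omega d / real d) \<le> C * exp (y * (\<Sum>p\<in>P. 1 / real p))"
    using euler_sum_le_exp by blast
  obtain D where D: "D \<ge> 0" "\<And>z. z \<ge> 3 \<Longrightarrow>
    (\<Sum>p | prime p \<and> p mod 4 = 3 \<and> real p \<le> z. 1 / real p) \<le> ln (ln z) / 2 + D"
    using primes_mod4_recip_le[of 3] by blast
  define K where "K = C * exp D"
  have K: "K > 0" using C by (simp add: K_def)
  have "(\<Sum>m | m \<in> two_squares \<and> m \<le> N. 1 / real m) \<ge> 1 / (2 * K) * sqrt (ln (real N))" if N: "N \<ge> 3" for N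
  proof -
    define M where "M = {m. m \<in> two_squares \<and> m \<le> N}"
    have finM: "finite M" unfolding M_def by simp
    define P where "P = {p. prime p \<and> p mod 4 = 3 \<and> real p \<le> real N}"
    have finP: "finite P" unfolding P_def by simp
    define Q where "Q = {b\<in>{1..N}. \<forall>p\<in>prime_factors b. p mod 4 = 3}"
    have finQ: "finite Q" unfolding Q_def by simp
    have "\<forall>n. \<exists>ab. n \<in> {1..N} \<longrightarrow> n = fst ab * snd ab \<and> fst ab \<in> two_squares \<and> snd ab > 0 \<and>
        (\<forall>p\<in>prime_factors (snd ab). p mod 4 = 3)"
      using decompose_mod4 by (metis (no_types, lifting) fst_conv snd_conv atLeastAtMost_iff less_eq_Suc_le One_nat_def)
    then obtain h where h: "\<And>n. n \<in> {1..N} \<Longrightarrow> n = fst (h n) * snd (h n) \<and> fst (h n) \<in> two_squares \<and> snd (h n) > 0 \<and>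
        (\<forall>p\<in>prime_factors (snd (h n)). p mod 4 = 3)" by metis
    have inj: "inj_on h {1..N}" by (rule inj_onI) (metis h)
    have "ln (real N) \<le> 2 * (\<Sum>n\<in>{1..N}. 1 / real n)" by (rule ln_le_harm)
    also have "(\<Sum>n\<in>{1..N}. 1 / real n) = (\<Sum>n\<in>{1..N}. 1 / real (fst (h n)) * (1 / real (snd (h n))))"
    proof (intro sum.cong refl)
      fix n assume "n \<in> {1..N}"
      then have "real n = real (fst (h n)) * real (snd (h n))" using h by (metis of_nat_mult)
      then show "1 / real n = 1 / real (fst (h n)) * (1 / real (snd (h n)))" by simp
    qed
    also have "\<dots> = (\<Sum>(a,b)\<in>h ` {1..N}. 1 / real a * (1 / real b))"
      by (subst sum.reindex[OF inj]) (simp add: case_prod_unfold)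
    also have "\<dots> \<le> (\<Sum>(a,b)\<in>M \<times> Q. 1 / real a * (1 / real b))"
    proof (rule sum_mono2)
      show "h ` {1..N} \<subseteq> M \<times> Q"
      proof
        fix x assume "x \<in> h ` {1..N}"
        then obtain n where n: "n \<in> {1..N}" "x = h n" by auto
        note hn = h[OF n(1)]
        have "fst (h n) dvd n" "snd (h n) dvd n" using hn by (metis dvd_triv_left, metis dvd_triv_right)
        then have "fst (h n) \<le> N" "snd (h n) \<le> N" using n(1) by (auto dest!: dvd_imp_le)
        then show "x \<in> M \<times> Q" using hn n by (auto simp: M_def Q_def mem_Times_iff)
      qed
    qed (use finM finQ in auto)
    also have "\<dots> = (\<Sum>a\<in>M. 1 / real a) * (\<Sum>b\<in>Q. 1 / real b)"
      by (simp add: sum_product sum.cartesian_product)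
    also have "\<dots> \<le> (\<Sum>a\<in>M. 1 / real a) * (K * sqrt (ln (real N)))"
    proof (intro mult_left_mono sum_nonneg)
      have "(\<Sum>b\<in>Q. 1 ^ big_omega b / real b) \<le> C * exp (1 * (\<Sum>p\<in>P. 1 / real p))"
      proof (rule C(2))
        fix d assume d: "d \<in> Q"
        have "prime_factors d \<subseteq> P"
        proof
          fix p assume p: "p \<in> prime_factors d"
          then have "p \<le> d" using d by (auto simp: Q_def intro: dvd_imp_le)
          then show "p \<in> P" using p d by (auto simp: P_def Q_def)
        qed
        then show "d > 0 \<and> prime_factors d \<subseteq> P" using d by (simp add: Q_def)
      qed (use finP finQ in \<open>auto simp: P_def\<close>)
      also have "\<dots> \<le> C * exp (ln (ln (real N)) / 2 + D)"
        using D(2)[of "real N"] N C(1) unfolding P_def by simp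
      also have "\<dots> = K * sqrt (ln (real N))"
      proof -
        have lN: "ln (real N) > 0" using N by simp
        then have "exp (ln (ln (real N)) / 2) = sqrt (ln (real N))"
          by (simp add: powr_half_sqrt[symmetric] powr_def)
        then show ?thesis by (simp add: K_def exp_add mult_ac)
      qed
      finally show "(\<Sum>b\<in>Q. 1 / real b) \<le> K * sqrt (ln (real N))" by simp
    qed auto
    finally have "ln (real N) \<le> 2 * K * (\<Sum>a\<in>M. 1 / real a) * sqrt (ln (real N))" by (simp add: mult_ac)
    moreover have lN: "ln (real N) > 0" using N by simp
    then have "ln (real N) = sqrt (ln (real N)) * sqrt (ln (real N))" by simp
    ultimately have "sqrt (ln (real N)) * sqrt (ln (real N)) \<le> (2 * K * (\<Sum>a\<in>M. 1 / real a)) * sqrt (ln (real N))" by simp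
    then have "sqrt (ln (real N)) \<le> 2 * K * (\<Sum>a\<in>M. 1 / real a)"
      using lN by (elim mult_right_le_imp_le) simp
    then show ?thesis using K unfolding M_def by (simp add: field_simps)
  qed
  moreover have "1 / (2 * K) > 0" using K by simp
  ultimately show ?thesis using that by blast
qed

text \<open>Mertens' estimate is applied at N and at N/K. The choice log K >= 4C + 2 makes the main
  term (log K)/2 exceed both errors by 1, so the primes between carry a sum of log p / p of at least
  1, and each of them satisfies 1/p <= K/N.\<close>

lemma chebyshev_mod4_lower:
  obtains c K where "c > 0" "K \<ge> 1" "\<And>N. N \<ge> K \<Longrightarrow> (\<Sum>p | prime p \<and> p mod 4 = 1 \<and> p \<le> N. ln (real p)) \<ge> c * real N"
proof -
  obtain C where C: "C \<ge> 0" "\<And>N. N \<ge> 1 \<Longrightarrow>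
    \<bar>(\<Sum>p | prime p \<and> p mod 4 = 1 \<and> p \<le> N. ln (real p) / real p) - ln (real N) / 2\<bar> \<le> C"
    using mertens_first_mod4[of 1] by blast
  define K where "K = nat \<lceil>exp (4 * C + 2)\<rceil>"
  have expK: "exp (4 * C + 2) \<le> real K" unfolding K_def by (rule real_nat_ceiling_ge)
  then have "0 < real K" using exp_gt_zero[of "4 * C + 2"] by linarith
  then have K: "ln (real K) \<ge> 4 * C + 2" "K \<ge> 1" using expK by (simp_all add: ln_ge_iff)
  have "(\<Sum>p | prime p \<and> p mod 4 = 1 \<and> p \<le> N. ln (real p)) \<ge> 1 / real K * real N" if N: "N \<ge> K" for N
  proof -
    define M where "M = N div K"
    have M: "M \<ge> 1" unfolding M_def using N K by (simp add: div_greater_zero_iff Suc_le_eq)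
    have MN: "M \<le> N" unfolding M_def by simp
    have rM: "real M \<le> real N / real K" unfolding M_def by (rule real_div_le)
    let ?P = "\<lambda>N. {p. prime p \<and> p mod 4 = 1 \<and> p \<le> N}"
    have "ln (real M) \<le> ln (real N / real K)" using M rM by (subst ln_le_cancel_iff) auto
    also have "\<dots> = ln (real N) - ln (real K)" using N K by (simp add: ln_div)
    finally have "ln (real N) / 2 - ln (real M) / 2 \<ge> 2 * C + 1" using K by simp
    then have "1 \<le> (\<Sum>p\<in>?P N. ln (real p) / real p) - (\<Sum>p\<in>?P M. ln (real p) / real p)"
      using C(2)[of N] C(2)[of M] M N K by (simp add: abs_le_iff)
    also have "\<dots> = (\<Sum>p\<in>?P N - ?P M. ln (real p) / real p)"
      by (rule sum_diff[symmetric]) (use MN in auto)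
    also have "\<dots> \<le> (\<Sum>p\<in>?P N - ?P M. ln (real p) * (real K / real N))"
    proof (intro sum_mono)
      fix p assume p: "p \<in> ?P N - ?P M"
      then have "M + 1 \<le> p" by auto
      then have "real N / real K \<le> real p" using real_div_ge[of K N] K unfolding M_def by linarith
      then have "1 / real p \<le> real K / real N" using p K N by (simp add: field_simps prime_gt_0_nat)
      moreover have "ln (real p) \<ge> 0" using p by (auto intro!: ln_prime_nonneg)
      ultimately show "ln (real p) / real p \<le> ln (real p) * (real K / real N)"
        using mult_left_mono[of "1 / real p" "real K / real N" "ln (real p)"] by simp
    qed
    also have "\<dots> \<le> (\<Sum>p\<in>?P N. ln (real p) * (real K / real N))"
      by (intro sum_mono2) (auto intro!: mult_nonneg_nonneg ln_prime_nonneg)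
    also have "\<dots> = (\<Sum>p\<in>?P N. ln (real p)) * (real K / real N)"
      by (rule sum_distrib_right[symmetric])
    finally show ?thesis using K N by (simp add: field_simps)
  qed
  moreover have "1 / real K > 0" using K by simp
  ultimately show ?thesis using that K(2) by blast
qed

lemma ln_eq_sum_prime_factors:
  assumes "n > 0"
  shows "ln (real n) = (\<Sum>p\<in>prime_factors n. real (multiplicity p n) * ln (real p))"
proof -
  have "real n = (\<Prod>p\<in>prime_factors n. real p ^ multiplicity p n)"
    using prime_factorization_nat[OF assms] by (metis (no_types, lifting) of_nat_power of_nat_prod prod.cong)
  then have "ln (real n) = ln (\<Prod>p\<in>prime_factors n. real p ^ multiplicity p n)" by simp
  also have "\<dots> = (\<Sum>p\<in>prime_factors n. ln (real p ^ multiplicity p n))"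
    by (rule ln_prod) (auto dest!: in_prime_factors_imp_prime simp: prime_gt_0_nat)
  also have "\<dots> = (\<Sum>p\<in>prime_factors n. real (multiplicity p n) * ln (real p))"
    by (intro sum.cong refl ln_realpow) 
  finally show ?thesis .
qed

lemma sum_ln_primes_le_ln:
  assumes "n > 0" "Q \<subseteq> prime_factors n"
  shows "(\<Sum>p\<in>Q. ln (real p)) \<le> ln (real n)"
proof -
  have "(\<Sum>p\<in>Q. ln (real p)) \<le> (\<Sum>p\<in>prime_factors n. ln (real p))"
    by (intro sum_mono2) (use assms in \<open>auto intro!: ln_prime_nonneg dest: in_prime_factors_imp_prime\<close>)
  also have "\<dots> \<le> (\<Sum>p\<in>prime_factors n. real (multiplicity p n) * ln (real p))"
  proof (intro sum_mono)
    fix p assume p: "p \<in> prime_factors n"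
    then have "1 \<le> multiplicity p n" using assms(1) by (simp add: prime_factors_multiplicity Suc_le_eq)
    moreover have "ln (real p) \<ge> 0" using p by (auto intro!: ln_prime_nonneg)
    ultimately show "ln (real p) \<le> real (multiplicity p n) * ln (real p)"
      using mult_right_mono[of 1 "real (multiplicity p n)" "ln (real p)"] by simp
  qed
  also have "\<dots> = ln (real n)" using ln_eq_sum_prime_factors assms by simp
  finally show ?thesis .
qed

text \<open>Double counting of pairs (m, p) with p m <= N, weighted by log p. For fixed m the primes
  contribute at least of order N/m, so the total is at least of order N sqrt(log N) by the
  logarithmic bound; each n = p m receives total weight at most log N.\<close>

lemma two_squares_card_ge:
  obtains c N0 where "c > 0" "\<And>N. N \<ge> N0 \<Longrightarrow> real (card {n. n \<in> two_squares \<and> n \<le> N}) \<ge> c * real N / sqrt (ln (real N))"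
proof -
  obtain c1 where c1: "c1 > 0" "\<And>N. N \<ge> 3 \<Longrightarrow> (\<Sum>m | m \<in> two_squares \<and> m \<le> N. 1 / real m) \<ge> c1 * sqrt (ln (real N))"
    using two_squares_recip_sum_ge by blast
  obtain c2 K where c2: "c2 > 0" "K \<ge> 1" "\<And>N. N \<ge> K \<Longrightarrow> (\<Sum>p | prime p \<and> p mod 4 = 1 \<and> p \<le> N. ln (real p)) \<ge> c2 * real N"
    using chebyshev_mod4_lower by blast
  have "\<forall>\<^sub>F N :: nat in sequentially. sqrt (ln (real N)) / 2 \<le> sqrt (ln (real N / real K - 1)) \<and> real N / real K - 1 \<ge> 3 \<and> ln (real N) > 0"
  proof -
    have "real K > 0" using c2 by simp
    then show ?thesis by (intro eventually_conj; real_asymp)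
  qed
  then obtain N0 where N0: "\<And>N. N \<ge> N0 \<Longrightarrow> sqrt (ln (real N)) / 2 \<le> sqrt (ln (real N / real K - 1)) \<and> real N / real K - 1 \<ge> 3 \<and> ln (real N) > 0"
    unfolding eventually_sequentially by blast
  have "real (card {n. n \<in> two_squares \<and> n \<le> N}) \<ge> c1 * c2 / 4 * real N / sqrt (ln (real N))" if N: "N \<ge> N0" for N
  proof -
    define M where "M = N div K"
    note NN = N0[OF N]
    have rM: "real N / real K - 1 \<le> real M" using real_div_ge[of K N] c2 by (simp add: M_def)
    have M3: "M \<ge> 3" using rM NN by linarith
    have sM: "sqrt (ln (real N)) / 2 \<le> sqrt (ln (real M))"
    proof -
      have "ln (real N / real K - 1) \<le> ln (real M)" using rM NN by (subst ln_le_cancel_iff) linarith+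
      then show ?thesis using NN real_sqrt_le_mono order_trans by blast
    qed
    define S where "S = {n. n \<in> two_squares \<and> n \<le> N}"
    have finS: "finite S" unfolding S_def by simp
    have Spos: "n \<in> S \<Longrightarrow> n > 0" for n by (auto simp: S_def two_squares_pos)
    define Q where "Q n = {p. prime p \<and> p mod 4 = 1 \<and> p dvd n}" for n :: nat
    have "c2 / 2 * real N * (c1 * (sqrt (ln (real N)) / 2)) \<le> c2 / 2 * real N * (\<Sum>m | m \<in> two_squares \<and> m \<le> M. 1 / real m)"
    proof (intro mult_left_mono)
      have "c1 * (sqrt (ln (real N)) / 2) \<le> c1 * sqrt (ln (real M))" using c1(1) sM by simp
      also have "\<dots> \<le> (\<Sum>m | m \<in> two_squares \<and> m \<le> M. 1 / real m)" by (rule c1(2)[OF M3])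
      finally show "c1 * (sqrt (ln (real N)) / 2) \<le> (\<Sum>m | m \<in> two_squares \<and> m \<le> M. 1 / real m)" .
    qed (use c2 in auto)
    also have "\<dots> = (\<Sum>m | m \<in> two_squares \<and> m \<le> M. c2 / 2 * (real N / real m))"
      by (simp add: sum_distrib_left)
    also have "\<dots> \<le> (\<Sum>m | m \<in> two_squares \<and> m \<le> M. \<Sum>p | prime p \<and> p mod 4 = 1 \<and> p \<le> N div m. ln (real p))"
    proof (intro sum_mono)
      fix m assume "m \<in> {m \<in> two_squares. m \<le> M}"
      then have m: "m > 0" "m \<le> M" by (auto simp: two_squares_pos)
      have "m * K \<le> N" using m(2) c2(2) unfolding M_def by (simp add: less_eq_div_iff_mult_less_eq)
      then have "K \<le> N div m" using m(1) by (simp add: less_eq_div_iff_mult_less_eq mult.commute)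
      then have "c2 * real (N div m) \<le> (\<Sum>p | prime p \<and> p mod 4 = 1 \<and> p \<le> N div m. ln (real p))" by (rule c2(3))
      moreover have "1 \<le> N div m" using \<open>K \<le> N div m\<close> c2(2) by simp
      then have "real N / real m \<le> 2 * real (N div m)" using real_div_ge[OF m(1), of N] by linarith
      then have "c2 / 2 * (real N / real m) \<le> c2 / 2 * (2 * real (N div m))" using c2(1) by (intro mult_left_mono) auto
      ultimately show "c2 / 2 * (real N / real m) \<le> (\<Sum>p | prime p \<and> p mod 4 = 1 \<and> p \<le> N div m. ln (real p))" by simp
    qed
    also have "\<dots> = (\<Sum>(m,p)\<in>(SIGMA m:{m. m \<in> two_squares \<and> m \<le> M}. {p. prime p \<and> p mod 4 = 1 \<and> p \<le> N div m}). ln (real p))"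
      by (subst sum.Sigma) auto
    also have "\<dots> = (\<Sum>(n,p)\<in>(\<lambda>(m,p). (p * m, p)) ` (SIGMA m:{m. m \<in> two_squares \<and> m \<le> M}. {p. prime p \<and> p mod 4 = 1 \<and> p \<le> N div m}). ln (real p))"
      by (subst sum.reindex) (auto simp: inj_on_def case_prod_unfold)
    also have "\<dots> \<le> (\<Sum>(n,p)\<in>(SIGMA n:S. Q n). ln (real p))"
    proof (rule sum_mono2)
      show "finite (SIGMA n:S. Q n)"
        using finS Spos by (intro finite_SigmaI) (auto simp: Q_def intro!: finite_subset[OF _ finite_divisors_nat])
      show "(\<lambda>(m,p). (p * m, p)) ` (SIGMA m:{m. m \<in> two_squares \<and> m \<le> M}. {p. prime p \<and> p mod 4 = 1 \<and> p \<le> N div m}) \<subseteq> (SIGMA n:S. Q n)"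
      proof clarify
        fix m p assume mp: "m \<in> two_squares" "m \<le> M" "prime p" "p mod 4 = 1" "p \<le> N div m"
        then have "p * m \<in> two_squares" using two_squares_mult two_squares_prime by blast
        moreover have "p * m \<le> N" using mp(5) two_squares_pos[OF mp(1)] by (simp add: less_eq_div_iff_mult_less_eq)
        ultimately show "p * m \<in> S \<and> p \<in> Q (p * m)" using mp by (auto simp: S_def Q_def)
      qed
    qed (auto simp: Q_def ln_prime_nonneg)
    also have "\<dots> = (\<Sum>n\<in>S. \<Sum>p\<in>Q n. ln (real p))"
      using finS Spos by (subst sum.Sigma) (auto simp: Q_def intro!: finite_subset[OF _ finite_divisors_nat])
    also have "\<dots> \<le> (\<Sum>n\<in>S. ln (real N))"
    proof (intro sum_mono)
      fix n assume n: "n \<in> S"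
      have "(\<Sum>p\<in>Q n. ln (real p)) \<le> ln (real n)"
        by (rule sum_ln_primes_le_ln) (use Spos[OF n] in \<open>auto simp: Q_def prime_factors_dvd\<close>)
      also have "\<dots> \<le> ln (real N)" using Spos[OF n] n by (simp add: S_def)
      finally show "(\<Sum>p\<in>Q n. ln (real p)) \<le> ln (real N)" .
    qed
    also have "\<dots> = real (card S) * ln (real N)" by simp
    also have "\<dots> = real (card S) * sqrt (ln (real N)) * sqrt (ln (real N))" using NN by simp
    finally have "(c1 * c2 / 4 * real N) * sqrt (ln (real N)) \<le> (real (card S) * sqrt (ln (real N))) * sqrt (ln (real N))"
      by (simp add: mult_ac)
    then have "c1 * c2 / 4 * real N \<le> real (card S) * sqrt (ln (real N))" using NN by (elim mult_right_le_imp_le) simp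
    then show ?thesis using NN by (simp add: S_def divide_le_eq)
  qed
  moreover have "c1 * c2 / 4 > 0" using c1 c2 by simp
  ultimately show ?thesis using that by blast
qed


section \<open>Gaussian primes in narrow strips and arcs\<close>

lemma alternating_binomial_partial:
  "(\<Sum>j\<le>m. (-1) ^ j * real (Suc n choose j)) = (-1) ^ m * real (n choose m)"
  by (induction m) (auto simp: algebra_simps)

text \<open>For n > 0 the sum cut off at the even index 2k equals the binomial coefficient of n - 1
  over 2k, which is nonnegative.\<close>

lemma bonferroni_binomial:
  "(if n = 0 then 1 else 0) \<le> (\<Sum>j\<le>2 * k. (-1) ^ j * real (n choose j))"
proof (cases n)
  case 0
  have "(\<Sum>j\<le>2 * k. (-1) ^ j * real (0 choose j)) = (\<Sum>j\<in>{0}. (-1) ^ j * real (0 choose j))"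
    by (rule sum.mono_neutral_right) auto
  then show ?thesis using 0 by simp
next
  case (Suc m)
  then show ?thesis by (simp add: alternating_binomial_partial)
qed

lemma sum_subsets_by_card:
  fixes f :: "nat \<Rightarrow> real"
  assumes "finite S"
  shows "(\<Sum>D | D \<subseteq> S \<and> card D \<le> m. f (card D)) = (\<Sum>j\<le>m. f j * real (card S choose j))"
proof -
  let ?A = "{D. D \<subseteq> S \<and> card D \<le> m}"
  have fin: "finite ?A" using assms by simp
  have "(\<Sum>D\<in>?A. f (card D)) = (\<Sum>j\<in>{..m}. \<Sum>D\<in>{D. D \<in> ?A \<and> card D = j}. f (card D))"
    by (rule sum.group[symmetric]) (use fin in auto)
  also have "\<dots> = (\<Sum>j\<in>{..m}. f j * real (card S choose j))"
  proof (intro sum.cong refl)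
    fix j assume j: "j \<in> {..m}"
    have "{D. D \<in> ?A \<and> card D = j} = {D. D \<subseteq> S \<and> card D = j}" using j by auto
    moreover have "(\<Sum>D\<in>{D. D \<subseteq> S \<and> card D = j}. f (card D)) = (\<Sum>D\<in>{D. D \<subseteq> S \<and> card D = j}. f j)"
      by (intro sum.cong) auto
    ultimately show "(\<Sum>D\<in>{D. D \<in> ?A \<and> card D = j}. f (card D)) = f j * real (card S choose j)"
      using n_subsets[OF assms, of j] by simp
  qed
  finally show ?thesis .
qed

text \<open>The Bonferroni bound is applied to the number of q in \<open>Q\<close> that hit y; its
  binomial coefficients count the subsets \<open>D\<close>, and the two summations are
  exchanged.\<close>

lemma brun_inequality:
  assumes Y: "finite Y" and Q: "finite Q"
  shows "real (card {y \<in> Y. \<forall>q\<in>Q. \<not> E q y}) \<le>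
    (\<Sum>D | D \<subseteq> Q \<and> card D \<le> 2 * k. (-1) ^ card D * real (card {y \<in> Y. \<forall>q\<in>D. E q y}))"
proof -
  let ?A = "{D. D \<subseteq> Q \<and> card D \<le> 2 * k}"
  have "real (card {y \<in> Y. \<forall>q\<in>Q. \<not> E q y}) = (\<Sum>y\<in>Y. if card {q\<in>Q. E q y} = 0 then 1 else 0)"
  proof -
    have "card {q\<in>Q. E q y} = 0 \<longleftrightarrow> (\<forall>q\<in>Q. \<not> E q y)" for y using Q by auto
    then have "(\<Sum>y\<in>Y. if card {q\<in>Q. E q y} = 0 then 1 else (0::real)) = (\<Sum>y\<in>Y. if \<forall>q\<in>Q. \<not> E q y then 1 else 0)"
      by simp
    also have "\<dots> = (\<Sum>y\<in>{y\<in>Y. \<forall>q\<in>Q. \<not> E q y}. 1)"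
      using Y by (intro sum.mono_neutral_cong_right) auto
    finally show ?thesis by simp
  qed
  also have "\<dots> \<le> (\<Sum>y\<in>Y. \<Sum>j\<le>2 * k. (-1) ^ j * real (card {q\<in>Q. E q y} choose j))"
    by (intro sum_mono bonferroni_binomial)
  also have "\<dots> = (\<Sum>y\<in>Y. \<Sum>D | D \<subseteq> {q\<in>Q. E q y} \<and> card D \<le> 2 * k. (-1) ^ card D)"
    using Q by (simp add: sum_subsets_by_card)
  also have "\<dots> = (\<Sum>y\<in>Y. \<Sum>D\<in>?A. if \<forall>q\<in>D. E q y then (-1) ^ card D else 0)"
  proof (rule sum.cong[OF refl])
    fix y
    show "(\<Sum>D | D \<subseteq> {q\<in>Q. E q y} \<and> card D \<le> 2 * k. (-1) ^ card D) =
      (\<Sum>D\<in>?A. if \<forall>q\<in>D. E q y then (-1) ^ card D else (0::real))"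
      using Q by (intro sum.mono_neutral_cong_left) auto
  qed
  also have "\<dots> = (\<Sum>D\<in>?A. \<Sum>y\<in>Y. if \<forall>q\<in>D. E q y then (-1) ^ card D else 0)"
    by (rule sum.swap)
  also have "\<dots> = (\<Sum>D\<in>?A. (-1) ^ card D * real (card {y \<in> Y. \<forall>q\<in>D. E q y}))"
  proof (intro sum.cong refl)
    fix D
    have "(\<Sum>y\<in>Y. if \<forall>q\<in>D. E q y then (-1) ^ card D else (0::real)) = (\<Sum>y\<in>{y\<in>Y. \<forall>q\<in>D. E q y}. (-1) ^ card D)"
      using Y by (intro sum.mono_neutral_cong_right) auto
    then show "(\<Sum>y\<in>Y. if \<forall>q\<in>D. E q y then (-1) ^ card D else (0::real)) = (-1) ^ card D * real (card {y \<in> Y. \<forall>q\<in>D. E q y})"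
      by simp
  qed
  finally show ?thesis .
qed

text \<open>The roots are s x and - s x with s^2 congruent to -1. They differ because q is odd and
  divides neither s nor x.\<close>

lemma card_roots_prime:
  fixes x :: int
  assumes q: "prime q" "q mod 4 = 1" and x: "\<not> int q dvd x"
  shows "card {r::nat. r < q \<and> int q dvd x\<^sup>2 + (int r)\<^sup>2} = 2"
proof -
  obtain s :: int where s: "int q dvd s\<^sup>2 + 1" using sqrt_minus_one_mod q by blast
  have pq: "prime (int q)" using q by simp
  have q0: "int q > 0" using q prime_gt_0_nat by simp
  have q2: "q > 2" using q prime_ge_2_nat[of q] by (cases "q = 2") auto
  have ns: "\<not> int q dvd s"
  proof
    assume "int q dvd s"
    then have "int q dvd s\<^sup>2" by (simp add: power2_eq_square)
    then have "int q dvd 1" using s by (metis dvd_add_right_iff)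
    then show False using q2 by simp
  qed
  define r1 r2 where "r1 = nat ((s * x) mod int q)" and "r2 = nat ((- (s * x)) mod int q)"
  have r1: "int r1 = (s * x) mod int q" and r2: "int r2 = (- (s * x)) mod int q"
    using q0 by (simp_all add: r1_def r2_def)
  have iff: "int q dvd x\<^sup>2 + t\<^sup>2 \<longleftrightarrow> int q dvd t - s * x \<or> int q dvd t + s * x" for t
  proof -
    have "x\<^sup>2 + t\<^sup>2 = (t - s * x) * (t + s * x) + x\<^sup>2 * (s\<^sup>2 + 1)"
      by (simp add: power2_eq_square algebra_simps)
    then have "int q dvd x\<^sup>2 + t\<^sup>2 \<longleftrightarrow> int q dvd (t - s * x) * (t + s * x)"
      using s by (metis dvd_add_left_iff dvd_mult)
    then show ?thesis using pq by (simp add: prime_dvd_mult_iff)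
  qed
  have "{r::nat. r < q \<and> int q dvd x\<^sup>2 + (int r)\<^sup>2} = {r1, r2}"
  proof (intro Set.set_eqI iffI)
    fix r assume "r \<in> {r::nat. r < q \<and> int q dvd x\<^sup>2 + (int r)\<^sup>2}"
    then have r: "r < q" "int q dvd int r - s * x \<or> int q dvd int r + s * x" using iff by auto
    have m: "int r mod int q = int r" using r(1) by simp
    from r(2) show "r \<in> {r1, r2}"
    proof
      assume "int q dvd int r - s * x"
      then have "int r mod int q = s * x mod int q" by (simp add: mod_eq_dvd_iff)
      then show ?thesis using m r1 by simp
    next
      assume "int q dvd int r + s * x"
      then have "int r mod int q = - (s * x) mod int q" by (simp add: mod_eq_dvd_iff)
      then show ?thesis using m r2 by simp
    qed
  next
    fix r assume r: "r \<in> {r1, r2}"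
    have "int r1 < int q" "int r2 < int q" unfolding r1 r2 using pos_mod_bound[OF q0] by blast+
    then have lt: "r < q" using r by auto
    have "int q dvd int r1 - s * x" unfolding r1 by (simp add: mod_eq_dvd_iff[symmetric])
    moreover have "int q dvd int r2 + s * x"
    proof -
      have "int q dvd int r2 - (- (s * x))" unfolding r2 by (subst mod_eq_dvd_iff[symmetric]) simp
      then show ?thesis by simp
    qed
    ultimately show "r \<in> {r::nat. r < q \<and> int q dvd x\<^sup>2 + (int r)\<^sup>2}" using lt r iff by auto
  qed
  moreover have "r1 \<noteq> r2"
  proof
    assume "r1 = r2"
    then have "s * x mod int q = - (s * x) mod int q" using r1 r2 by simp
    then have "int q dvd s * x - (- (s * x))" by (simp add: mod_eq_dvd_iff)
    then have "int q dvd 2 * (s * x)" by simp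
    then have "int q dvd 2" using pq ns x by (simp add: prime_dvd_mult_iff)
    then show False using q2 by (auto dest: zdvd_imp_le)
  qed
  ultimately show ?thesis by simp
qed

lemma dvd_shift_mod:
  fixes x y :: int
  assumes "int q dvd int d"
  shows "int q dvd x\<^sup>2 + (y mod int d)\<^sup>2 \<longleftrightarrow> int q dvd x\<^sup>2 + y\<^sup>2"
proof -
  have "int q dvd y - y mod int d" using assms by (metis dvd_minus_mod dvd_trans)
  then obtain t where "y - y mod int d = int q * t" by (auto elim: dvdE)
  then have y: "y = y mod int d + int q * t" by simp
  have "y\<^sup>2 = (y mod int d)\<^sup>2 + int q * (t * (2 * (y mod int d) + int q * t))"
    by (subst y) (simp add: power2_eq_square algebra_simps)
  then have "x\<^sup>2 + y\<^sup>2 = int q * (t * (2 * (y mod int d) + int q * t)) + (x\<^sup>2 + (y mod int d)\<^sup>2)" by simp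
  then show ?thesis by (metis dvd_add_right_iff dvd_triv_left)
qed

text \<open>Chinese remainder theorem: every new prime doubles the number of residue
  classes.\<close>

lemma card_roots_squarefree:
  fixes x :: int
  assumes "finite D" "\<And>q. q \<in> D \<Longrightarrow> prime q \<and> q mod 4 = 1 \<and> \<not> int q dvd x"
  shows "card {r::nat. r < \<Prod>D \<and> (\<forall>q\<in>D. int q dvd x\<^sup>2 + (int r)\<^sup>2)} = 2 ^ card D"
  using assms
proof (induction D rule: finite_induct)
  case empty
  have "{r::nat. r < 1} = {0}" by auto
  then show ?case by simp
next
  case (insert q D)
  define d where "d = \<Prod>D"
  define A where "A = {r::nat. r < q \<and> int q dvd x\<^sup>2 + (int r)\<^sup>2}"
  define B where "B = {r::nat. r < d \<and> (\<forall>q\<in>D. int q dvd x\<^sup>2 + (int r)\<^sup>2)}"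
  define R where "R = {r::nat. r < \<Prod>(insert q D) \<and> (\<forall>q\<in>insert q D. int q dvd x\<^sup>2 + (int r)\<^sup>2)}"
  have q: "prime q" "q > 0" using insert by (auto simp: prime_gt_0_nat)
  have d0: "d > 0" unfolding d_def using insert by (auto simp: prime_gt_0_nat intro!: prod_pos)
  have cop: "coprime q d" unfolding d_def
    by (rule prod_coprime_right) (use insert in \<open>auto intro: primes_coprime\<close>)
  have dq: "\<Prod>(insert q D) = q * d" using insert by (simp add: d_def)
  have dd: "q' \<in> D \<Longrightarrow> int q' dvd int d" for q' unfolding d_def using insert(1) by (auto intro: dvd_prodI)
  have "bij_betw (\<lambda>r. (r mod q, r mod d)) R (A \<times> B)"
  proof (rule bij_betwI')
    fix r r' assume r: "r \<in> R" "r' \<in> R"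
    show "((r mod q, r mod d) = (r' mod q, r' mod d)) = (r = r')"
    proof
      assume eq: "(r mod q, r mod d) = (r' mod q, r' mod d)"
      then have "[r = r'] (mod q)" "[r = r'] (mod d)" by (auto simp: cong_def)
      then have "[r = r'] (mod q * d)" using coprime_cong_mult_nat[of r r' q d] cop by simp
      then show "r = r'" using r unfolding R_def dq by (simp add: cong_less_modulus_unique_nat)
    qed simp
  next
    fix r assume r: "r \<in> R"
    have "int q dvd x\<^sup>2 + (int (r mod q))\<^sup>2" using r dvd_shift_mod[of q q x "int r"] by (simp add: R_def zmod_int)
    moreover have "int q' dvd x\<^sup>2 + (int (r mod d))\<^sup>2" if "q' \<in> D" for q'
      using r dvd_shift_mod[OF dd[OF that], of x "int r"] that by (simp add: R_def zmod_int)
    ultimately show "(r mod q, r mod d) \<in> A \<times> B" using q d0 by (simp add: A_def B_def)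
  next
    fix ab assume "ab \<in> A \<times> B"
    then obtain a b where ab: "ab = (a,b)" "a \<in> A" "b \<in> B" by auto
    obtain r where r: "r < q * d" "[r = a] (mod q)" "[r = b] (mod d)"
      using binary_chinese_remainder_unique_nat[OF cop, of a b] q d0 by auto
    have m: "r mod q = a" "r mod d = b" using r ab by (auto simp: cong_def A_def B_def)
    have "int q dvd x\<^sup>2 + (int r)\<^sup>2" using ab m dvd_shift_mod[of q q x "int r"] by (simp add: A_def flip: zmod_int)
    moreover have "int q' dvd x\<^sup>2 + (int r)\<^sup>2" if "q' \<in> D" for q'
      using ab m dvd_shift_mod[OF dd[OF that], of x "int r"] that by (simp add: B_def flip: zmod_int)
    ultimately have "r \<in> R" using r unfolding R_def dq by simp
    then show "\<exists>r\<in>R. ab = (r mod q, r mod d)" using m ab by auto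
  qed
  then have "card R = card (A \<times> B)" by (rule bij_betw_same_card)
  also have "\<dots> = card A * card B" by (rule card_cartesian_product)
  also have "card A = 2" unfolding A_def by (rule card_roots_prime) (use insert in auto)
  also have "card B = 2 ^ card D" unfolding B_def d_def using insert by auto
  finally show ?case using insert by (simp add: R_def)
qed

lemma card_int_real_interval:
  fixes a b :: real
  assumes "a \<le> b"
  shows "finite {t::int. a \<le> of_int t \<and> of_int t \<le> b}"
    "\<bar>real (card {t::int. a \<le> of_int t \<and> of_int t \<le> b}) - (b - a)\<bar> \<le> 1"
proof -
  have eq: "{t::int. a \<le> of_int t \<and> of_int t \<le> b} = {\<lceil>a\<rceil>..\<lfloor>b\<rfloor>}"
    by (auto simp: ceiling_le_iff le_floor_iff)
  show "finite {t::int. a \<le> of_int t \<and> of_int t \<le> b}" unfolding eq by simp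
  have "\<lceil>a\<rceil> \<le> \<lfloor>b\<rfloor> + 1" using assms by linarith
  then have "real (card {\<lceil>a\<rceil>..\<lfloor>b\<rfloor>}) = of_int (\<lfloor>b\<rfloor> + 1 - \<lceil>a\<rceil>)" by simp
  then show "\<bar>real (card {t::int. a \<le> of_int t \<and> of_int t \<le> b}) - (b - a)\<bar> \<le> 1"
    unfolding eq by linarith
qed

lemma card_int_interval_residue:
  fixes a b :: real
  assumes ab: "a \<le> b" and d: "d > 0" and r: "r < d"
  shows "\<bar>real (card {y::int. a \<le> of_int y \<and> of_int y \<le> b \<and> y mod int d = int r}) - (b - a) / real d\<bar> \<le> 1"
proof -
  let ?T = "{t::int. (a - real r) / real d \<le> of_int t \<and> of_int t \<le> (b - real r) / real d}"
  have "bij_betw (\<lambda>t. int r + int d * t) ?T {y::int. a \<le> of_int y \<and> of_int y \<le> b \<and> y mod int d = int r}"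
  proof (rule bij_betwI')
    fix t t' show "(int r + int d * t = int r + int d * t') = (t = t')" using d by simp
  next
    fix t assume t: "t \<in> ?T"
    then have "a \<le> real_of_int (int r + int d * t)" "real_of_int (int r + int d * t) \<le> b"
      using d by (auto simp: field_simps)
    moreover have "(int r + int d * t) mod int d = int r" using r by simp
    ultimately show "int r + int d * t \<in> {y::int. a \<le> of_int y \<and> of_int y \<le> b \<and> y mod int d = int r}" by simp
  next
    fix y assume y: "y \<in> {y::int. a \<le> of_int y \<and> of_int y \<le> b \<and> y mod int d = int r}"
    then have eq: "y = int r + int d * (y div int d)"
      using mod_mult_div_eq[of y "int d"] by simp
    have "real_of_int y = real r + real d * of_int (y div int d)"
      using eq by (metis of_int_add of_int_mult of_int_of_nat_eq)
    then have "y div int d \<in> ?T" using y d by (auto simp: field_simps)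
    then show "\<exists>t\<in>?T. y = int r + int d * t" using eq by blast
  qed
  then have "card ?T = card {y::int. a \<le> of_int y \<and> of_int y \<le> b \<and> y mod int d = int r}"
    by (rule bij_betw_same_card)
  moreover have "(a - real r) / real d \<le> (b - real r) / real d" using ab d by (intro divide_right_mono) auto
  then have "\<bar>real (card ?T) - ((b - real r) / real d - (a - real r) / real d)\<bar> \<le> 1"
    by (rule card_int_real_interval)
  moreover have "(b - real r) / real d - (a - real r) / real d = (b - a) / real d"
    by (simp flip: diff_divide_distrib)
  ultimately show ?thesis by simp
qed

text \<open>The solutions fill 2^|D| residue classes modulo the product of D, and in an interval
  each class misses its expected count by at most 1.\<close>

lemma card_multiples_interval:
  fixes x :: int and a b :: real
  assumes D: "finite D" "\<And>q. q \<in> D \<Longrightarrow> prime q \<and> q mod 4 = 1 \<and> \<not> int q dvd x" and ab: "a \<le> b"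
  shows "\<bar>real (card {y::int. a \<le> of_int y \<and> of_int y \<le> b \<and> (\<forall>q\<in>D. int q dvd x\<^sup>2 + y\<^sup>2)})
     - 2 ^ card D * ((b - a) / real (\<Prod>D))\<bar> \<le> 2 ^ card D"
proof -
  define d where "d = \<Prod>D"
  have d0: "d > 0" unfolding d_def using D by (auto simp: prime_gt_0_nat intro!: prod_pos)
  have dd: "q \<in> D \<Longrightarrow> int q dvd int d" for q unfolding d_def using D(1) by (auto intro: dvd_prodI)
  define R where "R = {r::nat. r < d \<and> (\<forall>q\<in>D. int q dvd x\<^sup>2 + (int r)\<^sup>2)}"
  have finR: "finite R" unfolding R_def by simp
  have cR: "card R = 2 ^ card D" unfolding R_def d_def by (rule card_roots_squarefree) (use D in auto)
  let ?Z = "\<lambda>r. {y::int. a \<le> of_int y \<and> of_int y \<le> b \<and> y mod int d = int r}"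
  have finZ: "finite (?Z r)" for r
    by (rule finite_subset[OF _ card_int_real_interval(1)[OF ab]]) auto
  have "{y::int. a \<le> of_int y \<and> of_int y \<le> b \<and> (\<forall>q\<in>D. int q dvd x\<^sup>2 + y\<^sup>2)} = (\<Union>r\<in>R. ?Z r)"
  proof (intro Set.set_eqI iffI)
    fix y assume y: "y \<in> {y::int. a \<le> of_int y \<and> of_int y \<le> b \<and> (\<forall>q\<in>D. int q dvd x\<^sup>2 + y\<^sup>2)}"
    define r where "r = nat (y mod int d)"
    have m: "int r = y mod int d" using d0 by (simp add: r_def)
    have "r < d" using d0 by (simp add: r_def nat_less_iff)
    then have "r \<in> R" using y dvd_shift_mod[OF dd, of _ x y] unfolding R_def by (simp add: m)
    moreover have "y \<in> ?Z r" using y m by simp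
    ultimately show "y \<in> (\<Union>r\<in>R. ?Z r)" by (rule UN_I)
  next
    fix y assume "y \<in> (\<Union>r\<in>R. ?Z r)"
    then obtain r where r: "r \<in> R" "y \<in> ?Z r" by auto
    have "int q dvd x\<^sup>2 + y\<^sup>2" if "q \<in> D" for q
      using r that dvd_shift_mod[OF dd[OF that], of x y] by (simp add: R_def)
    then show "y \<in> {y::int. a \<le> of_int y \<and> of_int y \<le> b \<and> (\<forall>q\<in>D. int q dvd x\<^sup>2 + y\<^sup>2)}" using r by simp
  qed
  then have "card {y::int. a \<le> of_int y \<and> of_int y \<le> b \<and> (\<forall>q\<in>D. int q dvd x\<^sup>2 + y\<^sup>2)} = (\<Sum>r\<in>R. card (?Z r))"
    using finR finZ by (simp only:) (rule card_UN_disjoint; auto)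
  then have "real (card {y::int. a \<le> of_int y \<and> of_int y \<le> b \<and> (\<forall>q\<in>D. int q dvd x\<^sup>2 + y\<^sup>2)})
      - 2 ^ card D * ((b - a) / real d) = (\<Sum>r\<in>R. real (card (?Z r)) - (b - a) / real d)"
    by (simp add: sum_subtractf cR)
  also have "\<bar>\<dots>\<bar> \<le> (\<Sum>r\<in>R. \<bar>real (card (?Z r)) - (b - a) / real d\<bar>)" by (rule sum_abs)
  also have "\<dots> \<le> (\<Sum>r\<in>R. 1)"
    by (intro sum_mono card_int_interval_residue ab d0) (simp add: R_def)
  also have "\<dots> = 2 ^ card D" by (simp add: cR)
  finally show ?thesis by (simp add: d_def)
qed

lemma prod_one_plus_eq_sum_subsets:
  fixes f :: "'a \<Rightarrow> real"
  assumes "finite Q"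
  shows "(\<Prod>q\<in>Q. 1 + f q) = (\<Sum>D\<in>Pow Q. \<Prod>q\<in>D. f q)"
  using prod_add[OF assms, of f "\<lambda>_. 1"] by (simp add: add.commute)

lemma sum_truncated_power2:
  assumes "finite Q"
  shows "(\<Sum>D | D \<subseteq> Q \<and> card D \<le> m. (2::real) ^ card D) \<le> (1 + 2 * real (card Q)) ^ m"
proof -
  have "(\<Sum>D | D \<subseteq> Q \<and> card D \<le> m. (2::real) ^ card D) = (\<Sum>j\<le>m. 2 ^ j * real (card Q choose j))"
    using sum_subsets_by_card[OF assms, of "\<lambda>j. 2 ^ j" m] by simp
  also have "\<dots> \<le> (\<Sum>j\<le>m. real (m choose j) * (2 * real (card Q)) ^ j * 1 ^ (m - j))"
  proof (intro sum_mono)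
    fix j assume j: "j \<in> {..m}"
    have "card Q choose j \<le> card Q ^ j"
      by (cases "j \<le> card Q") (auto intro: binomial_le_pow simp: not_le binomial_eq_0)
    then have "real (card Q choose j) \<le> real (card Q) ^ j" by (metis of_nat_le_iff of_nat_power)
    then have "2 ^ j * real (card Q choose j) \<le> (2 * real (card Q)) ^ j" by (simp add: power_mult_distrib)
    also have "\<dots> \<le> real (m choose j) * (2 * real (card Q)) ^ j"
    proof -
      have "1 \<le> m choose j" using j by (simp add: Suc_le_eq)
      then have "1 \<le> real (m choose j)" by simp
      then show ?thesis using mult_right_mono[of 1 "real (m choose j)" "(2 * real (card Q)) ^ j"] by simp
    qed
    finally show "2 ^ j * real (card Q choose j) \<le> real (m choose j) * (2 * real (card Q)) ^ j * 1 ^ (m - j)" by simp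
  qed
  also have "\<dots> = (2 * real (card Q) + 1) ^ m" by (rule binomial_ring[symmetric])
  finally show ?thesis by (simp add: add.commute)
qed

text \<open>Completing the truncated main term to all subsets gives the product of 1 - 2/q. The
  subsets with more than 2k elements are controlled by 2^|D| = 3^(-|D|) 6^|D| <= 3^(-2k) 6^|D|,
  which leads to the exponential with factor 6. The last summand collects the rounding errors
  2^|D|.\<close>

lemma brun_sieve_interval:
  fixes x :: int and a b :: real
  assumes Q: "finite Q" "\<And>q. q \<in> Q \<Longrightarrow> prime q \<and> q mod 4 = 1 \<and> \<not> int q dvd x" and ab: "a \<le> b"
  shows "real (card {y::int. a \<le> of_int y \<and> of_int y \<le> b \<and> (\<forall>q\<in>Q. \<not> int q dvd x\<^sup>2 + y\<^sup>2)})
    \<le> (b - a) * (exp (- 2 * (\<Sum>q\<in>Q. 1 / real q)) + (1/3) ^ (2 * k) * exp (6 * (\<Sum>q\<in>Q. 1 / real q)))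
      + (1 + 2 * real (card Q)) ^ (2 * k)"
proof -
  define Y where "Y = {y::int. a \<le> of_int y \<and> of_int y \<le> b}"
  have finY: "finite Y" unfolding Y_def by (rule card_int_real_interval(1)[OF ab])
  let ?S = "{D. D \<subseteq> Q \<and> card D \<le> 2 * k}"
  let ?L = "{D. D \<subseteq> Q \<and> card D > 2 * k}"
  have finS: "finite ?S" "finite ?L" using Q(1) by simp_all
  have finD: "D \<subseteq> Q \<Longrightarrow> finite D" for D using Q(1) finite_subset by blast
  define M where "M D = real (card {y\<in>Y. \<forall>q\<in>D. int q dvd x\<^sup>2 + y\<^sup>2})" for D
  have M: "\<bar>M D - 2 ^ card D * ((b - a) / real (\<Prod>D))\<bar> \<le> 2 ^ card D" if "D \<subseteq> Q" for D
    using card_multiples_interval[OF finD[OF that] _ ab, of x] Q(2) that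
    unfolding M_def Y_def by (simp add: conj_assoc subset_iff)
  have prodD: "(\<Prod>q\<in>D. c / real q) = c ^ card D / real (\<Prod>D)" for D c
    by (simp add: prod_dividef of_nat_prod)
  have "{y::int. a \<le> of_int y \<and> of_int y \<le> b \<and> (\<forall>q\<in>Q. \<not> int q dvd x\<^sup>2 + y\<^sup>2)} = {y\<in>Y. \<forall>q\<in>Q. \<not> int q dvd x\<^sup>2 + y\<^sup>2}"
    by (auto simp: Y_def)
  then have "real (card {y::int. a \<le> of_int y \<and> of_int y \<le> b \<and> (\<forall>q\<in>Q. \<not> int q dvd x\<^sup>2 + y\<^sup>2)})
      = real (card {y\<in>Y. \<forall>q\<in>Q. \<not> int q dvd x\<^sup>2 + y\<^sup>2})" by simp
  also have "\<dots> \<le> (\<Sum>D\<in>?S. (-1) ^ card D * M D)"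
    unfolding M_def by (rule brun_inequality[OF finY Q(1)])
  also have "\<dots> \<le> (\<Sum>D\<in>?S. (b - a) * (\<Prod>q\<in>D. - 2 / real q) + 2 ^ card D)"
  proof (intro sum_mono)
    fix D assume D: "D \<in> ?S"
    have eq: "(b - a) * (\<Prod>q\<in>D. - 2 / real q) = (-1) ^ card D * (2 ^ card D * ((b - a) / real (\<Prod>D)))"
      unfolding prodD by (simp add: power_minus[of 2])
    have "(-1) ^ card D * M D - (-1) ^ card D * (2 ^ card D * ((b - a) / real (\<Prod>D)))
      = (-1) ^ card D * (M D - 2 ^ card D * ((b - a) / real (\<Prod>D)))" by (simp add: algebra_simps)
    also have "\<dots> \<le> \<bar>(-1) ^ card D * (M D - 2 ^ card D * ((b - a) / real (\<Prod>D)))\<bar>" by (rule abs_ge_self)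
    also have "\<dots> \<le> 2 ^ card D" using M[of D] D by (simp add: abs_mult power_abs)
    finally show "(-1) ^ card D * M D \<le> (b - a) * (\<Prod>q\<in>D. - 2 / real q) + 2 ^ card D" unfolding eq by linarith
  qed
  also have "\<dots> = (b - a) * (\<Sum>D\<in>?S. \<Prod>q\<in>D. - 2 / real q) + (\<Sum>D\<in>?S. 2 ^ card D)"
    by (simp add: sum.distrib sum_distrib_left)
  also have "\<dots> \<le> (b - a) * (exp (- 2 * (\<Sum>q\<in>Q. 1 / real q)) + (1/3) ^ (2 * k) * exp (6 * (\<Sum>q\<in>Q. 1 / real q)))
      + (1 + 2 * real (card Q)) ^ (2 * k)"
  proof (intro add_mono mult_left_mono sum_truncated_power2 Q(1))
    have Pow: "Pow Q = ?S \<union> ?L" "?S \<inter> ?L = {}" by auto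
    have "(\<Sum>D\<in>?S. \<Prod>q\<in>D. - 2 / real q) = (\<Sum>D\<in>Pow Q. \<Prod>q\<in>D. - 2 / real q) - (\<Sum>D\<in>?L. \<Prod>q\<in>D. - 2 / real q)"
      unfolding Pow(1) using sum.union_disjoint[OF finS Pow(2), of "\<lambda>D. \<Prod>q\<in>D. - 2 / real q"] by linarith
    also have "\<dots> \<le> (\<Prod>q\<in>Q. 1 + - 2 / real q) + (\<Sum>D\<in>?L. \<Prod>q\<in>D. 2 / real q)"
    proof -
      have "- (\<Sum>D\<in>?L. \<Prod>q\<in>D. - 2 / real q) \<le> \<bar>\<Sum>D\<in>?L. \<Prod>q\<in>D. - 2 / real q\<bar>" by simp
      also have "\<dots> \<le> (\<Sum>D\<in>?L. \<bar>\<Prod>q\<in>D. - 2 / real q\<bar>)" by (rule sum_abs)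
      also have "\<dots> = (\<Sum>D\<in>?L. \<Prod>q\<in>D. 2 / real q)" by (simp add: abs_prod)
      finally show ?thesis using prod_one_plus_eq_sum_subsets[OF Q(1), of "\<lambda>q. - 2 / real q"] by simp
    qed
    also have "(\<Prod>q\<in>Q. 1 + - 2 / real q) \<le> (\<Prod>q\<in>Q. exp (- 2 / real q))"
    proof (intro prod_mono conjI)
      fix q assume "q \<in> Q"
      then have "q \<ge> 2" using Q(2) prime_ge_2_nat by blast
      then show "0 \<le> 1 + - 2 / real q" by (simp add: field_simps)
      show "1 + - 2 / real q \<le> exp (- 2 / real q)" by (rule exp_ge_add_one_self)
    qed
    also have "\<dots> = exp (- 2 * (\<Sum>q\<in>Q. 1 / real q))"
      using Q(1) by (simp add: exp_sum[symmetric] sum_distrib_left sum_negf)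
    also have "(\<Sum>D\<in>?L. \<Prod>q\<in>D. 2 / real q) \<le> (\<Sum>D\<in>?L. (1/3) ^ (2 * k) * (\<Prod>q\<in>D. 6 / real q))"
    proof (intro sum_mono)
      fix D assume D: "D \<in> ?L"
      have "(\<Prod>q\<in>D. 2 / real q) = (1/3) ^ card D * (\<Prod>q\<in>D. 6 / real q)"
        unfolding prodD by (simp flip: power_mult_distrib)
      also have "\<dots> \<le> (1/3) ^ (2 * k) * (\<Prod>q\<in>D. 6 / real q)"
        using D by (intro mult_right_mono power_decreasing) (auto intro!: prod_nonneg)
      finally show "(\<Prod>q\<in>D. 2 / real q) \<le> (1/3) ^ (2 * k) * (\<Prod>q\<in>D. 6 / real q)" .
    qed
    also have "\<dots> = (1/3) ^ (2 * k) * (\<Sum>D\<in>?L. \<Prod>q\<in>D. 6 / real q)" by (simp add: sum_distrib_left)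
    also have "\<dots> \<le> (1/3) ^ (2 * k) * (\<Sum>D\<in>Pow Q. \<Prod>q\<in>D. 6 / real q)"
      by (intro mult_left_mono sum_mono2) (use Q(1) in \<open>auto intro!: prod_nonneg\<close>)
    also have "(\<Sum>D\<in>Pow Q. \<Prod>q\<in>D. 6 / real q) = (\<Prod>q\<in>Q. 1 + 6 / real q)"
      by (rule prod_one_plus_eq_sum_subsets[OF Q(1), symmetric])
    also have "\<dots> \<le> (\<Prod>q\<in>Q. exp (6 / real q))"
      by (intro prod_mono conjI exp_ge_add_one_self) (auto intro: add_nonneg_nonneg)
    also have "\<dots> = exp (6 * (\<Sum>q\<in>Q. 1 / real q))"
      using Q(1) by (simp add: exp_sum[symmetric] sum_distrib_left)
    finally show "(\<Sum>D\<in>?S. \<Prod>q\<in>D. - 2 / real q) \<le> exp (- 2 * (\<Sum>q\<in>Q. 1 / real q)) + (1/3) ^ (2 * k) * exp (6 * (\<Sum>q\<in>Q. 1 / real q))"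
      by simp
  qed (use ab in auto)
  finally show ?thesis .
qed


text \<open>For z >= 4 the square of floor(z) is at least z, so taking the floor changes log log z
  by at most log 2.\<close>

lemma primes_mod4_recip_ge:
  obtains C where "C \<ge> 0" "\<And>z. z \<ge> 4 \<Longrightarrow>
    (\<Sum>p | prime p \<and> p mod 4 = 1 \<and> real p \<le> z. 1 / real p) \<ge> ln (ln z) / 2 - C"
proof -
  obtain C where C: "C \<ge> 0" "\<And>N. N \<ge> 2 \<Longrightarrow>
    \<bar>(\<Sum>p | prime p \<and> p mod 4 = 1 \<and> p \<le> N. 1 / real p) - ln (ln (real N)) / 2\<bar> \<le> C"
    using mertens_second_mod4[of 1] by blast
  have "(\<Sum>p | prime p \<and> p mod 4 = 1 \<and> real p \<le> z. 1 / real p) \<ge> ln (ln z) / 2 - (C + ln 2 / 2)"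
    if z: "z \<ge> 4" for z
  proof -
    define N where "N = nat \<lfloor>z\<rfloor>"
    have N: "N \<ge> 4" unfolding N_def using z by (simp add: le_nat_iff le_floor_iff)
    have "real N \<ge> z - 1" unfolding N_def using z by linarith
    then have "(z - 1)\<^sup>2 \<le> (real N)\<^sup>2" using z by (intro power_mono) auto
    moreover have "z \<le> (z - 1)\<^sup>2"
    proof -
      have "(z - 1)\<^sup>2 - z = z * (z - 3) + 1" by (simp add: power2_eq_square algebra_simps)
      moreover have "z * (z - 3) \<ge> 0" using z by (intro mult_nonneg_nonneg) auto
      ultimately show ?thesis by linarith
    qed
    ultimately have "z \<le> (real N)\<^sup>2" by linarith
    then have "ln z \<le> ln ((real N)\<^sup>2)" using z by (subst ln_le_cancel_iff) (use N in auto)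
    then have "ln z \<le> 2 * ln (real N)" using N by (simp add: ln_realpow)
    moreover have "ln z > 0" "ln (real N) > 0" using z N by auto
    ultimately have "ln (ln z) \<le> ln (2 * ln (real N))" by (subst ln_le_cancel_iff) auto
    also have "\<dots> = ln 2 + ln (ln (real N))" using \<open>ln (real N) > 0\<close> by (simp add: ln_mult)
    finally have "ln (ln z) / 2 - ln 2 / 2 \<le> ln (ln (real N)) / 2" by simp
    moreover have "{p. prime p \<and> p mod 4 = 1 \<and> real p \<le> z} = {p. prime p \<and> p mod 4 = 1 \<and> p \<le> N}"
      unfolding N_def using z by (auto simp: real_le_iff_le_nat_floor)
    ultimately show ?thesis using C(2)[of N] N by (simp add: abs_le_iff)
  qed
  then show ?thesis using that[of "C + ln 2 / 2"] C(1) by simp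
qed

lemma card_int_real_interval_le:
  fixes a b :: real
  assumes "a \<le> b"
  shows "real (card {t::int. a \<le> of_int t \<and> of_int t \<le> b}) \<le> b - a + 1"
  using card_int_real_interval(2)[OF assms] by linarith

text \<open>
  Only primes q > L are sieved: an integer x has at most L prime factors, so those exceeding L can be left out of
  the sieve at the cost of a constant factor.
\<close>

lemma prime_fiber_count:
  obtains C where "C > 0" "\<And>L T x a b. ln L \<ge> 100 \<Longrightarrow> (ln L) ^ 3 \<le> ln T \<Longrightarrow> ln T \<le> L \<Longrightarrow> T > 0 \<Longrightarrow> x \<noteq> 0 \<Longrightarrow>
     \<bar>real_of_int x\<bar> \<le> sqrt T \<Longrightarrow> a \<le> b \<Longrightarrow>
     real (card {y::int. a \<le> of_int y \<and> of_int y \<le> b \<and> prime (nat (x\<^sup>2 + y\<^sup>2))})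
       \<le> (b - a) * (C * (ln L)\<^sup>2 / ln T) + 2 * exp (ln T * (12/100))"
proof -
  obtain C1 where C1: "C1 \<ge> 0" "\<And>z. z \<ge> 4 \<Longrightarrow>
    (\<Sum>p | prime p \<and> p mod 4 = 1 \<and> real p \<le> z. 1 / real p) \<ge> ln (ln z) / 2 - C1"
    using primes_mod4_recip_ge by blast
  obtain C2 where C2: "C2 \<ge> 0" "\<And>z. z \<ge> 3 \<Longrightarrow>
    (\<Sum>p | prime p \<and> p mod 4 = 1 \<and> real p \<le> z. 1 / real p) \<le> ln (ln z) / 2 + C2"
    using primes_mod4_recip_le[of 1] by blast
  define C where "C = 100 * exp (2 * (C1 + C2 + 1)) + exp (6 * C2)"
  have "real (card {y::int. a \<le> of_int y \<and> of_int y \<le> b \<and> prime (nat (x\<^sup>2 + y\<^sup>2))})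
       \<le> (b - a) * (C * (ln L)\<^sup>2 / ln T) + 2 * exp (ln T * (12/100))"
    if L0: "ln L \<ge> 100" and T: "(ln L) ^ 3 \<le> ln T" "ln T \<le> L" "T > 0" and x: "x \<noteq> 0" "\<bar>real_of_int x\<bar> \<le> sqrt T"
      and ab: "a \<le> b" for L T a b :: real and x :: int
  proof -
    define l where "l = ln L"
    have l: "l \<ge> 100" using L0 by (simp add: l_def)
    have l3: "l ^ 3 \<le> ln T" using T by (simp add: l_def)
    have lT: "ln T > 0" using l l3 by (meson less_le_trans zero_less_power zero_less_numeral)
    then have Lpos: "L > 0" using T(2) by linarith
    have eL: "L = exp l" using Lpos by (simp add: l_def)
    have L4: "L \<ge> 4" unfolding eL using exp_ge_add_one_self[of l] l by linarith
    \<comment> \<open>The sieve level T^(1/(100 l)). The sieve error is at most w^(4k), and k <= 3l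
      turns it into T^(12/100). The assumption l^3 <= log T with l >= 100 makes w at least L, so
      that there is something to sieve.\<close>
    define w where "w = exp (ln T / (100 * l))"
    have lw: "ln w = ln T / (100 * l)" by (simp add: w_def)
    have lw1: "ln w \<ge> l"
    proof -
      have "l * (100 * l) \<le> l * (l * l)" using l by (intro mult_left_mono mult_right_mono) auto
      also have "\<dots> = l ^ 3" by (simp add: power3_eq_cube mult.assoc)
      finally have "l * (100 * l) \<le> ln T" using l3 by simp
      then show ?thesis unfolding lw using l by (simp add: le_divide_eq)
    qed
    have wL: "w \<ge> L" unfolding eL using lw1 by (simp add: w_def)
    have w4: "w \<ge> 4" using wL L4 by simp
    \<comment> \<open>With k >= 2l the factor 3^(-2k) is at most exp(-4l), while the exponential of
      six times the sum of 1/q is at most a constant times exp(3l). The remaining exp(-l) = 1/L is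
      at most 1 / log T.\<close>
    define k where "k = nat \<lceil>2 * l\<rceil>"
    have k1: "2 * l \<le> real k" unfolding k_def by (rule real_nat_ceiling_ge)
    have k2: "real k \<le> 3 * l" unfolding k_def using l by linarith
    define Q where "Q = {q. prime q \<and> q mod 4 = 1 \<and> L < real q \<and> real q \<le> w \<and> \<not> int q dvd x}"
    define P where "P z = {p. prime p \<and> p mod 4 = 1 \<and> real p \<le> z}" for z
    define B where "B = {q. prime q \<and> int q dvd x \<and> L < real q}"
    have finP: "finite (P z)" for z
      using finite_real_le[of "\<lambda>p. prime p \<and> p mod 4 = 1" z] by (simp add: P_def conj_assoc)
    have QP: "Q \<subseteq> P w" by (auto simp: Q_def P_def)
    have finQ: "finite Q" by (rule finite_subset[OF QP finP])
    have nx: "nat \<bar>x\<bar> > 0" using x by simp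
    have Bsub: "B \<subseteq> prime_factors (nat \<bar>x\<bar>)"
      using nx by (auto simp: B_def prime_factors_dvd int_dvd_int_iff[symmetric] simp del: int_dvd_int_iff)
    have finB: "finite B" by (rule finite_subset[OF Bsub]) simp
    have cardB: "real (card B) \<le> L"
    proof -
      have "real (card B) * (1/2) = (\<Sum>q\<in>B. 1/2)" by simp
      also have "\<dots> \<le> (\<Sum>q\<in>B. ln (real q))"
      proof (intro sum_mono)
        fix q assume "q \<in> B"
        then have "2 \<le> real q" using prime_ge_2_nat by (auto simp: B_def)
        then have "ln 2 \<le> ln (real q)" by simp
        then show "1/2 \<le> ln (real q)" using ln2_ge_two_thirds by linarith
      qed
      also have "\<dots> \<le> ln (real (nat \<bar>x\<bar>))" by (rule sum_ln_primes_le_ln[OF nx Bsub])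
      also have "\<dots> \<le> ln (sqrt T)" using x nx T(3) by (subst ln_le_cancel_iff) auto
      also have "\<dots> = ln T / 2" using T(3) by (simp add: ln_sqrt)
      finally show ?thesis using T(2) by simp
    qed
    have sumB: "(\<Sum>q\<in>B. 1 / real q) \<le> 1"
    proof -
      have "(\<Sum>q\<in>B. 1 / real q) \<le> (\<Sum>q\<in>B. 1 / L)"
        by (intro sum_mono) (use Lpos in \<open>auto simp: B_def intro!: divide_left_mono mult_pos_pos\<close>)
      also have "\<dots> = real (card B) / L" by simp
      also have "\<dots> \<le> 1" using cardB Lpos by (simp add: divide_le_eq)
      finally show ?thesis .
    qed
    have "(\<Sum>q\<in>P w. 1 / real q) \<le> (\<Sum>q\<in>Q \<union> P L \<union> B. 1 / real q)"
      by (rule sum_mono2) (use finQ finP finB in \<open>auto simp: P_def Q_def B_def\<close>)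
    also have "\<dots> \<le> (\<Sum>q\<in>Q \<union> P L. 1 / real q) + (\<Sum>q\<in>B. 1 / real q)"
      by (rule sum_Un_le_real) (use finQ finP finB in auto)
    also have "(\<Sum>q\<in>Q \<union> P L. 1 / real q) \<le> (\<Sum>q\<in>Q. 1 / real q) + (\<Sum>q\<in>P L. 1 / real q)"
      by (rule sum_Un_le_real) (use finQ finP finB in auto)
    finally have Qlow: "(\<Sum>q\<in>Q. 1 / real q) \<ge> ln (ln w) / 2 - C1 - (ln l / 2 + C2) - 1"
      using C1(2)[OF w4] C2(2)[of L] L4 sumB unfolding P_def l_def by simp
    have Qup: "(\<Sum>q\<in>Q. 1 / real q) \<le> l / 2 + C2"
    proof -
      have "(\<Sum>q\<in>Q. 1 / real q) \<le> (\<Sum>q\<in>P w. 1 / real q)" by (rule sum_mono2) (use finP QP in auto)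
      also have "\<dots> \<le> ln (ln w) / 2 + C2" using C2(2)[of w] w4 unfolding P_def by simp
      also have "ln (ln w) \<le> ln L"
      proof -
        have "ln T / (100 * l) \<le> ln T / 1" using lT l by (intro divide_left_mono) auto
        then have "ln w \<le> L" using T(2) unfolding lw by simp
        then show ?thesis using lw1 l by (subst ln_le_cancel_iff) (auto intro: less_le_trans[of 0 l])
      qed
      finally show ?thesis by (simp add: l_def)
    qed
    \<comment> \<open>One factor l is the loss from leaving out the primes up to L; the other comes
      from log w = log T / (100 l).\<close>
    have main1: "exp (- 2 * (\<Sum>q\<in>Q. 1 / real q)) \<le> 100 * exp (2 * (C1 + C2 + 1)) * l\<^sup>2 / ln T"
    proof -
      have "exp (- 2 * (\<Sum>q\<in>Q. 1 / real q)) \<le> exp (2 * (C1 + C2 + 1) + (ln l - ln (ln w)))"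
        using Qlow by simp
      also have "\<dots> = exp (2 * (C1 + C2 + 1)) * (l / ln w)"
      proof -
        have "ln w > 0" using lw1 l by linarith
        then show ?thesis using l by (simp add: exp_add exp_diff)
      qed
      also have "\<dots> = 100 * exp (2 * (C1 + C2 + 1)) * l\<^sup>2 / ln T"
        unfolding lw by (simp add: power2_eq_square)
      finally show ?thesis .
    qed
    have main2: "(1/3) ^ (2 * k) * exp (6 * (\<Sum>q\<in>Q. 1 / real q)) \<le> exp (6 * C2) * l\<^sup>2 / ln T"
    proof -
      have "exp (1::real) \<le> 3" using e_less_272 by simp
      then have "(1/3::real) \<le> exp (-1)" by (simp add: exp_minus field_simps)
      then have "(1/3::real) ^ (2 * k) \<le> exp (-1) ^ (2 * k)" by (intro power_mono) auto
      also have "\<dots> = exp (- real (2 * k))" by (simp flip: exp_of_nat_mult)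
      also have "\<dots> \<le> exp (- 4 * l)" using k1 by simp
      finally have "(1/3) ^ (2 * k) * exp (6 * (\<Sum>q\<in>Q. 1 / real q)) \<le> exp (- 4 * l) * exp (6 * (l / 2 + C2))"
        using Qup by (intro mult_mono) auto
      also have "\<dots> = exp (6 * C2) * exp (- l)" by (simp add: algebra_simps flip: exp_add)
      also have "\<dots> = exp (6 * C2) * (1 / L)" by (simp add: eL exp_minus field_simps)
      also have "\<dots> \<le> exp (6 * C2) * (l\<^sup>2 / ln T)"
      proof (intro mult_left_mono)
        have "1 / L \<le> 1 / ln T" using T(2) lT by (intro divide_left_mono) auto
        also have "\<dots> \<le> l\<^sup>2 / ln T" using l lT by (intro divide_right_mono) (auto simp: power2_eq_square intro: order_trans[of 1 100] mult_ge1_I)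
        finally show "1 / L \<le> l\<^sup>2 / ln T" .
      qed auto
      finally show ?thesis by simp
    qed
    have cardQ: "real (card Q) \<le> w"
    proof -
      have "Q \<subseteq> {1..nat \<lfloor>w\<rfloor>}"
        using w4 by (auto simp: Q_def real_le_iff_le_nat_floor Suc_le_eq prime_gt_0_nat)
      then have "card Q \<le> nat \<lfloor>w\<rfloor>" using card_mono[of "{1..nat \<lfloor>w\<rfloor>}" Q] by simp
      then show ?thesis using w4 by (simp add: real_le_iff_le_nat_floor)
    qed
    have w2: "1 + 2 * w \<le> w\<^sup>2" "3 * w \<le> w\<^sup>2"
    proof -
      have "4 * w \<le> w\<^sup>2" using w4 by (simp add: power2_eq_square)
      then show "1 + 2 * w \<le> w\<^sup>2" "3 * w \<le> w\<^sup>2" using w4 by linarith+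
    qed
    have main3: "(1 + 2 * real (card Q)) ^ (2 * k) \<le> exp (ln T * (12/100))"
    proof -
      have "(1 + 2 * real (card Q)) ^ (2 * k) \<le> (w\<^sup>2) ^ (2 * k)"
        using cardQ w2 by (intro power_mono) auto
      also have "\<dots> = exp (real (4 * k) * (ln T / (100 * l)))"
        unfolding exp_of_nat_mult w_def by (simp flip: power_mult)
      also have "\<dots> \<le> exp (12 * l * (ln T / (100 * l)))"
        using k2 lT l by (intro iffD2[OF exp_le_cancel_iff] mult_right_mono) auto
      also have "12 * l * (ln T / (100 * l)) = ln T * (12/100)" using l by (simp add: field_simps)
      finally show ?thesis .
    qed
    have main4: "3 * w \<le> exp (ln T * (12/100))"
    proof -
      have "3 * w \<le> w\<^sup>2" by (rule w2)
      also have "w\<^sup>2 = exp (2 * (ln T / (100 * l)))" unfolding w_def by (simp add: power2_eq_square flip: exp_add)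
      also have "\<dots> \<le> exp (ln T * (12/100))"
      proof -
        have "2 * (ln T / (100 * l)) \<le> 2 * (ln T / 100)" using l lT by (intro mult_left_mono divide_left_mono) auto
        also have "\<dots> \<le> ln T * (12/100)" using lT by simp
        finally show ?thesis by simp
      qed
      finally show ?thesis .
    qed
    let ?F = "{y::int. a \<le> of_int y \<and> of_int y \<le> b \<and> prime (nat (x\<^sup>2 + y\<^sup>2))}"
    let ?S = "{y::int. a \<le> of_int y \<and> of_int y \<le> b \<and> (\<forall>q\<in>Q. \<not> int q dvd x\<^sup>2 + y\<^sup>2)}"
    \<comment> \<open>A prime value that is itself one of the sieving primes is not caught by the
      sieve. It is at most w, which confines y to this short interval.\<close>
    let ?R = "{y::int. - sqrt w \<le> of_int y \<and> of_int y \<le> sqrt w}"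
    have finS: "finite ?S" by (rule finite_subset[OF _ card_int_real_interval(1)[OF ab]]) auto
    have sw: "- sqrt w \<le> sqrt w" using w4 by (meson order_trans neg_le_0_iff_le real_sqrt_ge_zero order.trans zero_le_numeral)
    have finR: "finite ?R" by (rule card_int_real_interval(1)[OF sw])
    have "?F \<subseteq> ?S \<union> ?R"
    proof
      fix y assume y: "y \<in> ?F"
      show "y \<in> ?S \<union> ?R"
      proof (cases "\<forall>q\<in>Q. \<not> int q dvd x\<^sup>2 + y\<^sup>2")
        case True then show ?thesis using y by auto
      next
        case False
        then obtain q where q: "q \<in> Q" "int q dvd x\<^sup>2 + y\<^sup>2" by auto
        have e: "int (nat (x\<^sup>2 + y\<^sup>2)) = x\<^sup>2 + y\<^sup>2" by simp
        then have "int q dvd int (nat (x\<^sup>2 + y\<^sup>2))" using q(2) by metis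
        then have "q dvd nat (x\<^sup>2 + y\<^sup>2)" by (simp only: int_dvd_int_iff)
        moreover have "prime q" using q(1) by (simp add: Q_def)
        moreover have "prime (nat (x\<^sup>2 + y\<^sup>2))" using y by blast
        ultimately have "q = nat (x\<^sup>2 + y\<^sup>2)" using primes_dvd_imp_eq by blast
        then have "int q = x\<^sup>2 + y\<^sup>2" using e by simp
        then have "real q = of_int (x\<^sup>2 + y\<^sup>2)" by (metis of_int_of_nat_eq)
        then have "(of_int y)\<^sup>2 \<le> w" using q(1) by (auto simp: Q_def intro: order_trans[rotated])
        then have "\<bar>real_of_int y\<bar> \<le> sqrt w" using real_le_rsqrt[of "\<bar>real_of_int y\<bar>" w] by simp
        then show ?thesis by auto
      qed
    qed
    then have "card ?F \<le> card (?S \<union> ?R)" using finS finR by (intro card_mono) auto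
    also have "\<dots> \<le> card ?S + card ?R" by (rule card_Un_le)
    finally have "real (card ?F) \<le> real (card ?S) + real (card ?R)" by linarith
    moreover have "real (card ?R) \<le> 3 * w"
    proof -
      have "sqrt w \<le> w" using w4 by (intro real_le_lsqrt) (auto simp: power2_eq_square)
      then show ?thesis using card_int_real_interval_le[OF sw] w4 by simp
    qed
    moreover have "real (card ?S) \<le> (b - a) * (exp (- 2 * (\<Sum>q\<in>Q. 1 / real q)) + (1/3) ^ (2 * k) * exp (6 * (\<Sum>q\<in>Q. 1 / real q)))
      + (1 + 2 * real (card Q)) ^ (2 * k)"
      by (rule brun_sieve_interval[OF finQ _ ab]) (simp add: Q_def)
    moreover have "(b - a) * (exp (- 2 * (\<Sum>q\<in>Q. 1 / real q)) + (1/3) ^ (2 * k) * exp (6 * (\<Sum>q\<in>Q. 1 / real q)))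
      \<le> (b - a) * (C * (ln L)\<^sup>2 / ln T)"
    proof (rule mult_left_mono)
      have "C * (ln L)\<^sup>2 / ln T = 100 * exp (2 * (C1 + C2 + 1)) * l\<^sup>2 / ln T + exp (6 * C2) * l\<^sup>2 / ln T"
        by (simp add: C_def l_def distrib_right add_divide_distrib)
      then show "exp (- 2 * (\<Sum>q\<in>Q. 1 / real q)) + (1/3) ^ (2 * k) * exp (6 * (\<Sum>q\<in>Q. 1 / real q)) \<le> C * (ln L)\<^sup>2 / ln T"
        using main1 main2 by linarith
    qed (use ab in simp)
    ultimately show ?thesis using main3 main4 by linarith
  qed
  moreover have "C > 0" unfolding C_def by (intro add_pos_pos mult_pos_pos) auto
  ultimately show ?thesis using that by blast
qed

section \<open>Primes in strips\<close>

lemma strip_subset_Sigma: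
  fixes t h T :: real
  shows "{(x::int,y::int). P x y \<and> of_int (x\<^sup>2 + y\<^sup>2) \<le> T \<and> \<bar>of_int y - t * of_int x\<bar> \<le> h}
    \<subseteq> (SIGMA x:{x::int. - sqrt T \<le> of_int x \<and> of_int x \<le> sqrt T}.
         {y::int. t * of_int x - h \<le> of_int y \<and> of_int y \<le> t * of_int x + h \<and> P x y})"
proof
  fix z assume "z \<in> {(x::int,y::int). P x y \<and> of_int (x\<^sup>2 + y\<^sup>2) \<le> T \<and> \<bar>of_int y - t * of_int x\<bar> \<le> h}"
  then obtain x y where a: "z = (x,y)" "P x y" "of_int (x\<^sup>2 + y\<^sup>2) \<le> T" "\<bar>of_int y - t * of_int x\<bar> \<le> h"
    by auto
  have "(of_int x)\<^sup>2 \<le> T" using a(3) by (auto intro: order_trans[rotated])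
  then have "\<bar>real_of_int x\<bar> \<le> sqrt T" using real_le_rsqrt[of "\<bar>real_of_int x\<bar>" T] by simp
  then have "- sqrt T \<le> of_int x" "of_int x \<le> sqrt T" "t * of_int x - h \<le> of_int y" "of_int y \<le> t * of_int x + h"
    using a(4) by linarith+
  then show "z \<in> (SIGMA x:{x::int. - sqrt T \<le> of_int x \<and> of_int x \<le> sqrt T}.
         {y::int. t * of_int x - h \<le> of_int y \<and> of_int y \<le> t * of_int x + h \<and> P x y})"
    using a by simp
qed

lemma strip_card_le:
  fixes t h T :: real
  assumes T: "T \<ge> 0" and h: "h \<ge> 0"
    and c: "\<And>x. - sqrt T \<le> real_of_int x \<Longrightarrow> real_of_int x \<le> sqrt T \<Longrightarrow>
      real (card {y::int. t * of_int x - h \<le> of_int y \<and> of_int y \<le> t * of_int x + h \<and> P x y}) \<le> M"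
  shows "finite {(x::int,y::int). P x y \<and> of_int (x\<^sup>2 + y\<^sup>2) \<le> T \<and> \<bar>of_int y - t * of_int x\<bar> \<le> h}"
    "real (card {(x::int,y::int). P x y \<and> of_int (x\<^sup>2 + y\<^sup>2) \<le> T \<and> \<bar>of_int y - t * of_int x\<bar> \<le> h}) \<le> (2 * sqrt T + 1) * M"
proof -
  let ?X = "{x::int. - sqrt T \<le> of_int x \<and> of_int x \<le> sqrt T}"
  let ?Y = "\<lambda>x. {y::int. t * of_int x - h \<le> of_int y \<and> of_int y \<le> t * of_int x + h \<and> P x y}"
  have sT: "- sqrt T \<le> sqrt T" using T real_sqrt_ge_zero[OF T] by linarith
  have finX: "finite ?X" by (rule card_int_real_interval(1)[OF sT])
  have finY: "finite (?Y x)" for x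
  proof (rule finite_subset[OF _ card_int_real_interval(1)])
    show "?Y x \<subseteq> {y. t * of_int x - h \<le> of_int y \<and> of_int y \<le> t * of_int x + h}" by auto
    show "t * of_int x - h \<le> t * of_int x + h" using h by simp
  qed
  have finS: "finite (SIGMA x:?X. ?Y x)" using finX finY by (intro finite_SigmaI) auto
  show "finite {(x::int,y::int). P x y \<and> of_int (x\<^sup>2 + y\<^sup>2) \<le> T \<and> \<bar>of_int y - t * of_int x\<bar> \<le> h}"
    by (rule finite_subset[OF strip_subset_Sigma finS])
  have "card {(x::int,y::int). P x y \<and> of_int (x\<^sup>2 + y\<^sup>2) \<le> T \<and> \<bar>of_int y - t * of_int x\<bar> \<le> h} \<le> card (SIGMA x:?X. ?Y x)"
    by (rule card_mono[OF finS strip_subset_Sigma])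
  also have "\<dots> = (\<Sum>x\<in>?X. card (?Y x))" using finX finY by (intro card_SigmaI) auto
  finally have "real (card {(x::int,y::int). P x y \<and> of_int (x\<^sup>2 + y\<^sup>2) \<le> T \<and> \<bar>of_int y - t * of_int x\<bar> \<le> h})
      \<le> (\<Sum>x\<in>?X. real (card (?Y x)))" by (simp only: of_nat_le_iff flip: of_nat_sum)
  also have "\<dots> \<le> (\<Sum>x\<in>?X. M)" by (intro sum_mono c) auto
  also have "\<dots> = real (card ?X) * M" by simp
  also have "\<dots> \<le> (2 * sqrt T + 1) * M"
  proof (rule mult_right_mono)
    show "real (card ?X) \<le> 2 * sqrt T + 1" using card_int_real_interval_le[OF sT] by simp
    have "0 \<le> real (card (?Y 0))" by simp
    also have "\<dots> \<le> M" by (rule c) (use T in auto)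
    finally show "0 \<le> M" .
  qed
  finally show "real (card {(x::int,y::int). P x y \<and> of_int (x\<^sup>2 + y\<^sup>2) \<le> T \<and> \<bar>of_int y - t * of_int x\<bar> \<le> h}) \<le> (2 * sqrt T + 1) * M" .
qed

lemma strip_card_trivial:
  fixes t h T :: real
  assumes T: "T \<ge> 0" and h: "h \<ge> 0"
  shows "finite {(x::int,y::int). P x y \<and> of_int (x\<^sup>2 + y\<^sup>2) \<le> T \<and> \<bar>of_int y - t * of_int x\<bar> \<le> h}"
    "real (card {(x::int,y::int). P x y \<and> of_int (x\<^sup>2 + y\<^sup>2) \<le> T \<and> \<bar>of_int y - t * of_int x\<bar> \<le> h}) \<le> (2 * sqrt T + 1) * (2 * h + 1)"
proof -
  have *: "real (card {y::int. t * of_int x - h \<le> of_int y \<and> of_int y \<le> t * of_int x + h \<and> P x y}) \<le> 2 * h + 1" for x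
  proof -
    have i: "t * of_int x - h \<le> t * of_int x + h" using h by simp
    have "card {y::int. t * of_int x - h \<le> of_int y \<and> of_int y \<le> t * of_int x + h \<and> P x y}
        \<le> card {y::int. t * of_int x - h \<le> of_int y \<and> of_int y \<le> t * of_int x + h}"
      by (rule card_mono[OF card_int_real_interval(1)[OF i]]) auto
    then show ?thesis using card_int_real_interval_le[OF i] by simp
  qed
  show "finite {(x::int,y::int). P x y \<and> of_int (x\<^sup>2 + y\<^sup>2) \<le> T \<and> \<bar>of_int y - t * of_int x\<bar> \<le> h}"
    "real (card {(x::int,y::int). P x y \<and> of_int (x\<^sup>2 + y\<^sup>2) \<le> T \<and> \<bar>of_int y - t * of_int x\<bar> \<le> h}) \<le> (2 * sqrt T + 1) * (2 * h + 1)"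
    using strip_card_le[OF T h, of t P "2 * h + 1"] * by auto
qed

text \<open>If log T <= (log L)^3, the trivial count of lattice points is good enough, as log T is
  absorbed by the power of log L. Otherwise each vertical fibre is sieved, and L^D <= T^(1/10) gives
  h >= T^(4/10), which dominates the fibre error T^(12/100) log T. The lower bound on T ensures h >=
  1, so that fibres of length 2h + 1 are bounded by 3h.\<close>

lemma strip_prime_count:
  fixes D :: real
  assumes D: "D \<ge> 1"
  obtains C l0 where "C > 0" "\<And>L T t h. L > 0 \<Longrightarrow> ln L \<ge> l0 \<Longrightarrow> L powr (2 * D + 2) \<le> T \<Longrightarrow> ln T \<le> L \<Longrightarrow> L powr (-D) * sqrt T \<le> h \<Longrightarrow>
     real (card {(x::int,y::int). prime (nat (x\<^sup>2 + y\<^sup>2)) \<and> of_int (x\<^sup>2 + y\<^sup>2) \<le> T \<and> \<bar>of_int y - t * of_int x\<bar> \<le> h}) * ln T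
       \<le> C * (h * sqrt T * (ln L) ^ 3)"
proof -
  obtain C where C: "C > 0" "\<And>L T x a b. ln L \<ge> 100 \<Longrightarrow> (ln L) ^ 3 \<le> ln T \<Longrightarrow> ln T \<le> L \<Longrightarrow> T > 0 \<Longrightarrow> x \<noteq> 0 \<Longrightarrow>
     \<bar>real_of_int x\<bar> \<le> sqrt T \<Longrightarrow> a \<le> b \<Longrightarrow>
     real (card {y::int. a \<le> of_int y \<and> of_int y \<le> b \<and> prime (nat (x\<^sup>2 + y\<^sup>2))})
       \<le> (b - a) * (C * (ln L)\<^sup>2 / ln T) + 2 * exp (ln T * (12/100))"
    using prime_fiber_count by blast
  define l0 where "l0 = 100 + 10 * D"
  have "real (card {(x::int,y::int). prime (nat (x\<^sup>2 + y\<^sup>2)) \<and> of_int (x\<^sup>2 + y\<^sup>2) \<le> T \<and> \<bar>of_int y - t * of_int x\<bar> \<le> h}) * ln T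
       \<le> (6 * C + 15) * (h * sqrt T * (ln L) ^ 3)"
    if Lpos: "L > 0" and L0: "ln L \<ge> l0" and T: "L powr (2 * D + 2) \<le> T" "ln T \<le> L" and h: "L powr (-D) * sqrt T \<le> h" for L T t h
  proof -
    define l where "l = ln L"
    have l: "l \<ge> 100" "l \<ge> 10 * D" using L0 D by (auto simp: l_def l0_def)
    have eL: "L = exp l" using Lpos by (simp add: l_def)
    have powL: "L powr a = exp (a * l)" for a using Lpos by (simp add: powr_def l_def)
    have T0: "T > 0" using T(1) unfolding powL using exp_gt_zero less_le_trans by blast
    have lT: "ln T \<ge> (2 * D + 2) * l" using T(1) T0 unfolding powL by (simp add: ln_ge_iff)
    have sT: "sqrt T = exp (ln T / 2)" using T0 by (simp add: powr_half_sqrt[symmetric] powr_def)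
    have lT1: "ln T \<ge> 100"
    proof -
      have "100 \<le> l" by (rule l)
      also have "l * 1 \<le> l * (2 * D + 2)" using l D by (intro mult_left_mono) auto
      finally show ?thesis using lT by (simp add: mult.commute)
    qed
    have sT1: "sqrt T \<ge> 1" unfolding sT using lT1 by simp
    have h': "h \<ge> exp (ln T / 2 - D * l)" using h unfolding powL sT by (simp flip: exp_add)
    have "ln T / 2 - D * l \<ge> 0"
    proof -
      have "(2 * D + 2) * l \<ge> 2 * (D * l)" using l by (simp add: algebra_simps)
      then show ?thesis using lT by linarith
    qed
    then have h1: "h \<ge> 1" using h' one_le_exp_iff order_trans by blast
    let ?Z = "{(x::int,y::int). prime (nat (x\<^sup>2 + y\<^sup>2)) \<and> of_int (x\<^sup>2 + y\<^sup>2) \<le> T \<and> \<bar>of_int y - t * of_int x\<bar> \<le> h}"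
    show ?thesis
    proof (cases "ln T \<le> l ^ 3")
      case True
      have "real (card ?Z) \<le> (2 * sqrt T + 1) * (2 * h + 1)"
        by (rule strip_card_trivial(2)) (use T0 h1 in auto)
      also have "\<dots> \<le> (3 * sqrt T) * (3 * h)" using sT1 h1 by (intro mult_mono) auto
      finally have "real (card ?Z) * ln T \<le> ((3 * sqrt T) * (3 * h)) * l ^ 3"
        using True lT1 by (intro mult_mono) auto
      also have "\<dots> = 9 * (h * sqrt T * l ^ 3)" by simp
      also have "\<dots> \<le> (6 * C + 15) * (h * sqrt T * l ^ 3)"
        using C(1) h1 sT1 l by (intro mult_right_mono) auto
      finally show ?thesis by (simp add: l_def)
    next
      case False
      have big: "exp (ln T * (12/100)) * ln T \<le> h"
      proof -
        have "D * l \<le> ln T / 10"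
        proof -
          have "10 * D * l \<le> l * l" using l by (intro mult_right_mono) auto
          also have "\<dots> * 1 \<le> l * l * l" using l by (intro mult_left_mono) auto
          also have "\<dots> = l ^ 3" by (simp add: power3_eq_cube)
          finally show ?thesis using False by simp
        qed
        then have "exp (ln T * (4/10)) \<le> exp (ln T / 2 - D * l)" by simp
        then have e4: "exp (ln T * (4/10)) \<le> h" using h' by linarith
        have "ln T \<le> exp (ln T * (28/100))"
        proof -
          define v where "v = ln T * (28/100)"
          have v: "v \<ge> 28" using lT1 by (simp add: v_def)
          then have "1 + v + v\<^sup>2 / 2 \<le> exp v" by (intro exp_lower_Taylor_quadratic) auto
          moreover have "28 * v \<le> v\<^sup>2" using v by (simp add: power2_eq_square)
          moreover have "ln T = v * (100/28)" by (simp add: v_def)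
          ultimately show ?thesis unfolding v_def[symmetric] using v by linarith
        qed
        then have "exp (ln T * (12/100)) * ln T \<le> exp (ln T * (12/100)) * exp (ln T * (28/100))"
          by (intro mult_left_mono) auto
        also have "\<dots> = exp (ln T * (4/10))" by (simp add: algebra_simps flip: exp_add)
        finally show ?thesis using e4 by linarith
      qed
      define M where "M = 2 * h * (C * l\<^sup>2 / ln T) + 2 * exp (ln T * (12/100))"
      have "real (card ?Z) \<le> (2 * sqrt T + 1) * M"
      proof (rule strip_card_le(2))
        fix x :: int assume x: "- sqrt T \<le> of_int x" "of_int x \<le> sqrt T"
        show "real (card {y::int. t * of_int x - h \<le> of_int y \<and> of_int y \<le> t * of_int x + h \<and> prime (nat (x\<^sup>2 + y\<^sup>2))}) \<le> M"
        \<comment> \<open>The sieve bound for fibres requires a nonzero x; on the axis the norm is a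
          perfect square and never prime.\<close>
        proof (cases "x = 0")
          case True
          have "\<not> prime (nat (y\<^sup>2))" for y :: int
            by (simp add: nat_power_eq[of "\<bar>y\<bar>" 2, simplified] prime_power_iff)
          then have "real (card {y::int. t * of_int x - h \<le> of_int y \<and> of_int y \<le> t * of_int x + h \<and> prime (nat (x\<^sup>2 + y\<^sup>2))}) = 0"
            using True by simp
          also have "\<dots> \<le> M" unfolding M_def using h1 C(1) lT1 by (intro add_nonneg_nonneg mult_nonneg_nonneg divide_nonneg_nonneg) auto
          finally show ?thesis .
        next
          case False2: False
          have "real (card {y::int. t * of_int x - h \<le> of_int y \<and> of_int y \<le> t * of_int x + h \<and> prime (nat (x\<^sup>2 + y\<^sup>2))})
            \<le> ((t * of_int x + h) - (t * of_int x - h)) * (C * (ln L)\<^sup>2 / ln T) + 2 * exp (ln T * (12/100))"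
            by (rule C(2)) (use l False False2 x T T0 h1 in \<open>auto simp: l_def[symmetric] abs_le_iff\<close>)
          then show ?thesis by (simp add: M_def l_def)
        qed
      qed (use T0 h1 in auto)
      also have "\<dots> \<le> (3 * sqrt T) * M"
        using sT1 h1 C(1) lT1 by (intro mult_right_mono) (auto simp: M_def intro!: add_nonneg_nonneg)
      finally have "real (card ?Z) * ln T \<le> (3 * sqrt T) * M * ln T" using lT1 by (intro mult_right_mono) auto
      also have "\<dots> = 3 * sqrt T * (2 * h * (C * l\<^sup>2) + 2 * (exp (ln T * (12/100)) * ln T))"
        using lT1 by (simp add: M_def field_simps)
      also have "\<dots> \<le> 3 * sqrt T * (2 * h * (C * l ^ 3) + 2 * (h * l ^ 3))"
      proof (intro mult_left_mono add_mono)
        show "l\<^sup>2 \<le> l ^ 3" using l by (intro power_increasing) auto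
        have "h * 1 \<le> h * l ^ 3" using h1 l by (intro mult_left_mono one_le_power) auto
        then show "exp (ln T * (12/100)) * ln T \<le> h * l ^ 3" using big by linarith
      qed (use h1 C(1) sT1 in auto)
      also have "\<dots> = (6 * C + 6) * (h * sqrt T * l ^ 3)" by (simp add: algebra_simps)
      also have "\<dots> \<le> (6 * C + 15) * (h * sqrt T * l ^ 3)"
        using C(1) h1 sT1 l by (intro mult_right_mono) auto
      finally show ?thesis by (simp add: l_def)
    qed
  qed
  moreover have "6 * C + 15 > 0" using C(1) by simp
  ultimately show ?thesis using that by blast
qed


section \<open>Gaussian primes in arcs\<close>

definition gnorm :: "complex \<Rightarrow> nat" where
  "gnorm z = nat \<lfloor>(cmod z)\<^sup>2\<rfloor>"

lemma gnorm_circ: "z \<in> circ m \<Longrightarrow> gnorm z = m"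
  by (simp add: gnorm_def circ_def)

lemma circ_gnorm: "z \<in> gint \<Longrightarrow> z \<in> circ (gnorm z)"
  using gint_in_circ gnorm_circ by metis

lemma gnorm_Complex: "gnorm (Complex (of_int x) (of_int y)) = nat (x\<^sup>2 + y\<^sup>2)"
  by (rule gnorm_circ) (simp add: circ_Complex_iff)

text \<open>The inequality is unchanged when \<pi> is multiplied by a positive real number, so for
  given A and B it restricts only the direction of \<pi>. Prime norm singles out the Gaussian primes
  that are not associated to a rational prime.\<close>

definition gprime_arc :: "complex \<Rightarrow> complex \<Rightarrow> real \<Rightarrow> complex set" where
  "gprime_arc A B \<theta> = {\<pi> \<in> gint. prime (gnorm \<pi>) \<and> cmod (\<pi> * A + cnj \<pi> * B) \<le> \<theta> * cmod \<pi> * cmod B}"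

lemma arc_gnorm_pos: "\<pi> \<in> gprime_arc A B \<theta> \<Longrightarrow> gnorm \<pi> > 0"
  by (auto simp: gprime_arc_def prime_gt_0_nat)

lemma abs_ge_half_of_sq:
  fixes c :: real
  assumes "c\<^sup>2 \<ge> 1/2"
  shows "\<bar>c\<bar> \<ge> 1/2"
proof (rule ccontr)
  assume "\<not> \<bar>c\<bar> \<ge> 1/2"
  then have "\<bar>c\<bar>\<^sup>2 \<le> (1/2)\<^sup>2" by (intro power_mono) auto
  then show False using assms by (simp add: power2_eq_square)
qed

lemma strip_slope:
  fixes c s x y \<theta> R :: real
  assumes "\<bar>c\<bar> \<ge> 1/2" "\<bar>s * x - c * y\<bar> \<le> R" 
  shows "\<bar>y - s / c * x\<bar> \<le> 2 * R"
proof -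
  have c: "c \<noteq> 0" using assms(1) by auto
  have "c * (y - s / c * x) = - (s * x - c * y)" using c by (simp add: field_simps)
  then have 1: "\<bar>c\<bar> * \<bar>y - s / c * x\<bar> \<le> R" using assms(2) by (metis abs_minus_cancel abs_mult)
  define u where "u = \<bar>y - s / c * x\<bar>"
  have "1/2 * u \<le> \<bar>c\<bar> * u" using assms(1) by (intro mult_right_mono) (auto simp: u_def)
  then show ?thesis using 1 unfolding u_def[symmetric] by linarith
qed

text \<open>The strip s x - c y of small absolute value has c^2 + s^2 = 1, so one of |c|, |s| is at
  least 1/2 and the strip can be solved for y or for x, at the cost of a factor 2 in the width. In
  the second case the coordinates are interchanged; the norm is symmetric.\<close>

lemma arc_card_le_strip:
  assumes B: "B \<noteq> 0" and \<theta>: "\<theta> < 1" "\<theta> \<ge> 0"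
  obtains t where "\<And>T. T \<ge> 0 \<Longrightarrow> finite {\<pi> \<in> gprime_arc A B \<theta>. real (gnorm \<pi>) \<le> T} \<and>
    card {\<pi> \<in> gprime_arc A B \<theta>. real (gnorm \<pi>) \<le> T} \<le>
      card {(x::int,y::int). prime (nat (x\<^sup>2 + y\<^sup>2)) \<and> of_int (x\<^sup>2 + y\<^sup>2) \<le> T \<and> \<bar>of_int y - t * of_int x\<bar> \<le> 2 * (\<theta> * sqrt T)}"
proof -
  obtain c s where cs: "c\<^sup>2 + s\<^sup>2 = 1"
    "\<And>z. cmod (z * A + cnj z * B) \<le> \<theta> * cmod z * cmod B \<Longrightarrow> \<bar>s * Re z - c * Im z\<bar> \<le> \<theta> * cmod z"
    using arc_in_strip[OF B \<theta>(1)] by blast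
  let ?S = "\<lambda>t T. {(x::int,y::int). prime (nat (x\<^sup>2 + y\<^sup>2)) \<and> of_int (x\<^sup>2 + y\<^sup>2) \<le> T \<and> \<bar>of_int y - t * of_int x\<bar> \<le> 2 * (\<theta> * sqrt T)}"
  have main: "\<exists>x y :: int. \<pi> = Complex (of_int x) (of_int y) \<and> prime (nat (x\<^sup>2 + y\<^sup>2)) \<and> of_int (x\<^sup>2 + y\<^sup>2) \<le> T \<and> \<bar>s * of_int x - c * of_int y\<bar> \<le> \<theta> * sqrt T"
    if "\<pi> \<in> gprime_arc A B \<theta>" "real (gnorm \<pi>) \<le> T" for \<pi> T
  proof -
    have g: "\<pi> \<in> gint" using that by (simp add: gprime_arc_def)
    then obtain x y :: int where xy: "\<pi> = Complex (of_int x) (of_int y)" by (rule gintE)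
    have gn: "gnorm \<pi> = nat (x\<^sup>2 + y\<^sup>2)" unfolding xy by (rule gnorm_Complex)
    have "prime (nat (x\<^sup>2 + y\<^sup>2))" using that(1) gn by (simp add: gprime_arc_def)
    moreover have "real_of_int (x\<^sup>2 + y\<^sup>2) \<le> T"
    proof -
      have "real (nat (x\<^sup>2 + y\<^sup>2)) = real_of_int (x\<^sup>2 + y\<^sup>2)" by (rule of_nat_nat) simp
      then show ?thesis using that(2) gn by simp
    qed
    moreover have "\<bar>s * of_int x - c * of_int y\<bar> \<le> \<theta> * sqrt T"
    proof -
      have "\<bar>s * Re \<pi> - c * Im \<pi>\<bar> \<le> \<theta> * cmod \<pi>" using cs(2) that(1) by (simp add: gprime_arc_def)
      also have "\<dots> \<le> \<theta> * sqrt T"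
        using circ_cmod[OF circ_gnorm[OF g]] that(2) \<theta> by (intro mult_left_mono) auto
      finally show ?thesis by (simp add: xy)
    qed
    ultimately show ?thesis using xy by blast
  qed
  consider "\<bar>c\<bar> \<ge> 1/2" | "\<bar>s\<bar> \<ge> 1/2"
    using cs(1) abs_ge_half_of_sq[of c] abs_ge_half_of_sq[of s] by linarith
  then show ?thesis
  proof cases
    case 1
    show ?thesis
    proof (rule that[of "s / c"])
      fix T :: real assume T: "T \<ge> 0"
      have fin: "finite (?S (s / c) T)" by (rule strip_card_trivial(1)) (use T \<theta> in auto)
      have sub: "{\<pi> \<in> gprime_arc A B \<theta>. real (gnorm \<pi>) \<le> T} \<subseteq> (\<lambda>(x,y). Complex (of_int x) (of_int y)) ` ?S (s / c) T"
      proof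
        fix \<pi> assume "\<pi> \<in> {\<pi> \<in> gprime_arc A B \<theta>. real (gnorm \<pi>) \<le> T}"
        then obtain x y :: int where xy: "\<pi> = Complex (of_int x) (of_int y)" "prime (nat (x\<^sup>2 + y\<^sup>2))"
          "of_int (x\<^sup>2 + y\<^sup>2) \<le> T" "\<bar>s * of_int x - c * of_int y\<bar> \<le> \<theta> * sqrt T" using main by blast
        have "(x,y) \<in> ?S (s / c) T" using xy(2,3) strip_slope[OF 1 xy(4)] by blast
        then show "\<pi> \<in> (\<lambda>(x,y). Complex (of_int x) (of_int y)) ` ?S (s / c) T"
          using xy(1) by (intro image_eqI[of _ _ "(x,y)"]) auto
      qed
      then show "finite {\<pi> \<in> gprime_arc A B \<theta>. real (gnorm \<pi>) \<le> T} \<and>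
        card {\<pi> \<in> gprime_arc A B \<theta>. real (gnorm \<pi>) \<le> T} \<le> card (?S (s / c) T)"
        using fin by (meson finite_imageI finite_subset surj_card_le)
    qed
  next
    case 2
    show ?thesis
    proof (rule that[of "c / s"])
      fix T :: real assume T: "T \<ge> 0"
      have fin: "finite (?S (c / s) T)" by (rule strip_card_trivial(1)) (use T \<theta> in auto)
      have sub: "{\<pi> \<in> gprime_arc A B \<theta>. real (gnorm \<pi>) \<le> T} \<subseteq> (\<lambda>(x,y). Complex (of_int y) (of_int x)) ` ?S (c / s) T"
      proof
        fix \<pi> assume "\<pi> \<in> {\<pi> \<in> gprime_arc A B \<theta>. real (gnorm \<pi>) \<le> T}"
        then obtain y x :: int where xy: "\<pi> = Complex (of_int y) (of_int x)" "prime (nat (y\<^sup>2 + x\<^sup>2))"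
          "of_int (y\<^sup>2 + x\<^sup>2) \<le> T" "\<bar>s * of_int y - c * of_int x\<bar> \<le> \<theta> * sqrt T" using main by blast
        have 4: "\<bar>c * of_int x - s * of_int y\<bar> \<le> \<theta> * sqrt T" using xy(4) by linarith
        have "prime (nat (x\<^sup>2 + y\<^sup>2))" "real_of_int (x\<^sup>2 + y\<^sup>2) \<le> T" using xy(2,3) by (simp_all only: add.commute[of "y\<^sup>2"])
        then have "(x,y) \<in> ?S (c / s) T" using strip_slope[OF 2 4] by blast
        then show "\<pi> \<in> (\<lambda>(x,y). Complex (of_int y) (of_int x)) ` ?S (c / s) T"
          using xy(1) by (intro image_eqI[of _ _ "(x,y)"]) auto
      qed
      then show "finite {\<pi> \<in> gprime_arc A B \<theta>. real (gnorm \<pi>) \<le> T} \<and>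
        card {\<pi> \<in> gprime_arc A B \<theta>. real (gnorm \<pi>) \<le> T} \<le> card (?S (c / s) T)"
        using fin by (meson finite_imageI finite_subset surj_card_le)
    qed
  qed
qed

lemma finite_arc_le:
  assumes "B \<noteq> 0" "\<theta> < 1" "\<theta> \<ge> 0"
  shows "finite {\<pi> \<in> gprime_arc A B \<theta>. P \<pi> \<and> real (gnorm \<pi>) \<le> T}"
proof (cases "T \<ge> 0")
  case True
  have "finite {\<pi> \<in> gprime_arc A B \<theta>. real (gnorm \<pi>) \<le> T}"
    using arc_card_le_strip[OF assms, of A] True by blast
  then show ?thesis by (rule finite_subset[rotated]) auto
next
  case False
  have "\<not> real (gnorm \<pi>) \<le> T" for \<pi> using False of_nat_0_le_iff[of "gnorm \<pi>", where ?'a = real] by linarith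
  then show ?thesis by simp
qed

lemma arc_count:
  fixes D :: real
  assumes D: "D \<ge> 1"
  obtains C l0 where "C > 0" "\<And>L T A B \<theta>. L > 0 \<Longrightarrow> ln L \<ge> l0 \<Longrightarrow> L powr (2 * D + 2) \<le> T \<Longrightarrow> ln T \<le> L \<Longrightarrow>
     L powr (-D) \<le> \<theta> \<Longrightarrow> \<theta> < 1 \<Longrightarrow> B \<noteq> 0 \<Longrightarrow>
     real (card {\<pi> \<in> gprime_arc A B \<theta>. real (gnorm \<pi>) \<le> T}) * ln T \<le> C * (\<theta> * T * (ln L) ^ 3)"
proof -
  obtain C l0 where C: "C > 0" "\<And>L T t h. L > 0 \<Longrightarrow> ln L \<ge> l0 \<Longrightarrow> L powr (2 * D + 2) \<le> T \<Longrightarrow> ln T \<le> L \<Longrightarrow> L powr (-D) * sqrt T \<le> h \<Longrightarrow>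
     real (card {(x::int,y::int). prime (nat (x\<^sup>2 + y\<^sup>2)) \<and> of_int (x\<^sup>2 + y\<^sup>2) \<le> T \<and> \<bar>of_int y - t * of_int x\<bar> \<le> h}) * ln T
       \<le> C * (h * sqrt T * (ln L) ^ 3)"
    using strip_prime_count[OF D] by blast
  have "real (card {\<pi> \<in> gprime_arc A B \<theta>. real (gnorm \<pi>) \<le> T}) * ln T \<le> (2 * C) * (\<theta> * T * (ln L) ^ 3)"
    if L: "L > 0" "ln L \<ge> max l0 0" and T: "L powr (2 * D + 2) \<le> T" "ln T \<le> L" and \<theta>: "L powr (-D) \<le> \<theta>" "\<theta> < 1" and B: "B \<noteq> 0"
    for L T A B \<theta>
  proof -
    have T0: "T > 0" using T(1) L(1) less_le_trans[of 0 "L powr (2 * D + 2)" T] by simp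
    have \<theta>0: "\<theta> \<ge> 0" using \<theta>(1) powr_ge_zero[of L "-D"] by linarith
    have L1: "L \<ge> 1" using L by (simp add: ln_ge_zero_iff)
    have "1 \<le> L powr (2 * D + 2)" using L1 D by (intro ge_one_powr_ge_zero) auto
    then have T1: "T \<ge> 1" using T(1) by linarith
    obtain t where t: "card {\<pi> \<in> gprime_arc A B \<theta>. real (gnorm \<pi>) \<le> T} \<le>
      card {(x::int,y::int). prime (nat (x\<^sup>2 + y\<^sup>2)) \<and> of_int (x\<^sup>2 + y\<^sup>2) \<le> T \<and> \<bar>of_int y - t * of_int x\<bar> \<le> 2 * (\<theta> * sqrt T)}"
      using arc_card_le_strip[OF B \<theta>(2) \<theta>0, of A] less_imp_le[OF T0] by blast
    have "real (card {\<pi> \<in> gprime_arc A B \<theta>. real (gnorm \<pi>) \<le> T}) * ln T \<le>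
      real (card {(x::int,y::int). prime (nat (x\<^sup>2 + y\<^sup>2)) \<and> of_int (x\<^sup>2 + y\<^sup>2) \<le> T \<and> \<bar>of_int y - t * of_int x\<bar> \<le> 2 * (\<theta> * sqrt T)}) * ln T"
      using t T1 by (intro mult_right_mono) auto
    also have "\<dots> \<le> C * (2 * (\<theta> * sqrt T) * sqrt T * (ln L) ^ 3)"
    proof (rule C(2))
      have "L powr (-D) * sqrt T \<le> \<theta> * sqrt T" using \<theta>(1) T0 by (intro mult_right_mono) auto
      also have "\<dots> \<le> 2 * (\<theta> * sqrt T)" using \<theta>0 T0 by simp
      finally show "L powr (-D) * sqrt T \<le> 2 * (\<theta> * sqrt T)" .
    qed (use L T in auto)
    also have "\<dots> = (2 * C) * (\<theta> * (sqrt T * sqrt T) * (ln L) ^ 3)" by (simp only: mult_ac)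
    finally show ?thesis using T0 by simp
  qed
  then show ?thesis using that[of "2 * C" "max l0 0"] C(1) by simp
qed

text \<open>Lattice points of the strip are counted. The term of size sqrt T remains even for very
  narrow strips; after partial summation it is the source of the saving 1 / sqrt W.\<close>

lemma arc_count_trivial:
  assumes T: "T \<ge> 1" and B: "B \<noteq> 0" and \<theta>: "\<theta> < 1" "\<theta> \<ge> 0"
  shows "real (card {\<pi> \<in> gprime_arc A B \<theta>. real (gnorm \<pi>) \<le> T}) \<le> 12 * \<theta> * T + 3 * sqrt T"
proof -
  obtain t where t: "card {\<pi> \<in> gprime_arc A B \<theta>. real (gnorm \<pi>) \<le> T} \<le>
      card {(x::int,y::int). prime (nat (x\<^sup>2 + y\<^sup>2)) \<and> of_int (x\<^sup>2 + y\<^sup>2) \<le> T \<and> \<bar>of_int y - t * of_int x\<bar> \<le> 2 * (\<theta> * sqrt T)}"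
    using arc_card_le_strip[OF B \<theta>, of A] order_trans[OF zero_le_one T] by blast
  have sT: "sqrt T \<ge> 1" using T by simp
  have "real (card {\<pi> \<in> gprime_arc A B \<theta>. real (gnorm \<pi>) \<le> T}) \<le> (2 * sqrt T + 1) * (2 * (2 * (\<theta> * sqrt T)) + 1)"
    using t strip_card_trivial(2)[of T "2 * (\<theta> * sqrt T)" "\<lambda>x y. prime (nat (x\<^sup>2 + y\<^sup>2))" t] T \<theta> by simp
  also have "\<dots> \<le> (3 * sqrt T) * (4 * \<theta> * sqrt T + 1)" using sT \<theta> by (intro mult_mono) auto
  also have "\<dots> = 12 * \<theta> * (sqrt T * sqrt T) + 3 * sqrt T" by (simp add: algebra_simps)
  finally show ?thesis using T by simp
qed

text \<open>Bins between consecutive powers of e: in the bin starting at exp j every reciprocal is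
  at most exp(-j), and \<open>exp 1\<close> is the ratio of the endpoints of a bin.\<close>

lemma sum_recip_bins:
  fixes f :: "'a \<Rightarrow> nat" and a :: "nat \<Rightarrow> real"
  assumes fin: "finite X" and W: "W \<ge> 1" and f: "\<And>x. x \<in> X \<Longrightarrow> W \<le> real (f x) \<and> real (f x) \<le> Z"
    and a: "\<And>j. j \<in> {nat \<lfloor>ln W\<rfloor>..nat \<lfloor>ln Z\<rfloor>} \<Longrightarrow> real (card {x\<in>X. real (f x) \<le> exp (real j + 1)}) \<le> a j * exp (real j + 1)"
  shows "(\<Sum>x\<in>X. 1 / real (f x)) \<le> exp 1 * (\<Sum>j\<in>{nat \<lfloor>ln W\<rfloor>..nat \<lfloor>ln Z\<rfloor>}. a j)"
proof -
  define g where "g x = nat \<lfloor>ln (real (f x))\<rfloor>" for x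
  let ?J = "{nat \<lfloor>ln W\<rfloor>..nat \<lfloor>ln Z\<rfloor>}"
  have g: "g x \<in> ?J" "exp (real (g x)) \<le> real (f x)" "real (f x) \<le> exp (real (g x) + 1)" if "x \<in> X" for x
  proof -
    have fx: "1 \<le> real (f x)" "W \<le> real (f x)" "real (f x) \<le> Z" using f[OF that] W by auto
    have "ln W \<le> ln (real (f x))" "ln (real (f x)) \<le> ln Z" using fx W by auto
    then show "g x \<in> ?J" unfolding g_def by (auto intro!: nat_mono floor_mono)
    have l: "0 \<le> ln (real (f x))" using fx by simp
    then have "real (g x) \<le> ln (real (f x))" "ln (real (f x)) \<le> real (g x) + 1" unfolding g_def by linarith+
    moreover have "exp (ln (real (f x))) = real (f x)" using fx by simp
    ultimately show "exp (real (g x)) \<le> real (f x)" "real (f x) \<le> exp (real (g x) + 1)"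
      by (metis exp_le_cancel_iff)+
  qed
  have "(\<Sum>x\<in>X. 1 / real (f x)) = (\<Sum>j\<in>?J. \<Sum>x\<in>{x. x \<in> X \<and> g x = j}. 1 / real (f x))"
    by (rule sum.group[symmetric]) (use fin g in auto)
  also have "\<dots> \<le> (\<Sum>j\<in>?J. exp 1 * a j)"
  proof (intro sum_mono)
    fix j assume j: "j \<in> ?J"
    have "(\<Sum>x\<in>{x. x \<in> X \<and> g x = j}. 1 / real (f x)) \<le> (\<Sum>x\<in>{x. x \<in> X \<and> g x = j}. 1 / exp (real j))"
    proof (intro sum_mono divide_left_mono)
      fix x assume x: "x \<in> {x. x \<in> X \<and> g x = j}"
      show "exp (real j) \<le> real (f x)" using g(2)[of x] x by auto
      then have "real (f x) > 0" using exp_gt_zero[of "real j"] by linarith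
      then show "0 < real (f x) * exp (real j)" by simp
    qed simp
    also have "\<dots> = real (card {x. x \<in> X \<and> g x = j}) / exp (real j)" by simp
    also have "\<dots> \<le> (a j * exp (real j + 1)) / exp (real j)"
    proof (rule divide_right_mono)
      have "card {x. x \<in> X \<and> g x = j} \<le> card {x\<in>X. real (f x) \<le> exp (real j + 1)}"
        using fin g(3) by (intro card_mono) auto
      then show "real (card {x. x \<in> X \<and> g x = j}) \<le> a j * exp (real j + 1)" using a[OF j] by linarith
    qed simp
    also have "\<dots> = exp 1 * a j" by (simp add: exp_add)
    finally show "(\<Sum>x\<in>{x. x \<in> X \<and> g x = j}. 1 / real (f x)) \<le> exp 1 * a j" .
  qed
  also have "\<dots> = exp 1 * (\<Sum>j\<in>?J. a j)" by (simp add: sum_distrib_left)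
  finally show ?thesis .
qed

lemma harm_le_ln:
  assumes "n \<ge> 1"
  shows "(\<Sum>j\<in>{1..n}. 1 / real j) \<le> 1 + ln (real n)"
  using assms
proof (induction n rule: nat_induct_at_least)
  case (Suc n)
  have "ln (real n / real (Suc n)) \<le> real n / real (Suc n) - 1" using Suc by (intro ln_le_minus_one) simp
  moreover have "ln (real n / real (Suc n)) = ln (real n) - ln (real (Suc n))" using Suc by (simp add: ln_div)
  moreover have "real n / real (Suc n) - 1 = - (1 / real (Suc n))" by (simp add: field_simps)
  ultimately have "1 / real (Suc n) \<le> ln (real (Suc n)) - ln (real n)" by linarith
  then show ?case using Suc by (simp del: of_nat_Suc)
qed simp

text \<open>The count in the bin j carries a factor 1/j from the density of primes. The harmonic sum
  over j <= L produces the fourth power of log L in place of the third.\<close>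

lemma arc_recip_sum:
  fixes D :: real
  assumes D: "D \<ge> 1"
  obtains C l0 where "C > 0" "\<And>L Z A B \<theta>. L > 0 \<Longrightarrow> ln L \<ge> l0 \<Longrightarrow> Z > 0 \<Longrightarrow> ln Z \<le> L \<Longrightarrow>
     L powr (-D) \<le> \<theta> \<Longrightarrow> \<theta> < 1 \<Longrightarrow> B \<noteq> 0 \<Longrightarrow>
     (\<Sum>\<pi>\<in>{\<pi> \<in> gprime_arc A B \<theta>. L powr (2 * D + 2) \<le> real (gnorm \<pi>) \<and> real (gnorm \<pi>) \<le> Z}. 1 / real (gnorm \<pi>))
      \<le> C * (\<theta> * (ln L) ^ 4)"
proof -
  obtain C l0 where C: "C > 0" "\<And>L T A B \<theta>. L > 0 \<Longrightarrow> ln L \<ge> l0 \<Longrightarrow> L powr (2 * D + 2) \<le> T \<Longrightarrow> ln T \<le> L \<Longrightarrow>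
     L powr (-D) \<le> \<theta> \<Longrightarrow> \<theta> < 1 \<Longrightarrow> B \<noteq> 0 \<Longrightarrow>
     real (card {\<pi> \<in> gprime_arc A B \<theta>. real (gnorm \<pi>) \<le> T}) * ln T \<le> C * (\<theta> * T * (ln L) ^ 3)"
    using arc_count[OF D] by blast
  have "(\<Sum>\<pi>\<in>{\<pi> \<in> gprime_arc A B \<theta>. L powr (2 * D + 2) \<le> real (gnorm \<pi>) \<and> real (gnorm \<pi>) \<le> Z}. 1 / real (gnorm \<pi>))
      \<le> (exp 1 * C * 2) * (\<theta> * (ln L) ^ 4)"
    if L: "L > 0" "ln L \<ge> max l0 1" and Z: "Z > 0" "ln Z \<le> L" and \<theta>: "L powr (-D) \<le> \<theta>" "\<theta> < 1" and B: "B \<noteq> 0"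
    for L Z A B \<theta>
  proof -
    define W where "W = L powr (2 * D + 2)"
    define X where "X = {\<pi> \<in> gprime_arc A B \<theta>. W \<le> real (gnorm \<pi>) \<and> real (gnorm \<pi>) \<le> Z}"
    define l where "l = ln L"
    have l1: "l \<ge> 1" using L by (simp add: l_def)
    have L1: "L \<ge> 1" using L by (simp add: ln_ge_zero_iff[symmetric] del: ln_ge_zero_iff)
    have \<theta>0: "\<theta> \<ge> 0" using \<theta>(1) powr_ge_zero[of L "-D"] by linarith
    have lW: "ln W = (2 * D + 2) * l" using L by (simp add: W_def l_def ln_powr)
    have lW1: "ln W \<ge> 1"
    proof -
      have "1 * 1 \<le> (2 * D + 2) * l" using D l1 by (intro mult_mono) auto
      then show ?thesis by (simp add: lW)
    qed
    have Wpos: "W > 0" using L by (simp add: W_def)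
    have W1: "W \<ge> 1" using lW1 Wpos by (simp add: ln_ge_zero_iff[symmetric] del: ln_ge_zero_iff)
    have finX: "finite X" unfolding X_def by (rule finite_arc_le[OF B \<theta>(2) \<theta>0])
    have "(\<Sum>\<pi>\<in>X. 1 / real (gnorm \<pi>)) \<le> exp 1 * (\<Sum>j\<in>{nat \<lfloor>ln W\<rfloor>..nat \<lfloor>ln Z\<rfloor>}. C * (\<theta> * l ^ 3) * (1 / real j))"
    proof (rule sum_recip_bins[OF finX W1])
      fix j assume j: "j \<in> {nat \<lfloor>ln W\<rfloor>..nat \<lfloor>ln Z\<rfloor>}"
      have j1: "j \<ge> 1" 
      proof -
        have "1 \<le> nat \<lfloor>ln W\<rfloor>" using lW1 by (simp add: le_nat_iff le_floor_iff)
        then show ?thesis using j by simp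
      qed
      show "real (card {\<pi>\<in>X. real (gnorm \<pi>) \<le> exp (real j + 1)}) \<le> C * (\<theta> * l ^ 3) * (1 / real j) * exp (real j + 1)"
      proof (cases "W \<le> Z")
        case False
        then have "X = {}" by (auto simp: X_def)
        then show ?thesis using C(1) \<theta>0 l1 by simp
      next
        case True
        \<comment> \<open>The last bin may extend beyond Z; cutting at Z preserves log T <=
          L.\<close>
        define T where "T = min (exp (real j + 1)) Z"
        have jZ: "real j \<le> ln Z" using j True W1 by (auto simp: le_nat_iff le_floor_iff)
        then have jT: "real j \<le> ln T" using Z by (auto simp: T_def min_def ln_ge_iff[symmetric])
        have T0: "T > 0" using Z by (simp add: T_def)
        have "ln T \<le> ln Z" using T0 Z by (subst ln_le_cancel_iff) (auto simp: T_def)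
        then have lT: "ln T \<le> L" using Z by linarith
        have WT: "W \<le> T"
        proof -
          have "nat \<lfloor>ln W\<rfloor> \<le> j" using j by simp
          then have "ln W \<le> real j + 1" using lW1 by linarith
          then have "exp (ln W) \<le> exp (real j + 1)" by simp
          then show ?thesis using True Wpos by (simp add: T_def)
        qed
        have "card {\<pi>\<in>X. real (gnorm \<pi>) \<le> exp (real j + 1)} \<le> card {\<pi> \<in> gprime_arc A B \<theta>. real (gnorm \<pi>) \<le> T}"
          using finite_arc_le[OF B \<theta>(2) \<theta>0, of A "\<lambda>_. True" T] by (intro card_mono) (auto simp: X_def T_def)
        then have "real (card {\<pi>\<in>X. real (gnorm \<pi>) \<le> exp (real j + 1)}) * real j
            \<le> real (card {\<pi> \<in> gprime_arc A B \<theta>. real (gnorm \<pi>) \<le> T}) * ln T"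
          using jT by (intro mult_mono) auto
        also have "\<dots> \<le> C * (\<theta> * T * (ln L) ^ 3)"
          by (rule C(2)) (use L WT lT \<theta> B in \<open>auto simp: W_def\<close>)
        also have "\<dots> \<le> C * (\<theta> * exp (real j + 1) * l ^ 3)"
          using C(1) \<theta>0 l1 unfolding l_def by (intro mult_left_mono mult_right_mono) (auto simp: T_def)
        finally show ?thesis using j1 by (simp add: field_simps)
      qed
    qed (auto simp: X_def)
    also have "(\<Sum>j\<in>{nat \<lfloor>ln W\<rfloor>..nat \<lfloor>ln Z\<rfloor>}. C * (\<theta> * l ^ 3) * (1 / real j)) =
       C * (\<theta> * l ^ 3) * (\<Sum>j\<in>{nat \<lfloor>ln W\<rfloor>..nat \<lfloor>ln Z\<rfloor>}. 1 / real j)" by (rule sum_distrib_left[symmetric])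
    also have "(\<Sum>j\<in>{nat \<lfloor>ln W\<rfloor>..nat \<lfloor>ln Z\<rfloor>}. 1 / real j) \<le> 2 * l"
    proof (cases "nat \<lfloor>ln Z\<rfloor> \<ge> 1")
      case True
      have "(\<Sum>j\<in>{nat \<lfloor>ln W\<rfloor>..nat \<lfloor>ln Z\<rfloor>}. 1 / real j) \<le> (\<Sum>j\<in>{1..nat \<lfloor>ln Z\<rfloor>}. 1 / real j)"
      proof (rule sum_mono2)
        have "1 \<le> nat \<lfloor>ln W\<rfloor>" using lW1 by (simp add: le_nat_iff le_floor_iff)
        then show "{nat \<lfloor>ln W\<rfloor>..nat \<lfloor>ln Z\<rfloor>} \<subseteq> {1..nat \<lfloor>ln Z\<rfloor>}" by auto
      qed auto
      also have "\<dots> \<le> 1 + ln (real (nat \<lfloor>ln Z\<rfloor>))" by (rule harm_le_ln[OF True])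
      also have "ln (real (nat \<lfloor>ln Z\<rfloor>)) \<le> l"
      proof -
        have "real (nat \<lfloor>ln Z\<rfloor>) \<le> L" using Z L by linarith
        moreover have "0 < real (nat \<lfloor>ln Z\<rfloor>)" using True by linarith
        ultimately show ?thesis unfolding l_def using L(1) ln_le_cancel_iff by blast
      qed
      finally show ?thesis using l1 by linarith
    next
      case False
      then have "(\<Sum>j\<in>{nat \<lfloor>ln W\<rfloor>..nat \<lfloor>ln Z\<rfloor>}. 1 / real j) \<le> 0" by (intro sum_nonpos) auto
      then show ?thesis using l1 by linarith
    qed
    finally have "(\<Sum>\<pi>\<in>X. 1 / real (gnorm \<pi>)) \<le> exp 1 * (C * (\<theta> * l ^ 3) * (2 * l))"
      using C(1) \<theta>0 l1 by (simp add: mult_left_mono)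
    also have "\<dots> = (exp 1 * C * 2) * (\<theta> * l ^ 4)" by (simp add: eval_nat_numeral)
    finally show ?thesis by (simp add: X_def W_def l_def)
  qed
  then show ?thesis using that[of "exp 1 * C * 2" "max l0 1"] C(1) by simp
qed

lemma arc_recip_sum_small:
  assumes W: "W \<ge> 1" and Z: "Z \<ge> 1" and B: "B \<noteq> 0" and \<theta>: "\<theta> < 1" "\<theta> \<ge> 0"
  shows "(\<Sum>\<pi>\<in>{\<pi> \<in> gprime_arc A B \<theta>. W \<le> real (gnorm \<pi>) \<and> real (gnorm \<pi>) \<le> Z}. 1 / real (gnorm \<pi>))
      \<le> exp 1 * ((ln Z + 1) * (12 * \<theta> + 3 / sqrt W))"
proof -
  define X where "X = {\<pi> \<in> gprime_arc A B \<theta>. W \<le> real (gnorm \<pi>) \<and> real (gnorm \<pi>) \<le> Z}"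
  have finX: "finite X" unfolding X_def by (rule finite_arc_le[OF B \<theta>])
  have "(\<Sum>\<pi>\<in>X. 1 / real (gnorm \<pi>)) \<le> exp 1 * (\<Sum>j\<in>{nat \<lfloor>ln W\<rfloor>..nat \<lfloor>ln Z\<rfloor>}. 12 * \<theta> + 3 / sqrt W)"
  proof (rule sum_recip_bins[OF finX W])
    fix j assume j: "j \<in> {nat \<lfloor>ln W\<rfloor>..nat \<lfloor>ln Z\<rfloor>}"
    define T where "T = exp (real j + 1)"
    have T1: "T \<ge> 1" by (simp add: T_def)
    have WT: "W \<le> T"
    proof -
      have "nat \<lfloor>ln W\<rfloor> \<le> j" using j by simp
      then have "ln W \<le> real j + 1" using W by linarith
      then have "exp (ln W) \<le> T" by (simp add: T_def)
      then show ?thesis using W by simp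
    qed
    have "card {\<pi>\<in>X. real (gnorm \<pi>) \<le> T} \<le> card {\<pi> \<in> gprime_arc A B \<theta>. real (gnorm \<pi>) \<le> T}"
      using finite_arc_le[OF B \<theta>, of A "\<lambda>_. True" T] by (intro card_mono) (auto simp: X_def)
    then have "real (card {\<pi>\<in>X. real (gnorm \<pi>) \<le> T}) \<le> 12 * \<theta> * T + 3 * sqrt T"
      using arc_count_trivial[OF T1 B \<theta>, of A] by linarith
    also have "\<dots> \<le> 12 * \<theta> * T + 3 * (T / sqrt W)"
    proof -
      have "sqrt T * sqrt W \<le> sqrt T * sqrt T" using WT T1 by (intro mult_left_mono) auto
      then have "sqrt T * sqrt W \<le> T" using T1 by simp
      then have "sqrt T \<le> T / sqrt W" using W by (simp add: le_divide_eq)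
      then show ?thesis by simp
    qed
    finally show "real (card {\<pi>\<in>X. real (gnorm \<pi>) \<le> exp (real j + 1)}) \<le> (12 * \<theta> + 3 / sqrt W) * exp (real j + 1)"
      by (simp add: T_def algebra_simps)
  qed (auto simp: X_def)
  also have "\<dots> \<le> exp 1 * ((ln Z + 1) * (12 * \<theta> + 3 / sqrt W))"
  proof (rule mult_left_mono)
    have "(\<Sum>j\<in>{nat \<lfloor>ln W\<rfloor>..nat \<lfloor>ln Z\<rfloor>}. 12 * \<theta> + 3 / sqrt W) = real (card {nat \<lfloor>ln W\<rfloor>..nat \<lfloor>ln Z\<rfloor>}) * (12 * \<theta> + 3 / sqrt W)"
      by simp
    also have "\<dots> \<le> (ln Z + 1) * (12 * \<theta> + 3 / sqrt W)"
    proof (rule mult_right_mono)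
      have "ln Z \<ge> 0" using Z by simp
      then have "real (nat \<lfloor>ln Z\<rfloor>) \<le> ln Z" by linarith
      moreover have "card {nat \<lfloor>ln W\<rfloor>..nat \<lfloor>ln Z\<rfloor>} \<le> nat \<lfloor>ln Z\<rfloor> + 1" by simp
      then have "real (card {nat \<lfloor>ln W\<rfloor>..nat \<lfloor>ln Z\<rfloor>}) \<le> real (nat \<lfloor>ln Z\<rfloor>) + 1" by linarith
      ultimately show "real (card {nat \<lfloor>ln W\<rfloor>..nat \<lfloor>ln Z\<rfloor>}) \<le> ln Z + 1" by linarith
      show "0 \<le> 12 * \<theta> + 3 / sqrt W" using \<theta> W by simp
    qed
    finally show "(\<Sum>j\<in>{nat \<lfloor>ln W\<rfloor>..nat \<lfloor>ln Z\<rfloor>}. 12 * \<theta> + 3 / sqrt W) \<le> (ln Z + 1) * (12 * \<theta> + 3 / sqrt W)" .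
  qed simp
  finally show ?thesis by (simp add: X_def)
qed


lemma sum_le_sum_cover:
  fixes F :: "'b \<Rightarrow> real"
  assumes "finite I" "Z \<subseteq> g ` I" "\<And>i. i \<in> I \<Longrightarrow> F (g i) \<ge> 0"
  shows "sum F Z \<le> (\<Sum>i\<in>I. F (g i))"
proof -
  have "sum F Z \<le> sum F (g ` I)" by (intro sum_mono2) (use assms in auto)
  also have "\<dots> \<le> sum (F \<circ> g) I" by (rule sum_image_le) (use assms in auto)
  finally show ?thesis by simp
qed

section \<open>Logarithmic weights\<close>

lemma card_multiples_le: "real (card {n \<in> {1..N}. d dvd n}) \<le> real N / real d"
proof (cases "d = 0")
  case True
  then have "{n \<in> {1..N}. d dvd n} = {}" by auto
  then show ?thesis using True by simp
next
  case False
  have "{n \<in> {1..N}. d dvd n} \<subseteq> (\<lambda>k. d * k) ` {1..N div d}"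
  proof
    fix n assume n: "n \<in> {n \<in> {1..N}. d dvd n}"
    then obtain k where k: "n = d * k" by (auto elim: dvdE)
    then have "k \<ge> 1" using n by (cases k) auto
    moreover have "k \<le> N div d" using n k False by (simp add: less_eq_div_iff_mult_less_eq mult.commute)
    ultimately show "n \<in> (\<lambda>k. d * k) ` {1..N div d}" using k by auto
  qed
  then have "card {n \<in> {1..N}. d dvd n} \<le> card ((\<lambda>k. d * k) ` {1..N div d})" by (intro card_mono) auto
  also have "\<dots> \<le> N div d" using card_image_le[of "{1..N div d}" "\<lambda>k. d * k"] by simp
  finally show ?thesis using real_div_le[of N d] by linarith
qed

lemma sum_inverse_squares_tail:
  assumes "M \<ge> 1"
  shows "(\<Sum>d\<in>{M<..N}. 1 / real d ^ 2) \<le> 1 / real M"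
proof (cases "M \<le> N")
  case True
  have "(\<Sum>d\<in>{M<..N}. 1 / real d ^ 2) \<le> 1 / real M - 1 / real N"
    using True
  proof (induction N rule: nat_induct_at_least)
    case (Suc n)
    have "{M<..Suc n} = insert (Suc n) {M<..n}" using Suc by auto
    then have "(\<Sum>d\<in>{M<..Suc n}. 1 / real d ^ 2) = (\<Sum>d\<in>{M<..n}. 1 / real d ^ 2) + 1 / real (Suc n) ^ 2" by simp
    moreover have "1 / real (Suc n) ^ 2 \<le> 1 / real n - 1 / real (Suc n)"
    proof -
      have "1 / real (Suc n) ^ 2 \<le> 1 / (real n * real (Suc n))"
        using Suc(1) assms unfolding power2_eq_square by (intro divide_left_mono mult_right_mono) auto
      also have "\<dots> = 1 / real n - 1 / real (Suc n)" using Suc(1) assms by (simp add: field_simps)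
      finally show ?thesis .
    qed
    ultimately show ?case using Suc.IH by linarith
  qed simp
  moreover have "0 \<le> 1 / real N" by simp
  ultimately show ?thesis by linarith
qed simp

lemma prod_mset_le_power:
  fixes M :: "nat multiset"
  assumes "\<And>p. p \<in># M \<Longrightarrow> real p \<le> z" "z \<ge> 0"
  shows "real (prod_mset M) \<le> z ^ size M"
  using assms
proof (induction M)
  case (add x M)
  then have "real (prod_mset M) \<le> z ^ size M" "real x \<le> z" by auto
  then have "real x * real (prod_mset M) \<le> z * z ^ size M" using add.prems by (intro mult_mono) auto
  then show ?case by simp
qed simp

lemma smooth_le_power:
  assumes "d > 0" "smooth z d" "z \<ge> 0"
  shows "real d \<le> z ^ big_omega d"
proof -
  have "d = prod_mset (prime_factorization d)" using assms(1) by (simp add: prod_mset_prime_factorization_nat)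
  then have "real d = real (prod_mset (prime_factorization d))" by simp
  also have "\<dots> \<le> z ^ big_omega d" unfolding big_omega_def
    by (rule prod_mset_le_power) (use assms in \<open>auto simp: smooth_def\<close>)
  finally show ?thesis .
qed

text \<open>A prime that divides a sum of two squares exactly once and exceeds 2 is congruent to 1
  modulo 4, and the cofactor is again a sum of two squares coprime to it.\<close>

definition big_primes :: "real \<Rightarrow> nat \<Rightarrow> nat set" where
  "big_primes z n = {p. prime p \<and> p dvd n \<and> real p > z \<and> \<not> p\<^sup>2 dvd n}"

lemma finite_big_primes: "n > 0 \<Longrightarrow> finite (big_primes z n)"
  by (rule finite_subset[of _ "{p. p dvd n}"]) (auto simp: big_primes_def)

definition smooth_part :: "real \<Rightarrow> nat \<Rightarrow> nat" where
  "smooth_part z n = (\<Prod>p\<in>{p\<in>prime_factors n. real p \<le> z}. p ^ multiplicity p n)"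

lemma smooth_part_props:
  assumes n: "n > 0"
  shows "smooth_part z n > 0" "smooth_part z n dvd n" "smooth z (smooth_part z n)"
    "ln (real n) = ln (real (smooth_part z n)) + (\<Sum>p\<in>{p\<in>prime_factors n. \<not> real p \<le> z}. real (multiplicity p n) * ln (real p))"
proof -
  let ?A = "{p\<in>prime_factors n. real p \<le> z}" and ?B = "{p\<in>prime_factors n. \<not> real p \<le> z}"
  have un: "prime_factors n = ?A \<union> ?B" "?A \<inter> ?B = {}" by auto
  have fin: "finite ?A" "finite ?B" by auto
  have pos: "p \<in> prime_factors n \<Longrightarrow> p > 0" for p by (auto dest!: in_prime_factors_imp_prime simp: prime_gt_0_nat)
  show "smooth_part z n > 0" unfolding smooth_part_def by (intro prod_pos) (use pos in auto)
  have "n = (\<Prod>p\<in>?A \<union> ?B. p ^ multiplicity p n)" using prime_factorization_nat[OF n] un(1) by simp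
  also have "\<dots> = (\<Prod>p\<in>?A. p ^ multiplicity p n) * (\<Prod>p\<in>?B. p ^ multiplicity p n)"
    by (rule prod.union_disjoint[OF fin un(2)])
  finally show "smooth_part z n dvd n" unfolding smooth_part_def by (rule dvdI)
  show "smooth z (smooth_part z n)"
    unfolding smooth_def
  proof
    fix q assume "q \<in> prime_factors (smooth_part z n)"
    then have q: "prime q" "q dvd (\<Prod>p\<in>?A. p ^ multiplicity p n)" by (auto simp: smooth_part_def)
    then obtain p where p: "p \<in> ?A" "q dvd p ^ multiplicity p n"
      using prime_dvd_prod_iff[OF fin(1) q(1), of "\<lambda>p. p ^ multiplicity p n"] by blast
    then have "q dvd p" using q prime_dvd_power by blast
    then have "q = p" using p q primes_dvd_imp_eq by (auto dest: in_prime_factors_imp_prime)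
    then show "real q \<le> z" using p by simp
  qed
  have "ln (real (smooth_part z n)) = ln (\<Prod>p\<in>?A. real p ^ multiplicity p n)" by (simp add: smooth_part_def)
  also have "\<dots> = (\<Sum>p\<in>?A. ln (real p ^ multiplicity p n))" by (rule ln_prod) (use pos in auto)
  also have "\<dots> = (\<Sum>p\<in>?A. real (multiplicity p n) * ln (real p))" by (intro sum.cong refl ln_realpow)
  finally show "ln (real n) = ln (real (smooth_part z n)) + (\<Sum>p\<in>?B. real (multiplicity p n) * ln (real p))"
    using ln_eq_sum_prime_factors[OF n] sum.union_disjoint[OF fin un(2), of "\<lambda>p. real (multiplicity p n) * ln (real p)"] un(1)
    by (simp only:)
qed

lemma ln_le_via_big_primes:
  assumes n: "n > 0" and sq: "\<And>p. prime p \<Longrightarrow> real p > z \<Longrightarrow> \<not> p\<^sup>2 dvd n"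
  shows "ln (real n) \<le> ln (real (smooth_part z n)) + (\<Sum>p\<in>big_primes z n. ln (real p))"
proof -
  have "(\<Sum>p\<in>{p\<in>prime_factors n. \<not> real p \<le> z}. real (multiplicity p n) * ln (real p)) \<le> (\<Sum>p\<in>{p\<in>prime_factors n. \<not> real p \<le> z}. 1 * ln (real p))"
  proof (intro sum_mono mult_right_mono)
    fix p assume p: "p \<in> {p\<in>prime_factors n. \<not> real p \<le> z}"
    then have pp: "prime p" by (auto dest: in_prime_factors_imp_prime)
    have "\<not> p\<^sup>2 dvd n" using sq[OF pp] p by auto
    then have "multiplicity p n < 2" using multiplicity_geI[of p n 2] n pp by (metis le_imp_power_dvd multiplicity_dvd dvd_trans not_le)
    then show "real (multiplicity p n) \<le> 1" by simp
    show "0 \<le> ln (real p)" using pp by (rule ln_prime_nonneg)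
  qed
  also have "\<dots> = (\<Sum>p\<in>big_primes z n. ln (real p))"
  proof -
    have "{p\<in>prime_factors n. \<not> real p \<le> z} = big_primes z n"
      using n sq by (auto simp: big_primes_def prime_factors_dvd)
    then show ?thesis by simp
  qed
  finally show ?thesis using smooth_part_props(4)[OF n, of z] by linarith
qed

lemma ln_times_smooth_tail_eventually:
  fixes C E c :: real
  assumes "C > 0" "E > 0" "c > 0"
  shows "\<forall>\<^sub>F N :: nat in sequentially.
    ln (real N) * (C * (E * ln (ln (real N)))\<^sup>2 * exp (- c * (ln (real N) / (4 * (E * ln (ln (real N))))))) \<le> 1"
  using assms by real_asymp

text \<open>The weight log n = sum of log p is usable with large simple primes only. Outside an
  exceptional set one has log n >= (log N)/2, no square of a prime above z divides n, and the
  z-smooth part contributes less than (log N)/4, so the large primes carry at least (log N)/4. The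
  exceptional sets \<open>R1\<close>, \<open>R2\<close>, \<open>R3\<close> have at most N, 2N and N
  elements, each divided by log N; this is the additional 4N.\<close>

lemma log_weight_lemma:
  fixes E :: real
  assumes E: "E \<ge> 1"
  obtains N0 where "\<And>N A. N \<ge> N0 \<Longrightarrow> A \<subseteq> {1..N} \<Longrightarrow>
    ln (real N) * real (card A) \<le> 4 * (\<Sum>n\<in>A. \<Sum>p\<in>big_primes (ln (real N) powr E) n. ln (real p)) + 4 * real N"
proof -
  obtain C where C: "C > 0" "\<And>z F V. z \<ge> 3 \<Longrightarrow> finite F \<Longrightarrow>
    (\<And>d. d \<in> F \<Longrightarrow> d > 0 \<and> smooth z d \<and> V \<le> real (big_omega d)) \<Longrightarrow>
    (\<Sum>d\<in>F. 1 / real d) \<le> C * (ln z)\<^sup>2 * (2/3) powr V"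
    using smooth_tail_sum by blast
  have "\<forall>\<^sub>F N :: nat in sequentially. ln (real N) * (C * (E * ln (ln (real N)))\<^sup>2 * (2/3) powr (ln (real N) / (4 * (E * ln (ln (real N)))))) \<le> 1"
    using ln_times_smooth_tail_eventually[of C E "- ln (2/3)"] E C(1) by (simp add: powr_def mult.commute)
  moreover have "\<forall>\<^sub>F N :: nat in sequentially. ln (real N) * sqrt (real N) \<le> real N" by real_asymp
  moreover have "\<forall>\<^sub>F N :: nat in sequentially. ln (real N) \<ge> 3" by real_asymp
  ultimately have "\<forall>\<^sub>F N :: nat in sequentially.
    ln (real N) * (C * (E * ln (ln (real N)))\<^sup>2 * (2/3) powr (ln (real N) / (4 * (E * ln (ln (real N)))))) \<le> 1 \<and>
    ln (real N) * sqrt (real N) \<le> real N \<and> ln (real N) \<ge> 3"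
    by eventually_elim blast
  then obtain N0 where N0: "\<And>N. N \<ge> N0 \<Longrightarrow>
    ln (real N) * (C * (E * ln (ln (real N)))\<^sup>2 * (2/3) powr (ln (real N) / (4 * (E * ln (ln (real N)))))) \<le> 1 \<and>
    ln (real N) * sqrt (real N) \<le> real N \<and> ln (real N) \<ge> 3"
    unfolding eventually_sequentially by blast
  have "ln (real N) * real (card A) \<le> 4 * (\<Sum>n\<in>A. \<Sum>p\<in>big_primes (ln (real N) powr E) n. ln (real p)) + 4 * real N"
    if N: "N \<ge> N0" and A: "A \<subseteq> {1..N}" for N A
  proof -
    define L where "L = ln (real N)"
    define z where "z = L powr E"
    have L3: "L \<ge> 3" using N0[OF N] by (simp add: L_def)
    have Npos: "N > 0" using L3 by (cases N) (auto simp: L_def)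
    have zL: "z \<ge> L"
    proof -
      have "L powr 1 \<le> L powr E" using E L3 by (intro powr_mono) auto
      then show ?thesis using L3 by (simp add: z_def)
    qed
    have z3: "z \<ge> 3" using zL L3 by linarith
    have lz: "ln z = E * ln L" using L3 by (simp add: z_def ln_powr)
    have lz1: "ln z > 0" using z3 by simp
    \<comment> \<open>A z-smooth d of size at least N^(1/4) satisfies d <= z^Omega(d), hence has at
      least V prime factors; the smooth tail bound makes such d rare.\<close>
    define V where "V = L / (4 * ln z)"
    define R1 where "R1 = {n\<in>{1..N}. real n < sqrt (real N)}"
    define R2 where "R2 = {n\<in>{1..N}. \<exists>p. prime p \<and> real p > z \<and> p\<^sup>2 dvd n}"
    define R3 where "R3 = {n\<in>{1..N}. L / 4 \<le> ln (real (smooth_part z n))}"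
    define R where "R = R1 \<union> R2 \<union> R3"
    have finR: "finite R" by (auto simp: R_def R1_def R2_def R3_def)
    have finA: "finite A" using A finite_subset by blast
    have c1: "L * real (card R1) \<le> real N"
    proof -
      have "R1 \<subseteq> {1..nat \<lfloor>sqrt (real N)\<rfloor>}" by (auto simp: R1_def le_nat_iff le_floor_iff)
      then have "card R1 \<le> nat \<lfloor>sqrt (real N)\<rfloor>" using card_mono[of "{1..nat \<lfloor>sqrt (real N)\<rfloor>}" R1] by simp
      then have "real (card R1) \<le> real (nat \<lfloor>sqrt (real N)\<rfloor>)" by (simp only: of_nat_le_iff)
      also have "\<dots> \<le> sqrt (real N)" by simp
      finally have "L * real (card R1) \<le> L * sqrt (real N)" using L3 by (intro mult_left_mono) auto
      then show ?thesis using N0[OF N] unfolding L_def by linarith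
    qed
    have c2: "L * real (card R2) \<le> 2 * real N"
    proof -
      define M where "M = nat \<lfloor>z\<rfloor>"
      have M1: "M \<ge> 1" using z3 by (simp add: M_def le_nat_iff le_floor_iff)
      have Mz: "real M \<ge> z - 1" using z3 unfolding M_def by linarith
      have "R2 \<subseteq> (\<Union>d\<in>{M<..N}. {n\<in>{1..N}. d\<^sup>2 dvd n})"
      proof
        fix n assume "n \<in> R2"
        then obtain p where p: "n \<in> {1..N}" "prime p" "real p > z" "p\<^sup>2 dvd n" by (auto simp: R2_def)
        have "M < p"
        proof (rule ccontr)
          assume "\<not> M < p"
          then have "real p \<le> z" using z3 real_le_iff_le_nat_floor[of z p] by (simp add: M_def)
          then show False using p by simp
        qed
        moreover have "p \<le> N"
        proof -
          have "p dvd n" using p(4) by (metis dvd_trans dvd_triv_left power2_eq_square)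
          then have "p \<le> n" using p(1) by (auto intro: dvd_imp_le)
          then show ?thesis using p(1) by simp
        qed
        ultimately show "n \<in> (\<Union>d\<in>{M<..N}. {n\<in>{1..N}. d\<^sup>2 dvd n})" using p by auto
      qed
      then have "card R2 \<le> card (\<Union>d\<in>{M<..N}. {n\<in>{1..N}. d\<^sup>2 dvd n})" by (intro card_mono) auto
      also have "\<dots> \<le> (\<Sum>d\<in>{M<..N}. card {n\<in>{1..N}. d\<^sup>2 dvd n})" by (rule card_UN_le) simp
      finally have "real (card R2) \<le> (\<Sum>d\<in>{M<..N}. real (card {n\<in>{1..N}. d\<^sup>2 dvd n}))"
        by (simp only: of_nat_le_iff flip: of_nat_sum)
      also have "\<dots> \<le> (\<Sum>d\<in>{M<..N}. real N / real (d\<^sup>2))" by (intro sum_mono card_multiples_le)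
      also have "\<dots> = real N * (\<Sum>d\<in>{M<..N}. 1 / real d ^ 2)" by (simp add: sum_distrib_left)
      also have "\<dots> \<le> real N * (1 / real M)" by (intro mult_left_mono sum_inverse_squares_tail M1) simp
      finally have "L * real (card R2) \<le> L * (real N * (1 / real M))" using L3 by (intro mult_left_mono) auto
      also have "\<dots> = real N * (L / real M)" by simp
      also have "\<dots> \<le> real N * 2"
      proof (rule mult_left_mono)
        show "L / real M \<le> 2" using Mz zL L3 M1 by (simp add: divide_le_eq)
      qed simp
      finally show ?thesis by simp
    qed
    have c3: "L * real (card R3) \<le> real N"
    proof -
      define F where "F = {d\<in>{1..N}. smooth z d \<and> V \<le> real (big_omega d)}"
      have "R3 \<subseteq> (\<Union>d\<in>F. {n\<in>{1..N}. d dvd n})"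
      proof
        fix n assume n: "n \<in> R3"
        then have n1: "n > 0" "n \<le> N" by (auto simp: R3_def)
        define d where "d = smooth_part z n"
        have d: "d > 0" "d dvd n" "smooth z d" unfolding d_def by (rule smooth_part_props[OF n1(1)])+
        have "d \<le> N" using d(2) n1 by (meson dvd_imp_le le_trans)
        moreover have "V \<le> real (big_omega d)"
        proof -
          have "real d \<le> z ^ big_omega d" using smooth_le_power[OF d(1,3)] z3 by simp
          then have "ln (real d) \<le> ln (z ^ big_omega d)" using d(1) z3 by (subst ln_le_cancel_iff) auto
          then have "L / 4 \<le> real (big_omega d) * ln z" using n z3 by (simp add: R3_def d_def ln_realpow)
          then show ?thesis using lz1 by (simp add: V_def divide_le_eq mult_ac)
        qed
        ultimately have "d \<in> F" using d by (simp add: F_def)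
        then show "n \<in> (\<Union>d\<in>F. {n\<in>{1..N}. d dvd n})" using d(2) n1 by auto
      qed
      then have "card R3 \<le> card (\<Union>d\<in>F. {n\<in>{1..N}. d dvd n})" by (intro card_mono) (auto simp: F_def)
      also have "\<dots> \<le> (\<Sum>d\<in>F. card {n\<in>{1..N}. d dvd n})" by (rule card_UN_le) (simp add: F_def)
      finally have "real (card R3) \<le> (\<Sum>d\<in>F. real (card {n\<in>{1..N}. d dvd n}))"
        by (simp only: of_nat_le_iff flip: of_nat_sum)
      also have "\<dots> \<le> (\<Sum>d\<in>F. real N / real d)" by (intro sum_mono card_multiples_le)
      also have "\<dots> = real N * (\<Sum>d\<in>F. 1 / real d)" by (simp add: sum_distrib_left)
      also have "\<dots> \<le> real N * (C * (ln z)\<^sup>2 * (2/3) powr V)"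
        by (intro mult_left_mono C(2) z3) (auto simp: F_def)
      finally have "L * real (card R3) \<le> L * (real N * (C * (ln z)\<^sup>2 * (2/3) powr V))"
        using L3 by (intro mult_left_mono) auto
      also have "\<dots> = real N * (L * (C * (E * ln L)\<^sup>2 * (2/3) powr (L / (4 * (E * ln L)))))"
        by (simp add: V_def lz)
      also have "\<dots> \<le> real N * 1" using N0[OF N] unfolding L_def by (intro mult_left_mono) auto
      finally show ?thesis by simp
    qed
    have cR: "L * real (card R) \<le> 4 * real N"
    proof -
      have "card R \<le> card R1 + card R2 + card R3" unfolding R_def
        by (meson add_right_mono card_Un_le le_trans)
      then have "real (card R) \<le> real (card R1) + real (card R2) + real (card R3)" by linarith
      then have "L * real (card R) \<le> L * (real (card R1) + real (card R2) + real (card R3))" using L3 by (intro mult_left_mono) auto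
      then show ?thesis using c1 c2 c3 by (simp add: distrib_left)
    qed
    have good: "L \<le> 4 * (\<Sum>p\<in>big_primes z n. ln (real p))" if n: "n \<in> A - R" for n
    proof -
      have n1: "n \<in> {1..N}" "n \<notin> R1" "n \<notin> R2" "n \<notin> R3" using n A by (auto simp: R_def)
      have n0: "n > 0" using n1 by simp
      have "sqrt (real N) \<le> real n" using n1 by (auto simp: R1_def)
      then have "ln (sqrt (real N)) \<le> ln (real n)" using Npos n0 by (subst ln_le_cancel_iff) auto
      then have "L / 2 \<le> ln (real n)" using Npos by (simp add: L_def ln_sqrt)
      moreover have "ln (real (smooth_part z n)) < L / 4" using n1 by (auto simp: R3_def)
      moreover have "ln (real n) \<le> ln (real (smooth_part z n)) + (\<Sum>p\<in>big_primes z n. ln (real p))"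
        by (rule ln_le_via_big_primes[OF n0]) (use n1 in \<open>auto simp: R2_def\<close>)
      ultimately show ?thesis by linarith
    qed
    have "L * real (card A) \<le> L * real (card (A - R)) + L * real (card R)"
    proof -
      have "card A \<le> card ((A - R) \<union> R)" using finA finR by (intro card_mono) auto
      also have "\<dots> \<le> card (A - R) + card R" by (rule card_Un_le)
      finally have "real (card A) \<le> real (card (A - R)) + real (card R)" by linarith
      then have "L * real (card A) \<le> L * (real (card (A - R)) + real (card R))" using L3 by (intro mult_left_mono) auto
      then show ?thesis by (simp add: distrib_left)
    qed
    moreover have "L * real (card (A - R)) \<le> 4 * (\<Sum>n\<in>A. \<Sum>p\<in>big_primes z n. ln (real p))"
    proof -
      have "L * real (card (A - R)) = (\<Sum>n\<in>A - R. L)" by simp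
      also have "\<dots> \<le> (\<Sum>n\<in>A - R. 4 * (\<Sum>p\<in>big_primes z n. ln (real p)))" by (intro sum_mono good)
      also have "\<dots> \<le> (\<Sum>n\<in>A. 4 * (\<Sum>p\<in>big_primes z n. ln (real p)))"
        by (intro sum_mono2) (use finA in \<open>auto intro!: sum_nonneg ln_prime_nonneg simp: big_primes_def\<close>)
      also have "\<dots> = 4 * (\<Sum>n\<in>A. \<Sum>p\<in>big_primes z n. ln (real p))" by (simp add: sum_distrib_left)
      finally show ?thesis .
    qed
    ultimately show ?thesis using cR unfolding L_def z_def by linarith
  qed
  then show ?thesis using that by blast
qed

section \<open>Numbers with too many prime factors congruent to 1 modulo 4\<close>

lemma big_primes_two_squares:
  assumes n: "n \<in> two_squares" and p: "p \<in> big_primes z n" and z: "z \<ge> 2"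
  shows "p mod 4 = 1" "n = p * (n div p)" "n div p \<in> two_squares" "om1 n = 1 + om1 (n div p)"
proof -
  have pp: "prime p" "p dvd n" "real p > z" "\<not> p\<^sup>2 dvd n" using p by (auto simp: big_primes_def)
  from pp(1) show p1: "p mod 4 = 1"
  proof (rule prime_mod4_cases)
    assume "p = 2" then show ?thesis using pp z by simp
  next
    assume "p mod 4 = 3"
    then show ?thesis using two_squares_prime_3[OF n pp(1) _ pp(2)] pp(4) by (metis dvd_triv_left)
  qed
  show eq: "n = p * (n div p)" using pp by simp
  show S: "n div p \<in> two_squares" using two_squares_cancel_prime[of p "n div p"] n eq pp(1) p1 by simp
  have "om1 n = om1 p + om1 (n div p)"
    using om1_mult[of p "n div p"] eq two_squares_pos[OF S] pp(1) by (simp add: prime_gt_0_nat)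
  then show "om1 n = 1 + om1 (n div p)" using pp(1) p1 by (simp add: om1_prime)
qed

lemma sum_ln_primes_le:
  "(\<Sum>p | prime p \<and> p \<le> N. ln (real p)) \<le> 3 * real N"
proof -
  have "(\<Sum>p | prime p \<and> p \<le> N. ln (real p)) = (\<Sum>p | prime p \<and> p \<le> N. mangoldt p)"
    by (intro sum.cong) auto
  also have "\<dots> \<le> chebyshev_psi N"
    unfolding chebyshev_psi_def by (intro sum_mono2) (auto simp: mangoldt_nonneg Suc_le_eq prime_gt_0_nat)
  also have "\<dots> \<le> 3 * real N" by (rule chebyshev_psi_le)
  finally show ?thesis .
qed

lemma neg_powr_plus_eventually:
  fixes K \<nu> \<delta> :: real
  assumes "K > 0" "\<nu> > 0" "\<delta> > 0"
  shows "\<forall>\<^sub>F N :: nat in sequentially. K * ln (real N) powr (- \<nu>) + 4 / sqrt (ln (real N)) \<le> \<delta>"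
proof -
  have "filterlim (\<lambda>N :: nat. ln (real N)) at_top sequentially" by real_asymp
  then have "((\<lambda>N :: nat. ln (real N) powr (- \<nu>)) \<longlongrightarrow> 0) sequentially"
    using assms(2) by (intro tendsto_neg_powr) auto
  moreover have "((\<lambda>N :: nat. 4 / sqrt (ln (real N))) \<longlongrightarrow> 0) sequentially" by real_asymp
  ultimately have "((\<lambda>N :: nat. K * ln (real N) powr (- \<nu>) + 4 / sqrt (ln (real N))) \<longlongrightarrow> K * 0 + 0) sequentially"
    by (intro tendsto_intros)
  then have "((\<lambda>N :: nat. K * ln (real N) powr (- \<nu>) + 4 / sqrt (ln (real N))) \<longlongrightarrow> 0) sequentially" by simp
  then have "\<forall>\<^sub>F N :: nat in sequentially. K * ln (real N) powr (- \<nu>) + 4 / sqrt (ln (real N)) < \<delta>"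
    using assms(3) by (rule order_tendstoD(2))
  then show ?thesis by eventually_elim simp
qed

text \<open>Rankin's trick with y = 1 + u for \<open>om1\<close>, after the logarithmic weighting
  has reduced the count to a sum of 1/m. The sum is a power \<kappa> of log N, and everything rests
  on \<kappa> < 1/2.\<close>

lemma untypical_rare:
  fixes \<eta> \<delta> :: real
  assumes \<eta>: "\<eta> > 0" and \<delta>: "\<delta> > 0"
  shows "\<forall>\<^sub>F N :: nat in sequentially.
    real (card {n. n \<in> two_squares \<and> n \<le> N \<and> real (om1 n) > (1/2 + \<eta>) * ln (ln (real N))}) \<le> \<delta> * real N / sqrt (ln (real N))"
proof -
  obtain N1 where N1: "\<And>N A. N \<ge> N1 \<Longrightarrow> A \<subseteq> {1..N} \<Longrightarrow>
    ln (real N) * real (card A) \<le> 4 * (\<Sum>n\<in>A. \<Sum>p\<in>big_primes (ln (real N) powr 1) n. ln (real p)) + 4 * real N"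
    using log_weight_lemma[of 1] by auto
  obtain C where C: "C > 0" "\<And>y N. 1 \<le> y \<Longrightarrow> y \<le> 3/2 \<Longrightarrow> N \<ge> 3 \<Longrightarrow>
    (\<Sum>m | m \<in> two_squares \<and> m \<le> N. y ^ om1 m / real m) \<le> C * ln (real N) powr (y / 2)"
    using two_squares_sum_om1 by blast
  \<comment> \<open>Bounding log(1 + u) below by u - u^2 gives \<kappa> <= 1/2 - (\<eta> u - (1/2 +
    \<eta>) u^2); this u maximises the quantity in parentheses, whose value is then \<eta> u /
    2.\<close>
  define u where "u = \<eta> / (1 + 2 * \<eta>)"
  have u: "0 < u" "u \<le> 1/2" "u * (1/2 + \<eta>) = \<eta> / 2"
    using \<eta> by (auto simp: u_def field_simps)
  define y where "y = 1 + u"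
  have y: "1 < y" "y \<le> 3/2" using u by (auto simp: y_def)
  define \<kappa> where "\<kappa> = y / 2 - (1/2 + \<eta>) * ln y"
  have \<kappa>: "\<kappa> < 1/2"
  proof -
    have "u - u\<^sup>2 \<le> ln (1 + u)" using u by (intro ln_one_plus_pos_lower_bound) auto
    then have "(1/2 + \<eta>) * (u - u\<^sup>2) \<le> (1/2 + \<eta>) * ln y" using \<eta> by (intro mult_left_mono) (auto simp: y_def)
    then have "\<kappa> \<le> (1 + u) / 2 - (1/2 + \<eta>) * (u - u\<^sup>2)" by (simp add: \<kappa>_def y_def)
    also have "\<dots> = 1/2 + u * (u * (1/2 + \<eta>) - \<eta>)" by (simp add: power2_eq_square field_simps)
    also have "\<dots> = 1/2 - u * \<eta> / 2" unfolding u(3) by simp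
    also have "\<dots> < 1/2" using u \<eta> by simp
    finally show ?thesis .
  qed
  define K where "K = 12 * y * C"
  have K: "K > 0" using y C(1) by (simp add: K_def)
  have "\<forall>\<^sub>F N :: nat in sequentially. K * ln (real N) powr (- (1/2 - \<kappa>)) + 4 / sqrt (ln (real N)) \<le> \<delta>"
    by (rule neg_powr_plus_eventually) (use K \<kappa> \<delta> in auto)
  moreover have "\<forall>\<^sub>F N :: nat in sequentially. ln (real N) > 0" by real_asymp
  ultimately have ev: "\<forall>\<^sub>F N :: nat in sequentially. (12 * y * C) * ln (real N) powr \<kappa> + 4 \<le> \<delta> * sqrt (ln (real N))"
  proof eventually_elim
    case (elim N)
    have "ln (real N) powr \<kappa> = ln (real N) powr (- (1/2 - \<kappa>)) * sqrt (ln (real N))"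
      using elim by (simp add: powr_half_sqrt[symmetric] powr_add[symmetric])
    then have "K * ln (real N) powr \<kappa> + 4 = (K * ln (real N) powr (- (1/2 - \<kappa>)) + 4 / sqrt (ln (real N))) * sqrt (ln (real N))"
      using elim by (simp add: distrib_right)
    also have "\<dots> \<le> \<delta> * sqrt (ln (real N))" using elim by (intro mult_right_mono) auto
    finally show ?case by (simp add: K_def)
  qed
  have "\<forall>\<^sub>F N :: nat in sequentially. ln (real N) \<ge> 3 \<and> N \<ge> 3 \<and> N \<ge> N1"
    by (intro eventually_conj eventually_ge_at_top; real_asymp)
  with ev show ?thesis
  proof eventually_elim
    case (elim N)
    define L where "L = ln (real N)"
    define l where "l = ln L"
    have L3: "L \<ge> 3" "N \<ge> 3" "N \<ge> N1" using elim by (auto simp: L_def)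
    define A where "A = {n. n \<in> two_squares \<and> n \<le> N \<and> real (om1 n) > (1/2 + \<eta>) * l}"
    \<comment> \<open>The prime removed from n accounts for one factor of \<open>om1\<close>, hence
      the bound lower by 1.\<close>
    define M where "M = {m. m \<in> two_squares \<and> m \<le> N \<and> real (om1 m) \<ge> (1/2 + \<eta>) * l - 1}"
    have finA: "finite A" and finM: "finite M" by (simp_all add: A_def M_def)
    have AN: "A \<subseteq> {1..N}" by (auto simp: A_def Suc_le_eq two_squares_pos)
    have "(\<Sum>n\<in>A. \<Sum>p\<in>big_primes L n. ln (real p)) = (\<Sum>(n,p)\<in>(SIGMA n:A. big_primes L n). ln (real p))"
      using finA AN by (subst sum.Sigma) (auto intro!: finite_big_primes)
    also have "\<dots> \<le> (\<Sum>i\<in>(SIGMA m:M. {p. prime p \<and> p \<le> N div m}). (\<lambda>(n,p). ln (real p)) ((\<lambda>(m,p). (p * m, p)) i))"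
    proof (rule sum_le_sum_cover)
      show "finite (SIGMA m:M. {p. prime p \<and> p \<le> N div m})" using finM by auto
      show "(SIGMA n:A. big_primes L n) \<subseteq> (\<lambda>(m,p). (p * m, p)) ` (SIGMA m:M. {p. prime p \<and> p \<le> N div m})"
      proof clarify
        fix n p assume np: "n \<in> A" "p \<in> big_primes L n"
        have n: "n \<in> two_squares" "n \<le> N" "real (om1 n) > (1/2 + \<eta>) * l" using np(1) by (auto simp: A_def)
        have L2: "L \<ge> 2" using L3 by simp
        note b = big_primes_two_squares[OF n(1) np(2) L2]
        have p: "prime p" using np(2) by (simp add: big_primes_def)
        have m0: "n div p > 0" using two_squares_pos[OF b(3)] .
        have "n div p \<le> N" using n(2) by (meson div_le_dividend le_trans)
        then have "n div p \<in> M" using b(3,4) n(3) by (simp add: M_def)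
        moreover have "p \<le> N div (n div p)"
        proof -
          have "p * (n div p) \<le> N" using b(2) n(2) by simp
          then show ?thesis using m0 by (simp add: less_eq_div_iff_mult_less_eq)
        qed
        ultimately show "(n, p) \<in> (\<lambda>(m,p). (p * m, p)) ` (SIGMA m:M. {p. prime p \<and> p \<le> N div m})"
          using b(2) p by (intro image_eqI[of _ _ "(n div p, p)"]) auto
      qed
    qed (auto simp: ln_prime_nonneg)
    also have "\<dots> = (\<Sum>m\<in>M. \<Sum>p | prime p \<and> p \<le> N div m. ln (real p))"
      using finM by (subst sum.Sigma) (auto simp: case_prod_unfold)
    also have "\<dots> \<le> (\<Sum>m\<in>M. 3 * real N * (y * L powr (- (1/2 + \<eta>) * ln y)) * (y ^ om1 m / real m))"
    proof (intro sum_mono)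
      fix m assume m: "m \<in> M"
      have "(\<Sum>p | prime p \<and> p \<le> N div m. ln (real p)) \<le> 3 * real (N div m)" by (rule sum_ln_primes_le)
      also have "\<dots> \<le> 3 * (real N / real m)" using real_div_le[of N m] by linarith
      also have "\<dots> = 3 * real N / real m * 1" by simp
      also have "\<dots> \<le> 3 * real N / real m * (y * L powr (- (1/2 + \<eta>) * ln y) * y ^ om1 m)"
      proof (rule mult_left_mono)
        have "1 = y powr 0" using y by simp
        also have "\<dots> \<le> y powr (1 - (1/2 + \<eta>) * l + real (om1 m))" using y m by (intro powr_mono) (auto simp: M_def)
        also have "1 - (1/2 + \<eta>) * l + real (om1 m) = 1 + ((- (1/2 + \<eta>) * l) + real (om1 m))"
          by (simp add: algebra_simps)
        also have "y powr \<dots> = y * (y powr (- (1/2 + \<eta>) * l) * y ^ om1 m)"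
          using y by (simp only: powr_add) (simp add: powr_realpow)
        also have "\<dots> = y * y powr (- (1/2 + \<eta>) * l) * y ^ om1 m" by (simp only: mult.assoc)
        also have "y powr (- (1/2 + \<eta>) * l) = L powr (- (1/2 + \<eta>) * ln y)"
          using y L3 by (simp add: powr_def l_def mult_ac)
        finally show "1 \<le> y * L powr (- (1/2 + \<eta>) * ln y) * y ^ om1 m" .
      qed simp
      finally show "(\<Sum>p | prime p \<and> p \<le> N div m. ln (real p)) \<le> 3 * real N * (y * L powr (- (1/2 + \<eta>) * ln y)) * (y ^ om1 m / real m)"
        by simp
    qed
    also have "\<dots> = 3 * real N * (y * L powr (- (1/2 + \<eta>) * ln y)) * (\<Sum>m\<in>M. y ^ om1 m / real m)"
      by (rule sum_distrib_left[symmetric])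
    also have "\<dots> \<le> 3 * real N * (y * L powr (- (1/2 + \<eta>) * ln y)) * (C * L powr (y / 2))"
    proof (rule mult_left_mono)
      have "(\<Sum>m\<in>M. y ^ om1 m / real m) \<le> (\<Sum>m | m \<in> two_squares \<and> m \<le> N. y ^ om1 m / real m)"
        by (intro sum_mono2) (use y in \<open>auto simp: M_def\<close>)
      also have "\<dots> \<le> C * L powr (y / 2)" unfolding L_def by (rule C(2)) (use y L3 in auto)
      finally show "(\<Sum>m\<in>M. y ^ om1 m / real m) \<le> C * L powr (y / 2)" .
    qed (use y in auto)
    also have "\<dots> = 3 * real N * y * C * (L powr (- (1/2 + \<eta>) * ln y) * L powr (y / 2))" by (simp only: mult_ac)
    also have "L powr (- (1/2 + \<eta>) * ln y) * L powr (y / 2) = L powr \<kappa>"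
    proof -
      have "- (1/2 + \<eta>) * ln y + y / 2 = \<kappa>" by (simp add: \<kappa>_def algebra_simps)
      then show ?thesis by (simp only: powr_add[symmetric])
    qed
    finally have S: "(\<Sum>n\<in>A. \<Sum>p\<in>big_primes L n. ln (real p)) \<le> 3 * real N * y * C * L powr \<kappa>" .
    have "L * real (card A) \<le> 4 * (\<Sum>n\<in>A. \<Sum>p\<in>big_primes L n. ln (real p)) + 4 * real N"
      using N1[OF L3(3) AN] L3(1) by (simp add: L_def[symmetric])
    also have "\<dots> \<le> real N * ((12 * y * C) * L powr \<kappa> + 4)" using S by (simp add: algebra_simps)
    also have "\<dots> \<le> real N * (\<delta> * sqrt L)" using elim(1) unfolding L_def by (intro mult_left_mono) auto
    finally have "L * real (card A) \<le> (real N * \<delta>) * sqrt L" by (simp only: mult.assoc)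
    moreover have "(real (card A) * sqrt L) * sqrt L = L * real (card A)"
      using L3 by (simp only: mult.assoc real_sqrt_mult_self) simp
    ultimately have "(real (card A) * sqrt L) * sqrt L \<le> (real N * \<delta>) * sqrt L" by (simp only:)
    moreover have "sqrt L > 0" using L3 by simp
    ultimately have "real (card A) * sqrt L \<le> real N * \<delta>" by (rule mult_right_le_imp_le)
    then show ?case using L3 unfolding A_def l_def L_def[symmetric] by (simp add: le_divide_eq mult_ac)
  qed
qed


section \<open>Splitting tuples at a prime\<close>

text \<open>
  The exponent c(l) with a smaller loss, extended by a positive value to l < 2 so that single points are never
  exceptional and the recursion needs no special case for l = 2, 3.
\<close>

fun sep_exponent :: "real \<Rightarrow> nat \<Rightarrow> real" where
  "sep_exponent \<epsilon> l = (if l < 2 then \<epsilon> else real l / 2 * ln 2 + sep_exponent \<epsilon> (l div 2) + \<epsilon>)"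

declare sep_exponent.simps [simp del]

lemma sep_exponent_mono:
  assumes "\<epsilon> \<ge> 0" "l' \<le> l"
  shows "\<epsilon> \<le> sep_exponent \<epsilon> l' \<and> sep_exponent \<epsilon> l' \<le> sep_exponent \<epsilon> l"
  using assms(2)
proof (induction l arbitrary: l' rule: less_induct)
  case (less l)
  show ?case
  proof (cases "l < 2")
    case True
    then show ?thesis using less.prems assms(1) by (simp add: sep_exponent.simps)
  next
    case False
    have h: "l' div 2 \<le> l div 2" using less.prems by (simp add: div_le_mono)
    have IH: "\<epsilon> \<le> sep_exponent \<epsilon> (l' div 2)" "sep_exponent \<epsilon> (l' div 2) \<le> sep_exponent \<epsilon> (l div 2)"
      using less.IH[of "l div 2" "l' div 2"] h False by auto
    have l: "sep_exponent \<epsilon> l = real l / 2 * ln 2 + sep_exponent \<epsilon> (l div 2) + \<epsilon>"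
      using False by (simp add: sep_exponent.simps[of \<epsilon> l])
    have mono: "real l' / 2 * ln 2 \<le> real l / 2 * ln 2" "0 \<le> real l' / 2 * ln (2::real)"
      using less.prems by (auto intro!: mult_right_mono)
    show ?thesis
    proof (cases "l' < 2")
      case True
      then have "sep_exponent \<epsilon> l' = \<epsilon>" by (simp add: sep_exponent.simps)
      then show ?thesis using l IH mono assms(1) by linarith
    next
      case False
      then have "sep_exponent \<epsilon> l' = real l' / 2 * ln 2 + sep_exponent \<epsilon> (l' div 2) + \<epsilon>"
        by (simp add: sep_exponent.simps[of \<epsilon> l'])
      then show ?thesis using l IH mono assms(1) by linarith
    qed
  qed
qed

lemma sep_exponent_half:
  assumes "\<epsilon> \<ge> 0" "l \<ge> 2" "l' \<le> l div 2"
  shows "real l / 2 * ln 2 + \<epsilon> + sep_exponent \<epsilon> l' \<le> sep_exponent \<epsilon> l"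
  using sep_exponent_mono[OF assms(1,3)] assms(2) by (simp add: sep_exponent.simps[of \<epsilon> l])

text \<open>At l = 2 and l = 3 two losses \<epsilon>/4, one from the step and one from l < 2, stand
  against a single \<epsilon>, and each further halving widens the gap. The remaining \<epsilon>/4
  is spent on replacing log n by log N.\<close>

lemma sep_exponent_less_corr_exponent:
  assumes "\<epsilon> > 0" "l \<ge> 2"
  shows "sep_exponent (\<epsilon> / 4) l \<le> corr_exponent \<epsilon> l - \<epsilon> / 4"
  using assms(2)
proof (induction l rule: less_induct)
  case (less l)
  have l: "sep_exponent (\<epsilon> / 4) l = real l / 2 * ln 2 + sep_exponent (\<epsilon> / 4) (l div 2) + \<epsilon> / 4"
    using less.prems by (simp add: sep_exponent.simps[of _ l])
  show ?case
  proof (cases "l < 4")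
    case True
    then have "l = 2 \<or> l = 3" using less.prems by auto
    then show ?thesis using l assms(1) by (auto simp: sep_exponent.simps[of _ 1] sep_exponent.simps[of _ "Suc 0"] corr_exponent.simps[of _ 2] corr_exponent.simps[of _ 3])
  next
    case False
    then have "corr_exponent \<epsilon> l = real l / 2 * ln 2 + corr_exponent \<epsilon> (l div 2) + \<epsilon>"
      by (simp add: corr_exponent.simps[of _ l])
    moreover have "sep_exponent (\<epsilon> / 4) (l div 2) \<le> corr_exponent \<epsilon> (l div 2) - \<epsilon> / 4"
      using less.IH[of "l div 2"] False by simp
    ultimately show ?thesis using l assms(1) by linarith
  qed
qed

section \<open>Exceptional numbers and their factorisations\<close>

definition small_sum :: "nat \<Rightarrow> real \<Rightarrow> nat \<Rightarrow> bool" where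
  "small_sum l \<theta> m \<longleftrightarrow> (\<exists>zs. length zs = l \<and> set zs \<subseteq> circ m \<and> 0 < cmod (sum_list zs) \<and> cmod (sum_list zs) \<le> \<theta> * sqrt (real m))"

text \<open>The parameter \<open>L\<close> stands for log N and is independent of \<open>m\<close>,
  so the same threshold serves m, its divisors and its multiples.\<close>

definition bad :: "real \<Rightarrow> real \<Rightarrow> nat \<Rightarrow> nat \<Rightarrow> bool" where
  "bad \<epsilon> L l m \<longleftrightarrow> small_sum l (L powr - sep_exponent \<epsilon> l) m"

lemma small_sum_scale:
  assumes "small_sum l \<theta> m" "g \<in> circ k" "k > 0"
  shows "small_sum l \<theta> (k * m)"
proof -
  obtain zs where zs: "length zs = l" "set zs \<subseteq> circ m" "0 < cmod (sum_list zs)" "cmod (sum_list zs) \<le> \<theta> * sqrt (real m)"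
    using assms(1) by (auto simp: small_sum_def)
  have g: "cmod g = sqrt (real k)" by (rule circ_cmod[OF assms(2)])
  have "set (map (\<lambda>z. g * z) zs) \<subseteq> circ (k * m)" using zs(2) circ_mult[OF assms(2)] by auto
  moreover have "cmod (sum_list (map (\<lambda>z. g * z) zs)) = sqrt (real k) * cmod (sum_list zs)"
    by (simp add: sum_list_mult_const_left norm_mult g)
  moreover have "sqrt (real k) * cmod (sum_list zs) \<le> sqrt (real k) * (\<theta> * sqrt (real m))"
    using zs(4) by (intro mult_left_mono) auto
  ultimately show ?thesis unfolding small_sum_def using zs assms(3)
    by (intro exI[of _ "map (\<lambda>z. g * z) zs"]) (auto simp: real_sqrt_mult mult_ac)
qed

text \<open>The second list is the shorter side of a split. Its sum is the B that scales the arc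
  condition and therefore has to be nonzero; the length of each list is left free.\<close>

definition list_pairs :: "nat \<Rightarrow> nat \<Rightarrow> (complex list \<times> complex list) set" where
  "list_pairs m l = {(us, vs). set us \<subseteq> circ m \<and> set vs \<subseteq> circ m \<and> length us + length vs = l \<and> sum_list vs \<noteq> 0}"

lemma list_pairs_bound: "finite (list_pairs m l)" "card (list_pairs m l) \<le> (l + 1) * card (circ m) ^ l"
proof -
  let ?A = "\<lambda>j. {us. set us \<subseteq> circ m \<and> length us = j}"
  have fin: "finite (?A j)" for j by (rule finite_lists_length_eq) simp
  have sub: "list_pairs m l \<subseteq> (\<Union>j\<in>{..l}. ?A j \<times> ?A (l - j))" by (auto simp: list_pairs_def)
  have finU: "finite (\<Union>j\<in>{..l}. ?A j \<times> ?A (l - j))" using fin by (intro finite_UN_I finite_cartesian_product) auto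
  show "finite (list_pairs m l)" by (rule finite_subset[OF sub finU])
  have "card (list_pairs m l) \<le> card (\<Union>j\<in>{..l}. ?A j \<times> ?A (l - j))" by (rule card_mono[OF finU sub])
  also have "\<dots> \<le> (\<Sum>j\<in>{..l}. card (?A j \<times> ?A (l - j)))" by (rule card_UN_le) simp
  also have "\<dots> = (\<Sum>j\<in>{..l}. card (circ m) ^ l)"
  proof (intro sum.cong refl)
    fix j assume "j \<in> {..l}"
    then show "card (?A j \<times> ?A (l - j)) = card (circ m) ^ l"
      by (simp add: card_cartesian_product card_lists_length_eq power_add[symmetric])
  qed
  also have "\<dots> = (l + 1) * card (circ m) ^ l" by simp
  finally show "card (list_pairs m l) \<le> (l + 1) * card (circ m) ^ l" .
qed

text \<open>The quotient of the bound on the whole sum by the lower bound for an unexceptional half: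
  the exponent is at most the difference of \<open>sep_exponent\<close> at l and at any length up to
  l div 2.\<close>

definition arc_width :: "real \<Rightarrow> real \<Rightarrow> nat \<Rightarrow> real" where
  "arc_width \<epsilon> L l = L powr - (real l / 2 * ln 2 + \<epsilon>)"

text \<open>B is the sum of the shorter side. If B = 0, the modulus of the sum is sqrt p times that
  of A, and A is small for its shorter length because the exponents increase with the length. If B
  is nonzero but small, m is exceptional for \<open>length vs\<close>. Otherwise dividing by |B|
  leaves the factor \<open>arc_width\<close>.\<close>

lemma split_cases_aux:
  assumes \<epsilon>: "\<epsilon> > 0" and L: "L > 1" and m: "m > 0" and p: "prime p" and \<pi>: "\<pi> \<in> circ p"
    and us: "set us \<subseteq> circ m" and vs: "set vs \<subseteq> circ m" and ne: "us \<noteq> []" "vs \<noteq> []"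
    and l: "length us + length vs = l" and le: "length vs \<le> length us"
    and P0: "0 < cmod (\<pi> * sum_list us + cnj \<pi> * sum_list vs)"
    and P: "cmod (\<pi> * sum_list us + cnj \<pi> * sum_list vs) \<le> L powr - sep_exponent \<epsilon> l * sqrt (real (p * m))"
  shows "(\<exists>l'\<in>{1..<l}. bad \<epsilon> L l' m) \<or>
    ((us, vs) \<in> list_pairs m l \<and> \<pi> \<in> gprime_arc (sum_list us) (sum_list vs) (arc_width \<epsilon> L l) \<and> gnorm \<pi> = p)"
proof -
  define A B where "A = sum_list us" and "B = sum_list vs"
  have lv: "length vs \<le> l div 2" "1 \<le> length vs" "length vs < l" using l le ne by (auto simp: Suc_le_eq)
  have lu: "1 \<le> length us" "length us < l" using l ne by (auto simp: Suc_le_eq)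
  have l2: "l \<ge> 2" using lv lu by linarith
  have cp: "cmod \<pi> = sqrt (real p)" by (rule circ_cmod[OF \<pi>])
  have sp: "sqrt (real p) > 0" using p by (simp add: prime_gt_0_nat)
  show ?thesis
  proof (cases "B = 0")
    case True
    have e: "cmod (\<pi> * A + cnj \<pi> * B) = sqrt (real p) * cmod A" using True by (simp add: norm_mult cp)
    have "sqrt (real p) * cmod A \<le> sqrt (real p) * (L powr - sep_exponent \<epsilon> l * sqrt (real m))"
      using P e by (simp add: A_def B_def real_sqrt_mult mult_ac)
    then have "cmod A \<le> L powr - sep_exponent \<epsilon> l * sqrt (real m)" using sp by (simp add: mult_le_cancel_left)
    also have "\<dots> \<le> L powr - sep_exponent \<epsilon> (length us) * sqrt (real m)"
      using sep_exponent_mono[of \<epsilon> "length us" l] \<epsilon> L lu by (intro mult_right_mono powr_mono) auto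
    finally have "cmod A \<le> L powr - sep_exponent \<epsilon> (length us) * sqrt (real m)" .
    moreover have "0 < sqrt (real p) * cmod A" using P0 e unfolding A_def B_def by linarith
    then have "0 < cmod A" by (rule zero_less_mult_pos[OF _ sp])
    ultimately have "bad \<epsilon> L (length us) m" using us unfolding bad_def small_sum_def A_def by blast
    then show ?thesis using lu by auto
  next
    case False
    show ?thesis
    proof (cases "cmod B \<le> L powr - sep_exponent \<epsilon> (length vs) * sqrt (real m)")
      case True
      moreover have "0 < cmod B" using False by simp
      ultimately have "bad \<epsilon> L (length vs) m" using vs unfolding bad_def small_sum_def B_def by blast
      then show ?thesis using lv by auto
    next
      case big: False
      have "cmod (\<pi> * A + cnj \<pi> * B) \<le> L powr - sep_exponent \<epsilon> l * (sqrt (real p) * sqrt (real m))"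
        using P by (simp add: A_def B_def real_sqrt_mult)
      also have "\<dots> \<le> L powr (- (real l / 2 * ln 2 + \<epsilon>) + - sep_exponent \<epsilon> (length vs)) * (sqrt (real p) * sqrt (real m))"
        using sep_exponent_half[of \<epsilon> l "length vs"] \<epsilon> L lv l2 by (intro mult_right_mono powr_mono) auto
      also have "\<dots> = arc_width \<epsilon> L l * sqrt (real p) * (L powr - sep_exponent \<epsilon> (length vs) * sqrt (real m))"
        unfolding powr_add arc_width_def by (simp only: mult_ac)
      also have "\<dots> \<le> arc_width \<epsilon> L l * sqrt (real p) * cmod B"
        using big sp by (intro mult_left_mono) (auto simp: arc_width_def)
      finally have "cmod (\<pi> * A + cnj \<pi> * B) \<le> arc_width \<epsilon> L l * cmod \<pi> * cmod B" by (simp add: cp)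
      then have "\<pi> \<in> gprime_arc A B (arc_width \<epsilon> L l)"
        using circ_gint[OF \<pi>] gnorm_circ[OF \<pi>] p by (simp add: gprime_arc_def)
      moreover have "(us, vs) \<in> list_pairs m l" using us vs l False by (simp add: list_pairs_def B_def)
      ultimately show ?thesis using gnorm_circ[OF \<pi>] by (simp add: A_def B_def)
    qed
  qed
qed

text \<open>Replacing \<pi> by its conjugate exchanges the two sides, so the second list may be
  taken to be the shorter one.\<close>

lemma split_cases:
  assumes \<epsilon>: "\<epsilon> > 0" and L: "L > 1" and m: "m > 0" and p: "prime p" and \<pi>: "\<pi> \<in> circ p"
    and us: "set us \<subseteq> circ m" and vs: "set vs \<subseteq> circ m" and ne: "us \<noteq> []" "vs \<noteq> []"
    and l: "length us + length vs = l"
    and P0: "0 < cmod (\<pi> * sum_list us + cnj \<pi> * sum_list vs)"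
    and P: "cmod (\<pi> * sum_list us + cnj \<pi> * sum_list vs) \<le> L powr - sep_exponent \<epsilon> l * sqrt (real (p * m))"
  shows "(\<exists>l'\<in>{1..<l}. bad \<epsilon> L l' m) \<or>
    (\<exists>us vs \<pi>. (us, vs) \<in> list_pairs m l \<and> \<pi> \<in> gprime_arc (sum_list us) (sum_list vs) (arc_width \<epsilon> L l) \<and> gnorm \<pi> = p)"
proof (cases "length vs \<le> length us")
  case True
  then show ?thesis using split_cases_aux[OF \<epsilon> L m p \<pi> us vs ne l True P0 P] by blast
next
  case False
  then have le: "length us \<le> length vs" by simp
  have l': "length vs + length us = l" using l by simp
  have eq: "cnj \<pi> * sum_list vs + cnj (cnj \<pi>) * sum_list us = \<pi> * sum_list us + cnj \<pi> * sum_list vs" by simp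
  show ?thesis
    using split_cases_aux[OF \<epsilon> L m p circ_cnj[OF \<pi>] vs us ne(2,1) l' le] P0 P unfolding eq by blast
qed

text \<open>After a common factor has been taken out of a tuple it can be put back into the pair of
  lists without moving the arc.\<close>

lemma gprime_arc_scale:
  assumes "g \<noteq> 0"
  shows "gprime_arc (g * A) (g * B) \<theta> = gprime_arc A B \<theta>"
proof -
  have "cmod (\<pi> * (g * A) + cnj \<pi> * (g * B)) \<le> \<theta> * cmod \<pi> * cmod (g * B) \<longleftrightarrow>
    cmod (\<pi> * A + cnj \<pi> * B) \<le> \<theta> * cmod \<pi> * cmod B" for \<pi>
  proof -
    have "\<pi> * (g * A) + cnj \<pi> * (g * B) = g * (\<pi> * A + cnj \<pi> * B)" by (simp add: algebra_simps)
    then have e1: "cmod (\<pi> * (g * A) + cnj \<pi> * (g * B)) = cmod g * cmod (\<pi> * A + cnj \<pi> * B)" by (simp add: norm_mult)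
    have e2: "\<theta> * cmod \<pi> * cmod (g * B) = cmod g * (\<theta> * cmod \<pi> * cmod B)" by (simp add: norm_mult)
    have "cmod g > 0" using assms by simp
    then show ?thesis unfolding e1 e2 by (rule mult_le_cancel_left_pos)
  qed
  then show ?thesis by (simp add: gprime_arc_def)
qed

lemma list_pairs_scale:
  assumes "(us, vs) \<in> list_pairs m l" "g \<in> circ k" "k > 0"
  shows "(map (\<lambda>z. g * z) us, map (\<lambda>z. g * z) vs) \<in> list_pairs (k * m) l"
proof -
  have "g \<noteq> 0" using circ_nonzero assms by blast
  then show ?thesis using assms circ_mult[OF assms(2)]
    by (auto simp: list_pairs_def sum_list_mult_const_left)
qed

lemma prime_dvd_primitive_split:
  assumes \<epsilon>: "\<epsilon> > 0" and L: "L > 1" and prim: "primitive_list zs" and zs: "set zs \<subseteq> circ (p * m)" "length zs = l"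
    and m: "m > 0" and p: "prime p"
    and P: "0 < cmod (sum_list zs)" "cmod (sum_list zs) \<le> L powr - sep_exponent \<epsilon> l * sqrt (real (p * m))"
  shows "p mod 4 = 1 \<and> ((\<exists>l'\<in>{1..<l}. bad \<epsilon> L l' m) \<or>
    (\<exists>us vs \<pi>. (us, vs) \<in> list_pairs m l \<and> \<pi> \<in> gprime_arc (sum_list us) (sum_list vs) (arc_width \<epsilon> L l) \<and> gnorm \<pi> = p))"
proof -
  have p1: "p mod 4 = 1" by (rule primitive_prime_mod4[OF prim zs(1) p]) simp
  obtain \<pi> where \<pi>: "\<pi> \<in> circ p" using circ_prime_mod4_1[OF p p1] by auto
  obtain us vs where uv: "set us \<subseteq> circ m" "set vs \<subseteq> circ m" "length us + length vs = length zs"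
    "sum_list zs = \<pi> * sum_list us + cnj \<pi> * sum_list vs" "us \<noteq> []" "vs \<noteq> []"
    using primitive_split[OF prim p \<pi> zs(1)] by blast
  have l: "length us + length vs = l" using uv(3) zs(2) by simp
  show ?thesis
    using split_cases[OF \<epsilon> L m p \<pi> uv(1,2,5,6) l] P p1 unfolding uv(4) by blast
qed

text \<open>Everything is decided on the norm m' of the primitive part. A prime of m' above z is
  split off, and the common factor is put back, so that the cofactor is again a divisor of m. If m'
  is z-smooth, then either it has at least V prime factors or it has a prime factor of at least w.
  In the last alternative the common factor stays outside, because the bound V is known only for the
  primitive part.\<close>

lemma bad_cover:
  assumes \<epsilon>: "\<epsilon> > 0" and L: "L > 1" and m: "m > 0" and l: "l \<ge> 1" and bad: "bad \<epsilon> L l m"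
    and w: "w \<ge> 1" "w powr V < L powr (2 * \<epsilon>)"
  shows "(\<exists>l'\<in>{1..<l}. \<exists>p m2. prime p \<and> p mod 4 = 1 \<and> m = p * m2 \<and> bad \<epsilon> L l' m2) \<or>
    (\<exists>m2 us vs \<pi>. m = gnorm \<pi> * m2 \<and> gnorm \<pi> mod 4 = 1 \<and> (us, vs) \<in> list_pairs m2 l \<and>
       \<pi> \<in> gprime_arc (sum_list us) (sum_list vs) (arc_width \<epsilon> L l) \<and> z < real (gnorm \<pi>)) \<or>
    (\<exists>k m'. m = k * m' \<and> k \<in> two_squares \<and> m' > 0 \<and> smooth z m' \<and> V \<le> real (big_omega m')) \<or>
    (\<exists>k m2 us vs \<pi>. m = k * (gnorm \<pi> * m2) \<and> k \<in> two_squares \<and> m2 > 0 \<and> smooth z m2 \<and> real (om1 m2) \<le> V \<and>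
       (us, vs) \<in> list_pairs m2 l \<and> \<pi> \<in> gprime_arc (sum_list us) (sum_list vs) (arc_width \<epsilon> L l) \<and>
       w \<le> real (gnorm \<pi>) \<and> real (gnorm \<pi>) \<le> z)"
proof -
  obtain zs where zs: "length zs = l" "set zs \<subseteq> circ m" "0 < cmod (sum_list zs)"
    "cmod (sum_list zs) \<le> L powr - sep_exponent \<epsilon> l * sqrt (real m)"
    using bad by (auto simp: bad_def small_sum_def)
  have "zs \<noteq> []" using zs(1) l by auto
  from primitive_reduction[OF this zs(2) m] obtain g k m' zs' where
    g: "g \<in> circ k" "m = k * m'" "zs = map (\<lambda>z. g * z) zs'" "set zs' \<subseteq> circ m'" "primitive_list zs'" by blast
  have k0: "k > 0" and m'0: "m' > 0" using g(2) m by auto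
  have g0: "g \<noteq> 0" using circ_nonzero[OF g(1) k0] .
  have kS: "k \<in> two_squares" using g(1) k0 by (auto simp: two_squares_iff_circ)
  have sk: "sqrt (real k) > 0" using k0 by simp
  have len: "length zs' = l" using zs(1) g(3) by simp
  have sum: "cmod (sum_list zs) = sqrt (real k) * cmod (sum_list zs')"
    using circ_cmod[OF g(1)] by (simp add: g(3) sum_list_mult_const_left norm_mult)
  have P0: "0 < cmod (sum_list zs')" using zs(3) sum sk by (simp add: zero_less_mult_iff)
  have "sqrt (real k) * cmod (sum_list zs') \<le> sqrt (real k) * (L powr - sep_exponent \<epsilon> l * sqrt (real m'))"
    using zs(4) unfolding sum g(2) by (simp add: real_sqrt_mult mult_ac)
  then have P: "cmod (sum_list zs') \<le> L powr - sep_exponent \<epsilon> l * sqrt (real m')" using sk by (simp add: mult_le_cancel_left)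
  have split: "p mod 4 = 1 \<and> ((\<exists>l'\<in>{1..<l}. bad \<epsilon> L l' m2) \<or>
    (\<exists>us vs \<pi>. (us, vs) \<in> list_pairs m2 l \<and> \<pi> \<in> gprime_arc (sum_list us) (sum_list vs) (arc_width \<epsilon> L l) \<and> gnorm \<pi> = p))"
    if "prime p" "m' = p * m2" for p m2
  proof -
    have "m2 > 0" using that m'0 by auto
    then show ?thesis using prime_dvd_primitive_split[OF \<epsilon> L g(5) _ len _ that(1)] g(4) P0 P that(2) by simp
  qed
  have lift_bad: "bad \<epsilon> L l' (k * m2)" if "bad \<epsilon> L l' m2" for l' m2
    using that small_sum_scale[OF _ g(1) k0] by (simp add: bad_def)
  show ?thesis
  proof (cases "\<exists>p. prime p \<and> p dvd m' \<and> z < real p")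
    case True
    then obtain p m2 where p: "prime p" "m' = p * m2" "z < real p" by (auto elim: dvdE)
    have mm: "m = p * (k * m2)" using g(2) p(2) by simp
    from split[OF p(1,2)] have p1: "p mod 4 = 1" and cs: "(\<exists>l'\<in>{1..<l}. bad \<epsilon> L l' m2) \<or>
      (\<exists>us vs \<pi>. (us, vs) \<in> list_pairs m2 l \<and> \<pi> \<in> gprime_arc (sum_list us) (sum_list vs) (arc_width \<epsilon> L l) \<and> gnorm \<pi> = p)"
      by auto
    from cs show ?thesis
    proof
      assume "\<exists>l'\<in>{1..<l}. bad \<epsilon> L l' m2"
      then show ?thesis using lift_bad mm p(1) p1 by blast
    next
      assume "\<exists>us vs \<pi>. (us, vs) \<in> list_pairs m2 l \<and> \<pi> \<in> gprime_arc (sum_list us) (sum_list vs) (arc_width \<epsilon> L l) \<and> gnorm \<pi> = p"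
      then obtain us vs \<pi> where uv: "(us, vs) \<in> list_pairs m2 l" "\<pi> \<in> gprime_arc (sum_list us) (sum_list vs) (arc_width \<epsilon> L l)" "gnorm \<pi> = p"
        by blast
      have "\<pi> \<in> gprime_arc (sum_list (map (\<lambda>z. g * z) us)) (sum_list (map (\<lambda>z. g * z) vs)) (arc_width \<epsilon> L l)"
        using uv(2) by (simp add: sum_list_mult_const_left gprime_arc_scale[OF g0])
      then show ?thesis using list_pairs_scale[OF uv(1) g(1) k0] uv(3) mm p1 p(3) by blast
    qed
  next
    case False
    then have sm: "smooth z m'" unfolding smooth_def by (auto simp: not_less dest: in_prime_factors_imp_prime)
    show ?thesis
    proof (cases "V \<le> real (big_omega m')")
      case True
      then show ?thesis using g(2) kS m'0 sm by blast
    next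
      case V: False
      \<comment> \<open>A nonzero Gaussian integer has modulus at least 1, so a sum this small
        relative to sqrt m' forces m' to be at least L^(2 \<epsilon>).\<close>
      have "set zs' \<subseteq> gint" using g(4) circ_gint by blast
      then have "1 \<le> cmod (sum_list zs')" using gint_cmod_ge_1[OF gint_sum_list] P0 by auto
      then have "1 \<le> L powr - sep_exponent \<epsilon> l * sqrt (real m')" using P by linarith
      then have "L powr sep_exponent \<epsilon> l * 1 \<le> L powr sep_exponent \<epsilon> l * (L powr - sep_exponent \<epsilon> l * sqrt (real m'))"
        by (intro mult_left_mono) auto
      then have "L powr sep_exponent \<epsilon> l \<le> sqrt (real m')" using L by (simp add: mult.assoc[symmetric] flip: powr_add)
      moreover have "L powr \<epsilon> \<le> L powr sep_exponent \<epsilon> l"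
        using sep_exponent_mono[of \<epsilon> l l] \<epsilon> L by (intro powr_mono) auto
      ultimately have "(L powr \<epsilon>)\<^sup>2 \<le> (sqrt (real m'))\<^sup>2" by (intro power_mono) auto
      moreover have "(L powr \<epsilon>)\<^sup>2 = L powr (2 * \<epsilon>)" by (simp add: power2_eq_square flip: powr_add)
      ultimately have big: "L powr (2 * \<epsilon>) \<le> real m'" by simp
      \<comment> \<open>Fewer than V primes, all below w, would give m' <= w^V < L^(2
        \<epsilon>).\<close>
      have "\<exists>p. prime p \<and> p dvd m' \<and> w \<le> real p"
      proof (rule ccontr)
        assume "\<nexists>p. prime p \<and> p dvd m' \<and> w \<le> real p"
        then have "smooth w m'" unfolding smooth_def by (auto simp: not_le dest: in_prime_factors_imp_prime intro: less_imp_le)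
        then have "real m' \<le> w ^ big_omega m'" using smooth_le_power[OF m'0] w(1) by simp
        also have "\<dots> = w powr real (big_omega m')" using w(1) by (simp add: powr_realpow)
        also have "\<dots> \<le> w powr V" using V w(1) by (intro powr_mono) auto
        finally show False using w(2) big by linarith
      qed
      then obtain p m2 where p: "prime p" "m' = p * m2" "w \<le> real p" by (auto elim: dvdE)
      have m20: "m2 > 0" using p(2) m'0 by auto
      have mm: "m = p * (k * m2)" using g(2) p(2) by simp
      from split[OF p(1,2)] have p1: "p mod 4 = 1" and cs: "(\<exists>l'\<in>{1..<l}. bad \<epsilon> L l' m2) \<or>
        (\<exists>us vs \<pi>. (us, vs) \<in> list_pairs m2 l \<and> \<pi> \<in> gprime_arc (sum_list us) (sum_list vs) (arc_width \<epsilon> L l) \<and> gnorm \<pi> = p)"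
        by auto
      from cs show ?thesis
      proof
        assume "\<exists>l'\<in>{1..<l}. bad \<epsilon> L l' m2"
        then show ?thesis using lift_bad mm p(1) p1 by blast
      next
        assume "\<exists>us vs \<pi>. (us, vs) \<in> list_pairs m2 l \<and> \<pi> \<in> gprime_arc (sum_list us) (sum_list vs) (arc_width \<epsilon> L l) \<and> gnorm \<pi> = p"
        then obtain us vs \<pi> where uv: "(us, vs) \<in> list_pairs m2 l" "\<pi> \<in> gprime_arc (sum_list us) (sum_list vs) (arc_width \<epsilon> L l)" "gnorm \<pi> = p"
          by blast
        have "m = k * (gnorm \<pi> * m2)" using g(2) p(2) uv(3) by simp
        moreover have "smooth z m2" using sm m20 m'0 unfolding p(2) smooth_def
          by (auto simp: prime_factors_product)
        moreover have "real (om1 m2) \<le> V"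
        proof -
          have "big_omega m' = big_omega p + big_omega m2" unfolding p(2)
            using m20 p(1) by (intro big_omega_mult) (auto simp: prime_gt_0_nat)
          then show ?thesis using V om1_le_big_omega[of m2] by linarith
        qed
        moreover have "real (gnorm \<pi>) \<le> z" using False p uv(3) by (auto simp: not_less)
        ultimately show ?thesis using uv kS m20 p(3) by blast
      qed
    qed
  qed
qed

text \<open>Here the tuple itself is split, not its primitive part. One side may be empty, and then
  m is exceptional with the same l; hence the closed range of lengths.\<close>

lemma bad_mult_prime_cases:
  assumes \<epsilon>: "\<epsilon> > 0" and L: "L > 1" and m: "m > 0" and p: "prime p" "p mod 4 = 1" and l: "l \<ge> 1"
    and bad: "bad \<epsilon> L l (p * m)"
  shows "(\<exists>l'\<in>{1..l}. bad \<epsilon> L l' m) \<or>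
    (\<exists>us vs \<pi>. (us, vs) \<in> list_pairs m l \<and> \<pi> \<in> gprime_arc (sum_list us) (sum_list vs) (arc_width \<epsilon> L l) \<and> gnorm \<pi> = p)"
proof -
  obtain zs where zs: "length zs = l" "set zs \<subseteq> circ (p * m)" "0 < cmod (sum_list zs)"
    "cmod (sum_list zs) \<le> L powr - sep_exponent \<epsilon> l * sqrt (real (p * m))"
    using bad by (auto simp: bad_def small_sum_def)
  obtain \<pi> where \<pi>: "\<pi> \<in> circ p" using circ_prime_mod4_1[OF p] by auto
  obtain us vs where uv: "set us \<subseteq> circ m" "set vs \<subseteq> circ m" "length us + length vs = length zs"
     "sum_list zs = \<pi> * sum_list us + cnj \<pi> * sum_list vs"
    using circ_list_split[OF p(1) \<pi> zs(2)] by blast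
  have sp: "sqrt (real p) > 0" using p by (simp add: prime_gt_0_nat)
  have one: "bad \<epsilon> L l m" if ws: "length ws = l" "set ws \<subseteq> circ m" "cmod (sum_list zs) = sqrt (real p) * cmod (sum_list ws)" for ws
  proof -
    have "sqrt (real p) * cmod (sum_list ws) \<le> sqrt (real p) * (L powr - sep_exponent \<epsilon> l * sqrt (real m))"
      using zs(4) ws(3) by (simp add: real_sqrt_mult mult_ac)
    then have "cmod (sum_list ws) \<le> L powr - sep_exponent \<epsilon> l * sqrt (real m)" using sp by (simp add: mult_le_cancel_left)
    moreover have "0 < cmod (sum_list ws)" using zs(3) ws(3) sp by (simp add: zero_less_mult_iff)
    ultimately show ?thesis using ws unfolding bad_def small_sum_def by blast
  qed
  consider "vs = []" | "us = []" | "us \<noteq> []" "vs \<noteq> []" by blast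
  then show ?thesis
  proof cases
    case 1
    then have "bad \<epsilon> L l m" using uv zs(1) circ_cmod[OF \<pi>] by (intro one[of us]) (auto simp: norm_mult)
    then show ?thesis using l by auto
  next
    case 2
    then have "bad \<epsilon> L l m" using uv zs(1) circ_cmod[OF \<pi>] by (intro one[of vs]) (auto simp: norm_mult)
    then show ?thesis using l by auto
  next
    case 3
    have len: "length us + length vs = l" using uv(3) zs(1) by simp
    have "(\<exists>l'\<in>{1..<l}. bad \<epsilon> L l' m) \<or>
      (\<exists>us vs \<pi>. (us, vs) \<in> list_pairs m l \<and> \<pi> \<in> gprime_arc (sum_list us) (sum_list vs) (arc_width \<epsilon> L l) \<and> gnorm \<pi> = p)"
      by (rule split_cases[OF \<epsilon> L m p(1) \<pi> uv(1,2) 3 len]) (use zs uv(4) in auto)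
    then show ?thesis by (auto simp: less_imp_le)
  qed
qed


section \<open>Counting exceptional numbers\<close>

text \<open>Since the bound on \<open>om1\<close> refers to \<open>N\<close>, removing a prime
  congruent to 1 modulo 4 does not leave the set. The bound caps the number of l-tuples at a
  constant times L^(l (1/2 + \<eta>) log 2).\<close>

definition typical_set :: "real \<Rightarrow> nat \<Rightarrow> nat set" where
  "typical_set \<eta> N = {m. m \<in> two_squares \<and> m \<le> N \<and> real (om1 m) \<le> (1/2 + \<eta>) * ln (ln (real N))}"

definition bad_set :: "real \<Rightarrow> real \<Rightarrow> nat \<Rightarrow> nat \<Rightarrow> nat set" where
  "bad_set \<epsilon> \<eta> N l = {m \<in> typical_set \<eta> N. bad \<epsilon> (ln (real N)) l m}"

text \<open>A crude value D for which L^(-D) does not exceed the arc width, as the arc counts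
  require.\<close>

definition arc_dim :: "real \<Rightarrow> nat \<Rightarrow> real" where
  "arc_dim \<epsilon> l = real l + 1 + \<epsilon>"

text \<open>The norm from which on the sieved count with D = \<open>arc_dim\<close> is
  available.\<close>

definition sep_bound :: "real \<Rightarrow> nat \<Rightarrow> nat \<Rightarrow> real" where
  "sep_bound \<epsilon> N l = ln (real N) powr (2 * arc_dim \<epsilon> l + 2)"

lemma finite_typical_set [simp]: "finite (typical_set \<eta> N)" and finite_bad_set [simp]: "finite (bad_set \<epsilon> \<eta> N l)"
  by (simp_all add: typical_set_def bad_set_def)

lemma typical_set_pos: "m \<in> typical_set \<eta> N \<Longrightarrow> m > 0"
  by (auto simp: typical_set_def two_squares_pos)

lemma typical_set_cancel_prime:
  assumes "p * m \<in> typical_set \<eta> N" "prime p" "p mod 4 = 1"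
  shows "m \<in> typical_set \<eta> N" "p \<le> N" "p \<le> N div m"
proof -
  have S: "m \<in> two_squares" using assms two_squares_cancel_prime by (auto simp: typical_set_def)
  have m0: "m > 0" by (rule two_squares_pos[OF S])
  have p0: "p > 0" using assms(2) by (rule prime_gt_0_nat)
  have pm: "p * m \<le> N" using assms by (simp add: typical_set_def)
  have "om1 m \<le> om1 (p * m)" using m0 p0 by (intro om1_dvd_mono) auto
  then have "real (om1 m) \<le> (1/2 + \<eta>) * ln (ln (real N))" using assms(1) by (auto simp: typical_set_def)
  moreover have "m \<le> p * m" using p0 by simp
  then have "m \<le> N" using pm by linarith
  ultimately show "m \<in> typical_set \<eta> N" using S by (simp add: typical_set_def)
  have "p \<le> p * m" using m0 by simp
  then show "p \<le> N" using pm by linarith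
  show "p \<le> N div m" using pm m0 by (simp add: less_eq_div_iff_mult_less_eq)
qed

lemma arc_width_bounds:
  assumes "L > 1" "\<epsilon> > 0" "l \<ge> 1"
  shows "arc_width \<epsilon> L l < 1" "L powr - arc_dim \<epsilon> l \<le> arc_width \<epsilon> L l" "0 \<le> arc_width \<epsilon> L l" "arc_width \<epsilon> L l \<le> L powr - \<epsilon>"
proof -
  have p: "0 < real l / 2 * ln 2 + \<epsilon>" using assms by (intro add_nonneg_pos) auto
  have "arc_width \<epsilon> L l < L powr 0" unfolding arc_width_def using assms(1) p by (intro powr_less_mono) auto
  then show "arc_width \<epsilon> L l < 1" using assms(1) by simp
  have "real l / 2 * ln 2 \<le> real l / 2 * 1" using ln2_le_25_over_36 by (intro mult_left_mono) auto
  then have "real l / 2 * ln 2 + \<epsilon> \<le> arc_dim \<epsilon> l" using assms(2) by (simp add: arc_dim_def)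
  then show "L powr - arc_dim \<epsilon> l \<le> arc_width \<epsilon> L l" unfolding arc_width_def using assms(1) by (intro powr_mono) auto
  show "0 \<le> arc_width \<epsilon> L l" by (simp add: arc_width_def)
  show "arc_width \<epsilon> L l \<le> L powr - \<epsilon>" unfolding arc_width_def using assms(1) by (intro powr_mono) auto
qed

lemma card_list_pairs_le:
  assumes "m > 0" "real (om1 m) \<le> V"
  shows "real (card (list_pairs m l)) \<le> real (l + 1) * 4 ^ l * exp (real l * ln 2 * V)"
proof -
  have "card (list_pairs m l) \<le> (l + 1) * card (circ m) ^ l" by (rule list_pairs_bound)
  also have "\<dots> \<le> (l + 1) * (4 * 2 ^ om1 m) ^ l" by (intro mult_left_mono power_mono card_circ_le assms) auto
  finally have "real (card (list_pairs m l)) \<le> real ((l + 1) * (4 * 2 ^ om1 m) ^ l)" by (simp only: of_nat_le_iff)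
  also have "\<dots> = real (l + 1) * 4 ^ l * (2 ^ om1 m) ^ l" by (simp add: power_mult_distrib algebra_simps)
  also have "((2::real) ^ om1 m) ^ l = exp (real l * (real (om1 m) * ln 2))"
    by (simp add: exp_of_nat_mult)
  also have "\<dots> \<le> exp (real l * ln 2 * V)"
  proof -
    have "real l * ln 2 * real (om1 m) \<le> real l * ln 2 * V" using assms(2) by (intro mult_left_mono) auto
    then show ?thesis by (simp add: mult_ac)
  qed
  finally show ?thesis by (simp add: mult_left_mono)
qed

text \<open>The balance behind c(l): the number of pairs and the width have exponents (l/2) log 2 +
  \<eta> l log 2 and -(l/2) log 2 - \<epsilon>. The leading terms cancel, and a small \<eta> leaves
  a negative power.\<close>

lemma card_list_pairs_arc_width:
  assumes m: "m \<in> typical_set \<eta> N" and L: "ln (real N) > 1"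
  shows "real (card (list_pairs m l)) * arc_width \<epsilon> (ln (real N)) l \<le> real (l + 1) * 4 ^ l * ln (real N) powr (\<eta> * real l * ln 2 - \<epsilon>)"
proof -
  define L where "L = ln (real N)"
  have "real (card (list_pairs m l)) \<le> real (l + 1) * 4 ^ l * exp (real l * ln 2 * ((1/2 + \<eta>) * ln L))"
    by (rule card_list_pairs_le) (use m typical_set_pos[OF m] in \<open>auto simp: typical_set_def L_def\<close>)
  also have "exp (real l * ln 2 * ((1/2 + \<eta>) * ln L)) = L powr (real l * ln 2 * (1/2 + \<eta>))"
    using L by (simp add: powr_def L_def)
  finally have "real (card (list_pairs m l)) * arc_width \<epsilon> L l \<le> real (l + 1) * 4 ^ l * L powr (real l * ln 2 * (1/2 + \<eta>)) * arc_width \<epsilon> L l"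
    by (intro mult_right_mono) (auto simp: arc_width_def)
  also have "\<dots> = real (l + 1) * 4 ^ l * (L powr (real l * ln 2 * (1/2 + \<eta>)) * L powr (- (real l / 2 * ln 2 + \<epsilon>)))"
    unfolding arc_width_def by (simp only: mult.assoc)
  also have "L powr (real l * ln 2 * (1/2 + \<eta>)) * L powr (- (real l / 2 * ln 2 + \<epsilon>)) = L powr (\<eta> * real l * ln 2 - \<epsilon>)"
  proof -
    have "real l * ln 2 * (1/2 + \<eta>) + - (real l / 2 * ln 2 + \<epsilon>) = \<eta> * real l * ln 2 - \<epsilon>" by (simp add: algebra_simps)
    then show ?thesis by (simp only: powr_add[symmetric])
  qed
  finally show ?thesis by (simp add: L_def)
qed

definition arc_primes :: "real \<Rightarrow> nat \<Rightarrow> nat \<Rightarrow> real \<Rightarrow> real \<Rightarrow> complex list \<times> complex list \<Rightarrow> complex set" where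
  "arc_primes \<epsilon> N l W Z uv = {\<pi> \<in> gprime_arc (sum_list (fst uv)) (sum_list (snd uv)) (arc_width \<epsilon> (ln (real N)) l).
     W \<le> real (gnorm \<pi>) \<and> real (gnorm \<pi>) \<le> Z}"

lemma finite_arc_primes:
  assumes "ln (real N) > 1" "\<epsilon> > 0" "l \<ge> 1" "uv \<in> list_pairs m l"
  shows "finite (arc_primes \<epsilon> N l W Z uv)"
  unfolding arc_primes_def
  by (rule finite_arc_le) (use assms arc_width_bounds[OF assms(1-3)] in \<open>auto simp: list_pairs_def\<close>)

section \<open>Sums over pairs of lists and Gaussian primes in arcs\<close>

lemma two_squares_recip_sum_le:
  obtains C where "C > 0" "\<And>N. N \<ge> 3 \<Longrightarrow> (\<Sum>m | m \<in> two_squares \<and> m \<le> N. 1 / real m) \<le> C * sqrt (ln (real N))"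
proof -
  obtain C where C: "C > 0" "\<And>y N. 1 \<le> y \<Longrightarrow> y \<le> 3/2 \<Longrightarrow> N \<ge> 3 \<Longrightarrow>
    (\<Sum>m | m \<in> two_squares \<and> m \<le> N. y ^ om1 m / real m) \<le> C * ln (real N) powr (y / 2)"
    using two_squares_sum_om1 by blast
  have "(\<Sum>m | m \<in> two_squares \<and> m \<le> N. 1 / real m) \<le> C * sqrt (ln (real N))" if "N \<ge> 3" for N
    using C(2)[of 1 N] that by (simp add: powr_half_sqrt)
  then show ?thesis using that C(1) by blast
qed

lemma typical_set_recip_sum_le:
  obtains C where "C > 0" "\<And>\<eta> N. N \<ge> 3 \<Longrightarrow> (\<Sum>m\<in>typical_set \<eta> N. 1 / real m) \<le> C * sqrt (ln (real N))"
proof -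
  obtain C where C: "C > 0" "\<And>N. N \<ge> 3 \<Longrightarrow> (\<Sum>m | m \<in> two_squares \<and> m \<le> N. 1 / real m) \<le> C * sqrt (ln (real N))"
    using two_squares_recip_sum_le by blast
  have "(\<Sum>m\<in>typical_set \<eta> N. 1 / real m) \<le> (\<Sum>m | m \<in> two_squares \<and> m \<le> N. 1 / real m)" for \<eta> N
    by (intro sum_mono2) (auto simp: typical_set_def)
  then show ?thesis using that C order_trans by meson
qed

lemma arc_sum_recip_le:
  assumes \<epsilon>: "\<epsilon> > 0" and l: "l \<ge> 1"
  obtains C where "C > 0" "\<forall>\<^sub>F N :: nat in sequentially.
    (\<Sum>m\<in>typical_set \<eta> N. \<Sum>uv\<in>list_pairs m l. \<Sum>\<pi>\<in>arc_primes \<epsilon> N l (sep_bound \<epsilon> N l) (real N) uv. 1 / (real (gnorm \<pi>) * real m))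
     \<le> C * sqrt (ln (real N)) * (ln (real N) powr (\<eta> * real l * ln 2 - \<epsilon>) * ln (ln (real N)) ^ 4)"
proof -
  have D: "arc_dim \<epsilon> l \<ge> 1" using \<epsilon> by (simp add: arc_dim_def)
  obtain C l0 where C: "C > 0" "\<And>L Z A B \<theta>. L > 0 \<Longrightarrow> ln L \<ge> l0 \<Longrightarrow> Z > 0 \<Longrightarrow> ln Z \<le> L \<Longrightarrow>
     L powr (- arc_dim \<epsilon> l) \<le> \<theta> \<Longrightarrow> \<theta> < 1 \<Longrightarrow> B \<noteq> 0 \<Longrightarrow>
     (\<Sum>\<pi>\<in>{\<pi> \<in> gprime_arc A B \<theta>. L powr (2 * arc_dim \<epsilon> l + 2) \<le> real (gnorm \<pi>) \<and> real (gnorm \<pi>) \<le> Z}. 1 / real (gnorm \<pi>))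
      \<le> C * (\<theta> * (ln L) ^ 4)"
    using arc_recip_sum[OF D] by blast
  obtain C1 where C1: "C1 > 0" "\<And>\<eta> N. N \<ge> 3 \<Longrightarrow> (\<Sum>m\<in>typical_set \<eta> N. 1 / real m) \<le> C1 * sqrt (ln (real N))"
    using typical_set_recip_sum_le by blast
  define K where "K = C1 * (real (l + 1) * 4 ^ l * C)"
  have "\<forall>\<^sub>F N :: nat in sequentially. ln (real N) > 1 \<and> ln (ln (real N)) \<ge> max l0 0 \<and> N \<ge> 3"
    by (intro eventually_conj eventually_ge_at_top; real_asymp)
  then have "\<forall>\<^sub>F N :: nat in sequentially.
    (\<Sum>m\<in>typical_set \<eta> N. \<Sum>uv\<in>list_pairs m l. \<Sum>\<pi>\<in>arc_primes \<epsilon> N l (sep_bound \<epsilon> N l) (real N) uv. 1 / (real (gnorm \<pi>) * real m))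
     \<le> K * sqrt (ln (real N)) * (ln (real N) powr (\<eta> * real l * ln 2 - \<epsilon>) * ln (ln (real N)) ^ 4)"
  proof eventually_elim
    case (elim N)
    define L where "L = ln (real N)"
    define Q where "Q = L powr (\<eta> * real l * ln 2 - \<epsilon>) * ln L ^ 4"
    have L: "L > 1" "ln L \<ge> l0" "ln L \<ge> 0" "N \<ge> 3" using elim by (auto simp: L_def)
    have Q0: "Q \<ge> 0" using L by (simp add: Q_def)
    note aw = arc_width_bounds[OF L(1) \<epsilon> l]
    have "(\<Sum>m\<in>typical_set \<eta> N. \<Sum>uv\<in>list_pairs m l. \<Sum>\<pi>\<in>arc_primes \<epsilon> N l (sep_bound \<epsilon> N l) (real N) uv. 1 / (real (gnorm \<pi>) * real m))
      \<le> (\<Sum>m\<in>typical_set \<eta> N. real (l + 1) * 4 ^ l * C * Q * (1 / real m))"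
    proof (intro sum_mono)
      fix m assume m: "m \<in> typical_set \<eta> N"
      have "(\<Sum>uv\<in>list_pairs m l. \<Sum>\<pi>\<in>arc_primes \<epsilon> N l (sep_bound \<epsilon> N l) (real N) uv. 1 / (real (gnorm \<pi>) * real m))
        \<le> (\<Sum>uv\<in>list_pairs m l. C * (arc_width \<epsilon> L l * ln L ^ 4) * (1 / real m))"
      proof (rule sum_mono)
        fix uv assume uv: "uv \<in> list_pairs m l"
        have "(\<Sum>\<pi>\<in>arc_primes \<epsilon> N l (sep_bound \<epsilon> N l) (real N) uv. 1 / (real (gnorm \<pi>) * real m))
          = (\<Sum>\<pi>\<in>arc_primes \<epsilon> N l (sep_bound \<epsilon> N l) (real N) uv. 1 / real (gnorm \<pi>)) * (1 / real m)"
          unfolding sum_distrib_right by simp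
        also have "\<dots> \<le> C * (arc_width \<epsilon> L l * ln L ^ 4) * (1 / real m)"
        proof (rule mult_right_mono)
          show "(\<Sum>\<pi>\<in>arc_primes \<epsilon> N l (sep_bound \<epsilon> N l) (real N) uv. 1 / real (gnorm \<pi>)) \<le> C * (arc_width \<epsilon> L l * ln L ^ 4)"
            unfolding arc_primes_def sep_bound_def L_def[symmetric]
            by (rule C(2)) (use L aw uv in \<open>auto simp: L_def list_pairs_def\<close>)
        qed simp
        finally show "(\<Sum>\<pi>\<in>arc_primes \<epsilon> N l (sep_bound \<epsilon> N l) (real N) uv. 1 / (real (gnorm \<pi>) * real m))
          \<le> C * (arc_width \<epsilon> L l * ln L ^ 4) * (1 / real m)" .
      qed
      also have "\<dots> = (real (card (list_pairs m l)) * arc_width \<epsilon> L l) * (C * ln L ^ 4 * (1 / real m))" by simp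
      also have "\<dots> \<le> (real (l + 1) * 4 ^ l * L powr (\<eta> * real l * ln 2 - \<epsilon>)) * (C * ln L ^ 4 * (1 / real m))"
        using card_list_pairs_arc_width[OF m, of l \<epsilon>] L C(1) unfolding L_def by (intro mult_right_mono) auto
      also have "\<dots> = real (l + 1) * 4 ^ l * C * Q * (1 / real m)" unfolding Q_def by (simp only: mult_ac)
      finally show "(\<Sum>uv\<in>list_pairs m l. \<Sum>\<pi>\<in>arc_primes \<epsilon> N l (sep_bound \<epsilon> N l) (real N) uv. 1 / (real (gnorm \<pi>) * real m))
        \<le> real (l + 1) * 4 ^ l * C * Q * (1 / real m)" .
    qed
    also have "\<dots> = real (l + 1) * 4 ^ l * C * Q * (\<Sum>m\<in>typical_set \<eta> N. 1 / real m)" by (rule sum_distrib_left[symmetric])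
    also have "\<dots> \<le> real (l + 1) * 4 ^ l * C * Q * (C1 * sqrt L)"
      using C1(2)[OF L(4), of \<eta>] C(1) Q0 unfolding L_def by (intro mult_left_mono) auto
    also have "\<dots> = K * sqrt L * Q" unfolding K_def by (simp only: mult_ac)
    finally show ?case unfolding Q_def L_def .
  qed
  moreover have "K > 0" unfolding K_def using C C1 by (intro mult_pos_pos) auto
  ultimately show ?thesis using that by blast
qed

text \<open>The form needed for natural density: for each m the norm runs up to N/m with weight log
  p, so the count of the arc is used directly, and the harmonic sum that costs one more log log N
  does not arise.\<close>

lemma arc_sum_ln_le:
  assumes \<epsilon>: "\<epsilon> > 0" and l: "l \<ge> 1"
  obtains C where "C > 0" "\<forall>\<^sub>F N :: nat in sequentially.
    (\<Sum>m\<in>typical_set \<eta> N. \<Sum>uv\<in>list_pairs m l. \<Sum>\<pi>\<in>arc_primes \<epsilon> N l (sep_bound \<epsilon> N l) (real (N div m)) uv. ln (real (gnorm \<pi>)))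
     \<le> C * (real N * sqrt (ln (real N))) * (ln (real N) powr (\<eta> * real l * ln 2 - \<epsilon>) * ln (ln (real N)) ^ 3)"
proof -
  have D: "arc_dim \<epsilon> l \<ge> 1" using \<epsilon> by (simp add: arc_dim_def)
  obtain C l0 where C: "C > 0" "\<And>L T A B \<theta>. L > 0 \<Longrightarrow> ln L \<ge> l0 \<Longrightarrow> L powr (2 * arc_dim \<epsilon> l + 2) \<le> T \<Longrightarrow> ln T \<le> L \<Longrightarrow>
     L powr (- arc_dim \<epsilon> l) \<le> \<theta> \<Longrightarrow> \<theta> < 1 \<Longrightarrow> B \<noteq> 0 \<Longrightarrow>
     real (card {\<pi> \<in> gprime_arc A B \<theta>. real (gnorm \<pi>) \<le> T}) * ln T \<le> C * (\<theta> * T * (ln L) ^ 3)"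
    using arc_count[OF D] by blast
  obtain C1 where C1: "C1 > 0" "\<And>\<eta> N. N \<ge> 3 \<Longrightarrow> (\<Sum>m\<in>typical_set \<eta> N. 1 / real m) \<le> C1 * sqrt (ln (real N))"
    using typical_set_recip_sum_le by blast
  define K where "K = C1 * (real (l + 1) * 4 ^ l * C)"
  have "\<forall>\<^sub>F N :: nat in sequentially. ln (real N) > 1 \<and> ln (ln (real N)) \<ge> max l0 0 \<and> N \<ge> 3"
    by (intro eventually_conj eventually_ge_at_top; real_asymp)
  then have "\<forall>\<^sub>F N :: nat in sequentially.
    (\<Sum>m\<in>typical_set \<eta> N. \<Sum>uv\<in>list_pairs m l. \<Sum>\<pi>\<in>arc_primes \<epsilon> N l (sep_bound \<epsilon> N l) (real (N div m)) uv. ln (real (gnorm \<pi>)))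
     \<le> K * (real N * sqrt (ln (real N))) * (ln (real N) powr (\<eta> * real l * ln 2 - \<epsilon>) * ln (ln (real N)) ^ 3)"
  proof eventually_elim
    case (elim N)
    define L where "L = ln (real N)"
    define Q where "Q = L powr (\<eta> * real l * ln 2 - \<epsilon>) * ln L ^ 3"
    have L: "L > 1" "ln L \<ge> l0" "ln L \<ge> 0" "N \<ge> 3" using elim by (auto simp: L_def)
    have Q0: "Q \<ge> 0" using L by (simp add: Q_def)
    note aw = arc_width_bounds[OF L(1) \<epsilon> l]
    have "(\<Sum>m\<in>typical_set \<eta> N. \<Sum>uv\<in>list_pairs m l. \<Sum>\<pi>\<in>arc_primes \<epsilon> N l (sep_bound \<epsilon> N l) (real (N div m)) uv. ln (real (gnorm \<pi>)))
      \<le> (\<Sum>m\<in>typical_set \<eta> N. real (l + 1) * 4 ^ l * C * Q * real N * (1 / real m))"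
    proof (intro sum_mono)
      fix m assume m: "m \<in> typical_set \<eta> N"
      define T where "T = real (N div m)"
      have TN: "T \<le> real N / real m" unfolding T_def by (rule real_div_le)
      have "(\<Sum>uv\<in>list_pairs m l. \<Sum>\<pi>\<in>arc_primes \<epsilon> N l (sep_bound \<epsilon> N l) T uv. ln (real (gnorm \<pi>)))
        \<le> (\<Sum>uv\<in>list_pairs m l. C * (arc_width \<epsilon> L l * (real N / real m) * ln L ^ 3))"
      proof (rule sum_mono)
        fix uv assume uv: "uv \<in> list_pairs m l"
        define A B where "A = sum_list (fst uv)" and "B = sum_list (snd uv)"
        have B: "B \<noteq> 0" using uv by (auto simp: list_pairs_def B_def)
        define X where "X = arc_primes \<epsilon> N l (sep_bound \<epsilon> N l) T uv"
        show "(\<Sum>\<pi>\<in>X. ln (real (gnorm \<pi>))) \<le> C * (arc_width \<epsilon> L l * (real N / real m) * ln L ^ 3)"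
        proof (cases "L powr (2 * arc_dim \<epsilon> l + 2) \<le> T")
          case False
          then have "X = {}" by (auto simp: X_def arc_primes_def sep_bound_def L_def)
          then show ?thesis using C(1) aw L by simp
        next
          case True
          have T0: "T > 0" using True L(1) less_le_trans[of 0 "L powr (2 * arc_dim \<epsilon> l + 2)" T] by simp
          have "T \<le> real N" unfolding T_def by simp
          then have lT: "ln T \<le> L" unfolding L_def using T0 by (subst ln_le_cancel_iff) auto
          have T1: "T \<ge> 1" using T0 unfolding T_def by simp
          have fin: "finite {\<pi> \<in> gprime_arc A B (arc_width \<epsilon> L l). real (gnorm \<pi>) \<le> T}"
            using finite_arc_le[OF B aw(1,3), of A "\<lambda>_. True" T] by simp
          have "(\<Sum>\<pi>\<in>X. ln (real (gnorm \<pi>))) \<le> (\<Sum>\<pi>\<in>{\<pi> \<in> gprime_arc A B (arc_width \<epsilon> L l). real (gnorm \<pi>) \<le> T}. ln T)"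
          proof (rule order_trans)
            show "(\<Sum>\<pi>\<in>X. ln (real (gnorm \<pi>))) \<le> (\<Sum>\<pi>\<in>X. ln T)"
            proof (rule sum_mono)
              fix \<pi> assume p: "\<pi> \<in> X"
              then have "real (gnorm \<pi>) > 0" "real (gnorm \<pi>) \<le> T" by (auto simp: X_def arc_primes_def arc_gnorm_pos)
              then show "ln (real (gnorm \<pi>)) \<le> ln T" using T0 by (subst ln_le_cancel_iff) auto
            qed
            show "(\<Sum>\<pi>\<in>X. ln T) \<le> (\<Sum>\<pi>\<in>{\<pi> \<in> gprime_arc A B (arc_width \<epsilon> L l). real (gnorm \<pi>) \<le> T}. ln T)"
              by (intro sum_mono2 fin) (use T1 in \<open>auto simp: X_def arc_primes_def A_def B_def L_def\<close>)
          qed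
          also have "\<dots> = real (card {\<pi> \<in> gprime_arc A B (arc_width \<epsilon> L l). real (gnorm \<pi>) \<le> T}) * ln T" by simp
          also have "\<dots> \<le> C * (arc_width \<epsilon> L l * T * ln L ^ 3)" by (rule C(2)) (use L True lT aw B in auto)
          also have "\<dots> \<le> C * (arc_width \<epsilon> L l * (real N / real m) * ln L ^ 3)"
            using C(1) aw(3) TN L(3) by (intro mult_left_mono mult_right_mono) auto
          finally show ?thesis .
        qed
      qed
      also have "\<dots> = (real (card (list_pairs m l)) * arc_width \<epsilon> L l) * (C * ln L ^ 3 * (real N * (1 / real m)))" by simp
      also have "\<dots> \<le> (real (l + 1) * 4 ^ l * L powr (\<eta> * real l * ln 2 - \<epsilon>)) * (C * ln L ^ 3 * (real N * (1 / real m)))"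
        using card_list_pairs_arc_width[OF m, of l \<epsilon>] L C(1) unfolding L_def by (intro mult_right_mono) auto
      also have "\<dots> = real (l + 1) * 4 ^ l * C * Q * real N * (1 / real m)" unfolding Q_def by (simp only: mult_ac)
      finally show "(\<Sum>uv\<in>list_pairs m l. \<Sum>\<pi>\<in>arc_primes \<epsilon> N l (sep_bound \<epsilon> N l) (real (N div m)) uv. ln (real (gnorm \<pi>)))
        \<le> real (l + 1) * 4 ^ l * C * Q * real N * (1 / real m)" unfolding T_def .
    qed
    also have "\<dots> = real (l + 1) * 4 ^ l * C * Q * real N * (\<Sum>m\<in>typical_set \<eta> N. 1 / real m)" by (rule sum_distrib_left[symmetric])
    also have "\<dots> \<le> real (l + 1) * 4 ^ l * C * Q * real N * (C1 * sqrt L)"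
      using C1(2)[OF L(4), of \<eta>] C(1) Q0 unfolding L_def by (intro mult_left_mono) auto
    also have "\<dots> = K * (real N * sqrt L) * Q" unfolding K_def by (simp only: mult_ac)
    finally show ?case unfolding Q_def L_def .
  qed
  moreover have "K > 0" unfolding K_def using C C1 by (intro mult_pos_pos) auto
  ultimately show ?thesis using that by blast
qed

text \<open>The index sets \<open>I0\<close> to \<open>I3\<close> parametrise the four alternatives
  of \<open>bad_cover\<close>. All terms are nonnegative, so an m that is reached several times only
  enlarges the right-hand side.\<close>

lemma bad_set_sum_cover:
  fixes V w :: real
  assumes \<epsilon>: "\<epsilon> > 0" and L: "ln (real N) > 1" and l: "l \<ge> 1"
    and w: "w \<ge> 1" "w powr V < ln (real N) powr (2 * \<epsilon>)"
  defines "z \<equiv> sep_bound \<epsilon> N l"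
  shows "(\<Sum>m\<in>bad_set \<epsilon> \<eta> N l. 1 / real m) \<le>
    (\<Sum>l'\<in>{1..<l}. (\<Sum>m\<in>bad_set \<epsilon> \<eta> N l'. 1 / real m) * (\<Sum>p | prime p \<and> real p \<le> real N. 1 / real p)) +
    (\<Sum>m\<in>typical_set \<eta> N. \<Sum>uv\<in>list_pairs m l. \<Sum>\<pi>\<in>arc_primes \<epsilon> N l z (real N) uv. 1 / (real (gnorm \<pi>) * real m)) +
    (\<Sum>k | k \<in> two_squares \<and> k \<le> N. 1 / real k) * (\<Sum>d | d \<in> {1..N} \<and> smooth z d \<and> V \<le> real (big_omega d). 1 / real d) +
    (\<Sum>k | k \<in> two_squares \<and> k \<le> N. 1 / real k) *
      (\<Sum>d | d \<in> {1..N} \<and> smooth z d \<and> real (om1 d) \<le> V. \<Sum>uv\<in>list_pairs d l. \<Sum>\<pi>\<in>arc_primes \<epsilon> N l w z uv. 1 / (real (gnorm \<pi>) * real d))"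
proof -
  define L where "L = ln (real N)"
  have L1: "L > 1" using L by (simp add: L_def)
  define G where "G = bad_set \<epsilon> \<eta> N l"
  define Pr where "Pr = {p. prime p \<and> real p \<le> real N}"
  define S where "S = {k. k \<in> two_squares \<and> k \<le> N}"
  define F2 where "F2 = {d. d \<in> {1..N} \<and> smooth z d \<and> V \<le> real (big_omega d)}"
  define F3 where "F3 = {d. d \<in> {1..N} \<and> smooth z d \<and> real (om1 d) \<le> V}"
  have fin: "finite Pr" "finite S" "finite F2" "finite F3" by (simp_all add: Pr_def S_def F2_def F3_def)
  define I0 where "I0 = (SIGMA l':{1..<l}. bad_set \<epsilon> \<eta> N l' \<times> Pr)"
  define I1 where "I1 = (SIGMA m:typical_set \<eta> N. SIGMA uv:list_pairs m l. arc_primes \<epsilon> N l z (real N) uv)"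
  define I2 where "I2 = S \<times> F2"
  define I3 where "I3 = S \<times> (SIGMA d:F3. SIGMA uv:list_pairs d l. arc_primes \<epsilon> N l w z uv)"
  define g0 :: "nat \<times> (nat \<times> nat) \<Rightarrow> nat" where "g0 = (\<lambda>(l', m, p). p * m)"
  define g1 :: "nat \<times> ((complex list \<times> complex list) \<times> complex) \<Rightarrow> nat" where "g1 = (\<lambda>(m, uv, \<pi>). gnorm \<pi> * m)"
  define g2 :: "nat \<times> nat \<Rightarrow> nat" where "g2 = (\<lambda>(k, d). k * d)"
  define g3 :: "nat \<times> (nat \<times> ((complex list \<times> complex list) \<times> complex)) \<Rightarrow> nat" where "g3 = (\<lambda>(k, d, uv, \<pi>). k * (gnorm \<pi> * d))"
  note finA = finite_arc_primes[OF L \<epsilon> l]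
  have finI1: "finite (SIGMA uv:list_pairs m l. arc_primes \<epsilon> N l W Z uv)" for m W Z
    using finA list_pairs_bound(1) by (intro finite_SigmaI) auto
  have finI: "finite I0" "finite I1" "finite I2" "finite I3"
    unfolding I0_def I1_def I2_def I3_def using fin finI1 by (auto intro!: finite_SigmaI finite_cartesian_product)
  have cover: "G \<subseteq> g0 ` I0 \<union> g1 ` I1 \<union> g2 ` I2 \<union> g3 ` I3"
  proof
    fix m assume m: "m \<in> G"
    then have mT: "m \<in> typical_set \<eta> N" and mb: "bad \<epsilon> L l m" by (auto simp: G_def bad_set_def L_def)
    have m0: "m > 0" by (rule typical_set_pos[OF mT])
    have mN: "m \<le> N" using mT by (simp add: typical_set_def)
    have w': "w powr V < L powr (2 * \<epsilon>)" using w by (simp add: L_def)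
    consider
      (a) l' p m2 where "l' \<in> {1..<l}" "prime p" "p mod 4 = 1" "m = p * m2" "bad \<epsilon> L l' m2"
    | (b) m2 us vs \<pi> where "m = gnorm \<pi> * m2" "gnorm \<pi> mod 4 = 1" "(us, vs) \<in> list_pairs m2 l"
        "\<pi> \<in> gprime_arc (sum_list us) (sum_list vs) (arc_width \<epsilon> L l)" "z < real (gnorm \<pi>)"
    | (c) k m' where "m = k * m'" "k \<in> two_squares" "m' > 0" "smooth z m'" "V \<le> real (big_omega m')"
    | (d) k m2 us vs \<pi> where "m = k * (gnorm \<pi> * m2)" "k \<in> two_squares" "m2 > 0" "smooth z m2" "real (om1 m2) \<le> V"
        "(us, vs) \<in> list_pairs m2 l" "\<pi> \<in> gprime_arc (sum_list us) (sum_list vs) (arc_width \<epsilon> L l)"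
        "w \<le> real (gnorm \<pi>)" "real (gnorm \<pi>) \<le> z"
      using bad_cover[OF \<epsilon> L1 m0 l mb w(1) w', of z] by blast
    then show "m \<in> g0 ` I0 \<union> g1 ` I1 \<union> g2 ` I2 \<union> g3 ` I3"
    proof cases
      case a
      have t: "m2 \<in> typical_set \<eta> N" "p \<le> N" using typical_set_cancel_prime[of p m2 \<eta> N] a mT by auto
      then have "(l', m2, p) \<in> I0" using a by (auto simp: I0_def bad_set_def L_def Pr_def)
      moreover have "m = g0 (l', m2, p)" using a by (simp add: g0_def)
      ultimately show ?thesis by blast
    next
      case b
      have pr: "prime (gnorm \<pi>)" using b(4) by (simp add: gprime_arc_def)
      have t: "m2 \<in> typical_set \<eta> N" "gnorm \<pi> \<le> N" using typical_set_cancel_prime[of "gnorm \<pi>" m2 \<eta> N] b mT pr by auto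
      then have "(m2, (us, vs), \<pi>) \<in> I1" using b by (auto simp: I1_def arc_primes_def L_def)
      moreover have "m = g1 (m2, (us, vs), \<pi>)" using b by (simp add: g1_def)
      ultimately show ?thesis by blast
    next
      case c
      have "k \<le> m" "m' \<le> m" using c m0 by auto
      then have "k \<le> N" "m' \<le> N" using mN by linarith+
      then have "(k, m') \<in> I2" using c mN by (auto simp: I2_def S_def F2_def)
      moreover have "m = g2 (k, m')" using c by (simp add: g2_def)
      ultimately show ?thesis by blast
    next
      case d
      have pos: "k > 0" "gnorm \<pi> > 0" using d(1) m0 by (auto intro!: Nat.gr0I)
      have "k * 1 \<le> k * (gnorm \<pi> * m2)" using pos d(3) by (intro mult_left_mono) auto
      moreover have "1 * m2 \<le> (k * gnorm \<pi>) * m2" using pos by (intro mult_right_mono) auto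
      ultimately have "k \<le> m" "m2 \<le> m" using d(1) by (simp_all add: mult.assoc)
      then have "k \<le> N" "m2 \<le> N" using mN by linarith+
      then have "(k, m2, (us, vs), \<pi>) \<in> I3" using d mN by (auto simp: I3_def S_def F3_def arc_primes_def L_def)
      moreover have "m = g3 (k, m2, (us, vs), \<pi>)" using d by (simp add: g3_def)
      ultimately show ?thesis by blast
    qed
  qed
  have "(\<Sum>m\<in>G. 1 / real m) \<le> (\<Sum>m\<in>g0 ` I0 \<union> g1 ` I1 \<union> g2 ` I2 \<union> g3 ` I3. 1 / real m)"
    by (intro sum_mono2 cover) (use finI in auto)
  also have "\<dots> \<le> (\<Sum>m\<in>g0 ` I0 \<union> g1 ` I1 \<union> g2 ` I2. 1 / real m) + (\<Sum>m\<in>g3 ` I3. 1 / real m)"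
    by (intro sum_Un_le_real) (use finI in auto)
  also have "(\<Sum>m\<in>g0 ` I0 \<union> g1 ` I1 \<union> g2 ` I2. 1 / real m) \<le> (\<Sum>m\<in>g0 ` I0 \<union> g1 ` I1. 1 / real m) + (\<Sum>m\<in>g2 ` I2. 1 / real m)"
    by (intro sum_Un_le_real) (use finI in auto)
  also have "(\<Sum>m\<in>g0 ` I0 \<union> g1 ` I1. 1 / real m) \<le> (\<Sum>m\<in>g0 ` I0. 1 / real m) + (\<Sum>m\<in>g1 ` I1. 1 / real m)"
    by (intro sum_Un_le_real) (use finI in auto)
  finally have tot: "(\<Sum>m\<in>G. 1 / real m) \<le> (\<Sum>m\<in>g0 ` I0. 1 / real m) + (\<Sum>m\<in>g1 ` I1. 1 / real m) + (\<Sum>m\<in>g2 ` I2. 1 / real m) + (\<Sum>m\<in>g3 ` I3. 1 / real m)"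
    by simp
  have s0: "(\<Sum>m\<in>g0 ` I0. 1 / real m) \<le> (\<Sum>l'\<in>{1..<l}. (\<Sum>m\<in>bad_set \<epsilon> \<eta> N l'. 1 / real m) * (\<Sum>p\<in>Pr. 1 / real p))"
  proof -
    have "(\<Sum>m\<in>g0 ` I0. 1 / real m) \<le> (\<Sum>i\<in>I0. 1 / real (g0 i))"
      by (rule sum_le_sum_cover[OF finI(1) order_refl]) auto
    also have "\<dots> = (\<Sum>l'\<in>{1..<l}. \<Sum>(m,p)\<in>bad_set \<epsilon> \<eta> N l' \<times> Pr. 1 / real (g0 (l', m, p)))"
      unfolding I0_def using fin by (subst sum.Sigma) (auto simp: case_prod_unfold)
    also have "\<dots> = (\<Sum>l'\<in>{1..<l}. (\<Sum>m\<in>bad_set \<epsilon> \<eta> N l'. 1 / real m) * (\<Sum>p\<in>Pr. 1 / real p))"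
    proof (rule sum.cong[OF refl])
      fix l'
      have "1 / real (g0 (l', m, p)) = 1 / real m * (1 / real p)" for m p by (simp add: g0_def)
      then show "(\<Sum>(m,p)\<in>bad_set \<epsilon> \<eta> N l' \<times> Pr. 1 / real (g0 (l', m, p))) = (\<Sum>m\<in>bad_set \<epsilon> \<eta> N l'. 1 / real m) * (\<Sum>p\<in>Pr. 1 / real p)"
        by (simp only: sum_product sum.cartesian_product)
    qed
    finally show ?thesis .
  qed
  have s1: "(\<Sum>m\<in>g1 ` I1. 1 / real m) \<le>
    (\<Sum>m\<in>typical_set \<eta> N. \<Sum>uv\<in>list_pairs m l. \<Sum>\<pi>\<in>arc_primes \<epsilon> N l z (real N) uv. 1 / (real (gnorm \<pi>) * real m))"
  proof -
    have "(\<Sum>m\<in>g1 ` I1. 1 / real m) \<le> (\<Sum>i\<in>I1. 1 / real (g1 i))"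
      by (rule sum_le_sum_cover[OF finI(2) order_refl]) auto
    also have "\<dots> = (\<Sum>m\<in>typical_set \<eta> N. \<Sum>x\<in>(SIGMA uv:list_pairs m l. arc_primes \<epsilon> N l z (real N) uv). 1 / real (g1 (m, x)))"
      unfolding I1_def using finI1 by (subst sum.Sigma) (auto simp: case_prod_unfold)
    also have "\<dots> = (\<Sum>m\<in>typical_set \<eta> N. \<Sum>uv\<in>list_pairs m l. \<Sum>\<pi>\<in>arc_primes \<epsilon> N l z (real N) uv. 1 / (real (gnorm \<pi>) * real m))"
    proof (rule sum.cong[OF refl])
      fix m
      show "(\<Sum>x\<in>(SIGMA uv:list_pairs m l. arc_primes \<epsilon> N l z (real N) uv). 1 / real (g1 (m, x)))
        = (\<Sum>uv\<in>list_pairs m l. \<Sum>\<pi>\<in>arc_primes \<epsilon> N l z (real N) uv. 1 / (real (gnorm \<pi>) * real m))"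
        using finA list_pairs_bound(1) by (subst sum.Sigma) (auto simp: g1_def case_prod_unfold)
    qed
    finally show ?thesis .
  qed
  have s2: "(\<Sum>m\<in>g2 ` I2. 1 / real m) \<le> (\<Sum>k\<in>S. 1 / real k) * (\<Sum>d\<in>F2. 1 / real d)"
  proof -
    have "(\<Sum>m\<in>g2 ` I2. 1 / real m) \<le> (\<Sum>i\<in>I2. 1 / real (g2 i))"
      by (rule sum_le_sum_cover[OF finI(3) order_refl]) auto
    also have "\<dots> = (\<Sum>k\<in>S. 1 / real k) * (\<Sum>d\<in>F2. 1 / real d)"
      by (simp add: I2_def g2_def sum_product sum.cartesian_product case_prod_unfold)
    finally show ?thesis .
  qed
  have s3: "(\<Sum>m\<in>g3 ` I3. 1 / real m) \<le> (\<Sum>k\<in>S. 1 / real k) *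
      (\<Sum>d\<in>F3. \<Sum>uv\<in>list_pairs d l. \<Sum>\<pi>\<in>arc_primes \<epsilon> N l w z uv. 1 / (real (gnorm \<pi>) * real d))"
  proof -
    define J where "J = (SIGMA d:F3. SIGMA uv:list_pairs d l. arc_primes \<epsilon> N l w z uv)"
    have "(\<Sum>m\<in>g3 ` I3. 1 / real m) \<le> (\<Sum>i\<in>I3. 1 / real (g3 i))"
      by (rule sum_le_sum_cover[OF finI(4) order_refl]) auto
    also have "\<dots> = (\<Sum>k\<in>S. 1 / real k) * (\<Sum>(d,uv,\<pi>)\<in>J. 1 / (real (gnorm \<pi>) * real d))"
      by (simp add: I3_def J_def[symmetric] g3_def sum_product sum.cartesian_product case_prod_unfold)
    also have "(\<Sum>(d,uv,\<pi>)\<in>J. 1 / (real (gnorm \<pi>) * real d))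
      = (\<Sum>d\<in>F3. \<Sum>(uv,\<pi>)\<in>(SIGMA uv:list_pairs d l. arc_primes \<epsilon> N l w z uv). 1 / (real (gnorm \<pi>) * real d))"
      unfolding J_def using finI1 fin by (subst sum.Sigma) (auto simp: case_prod_unfold)
    also have "\<dots> = (\<Sum>d\<in>F3. \<Sum>uv\<in>list_pairs d l. \<Sum>\<pi>\<in>arc_primes \<epsilon> N l w z uv. 1 / (real (gnorm \<pi>) * real d))"
    proof (rule sum.cong[OF refl])
      fix d
      show "(\<Sum>(uv,\<pi>)\<in>(SIGMA uv:list_pairs d l. arc_primes \<epsilon> N l w z uv). 1 / (real (gnorm \<pi>) * real d))
        = (\<Sum>uv\<in>list_pairs d l. \<Sum>\<pi>\<in>arc_primes \<epsilon> N l w z uv. 1 / (real (gnorm \<pi>) * real d))"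
        using finA list_pairs_bound(1) by (subst sum.Sigma) auto
    qed
    finally show ?thesis .
  qed
  show ?thesis using tot s0 s1 s2 s3 unfolding G_def Pr_def S_def F2_def F3_def by linarith
qed

text \<open>Since d has at most V prime factors congruent to 1 modulo 4, there are only exp(O(V))
  pairs of lists. This leaves room for the trivial arc count, whose saving is L^(-\<epsilon>) or
  w^(-1/2).\<close>

lemma smooth_arc_sum_le:
  fixes V w :: real
  assumes \<epsilon>: "\<epsilon> > 0" and L: "ln (real N) > 1" and l: "l \<ge> 1" and w: "w \<ge> 1" and z: "z \<ge> 3"
    and C: "\<And>z F. z \<ge> 3 \<Longrightarrow> finite F \<Longrightarrow> (\<And>d. d \<in> F \<Longrightarrow> d > 0 \<and> smooth z d) \<Longrightarrow>
    (\<Sum>d\<in>F. (3/2) ^ big_omega d / real d) \<le> C * (ln z)\<^sup>2"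
  shows "(\<Sum>d | d \<in> {1..N} \<and> smooth z d \<and> real (om1 d) \<le> V. \<Sum>uv\<in>list_pairs d l. \<Sum>\<pi>\<in>arc_primes \<epsilon> N l w z uv. 1 / (real (gnorm \<pi>) * real d))
   \<le> C * (ln z)\<^sup>2 * (real (l + 1) * 4 ^ l * exp (real l * ln 2 * V) * (exp 1 * ((ln z + 1) * (12 * ln (real N) powr - \<epsilon> + 3 / sqrt w))))"
proof -
  define L where "L = ln (real N)"
  have L1: "L > 1" using L by (simp add: L_def)
  note aw = arc_width_bounds[OF L1 \<epsilon> l]
  define F where "F = {d. d \<in> {1..N} \<and> smooth z d \<and> real (om1 d) \<le> V}"
  define R where "R = exp 1 * ((ln z + 1) * (12 * L powr - \<epsilon> + 3 / sqrt w))"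
  have lz: "ln z \<ge> 0" using z by simp
  have R0: "R \<ge> 0" using lz w by (simp add: R_def)
  define Q where "Q = real (l + 1) * 4 ^ l * exp (real l * ln 2 * V) * R"
  have Q0: "Q \<ge> 0" using R0 by (simp add: Q_def)
  have "(\<Sum>d\<in>F. \<Sum>uv\<in>list_pairs d l. \<Sum>\<pi>\<in>arc_primes \<epsilon> N l w z uv. 1 / (real (gnorm \<pi>) * real d)) \<le> (\<Sum>d\<in>F. Q * ((3/2) ^ big_omega d / real d))"
  proof (rule sum_mono)
    fix d assume d: "d \<in> F"
    have "(\<Sum>uv\<in>list_pairs d l. \<Sum>\<pi>\<in>arc_primes \<epsilon> N l w z uv. 1 / (real (gnorm \<pi>) * real d)) \<le> (\<Sum>uv\<in>list_pairs d l. R * (1 / real d))"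
    proof (rule sum_mono)
      fix uv assume uv: "uv \<in> list_pairs d l"
      have "(\<Sum>\<pi>\<in>arc_primes \<epsilon> N l w z uv. 1 / (real (gnorm \<pi>) * real d)) = (\<Sum>\<pi>\<in>arc_primes \<epsilon> N l w z uv. 1 / real (gnorm \<pi>)) * (1 / real d)"
        unfolding sum_distrib_right by simp
      also have "\<dots> \<le> R * (1 / real d)"
      proof (rule mult_right_mono)
        have "(\<Sum>\<pi>\<in>arc_primes \<epsilon> N l w z uv. 1 / real (gnorm \<pi>)) \<le> exp 1 * ((ln z + 1) * (12 * arc_width \<epsilon> L l + 3 / sqrt w))"
          unfolding arc_primes_def L_def[symmetric]
          by (rule arc_recip_sum_small) (use w z aw uv in \<open>auto simp: list_pairs_def\<close>)
        also have "\<dots> \<le> R" unfolding R_def using aw lz by (intro mult_left_mono add_right_mono) auto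
        finally show "(\<Sum>\<pi>\<in>arc_primes \<epsilon> N l w z uv. 1 / real (gnorm \<pi>)) \<le> R" .
      qed simp
      finally show "(\<Sum>\<pi>\<in>arc_primes \<epsilon> N l w z uv. 1 / (real (gnorm \<pi>) * real d)) \<le> R * (1 / real d)" .
    qed
    also have "\<dots> = real (card (list_pairs d l)) * (R * (1 / real d))" by simp
    also have "\<dots> \<le> (real (l + 1) * 4 ^ l * exp (real l * ln 2 * V)) * (R * (1 / real d))"
      using d R0 by (intro mult_right_mono card_list_pairs_le) (auto simp: F_def)
    also have "\<dots> = Q * (1 / real d)" by (simp add: Q_def)
    \<comment> \<open>The weight is raised from 1 to (3/2)^Omega(d) so that the smooth sum already
      at hand applies.\<close>
    also have "\<dots> \<le> Q * ((3/2) ^ big_omega d / real d)"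
      using Q0 by (intro mult_left_mono divide_right_mono one_le_power) auto
    finally show "(\<Sum>uv\<in>list_pairs d l. \<Sum>\<pi>\<in>arc_primes \<epsilon> N l w z uv. 1 / (real (gnorm \<pi>) * real d)) \<le> Q * ((3/2) ^ big_omega d / real d)" .
  qed
  also have "\<dots> = Q * (\<Sum>d\<in>F. (3/2) ^ big_omega d / real d)" by (rule sum_distrib_left[symmetric])
  also have "\<dots> \<le> Q * (C * (ln z)\<^sup>2)" by (intro mult_left_mono C z Q0) (auto simp: F_def)
  finally show ?thesis unfolding F_def Q_def R_def L_def by (simp only: mult_ac)
qed


text \<open>Here x will be log log N, and its cube root the bound V on the number of prime
  factors.\<close>

lemma power_exp_cuberoot_small:
  fixes c C \<delta> :: real
  assumes "c > 0" "\<delta> > 0"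
  shows "\<forall>\<^sub>F x in at_top. C * x ^ a * exp (- c * x powr (1/3)) \<le> \<delta>"
proof -
  have lim: "filterlim (\<lambda>x::real. c * x powr (1/3)) at_top at_top" using assms(1) by real_asymp
  have "((\<lambda>x. (c * x powr (1/3)) ^ (3 * a) / exp (c * x powr (1/3))) \<longlongrightarrow> 0) at_top"
    by (rule filterlim_compose[OF tendsto_power_div_exp_0 lim])
  then have "((\<lambda>x. C / c ^ (3 * a) * ((c * x powr (1/3)) ^ (3 * a) / exp (c * x powr (1/3)))) \<longlongrightarrow> C / c ^ (3 * a) * 0) at_top"
    by (rule tendsto_mult_left)
  then have "\<forall>\<^sub>F x in at_top. C / c ^ (3 * a) * ((c * x powr (1/3)) ^ (3 * a) / exp (c * x powr (1/3))) < \<delta>"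
    using assms(2) by (intro order_tendstoD(2)) auto
  with eventually_gt_at_top[of 0] show ?thesis
  proof eventually_elim
    case (elim x)
    have "(x powr (1/3)) ^ 3 = x" using elim by (simp add: powr_power)
    then have "(c * x powr (1/3)) ^ (3 * a) = c ^ (3 * a) * x ^ a" by (simp add: power_mult_distrib power_mult)
    then have "C / c ^ (3 * a) * ((c * x powr (1/3)) ^ (3 * a) / exp (c * x powr (1/3))) = C * x ^ a * exp (- c * x powr (1/3))"
      using assms(1) by (simp add: exp_minus field_simps)
    then show ?case using elim by simp
  qed
qed

lemma filterlim_ln_ln: "filterlim (\<lambda>N :: nat. ln (ln (real N))) at_top sequentially"
  by real_asymp

lemma cuberoot_le_linear_eventually:
  fixes a c :: real
  assumes "a > 0" "c > 0"
  shows "\<forall>\<^sub>F x in at_top. a * x powr (1/3) \<le> c * x" "\<forall>\<^sub>F x in at_top. a * x powr (1/3) \<le> sqrt x / 2"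
    "\<forall>\<^sub>F x in at_top. sqrt x * x powr (1/3) < c * x" "\<forall>\<^sub>F x in at_top. 4 * a * (x + c) \<le> x ^ 2"
  using assms by real_asymp+

text \<open>The saving has to hold for every K at once. In the cover the shorter lengths come
  multiplied by the sum of 1/p, about log log N, and by the number of lengths; the induction
  hypothesis for K + 2 absorbs both. Each of the four terms of the cover is to be at most a quarter
  of the claim.\<close>

lemma bad_set_recip_sum_small:
  fixes \<epsilon> \<eta> :: real
  assumes \<epsilon>: "\<epsilon> > 0" and \<eta>: "\<eta> \<ge> 0"
  shows "l \<ge> 1 \<Longrightarrow> \<eta> * real l * ln 2 \<le> \<epsilon> / 2 \<Longrightarrow>
    \<forall>\<^sub>F N :: nat in sequentially. (\<Sum>m\<in>bad_set \<epsilon> \<eta> N l. 1 / real m) \<le> sqrt (ln (real N)) / ln (ln (real N)) ^ K"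
proof (induction l arbitrary: K rule: less_induct)
  case (less l)
  note l = less.prems(1) and \<eta>l = less.prems(2)
  define D2 where "D2 = 2 * arc_dim \<epsilon> l + 2"
  have D2: "D2 \<ge> 2" using \<epsilon> by (simp add: D2_def arc_dim_def)
  obtain C1 where C1: "C1 > 0" "\<forall>\<^sub>F N :: nat in sequentially.
    (\<Sum>m\<in>typical_set \<eta> N. \<Sum>uv\<in>list_pairs m l. \<Sum>\<pi>\<in>arc_primes \<epsilon> N l (sep_bound \<epsilon> N l) (real N) uv. 1 / (real (gnorm \<pi>) * real m))
     \<le> C1 * sqrt (ln (real N)) * (ln (real N) powr (\<eta> * real l * ln 2 - \<epsilon>) * ln (ln (real N)) ^ 4)"
    using arc_sum_recip_le[OF \<epsilon> l] by blast
  obtain C2 where C2: "C2 > 0" "\<And>N. N \<ge> 3 \<Longrightarrow> (\<Sum>m | m \<in> two_squares \<and> m \<le> N. 1 / real m) \<le> C2 * sqrt (ln (real N))"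
    using two_squares_recip_sum_le by blast
  obtain C3 where C3: "C3 > 0" "\<And>z F V. z \<ge> 3 \<Longrightarrow> finite F \<Longrightarrow>
    (\<And>d. d \<in> F \<Longrightarrow> d > 0 \<and> smooth z d \<and> V \<le> real (big_omega d)) \<Longrightarrow>
    (\<Sum>d\<in>F. 1 / real d) \<le> C3 * (ln z)\<^sup>2 * (2/3) powr V"
    using smooth_tail_sum by blast
  obtain C4 where C4: "C4 > 0" "\<And>z F. z \<ge> 3 \<Longrightarrow> finite F \<Longrightarrow> (\<And>d. d \<in> F \<Longrightarrow> d > 0 \<and> smooth z d) \<Longrightarrow>
    (\<Sum>d\<in>F. (3/2) ^ big_omega d / real d) \<le> C4 * (ln z)\<^sup>2"
    using smooth_sum_big_omega by blast
  obtain C5 where C5: "C5 \<ge> 0" "\<And>z. z \<ge> 3 \<Longrightarrow> (\<Sum>p | prime p \<and> real p \<le> z. 1 / real p) \<le> ln (ln z) + C5"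
    using primes_recip_le by blast
  \<comment> \<open>The extra 1 leaves a factor exp(-V) after the number of pairs, of size exp(l log
    2 V), has been beaten.\<close>
  define a3 where "a3 = real l * ln 2 + 1"
  have a3: "a3 > 0" by (simp add: a3_def add_nonneg_pos)
  define H where "H = C2 * C4 * D2\<^sup>2 * (real (l + 1) * 4 ^ l) * (exp 1 * (D2 + 1) * 15)"
  have "\<forall>\<^sub>F x in at_top. C1 * x ^ (4 + K) * exp (- (\<epsilon> / 2) * x powr (1/3)) \<le> 1/4 \<and>
     (C2 * C3 * D2\<^sup>2) * x ^ (2 + K) * exp (- ln (3/2) * x powr (1/3)) \<le> 1/4 \<and>
     H * x ^ (3 + K) * exp (- 1 * x powr (1/3)) \<le> 1/4 \<and>
     a3 * x powr (1/3) \<le> \<epsilon> * x \<and> a3 * x powr (1/3) \<le> sqrt x / 2 \<and> sqrt x * x powr (1/3) < (2 * \<epsilon>) * x \<and>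
     4 * real l * (x + (C5 + 1)) \<le> x ^ 2 \<and> x \<ge> (2::real)"
    using \<epsilon> a3 l C5(1)
    by (intro eventually_conj power_exp_cuberoot_small cuberoot_le_linear_eventually eventually_ge_at_top) auto
  from eventually_compose_filterlim[OF this filterlim_ln_ln]
  have ev: "\<forall>\<^sub>F N :: nat in sequentially. (\<lambda>x. C1 * x ^ (4 + K) * exp (- (\<epsilon> / 2) * x powr (1/3)) \<le> 1/4 \<and>
     (C2 * C3 * D2\<^sup>2) * x ^ (2 + K) * exp (- ln (3/2) * x powr (1/3)) \<le> 1/4 \<and>
     H * x ^ (3 + K) * exp (- 1 * x powr (1/3)) \<le> 1/4 \<and>
     a3 * x powr (1/3) \<le> \<epsilon> * x \<and> a3 * x powr (1/3) \<le> sqrt x / 2 \<and> sqrt x * x powr (1/3) < (2 * \<epsilon>) * x \<and>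
     4 * real l * (x + (C5 + 1)) \<le> x ^ 2 \<and> x \<ge> (2::real)) (ln (ln (real N)))" .
  have IH: "\<forall>\<^sub>F N :: nat in sequentially. \<forall>l'\<in>{1..<l}. (\<Sum>m\<in>bad_set \<epsilon> \<eta> N l'. 1 / real m) \<le> sqrt (ln (real N)) / ln (ln (real N)) ^ (K + 2)"
  proof (intro eventually_ball_finite ballI)
    fix l' assume l': "l' \<in> {1..<l}"
    have "\<eta> * real l' * ln 2 \<le> \<eta> * real l * ln 2" using \<eta> l' by (intro mult_right_mono mult_left_mono) auto
    then show "\<forall>\<^sub>F N :: nat in sequentially. (\<Sum>m\<in>bad_set \<epsilon> \<eta> N l'. 1 / real m) \<le> sqrt (ln (real N)) / ln (ln (real N)) ^ (K + 2)"
      using less.IH[of l' "K + 2"] l' \<eta>l by simp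
  qed simp
  have "\<forall>\<^sub>F N :: nat in sequentially. ln (real N) > 1 \<and> N \<ge> 3"
    by (intro eventually_conj eventually_ge_at_top; real_asymp)
  with ev IH C1(2) show ?case
  proof eventually_elim
    case (elim N)
    define L x s where "L = ln (real N)" and "x = ln L" and "s = sqrt L"
    have L1: "L > 1" and N3: "N \<ge> 3" using elim by (auto simp: L_def)
    note E = elim(1)[folded L_def, folded x_def]
    have e1: "C1 * x ^ (4 + K) * exp (- (\<epsilon> / 2) * x powr (1/3)) \<le> 1/4"
      and e2: "(C2 * C3 * D2\<^sup>2) * x ^ (2 + K) * exp (- ln (3/2) * x powr (1/3)) \<le> 1/4"
      and e3: "H * x ^ (3 + K) * exp (- 1 * x powr (1/3)) \<le> 1/4"
      and e4: "a3 * x powr (1/3) \<le> \<epsilon> * x" and e5: "a3 * x powr (1/3) \<le> sqrt x / 2" and e6: "sqrt x * x powr (1/3) < (2 * \<epsilon>) * x"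
      and e7: "4 * real l * (x + (C5 + 1)) \<le> x ^ 2" and x2: "x \<ge> 2"
      using E by blast+
    have s0: "s \<ge> 0" using L1 by (simp add: s_def)
    have xK: "x ^ K > 0" using x2 by simp
    have eL: "L powr b = exp (b * x)" for b using L1 by (simp add: powr_def x_def)
    \<comment> \<open>The exponents 1/3 and 1/2 satisfy two opposing demands: w^V = exp(x^(5/6))
      stays below L^(2 \<epsilon>) = exp(2 \<epsilon> x), and sqrt w = exp(sqrt x / 2) exceeds
      exp(O(V)).\<close>
    define V w z where "V = x powr (1/3)" and "w = exp (sqrt x)" and "z = sep_bound \<epsilon> N l"
    have zL: "z = exp (D2 * x)" unfolding z_def sep_bound_def L_def[symmetric] eL D2_def ..
    have lz: "ln z = D2 * x" by (simp add: zL)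
    have D2x: "D2 * x \<ge> 4" using D2 x2 mult_mono[of 2 D2 2 x] by simp
    have z3: "z \<ge> 3" unfolding zL using exp_ge_add_one_self[of "D2 * x"] D2x by linarith
    have w1: "w \<ge> 1" using x2 by (simp add: w_def)
    have Vx: "V \<le> x"
    proof -
      have "x powr (1/3) \<le> x powr 1" using x2 by (intro powr_mono) auto
      then show ?thesis using x2 by (simp add: V_def)
    qed
    have wV: "w powr V < L powr (2 * \<epsilon>)"
      unfolding eL using e6 by (simp add: w_def powr_def V_def mult.commute)
    have fin: "s * t \<le> s / x ^ K / 4" if "t * x ^ K \<le> 1/4" for t
    proof -
      have "t \<le> 1/4 / x ^ K" using that xK by (simp add: le_divide_eq)
      then have "s * t \<le> s * (1/4 / x ^ K)" using s0 by (rule mult_left_mono)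
      then show ?thesis by simp
    qed
    have t0: "(\<Sum>l'\<in>{1..<l}. (\<Sum>m\<in>bad_set \<epsilon> \<eta> N l'. 1 / real m) * (\<Sum>p | prime p \<and> real p \<le> real N. 1 / real p)) \<le> s / x ^ K / 4"
    proof -
      have "(\<Sum>l'\<in>{1..<l}. (\<Sum>m\<in>bad_set \<epsilon> \<eta> N l'. 1 / real m) * (\<Sum>p | prime p \<and> real p \<le> real N. 1 / real p))
        \<le> (\<Sum>l'\<in>{1..<l}. s / x ^ (K + 2) * (x + C5))"
      proof (intro sum_mono mult_mono)
        fix l' assume "l' \<in> {1..<l}"
        then show "(\<Sum>m\<in>bad_set \<epsilon> \<eta> N l'. 1 / real m) \<le> s / x ^ (K + 2)"
          using elim(2) by (simp add: s_def x_def L_def)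
        show "(\<Sum>p | prime p \<and> real p \<le> real N. 1 / real p) \<le> x + C5"
          using C5(2)[of "real N"] N3 by (simp add: x_def L_def)
      qed (use s0 x2 in \<open>auto intro!: sum_nonneg\<close>)
      also have "\<dots> = real (l - 1) * (s / x ^ (K + 2) * (x + C5))" by simp
      also have "\<dots> \<le> real l * (s / x ^ (K + 2) * (x + (C5 + 1)))"
        using s0 x2 C5(1) by (intro mult_mono mult_left_mono) auto
      also have "\<dots> = s * (real l * (x + (C5 + 1)) / x ^ (K + 2))" by simp
      also have "\<dots> \<le> s / x ^ K / 4"
      proof (rule fin)
        have "real l * (x + (C5 + 1)) / x ^ (K + 2) * x ^ K = real l * (x + (C5 + 1)) / x ^ 2"
          using x2 by (simp add: power_add power2_eq_square)
        also have "\<dots> \<le> 1/4" using e7 x2 by (simp add: divide_le_eq)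
        finally show "real l * (x + (C5 + 1)) / x ^ (K + 2) * x ^ K \<le> 1/4" .
      qed
      finally show ?thesis .
    qed
    have t1: "(\<Sum>m\<in>typical_set \<eta> N. \<Sum>uv\<in>list_pairs m l. \<Sum>\<pi>\<in>arc_primes \<epsilon> N l z (real N) uv. 1 / (real (gnorm \<pi>) * real m)) \<le> s / x ^ K / 4"
    proof -
      have "(\<Sum>m\<in>typical_set \<eta> N. \<Sum>uv\<in>list_pairs m l. \<Sum>\<pi>\<in>arc_primes \<epsilon> N l z (real N) uv. 1 / (real (gnorm \<pi>) * real m))
        \<le> C1 * s * (L powr (\<eta> * real l * ln 2 - \<epsilon>) * x ^ 4)"
        using elim(3) by (simp add: z_def s_def x_def L_def)
      also have "L powr (\<eta> * real l * ln 2 - \<epsilon>) \<le> exp (- (\<epsilon> / 2) * V)"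
      proof -
        have "(\<eta> * real l * ln 2 - \<epsilon>) * x \<le> (- (\<epsilon> / 2)) * x" using \<eta>l x2 by (intro mult_right_mono) auto
        also have "\<dots> \<le> - (\<epsilon> / 2) * V" using Vx \<epsilon> by simp
        finally show ?thesis by (simp add: eL)
      qed
      finally have "(\<Sum>m\<in>typical_set \<eta> N. \<Sum>uv\<in>list_pairs m l. \<Sum>\<pi>\<in>arc_primes \<epsilon> N l z (real N) uv. 1 / (real (gnorm \<pi>) * real m))
        \<le> C1 * s * (exp (- (\<epsilon> / 2) * V) * x ^ 4)"
        using C1(1) s0 x2 by (simp add: mult_left_mono mult_right_mono)
      also have "\<dots> = s * (C1 * x ^ 4 * exp (- (\<epsilon> / 2) * V))" by (simp only: mult_ac)
      also have "\<dots> \<le> s / x ^ K / 4"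
        by (rule fin) (use e1 in \<open>simp add: V_def power_add mult_ac\<close>)
      finally show ?thesis .
    qed
    have S: "(\<Sum>k | k \<in> two_squares \<and> k \<le> N. 1 / real k) \<le> C2 * s" using C2(2)[OF N3] by (simp add: s_def L_def)
    have t2: "(\<Sum>k | k \<in> two_squares \<and> k \<le> N. 1 / real k) * (\<Sum>d | d \<in> {1..N} \<and> smooth z d \<and> V \<le> real (big_omega d). 1 / real d) \<le> s / x ^ K / 4"
    proof -
      have "(\<Sum>d | d \<in> {1..N} \<and> smooth z d \<and> V \<le> real (big_omega d). 1 / real d) \<le> C3 * (ln z)\<^sup>2 * (2/3) powr V"
        by (rule C3(2)[OF z3]) auto
      also have "(2/3) powr V = exp (- ln (3/2) * V)"
      proof -
        have "ln (2/3 :: real) = - ln (3/2)" by (simp add: ln_div)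
        then show ?thesis by (simp add: powr_def)
      qed
      finally have "(\<Sum>k | k \<in> two_squares \<and> k \<le> N. 1 / real k) * (\<Sum>d | d \<in> {1..N} \<and> smooth z d \<and> V \<le> real (big_omega d). 1 / real d)
        \<le> (C2 * s) * (C3 * (D2 * x)\<^sup>2 * exp (- ln (3/2) * V))"
        unfolding lz using S C2(1) s0 by (intro mult_mono) (auto intro: sum_nonneg)
      also have "\<dots> = s * (C2 * C3 * D2\<^sup>2 * x\<^sup>2 * exp (- ln (3/2) * V))" by (simp add: power_mult_distrib mult_ac)
      also have "\<dots> \<le> s / x ^ K / 4"
        by (rule fin) (use e2 in \<open>simp add: V_def power_add power2_eq_square mult_ac\<close>)
      finally show ?thesis .
    qed
    have t3: "(\<Sum>k | k \<in> two_squares \<and> k \<le> N. 1 / real k) *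
      (\<Sum>d | d \<in> {1..N} \<and> smooth z d \<and> real (om1 d) \<le> V. \<Sum>uv\<in>list_pairs d l. \<Sum>\<pi>\<in>arc_primes \<epsilon> N l w z uv. 1 / (real (gnorm \<pi>) * real d)) \<le> s / x ^ K / 4"
    proof -
      have small: "exp (real l * ln 2 * V) * (12 * L powr - \<epsilon> + 3 / sqrt w) \<le> 15 * exp (- V)"
      proof -
        have "exp (real l * ln 2 * V) * L powr - \<epsilon> \<le> exp (- V)"
          using e4 by (simp add: eL a3_def V_def algebra_simps flip: exp_add)
        moreover have "exp (real l * ln 2 * V) * (1 / sqrt w) \<le> exp (- V)"
        proof -
          have "sqrt w = exp (sqrt x / 2)" by (rule real_sqrt_unique) (simp_all add: w_def power2_eq_square flip: exp_add)
          then have "1 / sqrt w = exp (- (sqrt x / 2))" by (simp add: exp_minus field_simps)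
          then show ?thesis using e5 by (simp add: a3_def V_def algebra_simps flip: exp_add)
        qed
        moreover have "exp (real l * ln 2 * V) * (12 * L powr - \<epsilon> + 3 / sqrt w)
          = 12 * (exp (real l * ln 2 * V) * L powr - \<epsilon>) + 3 * (exp (real l * ln 2 * V) * (1 / sqrt w))"
          by (simp add: distrib_left)
        ultimately show ?thesis by linarith
      qed
      have "(\<Sum>d | d \<in> {1..N} \<and> smooth z d \<and> real (om1 d) \<le> V. \<Sum>uv\<in>list_pairs d l. \<Sum>\<pi>\<in>arc_primes \<epsilon> N l w z uv. 1 / (real (gnorm \<pi>) * real d))
        \<le> C4 * (ln z)\<^sup>2 * (real (l + 1) * 4 ^ l * exp (real l * ln 2 * V) * (exp 1 * ((ln z + 1) * (12 * L powr - \<epsilon> + 3 / sqrt w))))"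
        unfolding L_def by (rule smooth_arc_sum_le[OF \<epsilon> _ l w1 z3 C4(2)]) (use L1 L_def in auto)
      also have "\<dots> = C4 * (D2 * x)\<^sup>2 * (real (l + 1) * 4 ^ l) * (exp 1 * (D2 * x + 1)) * (exp (real l * ln 2 * V) * (12 * L powr - \<epsilon> + 3 / sqrt w))"
        unfolding lz by (simp only: mult_ac)
      also have "\<dots> \<le> C4 * (D2 * x)\<^sup>2 * (real (l + 1) * 4 ^ l) * (exp 1 * ((D2 + 1) * x)) * (15 * exp (- V))"
      proof (rule mult_mono[OF mult_left_mono small])
        have "D2 * x + 1 \<le> (D2 + 1) * x" using x2 by (simp add: distrib_right)
        then show "exp 1 * (D2 * x + 1) \<le> exp 1 * ((D2 + 1) * x)" by (rule mult_left_mono) simp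
        show "0 \<le> C4 * (D2 * x)\<^sup>2 * (real (l + 1) * 4 ^ l)" using C4(1) by (intro mult_nonneg_nonneg) auto
        show "0 \<le> C4 * (D2 * x)\<^sup>2 * (real (l + 1) * 4 ^ l) * (exp 1 * ((D2 + 1) * x))"
          using C4(1) D2 x2 by (intro mult_nonneg_nonneg) auto
        show "0 \<le> exp (real l * ln 2 * V) * (12 * L powr - \<epsilon> + 3 / sqrt w)"
          using w1 by (intro mult_nonneg_nonneg add_nonneg_nonneg) auto
      qed
      finally have "(\<Sum>k | k \<in> two_squares \<and> k \<le> N. 1 / real k) *
        (\<Sum>d | d \<in> {1..N} \<and> smooth z d \<and> real (om1 d) \<le> V. \<Sum>uv\<in>list_pairs d l. \<Sum>\<pi>\<in>arc_primes \<epsilon> N l w z uv. 1 / (real (gnorm \<pi>) * real d))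
        \<le> (C2 * s) * (C4 * (D2 * x)\<^sup>2 * (real (l + 1) * 4 ^ l) * (exp 1 * ((D2 + 1) * x)) * (15 * exp (- V)))"
        using S C2(1) s0 by (intro mult_mono) (auto intro!: sum_nonneg)
      also have "\<dots> = s * (H * x ^ 3 * exp (- V))"
        unfolding H_def power_mult_distrib power2_eq_square power3_eq_cube by (simp only: mult_ac)
      also have "\<dots> \<le> s / x ^ K / 4"
        by (rule fin) (use e3 in \<open>simp add: V_def power_add mult_ac\<close>)
      finally show ?thesis .
    qed
    have "(\<Sum>m\<in>bad_set \<epsilon> \<eta> N l. 1 / real m) \<le> s / x ^ K / 4 + s / x ^ K / 4 + s / x ^ K / 4 + s / x ^ K / 4"
      using bad_set_sum_cover[OF \<epsilon> _ l w1 wV[unfolded L_def], of \<eta>] t0 t1 t2 t3 L1 unfolding z_def L_def by linarith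
    then show ?case by (simp add: s_def x_def L_def)
  qed
qed

text \<open>Writing n = p m in the logarithmic weight, the primes p <= N/m contribute at most 3N/m
  for an exceptional m. The logarithmic sums, with a single factor log log N saved, therefore
  suffice, and the arcs contribute N sqrt L times a negative power of L. Division by L gives the
  count.\<close>

lemma bad_set_card_small:
  fixes \<epsilon> \<eta> \<delta> :: real
  assumes \<epsilon>: "\<epsilon> > 0" and \<eta>: "\<eta> \<ge> 0" and l: "l \<ge> 1" and \<eta>l: "\<eta> * real l * ln 2 \<le> \<epsilon> / 2" and \<delta>: "\<delta> > 0"
  shows "\<forall>\<^sub>F N :: nat in sequentially. real (card (bad_set \<epsilon> \<eta> N l)) \<le> \<delta> * real N / sqrt (ln (real N))"
proof -
  have E1: "2 * arc_dim \<epsilon> l + 2 \<ge> 1" using \<epsilon> by (simp add: arc_dim_def)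
  obtain N1 where N1: "\<And>N A. N \<ge> N1 \<Longrightarrow> A \<subseteq> {1..N} \<Longrightarrow>
    ln (real N) * real (card A) \<le> 4 * (\<Sum>n\<in>A. \<Sum>p\<in>big_primes (ln (real N) powr (2 * arc_dim \<epsilon> l + 2)) n. ln (real p)) + 4 * real N"
    using log_weight_lemma[OF E1] by blast
  obtain C where C: "C > 0" "\<forall>\<^sub>F N :: nat in sequentially.
    (\<Sum>m\<in>typical_set \<eta> N. \<Sum>uv\<in>list_pairs m l. \<Sum>\<pi>\<in>arc_primes \<epsilon> N l (sep_bound \<epsilon> N l) (real (N div m)) uv. ln (real (gnorm \<pi>)))
     \<le> C * (real N * sqrt (ln (real N))) * (ln (real N) powr (\<eta> * real l * ln 2 - \<epsilon>) * ln (ln (real N)) ^ 3)"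
    using arc_sum_ln_le[OF \<epsilon> l] by blast
  have "\<forall>\<^sub>F x in at_top. 4 * C * x ^ 3 * exp (- (\<epsilon> / 2) * x powr (1/3)) \<le> \<delta> / 3 \<and> x \<ge> max 2 (36 * real l / \<delta>)"
    using \<epsilon> \<delta> by (intro eventually_conj power_exp_cuberoot_small eventually_ge_at_top) auto
  from eventually_compose_filterlim[OF this filterlim_ln_ln]
  have ev: "\<forall>\<^sub>F N :: nat in sequentially. (\<lambda>x. 4 * C * x ^ 3 * exp (- (\<epsilon> / 2) * x powr (1/3)) \<le> \<delta> / 3 \<and> x \<ge> max 2 (36 * real l / \<delta>)) (ln (ln (real N)))" .
  have G: "\<forall>\<^sub>F N :: nat in sequentially. \<forall>l'\<in>{1..l}. (\<Sum>m\<in>bad_set \<epsilon> \<eta> N l'. 1 / real m) \<le> sqrt (ln (real N)) / ln (ln (real N)) ^ 1"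
  proof (intro eventually_ball_finite ballI)
    fix l' assume l': "l' \<in> {1..l}"
    have "\<eta> * real l' * ln 2 \<le> \<eta> * real l * ln 2" using \<eta> l' by (intro mult_right_mono mult_left_mono) auto
    then show "\<forall>\<^sub>F N :: nat in sequentially. (\<Sum>m\<in>bad_set \<epsilon> \<eta> N l'. 1 / real m) \<le> sqrt (ln (real N)) / ln (ln (real N)) ^ 1"
      using l' \<eta>l by (intro bad_set_recip_sum_small \<epsilon> \<eta>) auto
  qed simp
  have "\<forall>\<^sub>F N :: nat in sequentially. 12 / \<delta> \<le> sqrt (ln (real N))" 
  proof -
    have "filterlim (\<lambda>N :: nat. sqrt (ln (real N))) at_top sequentially" by real_asymp
    then show ?thesis by (simp add: filterlim_at_top)
  qed
  moreover have "\<forall>\<^sub>F N :: nat in sequentially. ln (real N) > 1 \<and> N \<ge> N1"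
    by (intro eventually_conj eventually_ge_at_top; real_asymp)
  ultimately show ?thesis using ev G C(2)
  proof eventually_elim
    case (elim N)
    define L x s where "L = ln (real N)" and "x = ln L" and "s = sqrt L"
    have L1: "L > 1" and NN: "N \<ge> N1" using elim by (auto simp: L_def)
    note E = elim(3)[folded L_def, folded x_def]
    have x2: "x \<ge> 2" and xl: "x \<ge> 36 * real l / \<delta>" using E by auto
    have eL: "L powr b = exp (b * x)" for b using L1 by (simp add: powr_def x_def)
    have s0: "s > 0" "s * s = L" using L1 by (simp_all add: s_def)
    define z where "z = sep_bound \<epsilon> N l"
    have zL: "z = L powr (2 * arc_dim \<epsilon> l + 2)" by (simp add: z_def sep_bound_def L_def)
    have z2: "z \<ge> 2"
    proof -
      have "arc_dim \<epsilon> l * x \<ge> 0" using \<epsilon> x2 by (intro mult_nonneg_nonneg) (auto simp: arc_dim_def)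
      then have "(2 * arc_dim \<epsilon> l + 2) * x \<ge> 1" using x2 by (simp add: algebra_simps)
      then show ?thesis unfolding zL eL using exp_ge_add_one_self[of "(2 * arc_dim \<epsilon> l + 2) * x"] by linarith
    qed
    define G where "G = bad_set \<epsilon> \<eta> N l"
    define I0 where "I0 = (SIGMA l':{1..l}. SIGMA m:bad_set \<epsilon> \<eta> N l'. {p. prime p \<and> p \<le> N div m})"
    define I1 where "I1 = (SIGMA m:typical_set \<eta> N. SIGMA uv:list_pairs m l. arc_primes \<epsilon> N l z (real (N div m)) uv)"
    define g0 :: "nat \<times> (nat \<times> nat) \<Rightarrow> nat \<times> nat" where "g0 = (\<lambda>(l', m, p). (p * m, p))"
    define g1 :: "nat \<times> ((complex list \<times> complex list) \<times> complex) \<Rightarrow> nat \<times> nat" where "g1 = (\<lambda>(m, uv, \<pi>). (gnorm \<pi> * m, gnorm \<pi>))"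
    define F :: "nat \<times> nat \<Rightarrow> real" where "F = (\<lambda>(n, p). ln (real p))"
    note finA = finite_arc_primes[OF L1[unfolded L_def] \<epsilon> l]
    have finP: "finite {p. prime p \<and> p \<le> N div m}" for m by simp
    have finI1: "finite (SIGMA uv:list_pairs m l. arc_primes \<epsilon> N l z W uv)" for m W
      using finA list_pairs_bound(1) by (intro finite_SigmaI) auto
    have finI: "finite I0" "finite I1" unfolding I0_def I1_def using finI1 by (auto intro!: finite_SigmaI)
    have GN: "G \<subseteq> {1..N}" by (auto simp: G_def bad_set_def typical_set_def Suc_le_eq two_squares_pos)
    have finG: "finite G" by (simp add: G_def)
    have F0: "i \<in> I0 \<Longrightarrow> F (g0 i) \<ge> 0" for i by (auto simp: I0_def F_def g0_def ln_prime_nonneg)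
    have F1: "i \<in> I1 \<Longrightarrow> F (g1 i) \<ge> 0" for i by (auto simp: I1_def F_def g1_def arc_primes_def gprime_arc_def ln_prime_nonneg)
    have cover: "(SIGMA n:G. big_primes z n) \<subseteq> g0 ` I0 \<union> g1 ` I1"
    proof
      fix y assume "y \<in> (SIGMA n:G. big_primes z n)"
      then obtain n p where y: "y = (n, p)" and n: "n \<in> G" and p: "p \<in> big_primes z n" by auto
      have nT: "n \<in> typical_set \<eta> N" and nb: "bad \<epsilon> L l n" using n by (auto simp: G_def bad_set_def L_def)
      have nS: "n \<in> two_squares" using nT by (simp add: typical_set_def)
      note b = big_primes_two_squares[OF nS p z2]
      have pp: "prime p" "real p > z" using p by (auto simp: big_primes_def)
      define m where "m = n div p"
      have nm: "n = p * m" using b(2) by (simp add: m_def)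
      have m0: "m > 0" using two_squares_pos[OF b(3)] by (simp add: m_def)
      have t: "m \<in> typical_set \<eta> N" "p \<le> N div m" using typical_set_cancel_prime[of p m \<eta> N] nT pp b(1) unfolding nm by auto
      from bad_mult_prime_cases[OF \<epsilon> L1 m0 pp(1) b(1) l] nb nm
      consider (a) l' where "l' \<in> {1..l}" "bad \<epsilon> L l' m"
        | (b) us vs \<pi> where "(us, vs) \<in> list_pairs m l" "\<pi> \<in> gprime_arc (sum_list us) (sum_list vs) (arc_width \<epsilon> L l)" "gnorm \<pi> = p"
        by blast
      then show "y \<in> g0 ` I0 \<union> g1 ` I1"
      proof cases
        case a
        then have "(l', m, p) \<in> I0" using t pp by (auto simp: I0_def bad_set_def L_def)
        moreover have "y = g0 (l', m, p)" by (simp add: y g0_def nm)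
        ultimately show ?thesis by blast
      next
        case b
        then have "(m, (us, vs), \<pi>) \<in> I1" using t pp by (auto simp: I1_def arc_primes_def L_def)
        moreover have "y = g1 (m, (us, vs), \<pi>)" using b(3) by (simp add: y g1_def nm)
        ultimately show ?thesis by blast
      qed
    qed
    have "(\<Sum>n\<in>G. \<Sum>p\<in>big_primes z n. ln (real p)) = (\<Sum>y\<in>(SIGMA n:G. big_primes z n). F y)"
      using finG GN by (subst sum.Sigma) (auto simp: F_def intro!: finite_big_primes)
    also have "\<dots> \<le> (\<Sum>y\<in>g0 ` I0 \<union> g1 ` I1. F y)"
      by (intro sum_mono2 cover) (use finI F0 F1 in auto)
    also have "\<dots> \<le> (\<Sum>y\<in>g0 ` I0. F y) + (\<Sum>y\<in>g1 ` I1. F y)"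
      by (intro sum_Un_le_real) (use finI F0 F1 in auto)
    also have "(\<Sum>y\<in>g0 ` I0. F y) \<le> (\<Sum>i\<in>I0. F (g0 i))" by (rule sum_le_sum_cover[where F = F and g = g0 and I = I0]) (use finI F0 in auto)
    also have "(\<Sum>i\<in>I0. F (g0 i)) = (\<Sum>l'\<in>{1..l}. \<Sum>m\<in>bad_set \<epsilon> \<eta> N l'. \<Sum>p | prime p \<and> p \<le> N div m. ln (real p))"
    proof -
      have "(\<Sum>i\<in>I0. F (g0 i)) = (\<Sum>l'\<in>{1..l}. \<Sum>y\<in>(SIGMA m:bad_set \<epsilon> \<eta> N l'. {p. prime p \<and> p \<le> N div m}). F (g0 (l', y)))"
        unfolding I0_def by (subst sum.Sigma) (auto simp: case_prod_unfold intro!: finite_SigmaI)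
      also have "\<dots> = (\<Sum>l'\<in>{1..l}. \<Sum>m\<in>bad_set \<epsilon> \<eta> N l'. \<Sum>p | prime p \<and> p \<le> N div m. ln (real p))"
      proof (rule sum.cong[OF refl])
        fix l'
        show "(\<Sum>y\<in>(SIGMA m:bad_set \<epsilon> \<eta> N l'. {p. prime p \<and> p \<le> N div m}). F (g0 (l', y)))
          = (\<Sum>m\<in>bad_set \<epsilon> \<eta> N l'. \<Sum>p | prime p \<and> p \<le> N div m. ln (real p))"
          by (subst sum.Sigma) (auto simp: F_def g0_def case_prod_unfold)
      qed
      finally show ?thesis .
    qed
    also have "\<dots> \<le> (\<Sum>l'\<in>{1..l}. 3 * real N * (s / x))"
    proof (rule sum_mono)
      fix l' assume l': "l' \<in> {1..l}"
      have "(\<Sum>m\<in>bad_set \<epsilon> \<eta> N l'. \<Sum>p | prime p \<and> p \<le> N div m. ln (real p)) \<le> (\<Sum>m\<in>bad_set \<epsilon> \<eta> N l'. 3 * real N * (1 / real m))"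
      proof (rule sum_mono)
        fix m
        have "(\<Sum>p | prime p \<and> p \<le> N div m. ln (real p)) \<le> 3 * real (N div m)" by (rule sum_ln_primes_le)
        also have "\<dots> \<le> 3 * (real N / real m)" using real_div_le[of N m] by linarith
        finally show "(\<Sum>p | prime p \<and> p \<le> N div m. ln (real p)) \<le> 3 * real N * (1 / real m)" by simp
      qed
      also have "\<dots> = 3 * real N * (\<Sum>m\<in>bad_set \<epsilon> \<eta> N l'. 1 / real m)" by (rule sum_distrib_left[symmetric])
      also have "\<dots> \<le> 3 * real N * (s / x)"
        using elim(4) l' by (intro mult_left_mono) (auto simp: s_def x_def L_def)
      finally show "(\<Sum>m\<in>bad_set \<epsilon> \<eta> N l'. \<Sum>p | prime p \<and> p \<le> N div m. ln (real p)) \<le> 3 * real N * (s / x)" .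
    qed
    also have "(\<Sum>y\<in>g1 ` I1. F y) \<le> (\<Sum>i\<in>I1. F (g1 i))" by (rule sum_le_sum_cover[where F = F and g = g1 and I = I1]) (use finI F1 in auto)
    also have "(\<Sum>i\<in>I1. F (g1 i)) = (\<Sum>m\<in>typical_set \<eta> N. \<Sum>uv\<in>list_pairs m l. \<Sum>\<pi>\<in>arc_primes \<epsilon> N l z (real (N div m)) uv. ln (real (gnorm \<pi>)))"
    proof -
      have "(\<Sum>i\<in>I1. F (g1 i)) = (\<Sum>m\<in>typical_set \<eta> N. \<Sum>y\<in>(SIGMA uv:list_pairs m l. arc_primes \<epsilon> N l z (real (N div m)) uv). F (g1 (m, y)))"
        unfolding I1_def using finI1 by (subst sum.Sigma) (auto simp: case_prod_unfold)
      also have "\<dots> = (\<Sum>m\<in>typical_set \<eta> N. \<Sum>uv\<in>list_pairs m l. \<Sum>\<pi>\<in>arc_primes \<epsilon> N l z (real (N div m)) uv. ln (real (gnorm \<pi>)))"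
      proof (rule sum.cong[OF refl])
        fix m
        show "(\<Sum>y\<in>(SIGMA uv:list_pairs m l. arc_primes \<epsilon> N l z (real (N div m)) uv). F (g1 (m, y)))
          = (\<Sum>uv\<in>list_pairs m l. \<Sum>\<pi>\<in>arc_primes \<epsilon> N l z (real (N div m)) uv. ln (real (gnorm \<pi>)))"
          using finA list_pairs_bound(1) by (subst sum.Sigma) (auto simp: F_def g1_def case_prod_unfold)
      qed
      finally show ?thesis .
    qed
    also have "\<dots> \<le> C * (real N * s) * (L powr (\<eta> * real l * ln 2 - \<epsilon>) * x ^ 3)"
      using elim(5) by (simp add: z_def s_def x_def L_def)
    finally have sum1: "(\<Sum>n\<in>G. \<Sum>p\<in>big_primes z n. ln (real p)) \<le> real l * (3 * real N * (s / x)) + C * (real N * s) * (L powr (\<eta> * real l * ln 2 - \<epsilon>) * x ^ 3)"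
      by simp
    \<comment> \<open>Each of the three contributions gets a share \<delta>/3. The number 36 is 4
      from the weighting times 3 from Chebyshev's bound times 3 from the share.\<close>
    have b1: "4 * (real l * (3 * real N * (s / x))) \<le> real N * s * (\<delta> / 3)"
    proof -
      have "36 * real l \<le> x * \<delta>" using xl \<delta> by (simp add: divide_le_eq)
      then have "12 * real l / x \<le> \<delta> / 3" using x2 by (simp add: divide_le_eq mult.commute)
      then have "(real N * s) * (12 * real l / x) \<le> (real N * s) * (\<delta> / 3)" using s0 by (intro mult_left_mono) auto
      then show ?thesis by (simp add: mult_ac)
    qed
    have b2: "4 * (C * (real N * s) * (L powr (\<eta> * real l * ln 2 - \<epsilon>) * x ^ 3)) \<le> real N * s * (\<delta> / 3)"
    proof -
      have Vx: "x powr (1/3) \<le> x"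
      proof -
        have "x powr (1/3) \<le> x powr 1" using x2 by (intro powr_mono) auto
        then show ?thesis using x2 by simp
      qed
      have "(\<eta> * real l * ln 2 - \<epsilon>) * x \<le> (- (\<epsilon> / 2)) * x" using \<eta>l x2 by (intro mult_right_mono) auto
      also have "\<dots> \<le> - (\<epsilon> / 2) * x powr (1/3)" using Vx \<epsilon> by simp
      finally have "L powr (\<eta> * real l * ln 2 - \<epsilon>) \<le> exp (- (\<epsilon> / 2) * x powr (1/3))" by (simp add: eL)
      then have "4 * C * x ^ 3 * L powr (\<eta> * real l * ln 2 - \<epsilon>) \<le> 4 * C * x ^ 3 * exp (- (\<epsilon> / 2) * x powr (1/3))"
        using C(1) x2 by (intro mult_left_mono) auto
      also have "\<dots> \<le> \<delta> / 3" using E by blast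
      finally have "(real N * s) * (4 * C * x ^ 3 * L powr (\<eta> * real l * ln 2 - \<epsilon>)) \<le> (real N * s) * (\<delta> / 3)"
        using s0 by (intro mult_left_mono) auto
      then show ?thesis by (simp add: mult_ac)
    qed
    have b3: "4 * real N \<le> real N * s * (\<delta> / 3)"
    proof -
      have "12 \<le> s * \<delta>" using elim(1) \<delta> by (simp add: s_def L_def divide_le_eq)
      then have "real N * 4 \<le> real N * (s * (\<delta> / 3))" by (intro mult_left_mono) auto
      then show ?thesis by (simp add: mult_ac)
    qed
    have "L * real (card G) \<le> 4 * (\<Sum>n\<in>G. \<Sum>p\<in>big_primes z n. ln (real p)) + 4 * real N"
      using N1[OF NN GN] by (simp add: zL L_def)
    also have "\<dots> \<le> real N * s * (\<delta> / 3) + real N * s * (\<delta> / 3) + real N * s * (\<delta> / 3)"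
      using sum1 b1 b2 b3 by linarith
    also have "\<dots> = s * (real N * \<delta>)" by simp
    finally have "s * (s * real (card G)) \<le> s * (real N * \<delta>)" using s0(2) by (simp only: mult.assoc[symmetric])
    then have "s * real (card G) \<le> real N * \<delta>" using s0(1) by (rule mult_left_le_imp_le)
    then show ?case using s0(1) by (simp add: G_def s_def L_def le_divide_eq mult_ac)
  qed
qed

section \<open>Transfer to lattice points and relative density\<close>

definition gauss_of_point :: "int \<times> int \<Rightarrow> complex" where
  "gauss_of_point \<xi> = Complex (of_int (fst \<xi>)) (of_int (snd \<xi>))"

lemma lnorm_gauss_of_point: "lnorm \<xi> = cmod (gauss_of_point \<xi>)"
  by (simp add: lnorm_def gauss_of_point_def norm_Pair cmod_def)

lemma gauss_of_point_sum_list: "gauss_of_point (sum_list \<xi>s) = sum_list (map gauss_of_point \<xi>s)"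
  by (induction \<xi>s) (auto simp: gauss_of_point_def complex_eq_iff)

lemma quasi_correlations_small_sum:
  assumes "quasi_correlations l n K \<noteq> {}" "K \<le> \<theta> * sqrt (real n)"
  shows "small_sum l \<theta> n"
proof -
  obtain \<xi>s where x: "length \<xi>s = l" "\<forall>\<xi>\<in>set \<xi>s. (lnorm \<xi>)\<^sup>2 = real n" "0 < lnorm (sum_list \<xi>s)" "lnorm (sum_list \<xi>s) \<le> K"
    using assms(1) by (auto simp: quasi_correlations_def)
  have "set (map gauss_of_point \<xi>s) \<subseteq> circ n" using x(2) by (auto simp: circ_def gauss_of_point_def lnorm_gauss_of_point[unfolded gauss_of_point_def])
  moreover have "cmod (sum_list (map gauss_of_point \<xi>s)) = lnorm (sum_list \<xi>s)" by (simp add: lnorm_gauss_of_point gauss_of_point_sum_list)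
  ultimately show ?thesis using x assms(2) unfolding small_sum_def
    by (intro exI[of _ "map gauss_of_point \<xi>s"]) auto
qed

text \<open>Three sources: n up to sqrt N, n with too many prime factors, and typical exceptional n.
  Above sqrt N the logarithm of n is at least L/2, so the threshold depending on n is at most the
  one with L, thanks to the gap between the two exponents.\<close>

lemma quasi_correlations_rare:
  fixes \<epsilon> \<delta> :: real
  assumes l: "l \<ge> 2" and \<epsilon>: "\<epsilon> > 0" and \<delta>: "\<delta> > 0"
  shows "\<forall>\<^sub>F N :: nat in sequentially.
    real (card {n. n \<in> two_squares \<and> n \<le> N \<and> quasi_correlations l n (sqrt (real n) / ln (real n) powr corr_exponent \<epsilon> l) \<noteq> {}})
      \<le> \<delta> * real N / sqrt (ln (real N))"
proof -
  define \<epsilon>' where "\<epsilon>' = \<epsilon> / 4"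
  have \<epsilon>': "\<epsilon>' > 0" using \<epsilon> by (simp add: \<epsilon>'_def)
  \<comment> \<open>Small enough for the surplus \<eta> l log 2 in the number of tuples to use up at
    most half of the \<epsilon>' gained by the arc width.\<close>
  define \<eta> where "\<eta> = \<epsilon>' / (2 * real l)"
  have \<eta>: "\<eta> > 0" using \<epsilon>' l by (simp add: \<eta>_def)
  have \<eta>l: "\<eta> * real l * ln 2 \<le> \<epsilon>' / 2"
  proof -
    have "\<eta> * real l * ln 2 = \<epsilon>' / 2 * ln 2" using l by (simp add: \<eta>_def)
    also have "\<dots> \<le> \<epsilon>' / 2 * 1" using \<epsilon>' ln2_le_25_over_36 by (intro mult_left_mono) auto
    finally show ?thesis by simp
  qed
  define c d where "c = corr_exponent \<epsilon> l" and "d = sep_exponent \<epsilon>' l"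
  have cd: "c - d \<ge> \<epsilon>'" using sep_exponent_less_corr_exponent[OF \<epsilon> l] by (simp add: c_def d_def \<epsilon>'_def)
  have d0: "d > 0" using sep_exponent_mono[of \<epsilon>' l l] \<epsilon>' unfolding d_def by linarith
  have "\<forall>\<^sub>F N :: nat in sequentially. ln (ln (real N)) \<ge> max 1 (c * ln 2 / \<epsilon>')"
    using filterlim_ln_ln unfolding filterlim_at_top by blast
  moreover have "\<forall>\<^sub>F N :: nat in sequentially. sqrt (real N) \<le> \<delta> / 3 * real N / sqrt (ln (real N))"
    using \<delta> by real_asymp
  moreover have "\<forall>\<^sub>F N :: nat in sequentially. ln (real N) > 2" by real_asymp
  moreover have "\<forall>\<^sub>F N :: nat in sequentially. real (card (bad_set \<epsilon>' \<eta> N l)) \<le> \<delta> / 3 * real N / sqrt (ln (real N))"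
    by (rule bad_set_card_small) (use \<epsilon>' \<eta> l \<eta>l \<delta> in auto)
  moreover have "\<forall>\<^sub>F N :: nat in sequentially.
    real (card {n. n \<in> two_squares \<and> n \<le> N \<and> real (om1 n) > (1/2 + \<eta>) * ln (ln (real N))}) \<le> \<delta> / 3 * real N / sqrt (ln (real N))"
    by (rule untypical_rare) (use \<eta> \<delta> in auto)
  ultimately show ?thesis
  proof eventually_elim
    case (elim N)
    define L x where "L = ln (real N)" and "x = ln L"
    have L2: "L > 2" using elim by (simp add: L_def)
    have N0: "N > 0" using L2 by (cases N) (auto simp: L_def)
    have x1: "x \<ge> 1" "x \<ge> c * ln 2 / \<epsilon>'" using elim(1) by (auto simp: x_def L_def)
    define Bd where "Bd = {n. n \<in> two_squares \<and> n \<le> N \<and> quasi_correlations l n (sqrt (real n) / ln (real n) powr c) \<noteq> {}}"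
    define R where "R = {1..nat \<lfloor>sqrt (real N)\<rfloor>}"
    define U where "U = {n. n \<in> two_squares \<and> n \<le> N \<and> real (om1 n) > (1/2 + \<eta>) * ln (ln (real N))}"
    have fin: "finite R" "finite U" "finite (bad_set \<epsilon>' \<eta> N l)" by (auto simp: R_def U_def)
    have "Bd \<subseteq> R \<union> U \<union> bad_set \<epsilon>' \<eta> N l"
    proof
      fix n assume n: "n \<in> Bd"
      then have nS: "n \<in> two_squares" and nN: "n \<le> N" and q: "quasi_correlations l n (sqrt (real n) / ln (real n) powr c) \<noteq> {}"
        by (auto simp: Bd_def)
      have n0: "n > 0" by (rule two_squares_pos[OF nS])
      show "n \<in> R \<union> U \<union> bad_set \<epsilon>' \<eta> N l"
      proof (cases "n \<in> R \<union> U")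
        case False
        have "\<not> n \<le> nat \<lfloor>sqrt (real N)\<rfloor>" using False n0 by (auto simp: R_def)
        then have "sqrt (real N) < real n" using real_le_iff_le_nat_floor[of "sqrt (real N)" n] by simp
        then have "ln (sqrt (real N)) \<le> ln (real n)" using N0 n0 by (subst ln_le_cancel_iff) auto
        then have ln: "L / 2 \<le> ln (real n)" using N0 by (simp add: L_def ln_sqrt)
        have nT: "n \<in> typical_set \<eta> N" using False nS nN by (auto simp: U_def typical_set_def)
        \<comment> \<open>The gap is spent here: with x = log L the claim reads c log 2 <= (c - d)
          x, true for large x because c - d >= \<epsilon>'.\<close>
        have "L powr d \<le> (L / 2) powr c"
        proof -
          have "c * ln 2 \<le> \<epsilon>' * x" using x1(2) \<epsilon>' by (simp add: divide_le_eq mult.commute)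
          also have "\<dots> \<le> (c - d) * x" using cd x1 by (intro mult_right_mono) auto
          finally have "d * x \<le> c * (x - ln 2)" by (simp add: algebra_simps)
          then show ?thesis using L2 by (simp add: powr_def x_def ln_div)
        qed
        also have "\<dots> \<le> ln (real n) powr c" using ln L2 cd d0 \<epsilon>' by (intro powr_mono2) auto
        finally have le: "L powr d \<le> ln (real n) powr c" .
        have "sqrt (real n) / ln (real n) powr c \<le> sqrt (real n) / L powr d"
          using le L2 by (intro divide_left_mono mult_pos_pos) (auto intro: less_le_trans[of 0 "L powr d"])
        also have "\<dots> = L powr - d * sqrt (real n)" by (simp add: powr_minus field_simps)
        finally have "small_sum l (L powr - d) n" using q by (rule quasi_correlations_small_sum[rotated])
        then have "bad \<epsilon>' (ln (real N)) l n" by (simp add: bad_def d_def L_def)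
        then show ?thesis using nT by (simp add: bad_set_def)
      qed auto
    qed
    then have "card Bd \<le> card (R \<union> U \<union> bad_set \<epsilon>' \<eta> N l)" using fin by (intro card_mono) auto
    also have "\<dots> \<le> card (R \<union> U) + card (bad_set \<epsilon>' \<eta> N l)" by (rule card_Un_le)
    also have "card (R \<union> U) \<le> card R + card U" by (rule card_Un_le)
    finally have "real (card Bd) \<le> real (card R) + real (card U) + real (card (bad_set \<epsilon>' \<eta> N l))" by linarith
    moreover have "real (card R) \<le> sqrt (real N)" unfolding R_def by simp
    ultimately have "real (card Bd) \<le> \<delta> / 3 * real N / sqrt (ln (real N)) + \<delta> / 3 * real N / sqrt (ln (real N)) + \<delta> / 3 * real N / sqrt (ln (real N))"
      using elim(2,4,5) unfolding U_def by linarith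
    also have "\<dots> = \<delta> * real N / sqrt (ln (real N))" by (simp add: field_simps)
    finally show ?case unfolding Bd_def c_def .
  qed
qed

theorem theorem1p1:
  fixes l :: nat and \<epsilon> :: real
  assumes "l \<ge> 2" and "\<epsilon> > 0"
  shows "\<exists>A. relative_density_one A \<and>
           (\<forall>n\<in>A. quasi_correlations l n (sqrt (real n) / ln (real n) powr corr_exponent \<epsilon> l) = {})"
proof -
  define bd where "bd n \<longleftrightarrow> quasi_correlations l n (sqrt (real n) / ln (real n) powr corr_exponent \<epsilon> l) \<noteq> {}" for n
  define A where "A = {n \<in> two_squares. \<not> bd n}"
  define S where "S N = {n. n \<in> two_squares \<and> n \<le> N}" for N
  define B where "B N = {n. n \<in> two_squares \<and> n \<le> N \<and> bd n}" for N
  define f where "f N = real (card (S N - B N)) / real (card (S N))" for N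
  have fin: "finite (S N)" "B N \<subseteq> S N" for N by (auto simp: S_def B_def)
  \<comment> \<open>A lower bound of the right order for S is enough, because the exceptional set is
    at most \<delta> N / sqrt(log N) for every \<delta>.\<close>
  obtain c N0 where c: "c > 0" "\<And>N. N \<ge> N0 \<Longrightarrow> real (card (S N)) \<ge> c * real N / sqrt (ln (real N))"
    using two_squares_card_ge unfolding S_def by blast
  have "f \<longlonglongrightarrow> 1"
  proof (rule tendstoI)
    fix e :: real assume e: "e > 0"
    \<comment> \<open>The factor c/2 turns the bound on exceptional numbers into the fraction e/2 of
      S.\<close>
    have "\<forall>\<^sub>F N in sequentially. real (card (B N)) \<le> (e * c / 2) * real N / sqrt (ln (real N))"
      unfolding B_def bd_def by (rule quasi_correlations_rare[OF assms]) (use e c in auto)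
    moreover have "\<forall>\<^sub>F N :: nat in sequentially. ln (real N) > 1 \<and> N \<ge> N0"
      by (intro eventually_conj eventually_ge_at_top; real_asymp)
    ultimately show "\<forall>\<^sub>F N in sequentially. dist (f N) 1 < e"
    proof eventually_elim
      case (elim N)
      have N0: "N > 0" using elim(2) by (cases N) auto
      define q where "q = real N / sqrt (ln (real N))"
      have "ln (real N) > 0" using elim(2) by linarith
      then have q: "q > 0" unfolding q_def using N0 by (intro divide_pos_pos real_sqrt_gt_zero) auto
      have S: "real (card (S N)) \<ge> c * q" using c(2)[of N] elim(2) by (simp add: q_def)
      have "0 < c * q" using q c(1) by (rule mult_pos_pos[rotated])
      then have S0: "real (card (S N)) > 0" using S by linarith
      have Bq: "real (card (B N)) \<le> e * c / 2 * q" using elim(1) by (simp add: q_def)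
      have "card (S N - B N) = card (S N) - card (B N)"
        using fin finite_subset[OF fin(2,1)] by (intro card_Diff_subset) auto
      moreover have "card (B N) \<le> card (S N)" using fin by (intro card_mono) auto
      ultimately have "f N = 1 - real (card (B N)) / real (card (S N))"
        using S0 by (simp add: f_def of_nat_diff diff_divide_distrib)
      moreover have "real (card (B N)) / real (card (S N)) \<le> (e * c / 2 * q) / (c * q)"
        using Bq S q c(1) e by (intro frac_le) auto
      moreover have "(e * c / 2 * q) / (c * q) = e / 2" using q c(1) by simp
      moreover have "0 \<le> real (card (B N)) / real (card (S N))" by simp
      ultimately show ?case using e by (simp add: dist_real_def)
    qed
  qed
  \<comment> \<open>The density is defined with a real bound X; both counts depend only on
    floor(X).\<close>
  moreover have "filterlim (\<lambda>X::real. nat \<lfloor>X\<rfloor>) sequentially at_top"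
    by (rule filterlim_compose[OF filterlim_nat_sequentially filterlim_floor_sequentially])
  ultimately have "((\<lambda>X::real. f (nat \<lfloor>X\<rfloor>)) \<longlongrightarrow> 1) at_top" by (rule filterlim_compose)
  moreover have "\<forall>\<^sub>F X in at_top. f (nat \<lfloor>X\<rfloor>) = real (card {n \<in> A. real n \<le> X}) / real (card {n \<in> two_squares. real n \<le> X})"
    using eventually_ge_at_top[of 0]
  proof eventually_elim
    case (elim X)
    have "{n \<in> A. real n \<le> X} = S (nat \<lfloor>X\<rfloor>) - B (nat \<lfloor>X\<rfloor>)" "{n \<in> two_squares. real n \<le> X} = S (nat \<lfloor>X\<rfloor>)"
      using real_le_iff_le_nat_floor[OF elim] by (auto simp: A_def S_def B_def)
    then show ?case by (simp add: f_def)
  qed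
  ultimately have "((\<lambda>X::real. real (card {n \<in> A. real n \<le> X}) / real (card {n \<in> two_squares. real n \<le> X})) \<longlongrightarrow> 1) at_top"
    by (simp add: tendsto_cong)
  then have "relative_density_one A" by (auto simp: relative_density_one_def A_def)
  moreover have "\<forall>n\<in>A. quasi_correlations l n (sqrt (real n) / ln (real n) powr corr_exponent \<epsilon> l) = {}"
    by (auto simp: A_def bd_def)
  ultimately show ?thesis by blast
qed

end
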